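(* Let $p>2$ and $B,b,\mu>0$. Assume $u_0\in H^1(\mathbb{R})\cap L^1(\mathbb{R})$, $xu_0\in L^1(\mathbb{R})$ and that $E_0:=\|u_0\|_{H^1}+\|u_0\|_{L^1}$ is sufficiently small (i.e. $E_0\le\delta$ for a suitable $\delta>0$ depending only on $p,B,b,\mu$). Let $u$ be the global mild solution of $$u_t+(|u|^{p-1}u)_x+\int_{\mathbb{R}}Be^{-b|x-y|}u_y(y,t)\,dy=\mu u_{xx}\quad (x\in\mathbb{R},\ t>0),\qquad u(x,0)=u_0(x).$$ Then, for any $2\le q\le\infty$, as $t\to\infty$, $$\|u(\cdot,t)-MG_0(\cdot,t)\|_{L^q}=\begin{cases}\left(|M|^p\|w_p\|_{L^q}+o(1)\right)t^{-\frac12\left(1-\frac1q\right)-\frac{p-2}{2}}, & 2<p<3,\\[4pt] \left(\frac{|M|^3}{4\sqrt3\,\pi\mu}\|\partial_xG(\cdot,1)\|_{L^q}+o(1)\right)t^{-\frac12\left(1-\frac1q\right)-\frac12}\log t, & p=3,\\[4pt] \left(\left\|(m+\mathcal{M})\partial_xG(\cdot,1)+\frac{2BM}{b^3}\partial_x^3G(\cdot,1)\right\|_{L^q}+o(1)\right)t^{-\frac12\left(1-\frac1q\right)-\frac12}, & p>3.\end{cases}$$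
   Context: Fourier transform: $\hat f(\xi)=\mathcal{F}[f](\xi)=\frac1{\sqrt{2\pi}}\int_{\mathbb{R}}e^{-ix\xi}f(x)dx$, $\mathcal{F}^{-1}[g](x)=\frac1{\sqrt{2\pi}}\int_{\mathbb{R}}e^{ix\xi}g(\xi)d\xi$; $\|f\|_{H^s}=\left(\int_{\mathbb{R}}(1+\xi^2)^s|\hat f(\xi)|^2d\xi\right)^{1/2}$. Functions are real-valued and $*$ denotes convolution in $x$. Mild solution: a solution of the integral equation $$u(t)=T(t)*u_0-\int_0^t\partial_xT(t-\tau)*(|u|^{p-1}u)(\tau)\,d\tau,$$ where $T(x,t)=\frac1{\sqrt{2\pi}}\mathcal{F}^{-1}\left[\exp\left(-\mu t\xi^2-\frac{i2Bbt\xi}{b^2+\xi^2}\right)\right](x)$. For $E_0$ sufficiently small there is a unique global mild solution $u\in C([0,\infty);H^1(\mathbb{R}))$ satisfying $\|\partial_x^lu(\cdot,t)\|_{L^2}\le CE_0(1+t)^{-\frac14-\frac l2}$ ($t\ge0$, $l=0,1$) and $\|u(\cdot,t)\|_{L^q}\le CE_0(1+t)^{-\frac12(1-\frac1q)}$ ($t\ge0$, $2\le q\le\infty$); "the solution" means this one. Definitions: $G(x,t)=\frac{1}{\sqrt{4\pi\mu t}}\exp\left(-\frac{x^2}{4\mu t}\right)$, $G_0(x,t)=G\left(x-\frac{2B}{b}t,t\right)$, and for $2<p<3$, $w_p(x)=\frac{d}{dx}\left(\int_0^1\left(G(1-s)*G^p(s)\right)(x)\,ds\right)$, where $G(s)=G(\cdot,s)$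 and $G^p(s)=(G(\cdot,s))^p$. Constants: $M=\int_{\mathbb{R}}u_0(x)dx$, $m=\int_{\mathbb{R}}xu_0(x)dx$, and for $p>3$, $\mathcal{M}=\int_0^\infty\int_{\mathbb{R}}(|u|^{p-1}u)(y,\tau)\,dy\,d\tau$. *)

theory Defs
  imports
    "HOL-Analysis.Analysis"
    "HOL-Probability.Essential_Supremum"
    "HOL-Library.Landau_Symbols"
begin

text \<open>Elements of the Lebesgue and Sobolev spaces are represented by Borel functions on the real
  line; every class has such a representative, and nothing below depends on its choice. Norms take
  values in \<^typ>\<open>ereal\<close>, so that a finite norm is a genuine assertion.\<close>

definition root_ereal :: "real \<Rightarrow> ennreal \<Rightarrow> ereal" where
  "root_ereal r a = (if a = \<infinity> then \<infinity> else ereal (enn2real a powr (1 / r)))"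

definition Lq_norm :: "ereal \<Rightarrow> (real \<Rightarrow> real) \<Rightarrow> ereal" where
  "Lq_norm q f =
    (if q = \<infinity> then esssup lborel (\<lambda>x. ereal \<bar>f x\<bar>)
     else root_ereal (real_of_ereal q) (\<integral>\<^sup>+ x. ennreal (\<bar>f x\<bar> powr real_of_ereal q) \<partial>lborel))"

definition fourier :: "(real \<Rightarrow> complex) \<Rightarrow> real \<Rightarrow> complex" where
  "fourier f \<xi> = complex_of_real (1 / sqrt (2 * pi)) *
     (LBINT x. exp (- (\<i> * complex_of_real x * complex_of_real \<xi>)) * f x)"

definition inv_fourier :: "(real \<Rightarrow> complex) \<Rightarrow> real \<Rightarrow> complex" where
  "inv_fourier g x = complex_of_real (1 / sqrt (2 * pi)) *
     (LBINT \<xi>. exp (\<i> * complex_of_real x * complex_of_real \<xi>) * g \<xi>)"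

text \<open>For a square integrable function that need not be integrable, the Fourier transform is the
  \<open>L\<^sup>2\<close>-limit of the transforms of its truncations (Plancherel). It is determined up to
  null sets, and agrees almost everywhere with \<^const>\<open>fourier\<close> if the function is also
  integrable.\<close>

definition is_fourier_L2 :: "(real \<Rightarrow> real) \<Rightarrow> (real \<Rightarrow> complex) \<Rightarrow> bool" where
  "is_fourier_L2 f g \<longleftrightarrow> g \<in> borel_measurable lborel \<and>
     ((\<lambda>R. \<integral>\<^sup>+ \<xi>. ennreal
          ((cmod (g \<xi> - fourier (\<lambda>x. complex_of_real (indicator {-R..R} x * f x)) \<xi>))\<^sup>2) \<partial>lborel)
        \<longlongrightarrow> 0) at_top"

definition fourier_L2 :: "(real \<Rightarrow> real) \<Rightarrow> real \<Rightarrow> complex" where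
  "fourier_L2 f = (SOME g. is_fourier_L2 f g)"

text \<open>Used for \<open>s \<ge> 0\<close> only, where \<open>H\<^sup>s\<close> is a subspace of \<open>L\<^sup>2\<close>.\<close>

definition Hs_norm :: "real \<Rightarrow> (real \<Rightarrow> real) \<Rightarrow> ereal" where
  "Hs_norm s f = root_ereal 2
     (\<integral>\<^sup>+ \<xi>. ennreal ((1 + \<xi>\<^sup>2) powr s * (cmod (fourier_L2 f \<xi>))\<^sup>2) \<partial>lborel)"

definition Hs_space :: "real \<Rightarrow> (real \<Rightarrow> real) set" where
  "Hs_space s = {f \<in> borel_measurable lborel. Lq_norm 2 f < \<infinity> \<and> Hs_norm s f < \<infinity>}"

definition test_function :: "(real \<Rightarrow> real) \<Rightarrow> bool" where
  "test_function \<phi> \<longleftrightarrow> (\<forall>k x. ((deriv ^^ k) \<phi>) differentiable (at x)) \<and>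
     (\<exists>R. \<forall>x. \<bar>x\<bar> > R \<longrightarrow> \<phi> x = 0)"

definition is_weak_deriv :: "nat \<Rightarrow> (real \<Rightarrow> real) \<Rightarrow> (real \<Rightarrow> real) \<Rightarrow> bool" where
  "is_weak_deriv l f v \<longleftrightarrow> v \<in> borel_measurable lborel \<and>
     (\<forall>R. set_integrable lborel {-R..R} v) \<and>
     (\<forall>\<phi>. test_function \<phi> \<longrightarrow>
        (LBINT x. f x * (deriv ^^ l) \<phi> x) = (-1) ^ l * (LBINT x. v x * \<phi> x))"

definition conv :: "(real \<Rightarrow> 'a) \<Rightarrow> (real \<Rightarrow> 'a) \<Rightarrow> real
    \<Rightarrow> 'a::{real_normed_algebra, banach, second_countable_topology}" where
  "conv f g x = (LBINT y. f (x - y) * g y)"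

definition heat :: "real \<Rightarrow> real \<Rightarrow> real \<Rightarrow> real" where
  "heat \<mu> t x = 1 / sqrt (4 * pi * \<mu> * t) * exp (- (x\<^sup>2 / (4 * \<mu> * t)))"

definition heat_drift :: "real \<Rightarrow> real \<Rightarrow> real \<Rightarrow> real \<Rightarrow> real \<Rightarrow> real" where
  "heat_drift B b \<mu> t x = heat \<mu> t (x - 2 * B / b * t)"

text \<open>The kernel of the linear part of the equation, for \<open>t > 0\<close>; its values are real numbers,
  since the symbol takes conjugate values at \<open>\<xi>\<close> and \<open>-\<xi>\<close>.\<close>

definition kernel_T :: "real \<Rightarrow> real \<Rightarrow> real \<Rightarrow> real \<Rightarrow> real \<Rightarrow> complex" where
  "kernel_T B b \<mu> t x = complex_of_real (1 / sqrt (2 * pi)) *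
     inv_fourier (\<lambda>\<xi>. exp (complex_of_real (- (\<mu> * t * \<xi>\<^sup>2))
        - \<i> * complex_of_real (2 * B * b * t * \<xi> / (b\<^sup>2 + \<xi>\<^sup>2)))) x"

definition kernel_T_dx :: "real \<Rightarrow> real \<Rightarrow> real \<Rightarrow> real \<Rightarrow> real \<Rightarrow> complex" where
  "kernel_T_dx B b \<mu> t x = vector_derivative (kernel_T B b \<mu> t) (at x)"

definition nonlin :: "real \<Rightarrow> (real \<Rightarrow> real) \<Rightarrow> real \<Rightarrow> real" where
  "nonlin p f x = \<bar>f x\<bar> powr (p - 1) * f x"

text \<open>In the following, \<open>u t\<close> is the function \<open>u(\<cdot>,t)\<close>. At \<open>t = 0\<close> the kernel is the Dirac
  measure and the integral equation reads \<open>u(0) = u\<^sub>0\<close>. The time integral converges absolutely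
  at every point \<open>x\<close> for \<open>u\<close> continuous with values in \<open>H\<^sup>1\<close>.\<close>

definition global_mild_solution ::
  "real \<Rightarrow> real \<Rightarrow> real \<Rightarrow> real \<Rightarrow> (real \<Rightarrow> real) \<Rightarrow> (real \<Rightarrow> real \<Rightarrow> real) \<Rightarrow> bool" where
  "global_mild_solution p B b \<mu> u\<^sub>0 u \<longleftrightarrow>
     (\<forall>t\<ge>0. u t \<in> Hs_space 1) \<and>
     (\<forall>t\<ge>0. ((\<lambda>s. Hs_norm 1 (\<lambda>x. u s x - u t x)) \<longlongrightarrow> 0) (at t within {0..})) \<and>
     (AE x in lborel. u 0 x = u\<^sub>0 x) \<and>
     (\<forall>t>0. AE x in lborel. complex_of_real (u t x) =
        conv (kernel_T B b \<mu> t) (\<lambda>y. complex_of_real (u\<^sub>0 y)) x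
        - (LBINT \<tau>:{0<..<t}.
             conv (kernel_T_dx B b \<mu> (t - \<tau>)) (\<lambda>y. complex_of_real (nonlin p (u \<tau>) y)) x))"

definition initial_size :: "(real \<Rightarrow> real) \<Rightarrow> ereal" where
  "initial_size u\<^sub>0 = Hs_norm 1 u\<^sub>0 + Lq_norm 1 u\<^sub>0"

definition decay_estimates :: "(real \<Rightarrow> real) \<Rightarrow> (real \<Rightarrow> real \<Rightarrow> real) \<Rightarrow> bool" where
  "decay_estimates u\<^sub>0 u \<longleftrightarrow> (\<exists>C>0.
     (\<forall>t\<ge>0. \<forall>l\<in>{0, 1}. \<exists>v. is_weak_deriv l (u t) v \<and>
        Lq_norm 2 v \<le> ereal C * initial_size u\<^sub>0 * ereal ((1 + t) powr (- (1/4) - real l / 2))) \<and>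
     (\<forall>t\<ge>0. \<forall>q\<ge>2. Lq_norm q (u t) \<le>
        ereal C * initial_size u\<^sub>0 * ereal ((1 + t) powr (- (1/2) * (1 - real_of_ereal (1 / q))))))"

definition w_profile :: "real \<Rightarrow> real \<Rightarrow> real \<Rightarrow> real" where
  "w_profile p \<mu> x = deriv (\<lambda>z. LBINT s:{0<..<1}.
     conv (heat \<mu> (1 - s)) (\<lambda>y. heat \<mu> s y powr p) z) x"

definition mass :: "(real \<Rightarrow> real) \<Rightarrow> real" where
  "mass u\<^sub>0 = (LBINT x. u\<^sub>0 x)"

definition moment :: "(real \<Rightarrow> real) \<Rightarrow> real" where
  "moment u\<^sub>0 = (LBINT x. x * u\<^sub>0 x)"

definition nonlinear_mass :: "real \<Rightarrow> (real \<Rightarrow> real \<Rightarrow> real) \<Rightarrow> real" where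
  "nonlinear_mass p u = (LBINT \<tau>:{0<..}. LBINT y. nonlin p (u \<tau>) y)"

text \<open>\<open>F t = (c + o(1)) r t\<close> as \<open>t \<rightarrow> \<infinity>\<close>.\<close>

definition leading_order :: "(real \<Rightarrow> ereal) \<Rightarrow> ereal \<Rightarrow> (real \<Rightarrow> real) \<Rightarrow> bool" where
  "leading_order F c r \<longleftrightarrow> (\<exists>\<epsilon>. \<epsilon> \<in> o[at_top](\<lambda>_. 1 :: real) \<and>
     (\<forall>\<^sub>F t in at_top. F t = (c + ereal (\<epsilon> t)) * ereal (r t)))"

end

theory Submission
  imports Defs "HOL-Probability.Characteristic_Functions" "HOL-Probability.Sinc_Integral"
begin

text \<open>By Duhamel's formula \<open>u(t)\<close> is the linear evolution of \<open>u\<^sub>0\<close> minus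
  \<open>D(t) = \<integral>\<^sub>0\<^sup>t \<partial>\<^sub>xT(t - \<tau>) * |u|\<^sup>p\<^sup>-\<^sup>1u(\<tau>) d\<tau>\<close>. Both are estimated in \<open>L\<^sup>2\<close> and \<open>L\<^sup>\<infinity>\<close> on the Fourier side,
  where \<open>\<xi>\<close> has the size \<open>t\<^sup>-\<^sup>1\<^sup>/\<^sup>2\<close>. There the phase \<open>2Bbt\<xi>/(b\<^sup>2 + \<xi>\<^sup>2)\<close> is the drift \<open>2Bt\<xi>/b\<close> minus \<open>2Bt\<xi>\<^sup>3/b\<^sup>3\<close>
  plus smaller terms, and the transform of \<open>u\<^sub>0\<close> is \<open>M - im\<xi>\<close> plus smaller terms; this gives the
  linear contributions of relative size \<open>t\<^sup>-\<^sup>1\<^sup>/\<^sup>2\<close>, namely those of \<open>m\<close> and of \<open>2BM/b\<^sup>3\<close>.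

  The forcing \<open>|u|\<^sup>p\<^sup>-\<^sup>1u\<close> has \<open>L\<^sup>1\<close> norm of order \<open>\<tau>\<close> to the power \<open>-(p - 1)/2\<close>. If \<open>p > 3\<close>, it is integrable in
  time, and \<open>D(t)\<close> is to leading order its total integral times \<open>\<partial>\<^sub>xG\<^sub>0(t)\<close>. If \<open>p \<le> 3\<close>, then \<open>u\<close> may be
  replaced by \<open>MG\<^sub>0\<close> in the forcing. Since \<open>G(\<tau>)\<^sup>p\<close> is a multiple of the heat kernel at time \<open>\<tau>/p\<close>,
  \<open>D(t)\<close> becomes the integral of \<open>\<tau>\<close> to the power \<open>-(p - 1)/2\<close> times \<open>\<partial>\<^sub>xG(t - (1 - 1/p)\<tau>)\<close>, translated by \<open>2Bt/b\<close>.
  For \<open>p < 3\<close> this integral is self-similar with profile \<open>w\<^sub>p\<close>; for \<open>p = 3\<close> the singular weight \<open>1/\<tau>\<close>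
  concentrates it at \<open>\<tau> << t\<close> and turns it into \<open>\<partial>\<^sub>xG(t) log t\<close>.\<close>

text \<open>The pair of norms L^2 and L^\<infinity> is chosen because both are read off a symbol (by
  Plancherel and by its L^1 norm), both scale alike under diffusion, and interpolation then covers
  every q \<ge> 2 at once. The obstacle is the Duhamel integral: in the supremum norm
  \<partial>xT(s) has size 1/s, which is not integrable at s = 0. Pairing its L^2 norm with that of
  the forcing weakens the singularity to s^(-3/4), and this leaves room for a slightly more singular
  kernel, which the comparison of \<partial>xT with its heat approximation uses. The solution is
  given as one class for every time, whereas these integrals need joint measurability in \<tau> and
  x. The one-dimensional Sobolev embedding provides continuous representatives, and continuity in
  H^1 makes them jointly continuous. For p \<le> 3 the replacement of u by MG_0 in the forcing needs
  a rate. A crude power of t, obtained from the Duhamel formula without any cancellation, is fed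
  back into the forcing; at p = 3 this small gain already makes the error integrable in time, so
  only the explicit part carries the logarithm.\<close>

abbreviation Cx :: "real \<Rightarrow> complex" where "Cx \<equiv> complex_of_real"

abbreviation nn_lborel :: "(real \<Rightarrow> real) \<Rightarrow> ennreal" (binder "NN " 10) where
  "NN x. f x \<equiv> \<integral>\<^sup>+ x. ennreal (f x) \<partial>lborel"

abbreviation gauss :: "real \<Rightarrow> real \<Rightarrow> real" where "gauss c x \<equiv> exp (- (c * x\<^sup>2))"

subsection \<open>The inverse Fourier integral\<close>

abbreviation L2sq :: "(real \<Rightarrow> complex) \<Rightarrow> ennreal" where
  "L2sq g \<equiv> \<integral>\<^sup>+ x. ennreal ((cmod (g x))\<^sup>2) \<partial>lborel"

text \<open>Normalised by 1/(2 pi), so that it inverts the Fourier integral without prefactor: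
  convolving \<open>ift g\<close> with \<open>f\<close> multiplies \<open>g\<close> by the plain
  integral of \<open>iexp (- (\<xi> * y)) * f y\<close>, and a kernel is \<open>ift\<close> of its
  symbol with no constant left over.\<close>

definition ift :: "(real \<Rightarrow> complex) \<Rightarrow> real \<Rightarrow> complex" where
  "ift g x = Cx (1 / (2 * pi)) * (LBINT \<xi>. iexp (x * \<xi>) * g \<xi>)"

lemma borel_measurable_iexp [measurable]: "iexp \<in> borel_measurable borel"
  by (intro borel_measurable_continuous_onI continuous_intros)

lemma borel_measurable_cnj [measurable]: "cnj \<in> borel_measurable borel"
  by (intro borel_measurable_continuous_onI continuous_intros)

lemma integrable_gauss:
  fixes c :: real assumes "c > 0"
  shows "integrable lborel (\<lambda>\<xi>. gauss c \<xi>)"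
    and "(LBINT \<xi>. gauss c \<xi>) = sqrt (pi / c)"
proof -
  define s where "s = sqrt (1 / (2 * c))"
  have s: "s > 0" "s\<^sup>2 = 1 / (2 * c)" using assms by (auto simp: s_def)
  have eq: "gauss c \<xi> = sqrt (pi / c) * normal_density 0 s \<xi>" for \<xi>
    using assms by (simp add: normal_density_def s real_sqrt_divide real_sqrt_mult field_simps)
  show "integrable lborel (\<lambda>\<xi>. gauss c \<xi>)"
    unfolding eq using s by (intro integrable_mult_right integrable_normal_density)
  show "(LBINT \<xi>. gauss c \<xi>) = sqrt (pi / c)"
    unfolding eq using s integral_normal_density[of s 0] by simp
qed

text \<open>This is the characteristic function of the standard normal law after the substitution z
  = s \<xi> with s^2 = 2 c.\<close>

lemma fourier_gauss:
  fixes c x :: real assumes c: "c > 0"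
  shows "(LBINT \<xi>. iexp (x * \<xi>) * Cx (gauss c \<xi>))
    = Cx (sqrt (pi / c) * exp (- (x\<^sup>2 / (4 * c))))"
proof -
  define s where "s = sqrt (2 * c)"
  have s: "s > 0" "s\<^sup>2 = 2 * c" using c by (auto simp: s_def)
  have "Cx (exp (- ((x / s)\<^sup>2) / 2)) = char std_normal_distribution (x / s)"
    by (simp add: char_std_normal_distribution)
  also have "\<dots> = (LBINT z. std_normal_density z *\<^sub>R iexp (x / s * z))"
    unfolding char_def by (subst integral_density) (auto simp: normal_density_nonneg)
  also have "\<dots> = \<bar>s\<bar> *\<^sub>R (LBINT \<xi>. std_normal_density (0 + s * \<xi>) *\<^sub>R iexp (x / s * (0 + s * \<xi>)))"
    using s by (intro lborel_integral_real_affine) auto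
  also have "(\<lambda>\<xi>. std_normal_density (0 + s * \<xi>) *\<^sub>R iexp (x / s * (0 + s * \<xi>)))
     = (\<lambda>\<xi>. Cx (1 / sqrt (2 * pi)) * (iexp (x * \<xi>) * Cx (gauss c \<xi>)))"
    using s c by (auto simp: fun_eq_iff std_normal_density_def power_mult_distrib scaleR_conv_of_real)
  finally have "Cx (exp (- ((x / s)\<^sup>2) / 2)) = Cx s *
     (Cx (1 / sqrt (2 * pi)) * (LBINT \<xi>. iexp (x * \<xi>) * Cx (gauss c \<xi>)))"
    using s by (simp add: scaleR_conv_of_real)
  moreover have "(x / s)\<^sup>2 / 2 = x\<^sup>2 / (4 * c)" using s by (simp add: power_divide)
  ultimately have "(LBINT \<xi>. iexp (x * \<xi>) * Cx (gauss c \<xi>))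
      = Cx (sqrt (2 * pi) / s * exp (- (x\<^sup>2 / (4 * c))))"
    using s by (simp add: field_simps)
  moreover have "sqrt (2 * pi) / s = sqrt (pi / c)"
    using c unfolding s_def by (simp flip: real_sqrt_divide)
  ultimately show ?thesis by simp
qed

text \<open>Domination by a product of two integrable functions is the form in which most exchanges
  of complex integrals below are justified.\<close>

lemma integrable_pair_bound:
  fixes f :: "'a \<Rightarrow> 'b::{banach,second_countable_topology}"
    and g :: "'c \<Rightarrow> 'd::{banach,second_countable_topology}"
    and h :: "'a \<times> 'c \<Rightarrow> 'e::{banach,second_countable_topology}"
  assumes "sigma_finite_measure M1" "sigma_finite_measure M2"
  assumes f: "integrable M1 f" and g: "integrable M2 g"
    and h [measurable]: "h \<in> borel_measurable (M1 \<Otimes>\<^sub>M M2)"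
    and bd: "\<And>x y. x \<in> space M1 \<Longrightarrow> y \<in> space M2 \<Longrightarrow> norm (h (x, y)) \<le> norm (f x) * norm (g y)"
  shows "integrable (M1 \<Otimes>\<^sub>M M2) h"
proof -
  interpret sigma_finite_measure M1 by fact
  interpret S2: sigma_finite_measure M2 by fact
  interpret P: pair_sigma_finite M1 M2 by standard
  have [measurable]: "f \<in> borel_measurable M1" "g \<in> borel_measurable M2" using f g by auto
  show ?thesis
  proof (rule P.Fubini_integrable[OF h])
    show "AE x in M1. integrable M2 (\<lambda>y. h (x, y))"
      proof (rule AE_I2)
      fix x assume x: "x \<in> space M1"
      show "integrable M2 (\<lambda>y. h (x, y))"
        by (rule Bochner_Integration.integrable_bound[OF integrable_mult_right[OF integrable_norm[OF g], of "norm (f x)"]])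
          (use x bd in auto)
    qed
    show "integrable M1 (\<lambda>x. \<integral>y. norm (h (x, y)) \<partial>M2)"
    proof (rule Bochner_Integration.integrable_bound[OF integrable_mult_left[OF integrable_norm[OF f], of "\<integral>y. norm (g y) \<partial>M2"]])
      show "AE x in M1. norm (\<integral>y. norm (h (x, y)) \<partial>M2) \<le> norm (norm (f x) * (\<integral>y. norm (g y) \<partial>M2))"
      proof (rule AE_I2)
        fix x assume x: "x \<in> space M1"
        have "(\<integral>y. norm (h (x, y)) \<partial>M2) \<le> (\<integral>y. norm (f x) * norm (g y) \<partial>M2)"
          using x by (intro integral_mono' integrable_mult_right integrable_norm g bd) auto
        moreover have "(\<integral>y. norm (h (x, y)) \<partial>M2) \<ge> 0" by (intro integral_nonneg_AE) auto
        moreover have "(\<integral>y. norm (g y) \<partial>M2) \<ge> 0" by (intro integral_nonneg_AE) auto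
        ultimately show "norm (\<integral>y. norm (h (x, y)) \<partial>M2) \<le> norm (norm (f x) * (\<integral>y. norm (g y) \<partial>M2))"
          by simp
      qed
    qed measurable
  qed
qed

lemma sigma_finite_lborel: "sigma_finite_measure (lborel :: real measure)"
  by (rule lborel.sigma_finite_measure_axioms)

lemma norm_integral_le_nn:
  fixes f :: "'a \<Rightarrow> 'b::{banach, second_countable_topology}"
  shows "ennreal (norm (integral\<^sup>L M f)) \<le> (\<integral>\<^sup>+ x. ennreal (norm (f x)) \<partial>M)"
  by (cases "integrable M f") (auto intro: integral_norm_bound_ennreal simp: not_integrable_integral_eq)

lemma integrable_iexp_mult:
  assumes "integrable M g" and [measurable]: "f \<in> borel_measurable M"
  shows "integrable M (\<lambda>\<xi>. iexp (f \<xi>) * g \<xi>)"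
proof (rule Bochner_Integration.integrable_bound[OF assms(1)])
  have [measurable]: "g \<in> borel_measurable M" using assms by auto
  show "(\<lambda>\<xi>. iexp (f \<xi>) * g \<xi>) \<in> borel_measurable M" by measurable
qed (auto simp: norm_mult)

lemma cmod_ift_le:
  assumes "integrable lborel g"
  shows "cmod (ift g x) \<le> (1 / (2 * pi)) * (LBINT \<xi>. cmod (g \<xi>))"
proof -
  have "cmod (LBINT \<xi>. iexp (x * \<xi>) * g \<xi>) \<le> (LBINT \<xi>. cmod (iexp (x * \<xi>) * g \<xi>))"
    by (rule integral_norm_bound)
  also have "\<dots> = (LBINT \<xi>. cmod (g \<xi>))" by (simp add: norm_mult)
  finally show ?thesis unfolding ift_def norm_mult norm_of_real by (intro mult_mono) auto
qed

lemma fourier_measurable: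
  assumes [measurable]: "g \<in> borel_measurable borel"
  shows "(\<lambda>x. LBINT \<xi>. iexp (x * \<xi>) * g \<xi>) \<in> borel_measurable borel"
proof -
  have "(\<lambda>x. LBINT \<xi>. iexp (x * \<xi>) * g \<xi>) \<in> borel_measurable lborel"
    by measurable
  then show ?thesis by simp
qed

lemma ift_measurable [measurable]:
  assumes "g \<in> borel_measurable borel"
  shows "ift g \<in> borel_measurable borel"
  unfolding ift_def[abs_def] using fourier_measurable[OF assms] by measurable

text \<open>The Gaussian weight makes the expanded square absolutely convergent. Integrating x out
  leaves the quadratic form of g with the kernel \<open>K (\<xi> - \<eta>)\<close>, the transform of
  the weight, which is nonnegative and has mass 2 pi for every \<epsilon>. The inequality 2
  |g(\<xi>)| |g(\<eta>)| \<le> |g(\<xi>)|^2 + |g(\<eta>)|^2 then gives a bound that is uniform in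
  \<epsilon>.\<close>

lemma plancherel_gauss:
  fixes g :: "real \<Rightarrow> complex"
  assumes g: "integrable lborel g" and e: "\<epsilon> > 0"
  defines "\<Phi> \<equiv> \<lambda>x. LBINT \<xi>. iexp (x * \<xi>) * g \<xi>"
  shows "(NN x. gauss \<epsilon> x * (cmod (\<Phi> x))\<^sup>2) \<le> ennreal (2 * pi) * L2sq g"
proof -
  have gm [measurable]: "g \<in> borel_measurable borel" using g by auto
  define K where "K s = sqrt (pi / \<epsilon>) * exp (- (s\<^sup>2 / (4 * \<epsilon>)))" for s
  have Km [measurable]: "K \<in> borel_measurable borel" unfolding K_def[abs_def] by measurable
  have K0: "K s \<ge> 0" for s using e by (simp add: K_def)
  have Kint: "integrable lborel K" "(LBINT s. K s) = 2 * pi"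
  proof -
    have *: "K = (\<lambda>s. sqrt (pi / \<epsilon>) * gauss (1 / (4 * \<epsilon>)) s)" by (auto simp: K_def fun_eq_iff)
    show "integrable lborel K" unfolding * using e by (intro integrable_mult_right integrable_gauss) auto
    have "(LBINT s. K s) = sqrt (pi / \<epsilon>) * sqrt (pi / (1 / (4 * \<epsilon>)))"
      unfolding * using e integrable_gauss(2)[of "1 / (4 * \<epsilon>)"] by simp
    also have "\<dots> = sqrt ((2 * pi)\<^sup>2)" using e by (simp add: power2_eq_square flip: real_sqrt_mult)
    also have "\<dots> = 2 * pi" by (subst real_sqrt_abs) simp
    finally show "(LBINT s. K s) = 2 * pi" .
  qed
  have \<Phi>m [measurable]: "\<Phi> \<in> borel_measurable borel"
    unfolding \<Phi>_def by (rule fourier_measurable) measurable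
  define N1 where "N1 = (LBINT \<xi>. cmod (g \<xi>))"
  have \<Phi>b: "cmod (\<Phi> x) \<le> N1" for x
    unfolding \<Phi>_def N1_def using integral_norm_bound[of lborel "\<lambda>\<xi>. iexp (x * \<xi>) * g \<xi>"] by (simp add: norm_mult)
  have gauss: "integrable lborel (\<lambda>x. gauss \<epsilon> x)" using integrable_gauss e by auto
  have gaussc: "integrable lborel (\<lambda>x. Cx (gauss \<epsilon> x))" using gauss by simp
  have N10: "N1 \<ge> 0" unfolding N1_def by (intro integral_nonneg_AE) auto
  let ?e = "\<lambda>x. Cx (gauss \<epsilon> x)"
  have int0: "integrable lborel (\<lambda>x. ?e x * \<Phi> x * cnj (\<Phi> x))"
  proof (rule Bochner_Integration.integrable_bound[OF integrable_mult_right[OF gauss, of "N1 * N1"]])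
    show "AE x in lborel. cmod (?e x * \<Phi> x * cnj (\<Phi> x)) \<le> norm (N1 * N1 * gauss \<epsilon> x)"
      using \<Phi>b N10 by (auto simp: norm_mult mult_ac intro!: mult_mono)
  qed measurable
  have inner: "(LBINT x. ?e x * iexp (x * \<xi>) * cnj (\<Phi> x)) = (LBINT \<eta>. cnj (g \<eta>) * K (\<xi> - \<eta>))" for \<xi>
  proof -
    have cnjP: "cnj (\<Phi> x) = (LBINT \<eta>. cnj (iexp (x * \<eta>) * g \<eta>))" for x
      unfolding \<Phi>_def by (rule Bochner_Integration.integral_cnj[symmetric])
    have "(LBINT x. ?e x * iexp (x * \<xi>) * cnj (\<Phi> x)) =
       (LBINT x. LBINT \<eta>. ?e x * iexp (x * \<xi>) * cnj (iexp (x * \<eta>) * g \<eta>))"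
      unfolding cnjP by simp
    also have "\<dots> = (LBINT \<eta>. LBINT x. ?e x * iexp (x * \<xi>) * cnj (iexp (x * \<eta>) * g \<eta>))"
    proof (rule lborel_pair.Fubini_integral[symmetric])
      show "integrable (lborel \<Otimes>\<^sub>M lborel) (\<lambda>(x, \<eta>). ?e x * iexp (x * \<xi>) * cnj (iexp (x * \<eta>) * g \<eta>))"
        by (rule integrable_pair_bound[OF sigma_finite_lborel sigma_finite_lborel gaussc g])
          (auto simp: norm_mult)
    qed
    also have "\<dots> = (LBINT \<eta>. cnj (g \<eta>) * K (\<xi> - \<eta>))"
    proof (rule Bochner_Integration.integral_cong[OF refl])
      fix \<eta>
      have "(LBINT x. ?e x * iexp (x * \<xi>) * cnj (iexp (x * \<eta>) * g \<eta>)) =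
        (LBINT x. cnj (g \<eta>) * (iexp ((\<xi> - \<eta>) * x) * ?e x))"
      proof (rule Bochner_Integration.integral_cong[OF refl])
        fix x
        have "cnj (iexp (x * \<eta>)) = iexp (- (x * \<eta>))" by (simp add: exp_cnj)
        moreover have "iexp ((\<xi> - \<eta>) * x) = iexp (x * \<xi>) * iexp (- (x * \<eta>))"
          by (simp add: exp_add[symmetric] algebra_simps)
        ultimately show "?e x * iexp (x * \<xi>) * cnj (iexp (x * \<eta>) * g \<eta>) = cnj (g \<eta>) * (iexp ((\<xi> - \<eta>) * x) * ?e x)"
          by (simp only: complex_cnj_mult mult_ac)
      qed
      also have "\<dots> = cnj (g \<eta>) * K (\<xi> - \<eta>)"
        using fourier_gauss[OF e, of "\<xi> - \<eta>"] by (simp add: K_def)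
      finally show "(LBINT x. ?e x * iexp (x * \<xi>) * cnj (iexp (x * \<eta>) * g \<eta>)) = cnj (g \<eta>) * K (\<xi> - \<eta>)" .
    qed
    finally show ?thesis .
  qed
  have "(LBINT x. ?e x * \<Phi> x * cnj (\<Phi> x)) = (LBINT x. LBINT \<xi>. ?e x * (iexp (x * \<xi>) * g \<xi>) * cnj (\<Phi> x))"
    unfolding \<Phi>_def by simp
  also have "\<dots> = (LBINT \<xi>. LBINT x. ?e x * (iexp (x * \<xi>) * g \<xi>) * cnj (\<Phi> x))"
  proof (rule lborel_pair.Fubini_integral[symmetric])
    show "integrable (lborel \<Otimes>\<^sub>M lborel) (\<lambda>(x, \<xi>). ?e x * (iexp (x * \<xi>) * g \<xi>) * cnj (\<Phi> x))"
      by (rule integrable_pair_bound[OF sigma_finite_lborel sigma_finite_lborel integrable_mult_right[OF gaussc, of N1] g])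
        (auto simp: norm_mult \<Phi>b N10 mult_ac intro!: mult_mono)
  qed
  also have "\<dots> = (LBINT \<xi>. g \<xi> * (LBINT \<eta>. cnj (g \<eta>) * K (\<xi> - \<eta>)))"
  proof (rule Bochner_Integration.integral_cong[OF refl])
    fix \<xi>
    have "(LBINT x. ?e x * (iexp (x * \<xi>) * g \<xi>) * cnj (\<Phi> x)) = (LBINT x. g \<xi> * (?e x * iexp (x * \<xi>) * cnj (\<Phi> x)))"
      by (intro Bochner_Integration.integral_cong refl) (simp add: mult_ac)
    also have "\<dots> = g \<xi> * (LBINT \<eta>. cnj (g \<eta>) * K (\<xi> - \<eta>))"
      using inner[of \<xi>] by simp
    finally show "(LBINT x. ?e x * (iexp (x * \<xi>) * g \<xi>) * cnj (\<Phi> x)) = g \<xi> * (LBINT \<eta>. cnj (g \<eta>) * K (\<xi> - \<eta>))" .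
  qed
  finally have main: "(LBINT x. ?e x * \<Phi> x * cnj (\<Phi> x)) = (LBINT \<xi>. g \<xi> * (LBINT \<eta>. cnj (g \<eta>) * K (\<xi> - \<eta>)))" .
  have "(NN x. gauss \<epsilon> x * (cmod (\<Phi> x))\<^sup>2) =
    ennreal (LBINT x. gauss \<epsilon> x * (cmod (\<Phi> x))\<^sup>2)"
    by (rule nn_integral_eq_integral) (use integrable_norm[OF int0] in \<open>auto simp: norm_mult power2_eq_square mult.assoc\<close>)
  also have "(LBINT x. gauss \<epsilon> x * (cmod (\<Phi> x))\<^sup>2) = cmod (LBINT x. ?e x * \<Phi> x * cnj (\<Phi> x))"
  proof -
    have "(LBINT x. ?e x * \<Phi> x * cnj (\<Phi> x)) = (LBINT x. Cx (gauss \<epsilon> x * (cmod (\<Phi> x))\<^sup>2))"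
      by (intro Bochner_Integration.integral_cong refl) (simp only: of_real_mult complex_norm_square mult.assoc)
    then have "(LBINT x. ?e x * \<Phi> x * cnj (\<Phi> x)) = Cx (LBINT x. gauss \<epsilon> x * (cmod (\<Phi> x))\<^sup>2)"
      by (simp only: integral_complex_of_real)
    moreover have "(LBINT x. gauss \<epsilon> x * (cmod (\<Phi> x))\<^sup>2) \<ge> 0"
      by (intro integral_nonneg_AE) auto
    ultimately show ?thesis by (simp only: norm_of_real abs_of_nonneg)
  qed
  also have "ennreal \<dots> \<le> (NN \<xi>. cmod (g \<xi> * (LBINT \<eta>. cnj (g \<eta>) * K (\<xi> - \<eta>))))"
    unfolding main by (rule norm_integral_le_nn)
  also have "\<dots> \<le> (\<integral>\<^sup>+ \<xi>. \<integral>\<^sup>+ \<eta>. ennreal ((cmod (g \<xi>))\<^sup>2 / 2 * K (\<xi> - \<eta>)) + ennreal ((cmod (g \<eta>))\<^sup>2 / 2 * K (\<xi> - \<eta>)) \<partial>lborel \<partial>lborel)"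
  proof (rule nn_integral_mono)
    fix \<xi>
    have "ennreal (cmod (g \<xi> * (LBINT \<eta>. cnj (g \<eta>) * K (\<xi> - \<eta>)))) =
      ennreal (cmod (LBINT \<eta>. g \<xi> * (cnj (g \<eta>) * K (\<xi> - \<eta>))))"
      by (subst integral_mult_right_zero) simp
    also have "\<dots> \<le> (NN \<eta>. cmod (g \<xi> * (cnj (g \<eta>) * K (\<xi> - \<eta>))))"
      by (rule norm_integral_le_nn)
    also have "\<dots> \<le> (\<integral>\<^sup>+ \<eta>. ennreal ((cmod (g \<xi>))\<^sup>2 / 2 * K (\<xi> - \<eta>)) + ennreal ((cmod (g \<eta>))\<^sup>2 / 2 * K (\<xi> - \<eta>)) \<partial>lborel)"
    proof (rule nn_integral_mono)
      fix \<eta>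
      have "0 \<le> (cmod (g \<xi>) - cmod (g \<eta>))\<^sup>2" by simp
      then have "cmod (g \<xi>) * cmod (g \<eta>) \<le> (cmod (g \<xi>))\<^sup>2 / 2 + (cmod (g \<eta>))\<^sup>2 / 2"
        by (simp add: power2_eq_square algebra_simps)
      then have *: "cmod (g \<xi>) * cmod (g \<eta>) * K (\<xi> - \<eta>) \<le> ((cmod (g \<xi>))\<^sup>2 / 2 + (cmod (g \<eta>))\<^sup>2 / 2) * K (\<xi> - \<eta>)"
        by (rule mult_right_mono) (rule K0)
      show "ennreal (cmod (g \<xi> * (cnj (g \<eta>) * K (\<xi> - \<eta>)))) \<le> ennreal ((cmod (g \<xi>))\<^sup>2 / 2 * K (\<xi> - \<eta>)) + ennreal ((cmod (g \<eta>))\<^sup>2 / 2 * K (\<xi> - \<eta>))"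
      proof -
        have eq: "cmod (g \<xi> * (cnj (g \<eta>) * K (\<xi> - \<eta>))) = cmod (g \<xi>) * cmod (g \<eta>) * K (\<xi> - \<eta>)"
          using K0[of "\<xi> - \<eta>"] by (simp add: norm_mult)
        have "ennreal ((cmod (g \<xi>))\<^sup>2 / 2 * K (\<xi> - \<eta>)) + ennreal ((cmod (g \<eta>))\<^sup>2 / 2 * K (\<xi> - \<eta>)) = ennreal (((cmod (g \<xi>))\<^sup>2 / 2 + (cmod (g \<eta>))\<^sup>2 / 2) * K (\<xi> - \<eta>))"
          using K0[of "\<xi> - \<eta>"] by (subst ennreal_plus[symmetric]) (simp_all add: distrib_right del: ennreal_plus)
        then show ?thesis unfolding eq using * by (simp only: ennreal_leI)
      qed
    qed
    finally show "ennreal (cmod (g \<xi> * (LBINT \<eta>. cnj (g \<eta>) * K (\<xi> - \<eta>)))) \<le> \<dots>" .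
  qed
  also have "\<dots> = (\<integral>\<^sup>+ \<xi>. \<integral>\<^sup>+ \<eta>. ennreal ((cmod (g \<xi>))\<^sup>2 / 2 * K (\<xi> - \<eta>)) \<partial>lborel \<partial>lborel) +
    (\<integral>\<^sup>+ \<xi>. \<integral>\<^sup>+ \<eta>. ennreal ((cmod (g \<eta>))\<^sup>2 / 2 * K (\<xi> - \<eta>)) \<partial>lborel \<partial>lborel)"
    by (subst nn_integral_add, measurable)+
  also have "(\<integral>\<^sup>+ \<xi>. \<integral>\<^sup>+ \<eta>. ennreal ((cmod (g \<eta>))\<^sup>2 / 2 * K (\<xi> - \<eta>)) \<partial>lborel \<partial>lborel) =
    (\<integral>\<^sup>+ \<eta>. \<integral>\<^sup>+ \<xi>. ennreal ((cmod (g \<eta>))\<^sup>2 / 2 * K (\<xi> - \<eta>)) \<partial>lborel \<partial>lborel)"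
    by (rule lborel_pair.Fubini') measurable
  also have "(\<integral>\<^sup>+ \<eta>. \<integral>\<^sup>+ \<xi>. ennreal ((cmod (g \<eta>))\<^sup>2 / 2 * K (\<xi> - \<eta>)) \<partial>lborel \<partial>lborel) = (\<integral>\<^sup>+ \<eta>. ennreal pi * ennreal ((cmod (g \<eta>))\<^sup>2) \<partial>lborel)"
  proof (rule nn_integral_cong)
    fix \<eta>
    have "(NN \<xi>. K (\<xi> - \<eta>)) = ennreal (2 * pi)"
      using nn_integral_real_affine[of "\<lambda>\<xi>. ennreal (K (\<xi> - \<eta>))" 1 \<eta>] Kint K0
      by (simp add: nn_integral_eq_integral)
    moreover have "(NN \<xi>. (cmod (g \<eta>))\<^sup>2 / 2 * K (\<xi> - \<eta>)) = ennreal ((cmod (g \<eta>))\<^sup>2 / 2) * (NN \<xi>. K (\<xi> - \<eta>))"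
      by (subst nn_integral_cmult[symmetric], measurable) (intro nn_integral_cong ennreal_mult, auto simp: K0)
    moreover have "ennreal ((cmod (g \<eta>))\<^sup>2 / 2) * ennreal (2 * pi) = ennreal pi * ennreal ((cmod (g \<eta>))\<^sup>2)"
      by (subst (1 2) ennreal_mult[symmetric]) auto
    ultimately show "(NN \<xi>. (cmod (g \<eta>))\<^sup>2 / 2 * K (\<xi> - \<eta>)) = ennreal pi * ennreal ((cmod (g \<eta>))\<^sup>2)"
      by simp
  qed
  also have "(\<integral>\<^sup>+ \<xi>. \<integral>\<^sup>+ \<eta>. ennreal ((cmod (g \<xi>))\<^sup>2 / 2 * K (\<xi> - \<eta>)) \<partial>lborel \<partial>lborel) = (\<integral>\<^sup>+ \<xi>. ennreal pi * ennreal ((cmod (g \<xi>))\<^sup>2) \<partial>lborel)"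
  proof (rule nn_integral_cong)
    fix \<xi>
    have "(NN \<eta>. K (\<xi> - \<eta>)) = ennreal (2 * pi)"
      using nn_integral_real_affine[of "\<lambda>\<eta>. ennreal (K (\<xi> - \<eta>))" "-1" \<xi>] Kint K0
      by (simp add: nn_integral_eq_integral)
    moreover have "(NN \<eta>. (cmod (g \<xi>))\<^sup>2 / 2 * K (\<xi> - \<eta>)) = ennreal ((cmod (g \<xi>))\<^sup>2 / 2) * (NN \<eta>. K (\<xi> - \<eta>))"
      by (subst nn_integral_cmult[symmetric], measurable) (intro nn_integral_cong ennreal_mult, auto simp: K0)
    moreover have "ennreal ((cmod (g \<xi>))\<^sup>2 / 2) * ennreal (2 * pi) = ennreal pi * ennreal ((cmod (g \<xi>))\<^sup>2)"
      by (subst (1 2) ennreal_mult[symmetric]) auto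
    ultimately show "(NN \<eta>. (cmod (g \<xi>))\<^sup>2 / 2 * K (\<xi> - \<eta>)) = ennreal pi * ennreal ((cmod (g \<xi>))\<^sup>2)"
      by simp
  qed
  also have "(\<integral>\<^sup>+ \<xi>. ennreal pi * ennreal ((cmod (g \<xi>))\<^sup>2) \<partial>lborel) + (\<integral>\<^sup>+ \<xi>. ennreal pi * ennreal ((cmod (g \<xi>))\<^sup>2) \<partial>lborel)
    = ennreal (2 * pi) * L2sq g"
  proof -
    have "(\<integral>\<^sup>+ \<xi>. ennreal pi * ennreal ((cmod (g \<xi>))\<^sup>2) \<partial>lborel) = ennreal pi * L2sq g"
      by (rule nn_integral_cmult) measurable
    moreover have "ennreal (2 * pi) = ennreal pi + ennreal pi"
      by (subst ennreal_plus[symmetric]) (simp_all del: ennreal_plus)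
    ultimately show ?thesis by (simp only: distrib_right)
  qed
  finally show ?thesis .
qed

text \<open>Fatou's lemma removes the Gaussian weight. The inequality alone is enough, since it is
  only used to bound L^2 norms from above.\<close>

lemma plancherel_le:
  fixes g :: "real \<Rightarrow> complex"
  assumes g: "integrable lborel g"
  shows "L2sq (\<lambda>x. LBINT \<xi>. iexp (x * \<xi>) * g \<xi>) \<le> ennreal (2 * pi) * L2sq g"
proof -
  have [measurable]: "g \<in> borel_measurable borel" using g by auto
  define \<Phi> where "\<Phi> = (\<lambda>x. LBINT \<xi>. iexp (x * \<xi>) * g \<xi>)"
  have [measurable]: "\<Phi> \<in> borel_measurable borel"
    unfolding \<Phi>_def by (rule fourier_measurable) measurable
  have lim: "(\<lambda>n. ennreal (gauss (inverse (real (Suc n))) x * (cmod (\<Phi> x))\<^sup>2)) \<longlonglongrightarrow> ennreal ((cmod (\<Phi> x))\<^sup>2)" for x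
  proof -
    have "(\<lambda>n. gauss (inverse (real (Suc n))) x * (cmod (\<Phi> x))\<^sup>2) \<longlonglongrightarrow> gauss 0 x * (cmod (\<Phi> x))\<^sup>2"
      by (intro tendsto_intros LIMSEQ_inverse_real_of_nat)
    then show ?thesis by (intro tendsto_ennrealI) simp
  qed
  have "L2sq \<Phi> = (\<integral>\<^sup>+ x. liminf (\<lambda>n. ennreal (gauss (inverse (real (Suc n))) x * (cmod (\<Phi> x))\<^sup>2)) \<partial>lborel)"
    by (intro nn_integral_cong, rule sym, rule lim_imp_Liminf[OF _ lim]) simp
  also have "\<dots> \<le> liminf (\<lambda>n. \<integral>\<^sup>+ x. ennreal (gauss (inverse (real (Suc n))) x * (cmod (\<Phi> x))\<^sup>2) \<partial>lborel)"
    by (rule nn_integral_liminf) measurable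
  also have "\<dots> \<le> liminf (\<lambda>n. ennreal (2 * pi) * L2sq g)"
    unfolding \<Phi>_def by (intro Liminf_mono always_eventually allI plancherel_gauss[OF g]) simp
  also have "\<dots> = ennreal (2 * pi) * L2sq g" by (rule Liminf_const) simp
  finally show ?thesis unfolding \<Phi>_def .
qed

lemma L2sq_cmult: "g \<in> borel_measurable borel \<Longrightarrow> L2sq (\<lambda>x. c * g x) = ennreal ((cmod c)\<^sup>2) * L2sq g"
  by (subst nn_integral_cmult[symmetric]) (auto simp: norm_mult power_mult_distrib ennreal_mult)

lemma L2sq_ift_le:
  assumes g: "integrable lborel g"
  shows "L2sq (ift g) \<le> ennreal (1 / (2 * pi)) * L2sq g"
proof -
  have [measurable]: "g \<in> borel_measurable borel" using g by auto
  have "L2sq (ift g) = ennreal ((cmod (Cx (1 / (2 * pi))))\<^sup>2) * L2sq (\<lambda>x. LBINT \<xi>. iexp (x * \<xi>) * g \<xi>)"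
    unfolding ift_def by (rule L2sq_cmult) (rule fourier_measurable, measurable)
  also have "\<dots> \<le> ennreal ((1 / (2 * pi))\<^sup>2) * (ennreal (2 * pi) * L2sq g)"
    unfolding norm_of_real by (intro mult_mono plancherel_le g) auto
  also have "\<dots> = ennreal (1 / (2 * pi)) * L2sq g"
    by (simp add: mult.assoc[symmetric] ennreal_mult[symmetric] power2_eq_square)
  finally show ?thesis .
qed

lemma has_vector_derivative_iff_quotient:
  fixes f :: "real \<Rightarrow> 'a::real_normed_vector"
  shows "(f has_vector_derivative d) (at x) \<longleftrightarrow> ((\<lambda>h. (f (x + h) - f x) /\<^sub>R h) \<longlongrightarrow> d) (at 0)"
proof -
  have "(f has_vector_derivative d) (at x) \<longleftrightarrow> ((\<lambda>h. norm (f (x + h) - f x - h *\<^sub>R d) / norm h) \<longlongrightarrow> 0) (at 0)"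
    unfolding has_vector_derivative_def has_derivative_at by (simp add: bounded_linear_scaleR_left)
  also have "\<dots> \<longleftrightarrow> ((\<lambda>h. norm ((f (x + h) - f x) /\<^sub>R h - d)) \<longlongrightarrow> 0) (at 0)"
  proof (rule Lim_cong_within[OF refl refl refl])
    fix h :: real assume "h \<noteq> 0"
    then have eq: "(f (x + h) - f x) /\<^sub>R h - d = (f (x + h) - f x - h *\<^sub>R d) /\<^sub>R h"
      by (simp add: algebra_simps)
    show "norm (f (x + h) - f x - h *\<^sub>R d) / norm h = norm ((f (x + h) - f x) /\<^sub>R h - d)"
      unfolding eq norm_scaleR by (simp add: divide_inverse mult.commute)
  qed
  also have "\<dots> \<longleftrightarrow> ((\<lambda>h. (f (x + h) - f x) /\<^sub>R h) \<longlongrightarrow> d) (at 0)"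
    by (simp only: tendsto_norm_zero_iff LIM_zero_iff)
  finally show ?thesis .
qed

text \<open>The difference quotients of \<open>iexp (x * \<xi>)\<close> in x are bounded by |\<xi>|,
  so the integrable function |\<xi> g| dominates those of the integrand. The limit is taken along
  sequences in order to apply dominated convergence.\<close>

lemma ift_has_derivative:
  assumes g: "integrable lborel g" and g1: "integrable lborel (\<lambda>\<xi>. Cx \<xi> * g \<xi>)"
  shows "(ift g has_vector_derivative ift (\<lambda>\<xi>. \<i> * Cx \<xi> * g \<xi>) x) (at x)"
proof -
  have [measurable]: "g \<in> borel_measurable borel" using g by auto
  define d where "d h \<xi> = (if h = 0 then \<i> * \<xi> * iexp (x * \<xi>) * g \<xi> else (iexp ((x + h) * \<xi>) * g \<xi> - iexp (x * \<xi>) * g \<xi>) / Cx h)" for h \<xi>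
  have "((\<lambda>h. LBINT \<xi>. (iexp ((x + h) * \<xi>) * g \<xi> - iexp (x * \<xi>) * g \<xi>) / Cx h) \<longlongrightarrow> (LBINT \<xi>. \<i> * \<xi> * iexp (x * \<xi>) * g \<xi>)) (at 0)"
  proof (rule tendsto_at_iff_sequentially[THEN iffD2], safe)
    fix X :: "nat \<Rightarrow> real" assume X: "\<forall>i. X i \<in> UNIV - {0}" "X \<longlonglongrightarrow> 0"
    show "((\<lambda>h. LBINT \<xi>. (iexp ((x + h) * \<xi>) * g \<xi> - iexp (x * \<xi>) * g \<xi>) / Cx h) \<circ> X) \<longlonglongrightarrow> (LBINT \<xi>. \<i> * \<xi> * iexp (x * \<xi>) * g \<xi>)"
      unfolding o_def
    proof (rule integral_dominated_convergence[OF _ _ integrable_norm[OF g1]])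
      show "AE \<xi> in lborel. (\<lambda>i. (iexp ((x + X i) * \<xi>) * g \<xi> - iexp (x * \<xi>) * g \<xi>) / Cx (X i)) \<longlonglongrightarrow> \<i> * \<xi> * iexp (x * \<xi>) * g \<xi>"
      proof (rule AE_I2)
        fix \<xi>
        have "((\<lambda>h. iexp ((x + h) * \<xi>) * g \<xi>) has_vector_derivative (\<i> * \<xi> * iexp (x * \<xi>) * g \<xi>)) (at 0)"
        proof -
          have "((\<lambda>z. exp (\<i> * ((Cx x + z) * \<xi>)) * g \<xi>) has_field_derivative (\<i> * \<xi> * iexp (x * \<xi>) * g \<xi>)) (at (of_real 0))"
            by (auto intro!: derivative_eq_intros)
          from has_vector_derivative_real_field[OF this] show ?thesis by simp
        qed
        then have "((\<lambda>h. (iexp ((x + h) * \<xi>) * g \<xi> - iexp ((x + 0) * \<xi>) * g \<xi>) /\<^sub>R h) \<longlongrightarrow> \<i> * \<xi> * iexp (x * \<xi>) * g \<xi>) (at 0)"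
          unfolding has_vector_derivative_iff_quotient by (simp only: add_0)
        note lim = this[unfolded tendsto_at_iff_sequentially o_def, rule_format, OF X(1)[rule_format] X(2)]
        have "(iexp ((x + X i) * \<xi>) * g \<xi> - iexp ((x + 0) * \<xi>) * g \<xi>) /\<^sub>R X i = (iexp ((x + X i) * \<xi>) * g \<xi> - iexp (x * \<xi>) * g \<xi>) / Cx (X i)" for i
          by (simp only: scaleR_conv_of_real divide_inverse mult.commute add_0_right of_real_inverse)
        with lim show "(\<lambda>i. (iexp ((x + X i) * \<xi>) * g \<xi> - iexp (x * \<xi>) * g \<xi>) / Cx (X i)) \<longlonglongrightarrow> \<i> * \<xi> * iexp (x * \<xi>) * g \<xi>"
          by (simp only:)
      qed
      show "AE \<xi> in lborel. cmod ((iexp ((x + X i) * \<xi>) * g \<xi> - iexp (x * \<xi>) * g \<xi>) / Cx (X i)) \<le> cmod (Cx \<xi> * g \<xi>)" for i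
      proof (rule AE_I2)
        fix \<xi>
        have "iexp ((x + X i) * \<xi>) = iexp (x * \<xi>) * iexp (X i * \<xi>)"
          by (simp add: exp_add[symmetric] algebra_simps)
        then have "iexp ((x + X i) * \<xi>) * g \<xi> - iexp (x * \<xi>) * g \<xi> = iexp (x * \<xi>) * ((iexp (X i * \<xi>) - 1) * g \<xi>)"
          by (simp only: algebra_simps mult_1)
        then have "cmod (iexp ((x + X i) * \<xi>) * g \<xi> - iexp (x * \<xi>) * g \<xi>) = cmod (iexp (X i * \<xi>) - 1) * cmod (g \<xi>)"
          by (simp only: norm_mult norm_exp_i_times mult_1)
        also have "\<dots> \<le> \<bar>X i * \<xi>\<bar> * cmod (g \<xi>)"
          using iexp_approx1[of "X i * \<xi>" 0] by (intro mult_right_mono) auto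
        finally have "cmod (iexp ((x + X i) * \<xi>) * g \<xi> - iexp (x * \<xi>) * g \<xi>) \<le> \<bar>X i\<bar> * (\<bar>\<xi>\<bar> * cmod (g \<xi>))"
          by (simp only: abs_mult mult.assoc)
        moreover have "\<bar>X i\<bar> > 0" using X(1) by auto
        ultimately show "cmod ((iexp ((x + X i) * \<xi>) * g \<xi> - iexp (x * \<xi>) * g \<xi>) / Cx (X i)) \<le> cmod (Cx \<xi> * g \<xi>)"
          unfolding norm_divide norm_of_real norm_mult[of "Cx \<xi>"] by (subst pos_divide_le_eq) (simp_all only: mult.commute)
      qed
    qed measurable
  qed
  then have *: "((\<lambda>h. Cx (1 / (2 * pi)) * (LBINT \<xi>. (iexp ((x + h) * \<xi>) * g \<xi> - iexp (x * \<xi>) * g \<xi>) / Cx h)) \<longlongrightarrow> Cx (1 / (2 * pi)) * (LBINT \<xi>. \<i> * \<xi> * iexp (x * \<xi>) * g \<xi>)) (at 0)"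
    by (intro tendsto_intros)
  have i: "integrable lborel (\<lambda>\<xi>. iexp (y * \<xi>) * g \<xi>)" for y
    by (rule integrable_iexp_mult[OF g]) simp
  have "Cx (1 / (2 * pi)) * (LBINT \<xi>. (iexp ((x + h) * \<xi>) * g \<xi> - iexp (x * \<xi>) * g \<xi>) / Cx h) = (ift g (x + h) - ift g x) /\<^sub>R h" for h
  proof -
    have eq: "(LBINT \<xi>. (iexp ((x + h) * \<xi>) * g \<xi> - iexp (x * \<xi>) * g \<xi>) / Cx h) =
      ((LBINT \<xi>. iexp ((x + h) * \<xi>) * g \<xi>) - (LBINT \<xi>. iexp (x * \<xi>) * g \<xi>)) / Cx h"
      by (simp only: integral_divide_zero Bochner_Integration.integral_diff[OF i i])
    have gen: "c * ((A - C) / Cx h) = (c * A - c * C) /\<^sub>R h" for c A C :: complex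
      by (simp add: scaleR_conv_of_real divide_inverse algebra_simps)
    show ?thesis unfolding ift_def eq by (rule gen)
  qed
  moreover have "Cx (1 / (2 * pi)) * (LBINT \<xi>. \<i> * \<xi> * iexp (x * \<xi>) * g \<xi>) = ift (\<lambda>\<xi>. \<i> * Cx \<xi> * g \<xi>) x"
    unfolding ift_def by (rule arg_cong2[where f="(*)", OF refl], rule Bochner_Integration.integral_cong[OF refl]) (simp only: mult_ac)
  ultimately show ?thesis
    using * unfolding has_vector_derivative_iff_quotient by (simp only:)
qed

lemma conv_ift:
  assumes g: "integrable lborel g" and f: "integrable lborel f"
  shows "conv (ift g) f x = ift (\<lambda>\<xi>. g \<xi> * (LBINT y. iexp (- (\<xi> * y)) * f y)) x"
proof -
  have [measurable]: "g \<in> borel_measurable borel" "f \<in> borel_measurable borel" using g f by auto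
  have "conv (ift g) f x = (LBINT y. LBINT \<xi>. Cx (1 / (2 * pi)) * (iexp ((x - y) * \<xi>) * g \<xi>) * f y)"
    unfolding conv_def ift_def by simp
  also have "\<dots> = (LBINT \<xi>. LBINT y. Cx (1 / (2 * pi)) * (iexp ((x - y) * \<xi>) * g \<xi>) * f y)"
  proof (rule lborel_pair.Fubini_integral[symmetric])
    show "integrable (lborel \<Otimes>\<^sub>M lborel) (\<lambda>(y, \<xi>). Cx (1 / (2 * pi)) * (iexp ((x - y) * \<xi>) * g \<xi>) * f y)"
      by (rule integrable_pair_bound[OF sigma_finite_lborel sigma_finite_lborel integrable_mult_right[OF f, of "Cx (1 / (2 * pi))"] g])
        (auto simp: norm_mult norm_divide mult.commute[of "cmod (f _)"])
  qed
  also have "\<dots> = (LBINT \<xi>. Cx (1 / (2 * pi)) * (iexp (x * \<xi>) * (g \<xi> * (LBINT y. iexp (- (\<xi> * y)) * f y))))"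
  proof (rule Bochner_Integration.integral_cong[OF refl])
    fix \<xi>
    have "(LBINT y. Cx (1 / (2 * pi)) * (iexp ((x - y) * \<xi>) * g \<xi>) * f y) =
      (LBINT y. Cx (1 / (2 * pi)) * (iexp (x * \<xi>) * (g \<xi> * (iexp (- (\<xi> * y)) * f y))))"
    proof (rule Bochner_Integration.integral_cong[OF refl])
      fix y
      have "iexp ((x - y) * \<xi>) = iexp (x * \<xi>) * iexp (- (\<xi> * y))"
        by (simp add: exp_add[symmetric] algebra_simps)
      then show "Cx (1 / (2 * pi)) * (iexp ((x - y) * \<xi>) * g \<xi>) * f y =
        Cx (1 / (2 * pi)) * (iexp (x * \<xi>) * (g \<xi> * (iexp (- (\<xi> * y)) * f y)))"
        by (simp only: mult_ac)
    qed
    then show "(LBINT y. Cx (1 / (2 * pi)) * (iexp ((x - y) * \<xi>) * g \<xi>) * f y) = Cx (1 / (2 * pi)) * (iexp (x * \<xi>) * (g \<xi> * (LBINT y. iexp (- (\<xi> * y)) * f y)))"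
      by (simp only: integral_mult_right_zero)
  qed
  also have "\<dots> = ift (\<lambda>\<xi>. g \<xi> * (LBINT y. iexp (- (\<xi> * y)) * f y)) x"
    unfolding ift_def by (simp only: integral_mult_right_zero)
  finally show ?thesis .
qed

subsection \<open>Bounds on the diffusive scale\<close>

text \<open>\<open>f\<close> is at most \<open>\<rho>\<close> times as large as the heat kernel at time \<open>t\<close>, in \<open>L\<^sup>2\<close> and in \<open>L\<^sup>\<infinity>\<close>, hence by interpolation in
  every \<open>L\<^sup>q\<close> with \<open>q \<ge> 2\<close>.\<close>

definition small :: "real \<Rightarrow> (real \<Rightarrow> complex) \<Rightarrow> real \<Rightarrow> bool" where
  "small t f \<rho> \<longleftrightarrow> f \<in> borel_measurable borel \<and> 0 \<le> \<rho> \<and> (\<forall>x. cmod (f x) \<le> \<rho> * t powr (- (1/2))) \<and>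
     L2sq f \<le> ennreal (\<rho>\<^sup>2 * t powr (- (1/2)))"

lemma small_measurable: "small t f \<rho> \<Longrightarrow> f \<in> borel_measurable borel" by (simp add: small_def)
lemma small_nonneg: "small t f \<rho> \<Longrightarrow> 0 \<le> \<rho>" by (simp add: small_def)

lemma small_mono:
  assumes "small t f a" "a \<le> b" shows "small t f b"
proof -
  have "a\<^sup>2 \<le> b\<^sup>2" using assms by (intro power_mono) (auto simp: small_def)
  then have "a\<^sup>2 * t powr (- (1/2)) \<le> b\<^sup>2 * t powr (- (1/2))" by (rule mult_right_mono) simp
  moreover have "a * t powr (- (1/2)) \<le> b * t powr (- (1/2))" using assms(2) by (rule mult_right_mono) simp
  ultimately show ?thesis using assms unfolding small_def
    by (auto intro: order_trans ennreal_leI)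
qed

lemma ennreal_power2_le_imp_le:
  assumes "(X :: ennreal)\<^sup>2 \<le> ennreal (y\<^sup>2)" "y \<ge> 0" shows "X \<le> ennreal y"
proof (cases X)
  case (real r)
  then have "ennreal (r\<^sup>2) \<le> ennreal (y\<^sup>2)" using assms(1) by (simp add: ennreal_power)
  then have "r\<^sup>2 \<le> y\<^sup>2" by (simp add: ennreal_le_iff)
  then have "r \<le> y" using assms(2) by (rule power2_le_imp_le)
  then show ?thesis unfolding real by (rule ennreal_leI)
next
  case top
  then show ?thesis using assms(1) by (simp add: power2_eq_square ennreal_mult_top top_unique)
qed

lemma nn_integral_mult_le_L2:
  assumes [measurable]: "f \<in> borel_measurable borel" "g \<in> borel_measurable borel"
  assumes f: "L2sq f \<le> ennreal (a\<^sup>2)" and g: "L2sq g \<le> ennreal (b\<^sup>2)" and ab: "a \<ge> 0" "b \<ge> 0"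
  shows "(NN x. cmod (f x) * cmod (g x)) \<le> ennreal (a * b)"
proof (rule ennreal_power2_le_imp_le)
  have "(NN x. cmod (f x) * cmod (g x))\<^sup>2 = (\<integral>\<^sup>+ x. ennreal (cmod (f x)) * ennreal (cmod (g x)) \<partial>lborel)\<^sup>2"
    by (simp add: ennreal_mult)
  also have "\<dots> \<le> (\<integral>\<^sup>+ x. (ennreal (cmod (f x)))\<^sup>2 \<partial>lborel) * (\<integral>\<^sup>+ x. (ennreal (cmod (g x)))\<^sup>2 \<partial>lborel)"
    by (rule Cauchy_Schwarz_nn_integral) measurable
  also have "\<dots> = L2sq f * L2sq g" by (simp add: ennreal_power)
  also have "\<dots> \<le> ennreal (a\<^sup>2) * ennreal (b\<^sup>2)" using f g by (rule mult_mono) auto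
  also have "\<dots> = ennreal ((a * b)\<^sup>2)" by (simp add: ennreal_mult power_mult_distrib)
  finally show "(NN x. cmod (f x) * cmod (g x))\<^sup>2 \<le> ennreal ((a * b)\<^sup>2)" .
qed (use ab in auto)

lemma L2sq_add_le:
  assumes [measurable]: "f \<in> borel_measurable borel" "g \<in> borel_measurable borel"
  assumes f: "L2sq f \<le> ennreal (a\<^sup>2)" and g: "L2sq g \<le> ennreal (b\<^sup>2)" and ab: "a \<ge> 0" "b \<ge> 0"
  shows "L2sq (\<lambda>x. f x + g x) \<le> ennreal ((a + b)\<^sup>2)"
proof -
  have "L2sq (\<lambda>x. f x + g x) \<le> (\<integral>\<^sup>+ x. ennreal ((cmod (f x))\<^sup>2) + (ennreal ((cmod (g x))\<^sup>2) + ennreal 2 * ennreal (cmod (f x) * cmod (g x))) \<partial>lborel)"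
  proof (rule nn_integral_mono)
    fix x
    have "(cmod (f x + g x))\<^sup>2 \<le> (cmod (f x) + cmod (g x))\<^sup>2" by (intro power_mono norm_triangle_ineq) auto
    also have "\<dots> = (cmod (f x))\<^sup>2 + ((cmod (g x))\<^sup>2 + 2 * (cmod (f x) * cmod (g x)))" by (simp add: power2_sum)
    finally have "ennreal ((cmod (f x + g x))\<^sup>2) \<le> ennreal ((cmod (f x))\<^sup>2 + ((cmod (g x))\<^sup>2 + 2 * (cmod (f x) * cmod (g x))))"
      by (rule ennreal_leI)
    also have "\<dots> = ennreal ((cmod (f x))\<^sup>2) + (ennreal ((cmod (g x))\<^sup>2) + ennreal (2 * (cmod (f x) * cmod (g x))))"
      by (simp del: ennreal_numeral)
    finally show "ennreal ((cmod (f x + g x))\<^sup>2) \<le> ennreal ((cmod (f x))\<^sup>2) + (ennreal ((cmod (g x))\<^sup>2) + ennreal 2 * ennreal (cmod (f x) * cmod (g x)))"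
      by (subst ennreal_mult[symmetric]) auto
  qed
  also have "\<dots> = L2sq f + (L2sq g + ennreal 2 * (NN x. cmod (f x) * cmod (g x)))"
    by (simp add: nn_integral_add nn_integral_cmult)
  also have "\<dots> \<le> ennreal (a\<^sup>2) + (ennreal (b\<^sup>2) + ennreal 2 * ennreal (a * b))"
    using f g ab by (intro add_mono mult_left_mono nn_integral_mult_le_L2) auto
  also have "\<dots> = ennreal ((a + b)\<^sup>2)"
  proof -
    have "ennreal ((a + b)\<^sup>2) = ennreal (a\<^sup>2 + (b\<^sup>2 + 2 * (a * b)))" by (simp add: power2_sum add.assoc mult.assoc)
    also have "\<dots> = ennreal (a\<^sup>2) + ennreal (b\<^sup>2 + 2 * (a * b))" using ab by (intro ennreal_plus) auto
    also have "ennreal (b\<^sup>2 + 2 * (a * b)) = ennreal (b\<^sup>2) + ennreal (2 * (a * b))" using ab by (intro ennreal_plus) auto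
    also have "ennreal (2 * (a * b)) = ennreal 2 * ennreal (a * b)" using ab by (intro ennreal_mult) auto
    finally show ?thesis by (rule sym)
  qed
  finally show ?thesis .
qed

text \<open>Exhibits the L^2 budget of \<open>small\<close> as the square of a norm, the form
  required by the triangle inequality and by Cauchy-Schwarz.\<close>

lemma small_sq:
  fixes \<rho> t :: real
  shows "\<rho>\<^sup>2 * t powr (- (1/2)) = (\<rho> * t powr (- (1/4)))\<^sup>2"
proof -
  have "(t powr (- (1/4)))\<^sup>2 = t powr (- (1/2))" by (simp add: power2_eq_square flip: powr_add)
  then show ?thesis by (simp only: power_mult_distrib)
qed

lemma small_add:
  assumes "small t f a" "small t g b" shows "small t (\<lambda>x. f x + g x) (a + b)"
proof -
  have [measurable]: "f \<in> borel_measurable borel" "g \<in> borel_measurable borel" using assms by (auto simp: small_def)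
  have "L2sq (\<lambda>x. f x + g x) \<le> ennreal ((a * t powr (- (1/4)) + b * t powr (- (1/4)))\<^sup>2)"
    using assms unfolding small_def small_sq by (intro L2sq_add_le) auto
  moreover have "a * t powr (- (1/4)) + b * t powr (- (1/4)) = (a + b) * t powr (- (1/4))" by (simp add: distrib_right)
  moreover have "cmod (f x + g x) \<le> (a + b) * t powr (- (1/2))" for x
  proof -
    have "cmod (f x) \<le> a * t powr (- (1/2))" "cmod (g x) \<le> b * t powr (- (1/2))" using assms by (auto simp: small_def)
    then show ?thesis using norm_triangle_ineq[of "f x" "g x"] unfolding distrib_right by linarith
  qed
  ultimately show ?thesis using assms unfolding small_def small_sq by auto
qed

lemma small_cmult:
  assumes "small t f a" shows "small t (\<lambda>x. c * f x) (cmod c * a)"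
proof -
  have [measurable]: "f \<in> borel_measurable borel" using assms by (auto simp: small_def)
  have "L2sq (\<lambda>x. c * f x) = ennreal ((cmod c)\<^sup>2) * L2sq f" by (rule L2sq_cmult) measurable
  also have "\<dots> \<le> ennreal ((cmod c)\<^sup>2) * ennreal (a\<^sup>2 * t powr (- (1/2)))"
    using assms by (intro mult_left_mono) (auto simp: small_def)
  also have "\<dots> = ennreal ((cmod c * a)\<^sup>2 * t powr (- (1/2)))"
    by (subst ennreal_mult[symmetric]) (auto simp: power_mult_distrib mult.assoc)
  finally show ?thesis using assms unfolding small_def
    by (auto simp: norm_mult mult.assoc intro!: mult_left_mono)
qed

lemma small_diff:
  assumes "small t f a" "small t g b" shows "small t (\<lambda>x. f x - g x) (a + b)"
  using small_add[OF assms(1) small_cmult[OF assms(2), of "-1"]] by simp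

lemma small_translate:
  assumes "small t f a" shows "small t (\<lambda>x. f (x - c)) a"
proof -
  have [measurable]: "f \<in> borel_measurable borel" using assms by (auto simp: small_def)
  have "L2sq f = L2sq (\<lambda>x. f (x - c))"
    using nn_integral_real_affine[of "\<lambda>x. ennreal ((cmod (f x))\<^sup>2)" 1 "-c"] by simp
  then show ?thesis using assms unfolding small_def by auto
qed

text \<open>Parabolic scaling: if the symbol is dominated by a profile of
  \<open>sqrt t * \<xi>\<close>, its L^1 norm (which bounds the supremum) and the square of its L^2
  norm (by Plancherel) both carry the factor t^(-1/2). Adding the two profile norms gives one
  constant that serves both requirements of \<open>small\<close>.\<close>

lemma small_ift:
  assumes g [measurable]: "g \<in> borel_measurable borel" and t: "t > 0"
    and \<gamma>: "integrable lborel \<gamma>" "integrable lborel (\<lambda>\<zeta>. (\<gamma> \<zeta>)\<^sup>2)"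
    and le: "\<And>\<xi>. cmod (g \<xi>) \<le> \<gamma> (sqrt t * \<xi>)"
  shows "integrable lborel g" "small t (ift g) ((LBINT \<zeta>. \<gamma> \<zeta>) + sqrt (LBINT \<zeta>. (\<gamma> \<zeta>)\<^sup>2))"
proof -
  have \<gamma>0: "\<gamma> \<zeta> \<ge> 0" for \<zeta>
    using le[of "\<zeta> / sqrt t"] t norm_ge_zero[of "g (\<zeta> / sqrt t)"] by (simp add: field_simps del: norm_ge_zero)
  have sc: "integrable lborel (\<lambda>\<xi>. \<gamma> (sqrt t * \<xi>))"
    using lborel_integrable_real_affine[OF \<gamma>(1), of "sqrt t" 0] t by simp
  have sc2: "integrable lborel (\<lambda>\<xi>. (\<gamma> (sqrt t * \<xi>))\<^sup>2)"
    using lborel_integrable_real_affine[OF \<gamma>(2), of "sqrt t" 0] t by simp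
  have t2: "t powr (- (1/2)) = 1 / sqrt t" using t by (simp add: powr_minus powr_half_sqrt inverse_eq_divide)
  have I1: "(LBINT \<xi>. \<gamma> (sqrt t * \<xi>)) = (LBINT \<zeta>. \<gamma> \<zeta>) * t powr (- (1/2))"
    using lborel_integral_real_affine[of "sqrt t" \<gamma> 0] t unfolding t2 by (simp add: field_simps)
  have I2: "(LBINT \<xi>. (\<gamma> (sqrt t * \<xi>))\<^sup>2) = (LBINT \<zeta>. (\<gamma> \<zeta>)\<^sup>2) * t powr (- (1/2))"
    using lborel_integral_real_affine[of "sqrt t" "\<lambda>\<zeta>. (\<gamma> \<zeta>)\<^sup>2" 0] t unfolding t2 by (simp add: field_simps)
  show gi: "integrable lborel g"
    by (rule Bochner_Integration.integrable_bound[OF sc]) (use le \<gamma>0 in \<open>auto simp: order_trans\<close>)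
  define A where "A = (LBINT \<zeta>. \<gamma> \<zeta>)"
  define C where "C = (LBINT \<zeta>. (\<gamma> \<zeta>)\<^sup>2)"
  have A0: "A \<ge> 0" unfolding A_def by (intro integral_nonneg_AE) (auto simp: \<gamma>0)
  have C0: "C \<ge> 0" unfolding C_def by (intro integral_nonneg_AE) auto
  have pi1: "1 / (2 * pi) \<le> 1" using pi_gt3 by (simp add: divide_le_eq)
  have "cmod (ift g x) \<le> A * t powr (- (1/2))" for x
  proof -
    have "cmod (ift g x) \<le> (1 / (2 * pi)) * (LBINT \<xi>. cmod (g \<xi>))" by (rule cmod_ift_le[OF gi])
    also have "\<dots> \<le> 1 * (LBINT \<xi>. cmod (g \<xi>))" using pi1 by (rule mult_right_mono) (auto intro: integral_nonneg_AE)
    also have "(LBINT \<xi>. cmod (g \<xi>)) \<le> (LBINT \<xi>. \<gamma> (sqrt t * \<xi>))"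
      using gi sc le by (intro integral_mono) auto
    finally show ?thesis unfolding I1 A_def by simp
  qed
  moreover have "A * t powr (- (1/2)) \<le> (A + sqrt C) * t powr (- (1/2))" using C0 by (intro mult_right_mono) auto
  moreover have "L2sq (ift g) \<le> ennreal ((A + sqrt C)\<^sup>2 * t powr (- (1/2)))"
  proof -
    have "L2sq (ift g) \<le> ennreal (1 / (2 * pi)) * L2sq g" by (rule L2sq_ift_le[OF gi])
    also have "\<dots> \<le> 1 * L2sq g" using pi1 by (intro mult_right_mono) auto
    also have "\<dots> \<le> (NN \<xi>. (\<gamma> (sqrt t * \<xi>))\<^sup>2)"
      unfolding mult_1 using le by (intro nn_integral_mono ennreal_leI power_mono) auto
    also have "\<dots> = ennreal (C * t powr (- (1/2)))"
      unfolding C_def I2[symmetric] using sc2 by (intro nn_integral_eq_integral) auto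
    also have "\<dots> \<le> ennreal ((A + sqrt C)\<^sup>2 * t powr (- (1/2)))"
    proof (intro ennreal_leI mult_right_mono)
      have "C = (sqrt C)\<^sup>2" using C0 by simp
      also have "\<dots> \<le> (A + sqrt C)\<^sup>2" using A0 C0 by (intro power_mono) auto
      finally show "C \<le> (A + sqrt C)\<^sup>2" .
    qed auto
    finally show ?thesis .
  qed
  ultimately show "small t (ift g) ((LBINT \<zeta>. \<gamma> \<zeta>) + sqrt (LBINT \<zeta>. (\<gamma> \<zeta>)\<^sup>2))"
    unfolding small_def A_def[symmetric] C_def[symmetric] using A0 C0 gi by (auto intro: order_trans ift_measurable)
qed

lemma integrable_abs_pow_gauss:
  assumes "c > (0::real)"
  shows "integrable lborel (\<lambda>\<zeta>. \<bar>\<zeta>\<bar> ^ k * gauss c \<zeta>)"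
proof -
  define s where "s = sqrt (1 / (2 * c))"
  have s: "s > 0" "s\<^sup>2 = 1 / (2 * c)" using assms by (auto simp: s_def)
  have eq: "\<bar>\<zeta>\<bar> ^ k * gauss c \<zeta> = sqrt (pi / c) * (normal_density 0 s \<zeta> * \<bar>\<zeta> - 0\<bar> ^ k)" for \<zeta>
    using assms by (simp add: normal_density_def s real_sqrt_divide real_sqrt_mult field_simps)
  show ?thesis unfolding eq by (intro integrable_mult_right integrable_normal_moment_abs s)
qed

text \<open>The constant that \<open>small_ift\<close> produces for the profile |\<zeta>|^k exp(-c
  \<zeta>^2).\<close>

definition gauss_const :: "nat \<Rightarrow> real \<Rightarrow> real" where
  "gauss_const k c = (LBINT \<zeta>. \<bar>\<zeta>\<bar> ^ k * gauss c \<zeta>) + sqrt (LBINT \<zeta>. (\<bar>\<zeta>\<bar> ^ k * gauss c \<zeta>)\<^sup>2)"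

lemma gauss_const_nonneg: "gauss_const k c \<ge> 0"
  unfolding gauss_const_def by (intro add_nonneg_nonneg real_sqrt_ge_zero integral_nonneg_AE) auto

lemma integrable_abs_pow_gauss_sq:
  assumes "c > (0::real)"
  shows "integrable lborel (\<lambda>\<zeta>. (\<bar>\<zeta>\<bar> ^ k * gauss c \<zeta>)\<^sup>2)"
proof -
  have "(\<bar>\<zeta>\<bar> ^ k * gauss c \<zeta>)\<^sup>2 = \<bar>\<zeta>\<bar> ^ (2 * k) * gauss (2 * c) \<zeta>" for \<zeta>
  proof -
    have "(\<bar>\<zeta>\<bar> ^ k)\<^sup>2 = \<bar>\<zeta>\<bar> ^ (2 * k)" by (simp only: power_mult[symmetric] mult.commute)
    moreover have "(gauss c \<zeta>)\<^sup>2 = gauss (2 * c) \<zeta>"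
      by (simp add: power2_eq_square[of "exp _"] flip: exp_add)
    ultimately show ?thesis by (simp only: power_mult_distrib)
  qed
  then show ?thesis using integrable_abs_pow_gauss[of "2 * c" "2 * k"] assms by simp
qed

lemma small_ift_gauss:
  assumes g [measurable]: "g \<in> borel_measurable borel" and t: "t > 0" and c: "c > 0" and C: "C \<ge> 0"
    and le: "\<And>\<xi>. cmod (g \<xi>) \<le> C * (\<bar>sqrt t * \<xi>\<bar> ^ k * gauss c (sqrt t * \<xi>))"
  shows "integrable lborel g" "small t (ift g) (C * gauss_const k c)"
proof -
  let ?\<gamma> = "\<lambda>\<zeta>. C * (\<bar>\<zeta>\<bar> ^ k * gauss c \<zeta>)"
  have 1: "integrable lborel ?\<gamma>" by (intro integrable_mult_right integrable_abs_pow_gauss c)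
  have 2: "integrable lborel (\<lambda>\<zeta>. (?\<gamma> \<zeta>)\<^sup>2)"
    unfolding power_mult_distrib[of C] by (intro integrable_mult_right integrable_abs_pow_gauss_sq c)
  note * = small_ift[OF g t 1 2 le]
  show "integrable lborel g" by (rule *(1))
  have "(LBINT \<zeta>. ?\<gamma> \<zeta>) + sqrt (LBINT \<zeta>. (?\<gamma> \<zeta>)\<^sup>2) = C * gauss_const k c"
    unfolding power_mult_distrib[of C] gauss_const_def using C by (simp add: real_sqrt_mult distrib_left)
  with *(2) show "small t (ift g) (C * gauss_const k c)" by simp
qed

text \<open>Minkowski's integral inequality for the two norms at once. In L^2 the square of the
  integral is bounded by a double integral over z and z', Tonelli moves the x-integral inside, and
  Cauchy-Schwarz in x separates the factors again.\<close>

lemma small_integral: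
  fixes f :: "'a \<Rightarrow> real \<Rightarrow> complex" and w :: "'a \<Rightarrow> complex"
  assumes N: "sigma_finite_measure N"
    and f [measurable]: "(\<lambda>(z, x). f z x) \<in> borel_measurable (N \<Otimes>\<^sub>M borel)"
    and w [measurable]: "w \<in> borel_measurable N" and \<rho> [measurable]: "\<rho> \<in> borel_measurable N"
    and sm: "\<And>z. z \<in> space N \<Longrightarrow> small t (f z) (\<rho> z)"
    and R: "(\<integral>\<^sup>+ z. ennreal (\<rho> z * cmod (w z)) \<partial>N) \<le> ennreal R" "R \<ge> 0"
  shows "small t (\<lambda>x. \<integral>z. f z x * w z \<partial>N) R"
proof -
  interpret N: sigma_finite_measure N by fact
  interpret NL: pair_sigma_finite N lborel by standard
  let ?F = "\<lambda>x. \<integral>z. f z x * w z \<partial>N"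
  have m1 [measurable]: "(\<lambda>(x, z). f z x) \<in> borel_measurable (borel \<Otimes>\<^sub>M N)"
    using measurable_compose[OF measurable_pair_swap' f] by (simp add: split_beta')
  have m2 [measurable]: "(\<lambda>x. f z x) \<in> borel_measurable borel" if "z \<in> space N" for z
    using sm[OF that] by (simp add: small_def)
  have m0: "(\<lambda>(x, z). f z x * w z) \<in> borel_measurable (borel \<Otimes>\<^sub>M N)" by measurable
  have meas: "?F \<in> borel_measurable borel"
    by (rule N.borel_measurable_lebesgue_integral) (use m0 in simp)
  let ?I = "\<lambda>x. \<integral>\<^sup>+ z. ennreal (cmod (f z x)) * ennreal (cmod (w z)) \<partial>N"
  have le_I: "ennreal (cmod (?F x)) \<le> ?I x" for x
    using norm_integral_le_nn[of N "\<lambda>z. f z x * w z"] by (simp add: norm_mult ennreal_mult)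
  have \<rho>0: "\<rho> z \<ge> 0" if "z \<in> space N" for z using sm[OF that] by (simp add: small_def)
  have bd: "cmod (?F x) \<le> R * t powr (- (1/2))" for x
  proof -
    have "?I x \<le> (\<integral>\<^sup>+ z. ennreal (\<rho> z * cmod (w z)) * ennreal (t powr (- (1/2))) \<partial>N)"
    proof (rule nn_integral_mono)
      fix z assume z: "z \<in> space N"
      have "cmod (f z x) * cmod (w z) \<le> \<rho> z * t powr (- (1/2)) * cmod (w z)"
        using sm[OF z] by (intro mult_right_mono) (auto simp: small_def)
      also have "\<dots> = \<rho> z * cmod (w z) * t powr (- (1/2))" by (simp only: mult_ac)
      finally show "ennreal (cmod (f z x)) * ennreal (cmod (w z)) \<le> ennreal (\<rho> z * cmod (w z)) * ennreal (t powr (- (1/2)))"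
        using \<rho>0[OF z] by (simp add: ennreal_mult[symmetric] ennreal_leI)
    qed
    also have "\<dots> = (\<integral>\<^sup>+ z. ennreal (\<rho> z * cmod (w z)) \<partial>N) * ennreal (t powr (- (1/2)))"
      by (rule nn_integral_multc) measurable
    also have "\<dots> \<le> ennreal R * ennreal (t powr (- (1/2)))" using R by (intro mult_right_mono) auto
    also have "\<dots> = ennreal (R * t powr (- (1/2)))" using R by (simp add: ennreal_mult)
    finally have "ennreal (cmod (?F x)) \<le> ennreal (R * t powr (- (1/2)))" using le_I[of x] by (rule order_trans[rotated])
    then show ?thesis using R(2) by (subst (asm) ennreal_le_iff) auto
  qed
  have "L2sq ?F \<le> (\<integral>\<^sup>+ x. ?I x * ?I x \<partial>lborel)"
  proof (rule nn_integral_mono)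
    fix x
    have "ennreal ((cmod (?F x))\<^sup>2) = ennreal (cmod (?F x)) * ennreal (cmod (?F x))"
      by (simp add: power2_eq_square ennreal_mult)
    also have "\<dots> \<le> ?I x * ?I x" by (intro mult_mono le_I) auto
    finally show "ennreal ((cmod (?F x))\<^sup>2) \<le> ?I x * ?I x" .
  qed
  also have "\<dots> = (\<integral>\<^sup>+ x. \<integral>\<^sup>+ z. ennreal (cmod (f z x)) * ennreal (cmod (w z)) * ?I x \<partial>N \<partial>lborel)"
    by (intro nn_integral_cong nn_integral_multc[symmetric]) measurable
  also have "\<dots> = (\<integral>\<^sup>+ z. \<integral>\<^sup>+ x. ennreal (cmod (f z x)) * ennreal (cmod (w z)) * ?I x \<partial>lborel \<partial>N)"
    by (rule NL.Fubini') measurable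
  also have "\<dots> = (\<integral>\<^sup>+ z. \<integral>\<^sup>+ x. \<integral>\<^sup>+ z'. ennreal (cmod (f z x)) * ennreal (cmod (w z)) * (ennreal (cmod (f z' x)) * ennreal (cmod (w z'))) \<partial>N \<partial>lborel \<partial>N)"
    by (intro nn_integral_cong nn_integral_cmult[symmetric]) measurable
  also have "\<dots> = (\<integral>\<^sup>+ z. \<integral>\<^sup>+ z'. \<integral>\<^sup>+ x. ennreal (cmod (f z x)) * ennreal (cmod (w z)) * (ennreal (cmod (f z' x)) * ennreal (cmod (w z'))) \<partial>lborel \<partial>N \<partial>N)"
    by (intro nn_integral_cong NL.Fubini') measurable
  also have "\<dots> \<le> (\<integral>\<^sup>+ z. \<integral>\<^sup>+ z'. ennreal (\<rho> z * cmod (w z)) * (ennreal (\<rho> z' * cmod (w z')) * ennreal (t powr (- (1/2)))) \<partial>N \<partial>N)"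
  proof (intro nn_integral_mono)
    fix z z' assume z: "z \<in> space N" "z' \<in> space N"
    have "(\<integral>\<^sup>+ x. ennreal (cmod (f z x)) * ennreal (cmod (w z)) * (ennreal (cmod (f z' x)) * ennreal (cmod (w z'))) \<partial>lborel)
      = (\<integral>\<^sup>+ x. ennreal (cmod (w z) * cmod (w z')) * ennreal (cmod (f z x) * cmod (f z' x)) \<partial>lborel)"
      by (intro nn_integral_cong) (simp add: ennreal_mult[symmetric] mult_ac)
    also have "\<dots> = ennreal (cmod (w z) * cmod (w z')) * (NN x. cmod (f z x) * cmod (f z' x))"
      using z by (intro nn_integral_cmult) measurable
    also have "\<dots> \<le> ennreal (cmod (w z) * cmod (w z')) * ennreal ((\<rho> z * t powr (- (1/4))) * (\<rho> z' * t powr (- (1/4))))"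
      using sm[OF z(1)] sm[OF z(2)] unfolding small_def small_sq by (intro mult_left_mono nn_integral_mult_le_L2) auto
    also have "\<dots> = ennreal (\<rho> z * cmod (w z) * (\<rho> z' * cmod (w z') * (t powr (- (1/4)) * t powr (- (1/4)))))"
      using \<rho>0[OF z(1)] \<rho>0[OF z(2)] by (simp add: ennreal_mult[symmetric] mult_ac)
    also have "t powr (- (1/4)) * t powr (- (1/4)) = t powr (- (1/2))" by (simp flip: powr_add)
    also have "ennreal (\<rho> z * cmod (w z) * (\<rho> z' * cmod (w z') * t powr (- (1/2)))) = ennreal (\<rho> z * cmod (w z)) * (ennreal (\<rho> z' * cmod (w z')) * ennreal (t powr (- (1/2))))"
      using \<rho>0[OF z(1)] \<rho>0[OF z(2)] by (simp add: ennreal_mult)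
    finally show "(\<integral>\<^sup>+ x. ennreal (cmod (f z x)) * ennreal (cmod (w z)) * (ennreal (cmod (f z' x)) * ennreal (cmod (w z'))) \<partial>lborel)
      \<le> ennreal (\<rho> z * cmod (w z)) * (ennreal (\<rho> z' * cmod (w z')) * ennreal (t powr (- (1/2))))" .
  qed
  also have "\<dots> = (\<integral>\<^sup>+ z. ennreal (\<rho> z * cmod (w z)) * ((\<integral>\<^sup>+ z'. ennreal (\<rho> z' * cmod (w z')) \<partial>N) * ennreal (t powr (- (1/2)))) \<partial>N)"
    by (intro nn_integral_cong) (simp add: nn_integral_cmult nn_integral_multc)
  also have "\<dots> = (\<integral>\<^sup>+ z. ennreal (\<rho> z * cmod (w z)) \<partial>N) * ((\<integral>\<^sup>+ z'. ennreal (\<rho> z' * cmod (w z')) \<partial>N) * ennreal (t powr (- (1/2))))"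
    by (rule nn_integral_multc) measurable
  also have "\<dots> \<le> ennreal R * (ennreal R * ennreal (t powr (- (1/2))))"
    using R(1) by (intro mult_mono) auto
  also have "\<dots> = ennreal (R\<^sup>2 * t powr (- (1/2)))" using R(2) by (simp add: ennreal_mult power2_eq_square mult.assoc)
  finally show ?thesis using meas bd R(2) unfolding small_def by blast
qed

lemma integrable_small:
  fixes f :: "'a \<Rightarrow> real \<Rightarrow> complex" and w :: "'a \<Rightarrow> complex"
  assumes f [measurable]: "(\<lambda>z. f z x) \<in> borel_measurable N"
    and w [measurable]: "w \<in> borel_measurable N" and \<rho> [measurable]: "\<rho> \<in> borel_measurable N"
    and sm: "\<And>z. z \<in> space N \<Longrightarrow> small t (f z) (\<rho> z)"
    and R: "(\<integral>\<^sup>+ z. ennreal (\<rho> z * cmod (w z)) \<partial>N) \<le> ennreal R"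
  shows "integrable N (\<lambda>z. f z x * w z)"
proof (rule Bochner_Integration.integrable_bound)
  show "integrable N (\<lambda>z. t powr (- (1/2)) * (\<rho> z * cmod (w z)))"
  proof (intro integrable_mult_right integrableI_nonneg)
    show "AE z in N. 0 \<le> \<rho> z * cmod (w z)" using sm by (intro AE_I2 mult_nonneg_nonneg) (auto simp: small_def)
    show "(\<integral>\<^sup>+ z. ennreal (\<rho> z * cmod (w z)) \<partial>N) < \<infinity>" using R le_less_trans[OF R ennreal_less_top] by simp
  qed measurable
  show "AE z in N. norm (f z x * w z) \<le> norm (t powr (- (1/2)) * (\<rho> z * cmod (w z)))"
  proof (rule AE_I2)
    fix z assume z: "z \<in> space N"
    have "cmod (f z x) * cmod (w z) \<le> \<rho> z * t powr (- (1/2)) * cmod (w z)"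
      using sm[OF z] by (intro mult_right_mono) (auto simp: small_def)
    moreover have "\<rho> z \<ge> 0" using sm[OF z] by (rule small_nonneg)
    ultimately show "norm (f z x * w z) \<le> norm (t powr (- (1/2)) * (\<rho> z * cmod (w z)))"
      by (simp add: norm_mult abs_mult mult_ac)
  qed
qed measurable

subsection \<open>Fourier transforms of square integrable functions\<close>

lemma integrable_inverse_1_plus_square_lborel: "integrable lborel (\<lambda>x::real. 1 / (1 + x\<^sup>2))"
  using integrable_inverse_1_plus_square by (simp add: set_integrable_def field_simps einterval_def)

lemma heat_eq_ift:
  assumes "\<mu> * t > 0"
  shows "Cx (heat \<mu> t x) = ift (\<lambda>\<xi>. Cx (gauss (\<mu> * t) \<xi>)) x"
proof -
  have "ift (\<lambda>\<xi>. Cx (gauss (\<mu> * t) \<xi>)) x =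
    Cx (1 / (2 * pi) * (sqrt (pi / (\<mu> * t)) * exp (- (x\<^sup>2 / (4 * (\<mu> * t))))))"
    unfolding ift_def using fourier_gauss[OF assms, of x] by simp
  also have "1 / (2 * pi) * (sqrt (pi / (\<mu> * t)) * exp (- (x\<^sup>2 / (4 * (\<mu> * t))))) = heat \<mu> t x"
  proof -
    have "1 / (2 * pi) * sqrt (pi / (\<mu> * t)) = 1 / sqrt (4 * pi * \<mu> * t)"
    proof -
      have "1 / (2 * pi) = sqrt ((1 / (2 * pi))\<^sup>2)" by (subst real_sqrt_abs) simp
      then have "1 / (2 * pi) * sqrt (pi / (\<mu> * t)) = sqrt ((1 / (2 * pi))\<^sup>2 * (pi / (\<mu> * t)))"
        by (simp only: real_sqrt_mult)
      also have "(1 / (2 * pi))\<^sup>2 * (pi / (\<mu> * t)) = 1 / (4 * pi * \<mu> * t)" by (simp add: power2_eq_square)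
      finally show ?thesis by (simp add: real_sqrt_divide)
    qed
    then show ?thesis unfolding heat_def mult.assoc[symmetric] by (simp only: mult.assoc)
  qed
  finally show ?thesis by simp
qed

lemma heat_measurable [measurable]: "heat \<mu> t \<in> borel_measurable borel"
  unfolding heat_def[abs_def] by measurable

lemma heat_nonneg: "\<mu> * t > 0 \<Longrightarrow> heat \<mu> t x \<ge> 0"
  by (simp add: heat_def mult.assoc)

lemma heat_le: "\<mu> * t > 0 \<Longrightarrow> heat \<mu> t x \<le> 1 / sqrt (4 * pi * \<mu> * t)"
  by (simp add: heat_def mult.assoc divide_right_mono)

lemma integrable_heat:
  assumes "\<mu> * t > 0"
  shows "integrable lborel (heat \<mu> t)" "(LBINT x. heat \<mu> t x) = 1"
proof -
  have *: "heat \<mu> t = (\<lambda>x. 1 / sqrt (4 * pi * \<mu> * t) * gauss (1 / (4 * \<mu> * t)) x)"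
    by (simp add: heat_def fun_eq_iff)
  have c: "1 / (4 * \<mu> * t) > 0" using assms by (simp add: mult.assoc)
  show "integrable lborel (heat \<mu> t)" unfolding * by (intro integrable_mult_right integrable_gauss c)
  have "(LBINT x. heat \<mu> t x) = 1 / sqrt (4 * pi * \<mu> * t) * sqrt (pi / (1 / (4 * \<mu> * t)))"
    unfolding * by (subst integrable_gauss(2)[OF c, symmetric]) (rule integral_mult_right_zero)
  also have "pi / (1 / (4 * \<mu> * t)) = 4 * pi * \<mu> * t" by simp
  finally show "(LBINT x. heat \<mu> t x) = 1" using assms by (auto simp: mult.assoc)
qed

text \<open>Heat averages of an interval indicator, written with x = y + sqrt \<epsilon> z. If x
  lies in the interval, then |y| \<le> A + |z| because \<epsilon> \<le> 1; this yields an
  exponentially decaying majorant uniform in \<epsilon>, integrable against any square integrable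
  function. It supplies the domination when the regularisation is moved from a function onto the
  indicator.\<close>

lemma heat_average:
  fixes a b :: real
  assumes A: "\<bar>a\<bar> \<le> A" "\<bar>b\<bar> \<le> A"
  defines "E \<equiv> LBINT z. exp \<bar>z\<bar> * heat 1 1 z"
  defines "\<Psi> \<equiv> \<lambda>\<epsilon> y. LBINT x. indicator {a..b} x * heat 1 \<epsilon> (x - y)"
  shows "\<And>\<epsilon> y. 0 < \<epsilon> \<Longrightarrow> \<epsilon> \<le> 1 \<Longrightarrow> \<bar>\<Psi> \<epsilon> y\<bar> \<le> exp A * E * exp (- \<bar>y\<bar>)"
    and "\<And>y. y \<noteq> a \<Longrightarrow> y \<noteq> b \<Longrightarrow> (\<lambda>n. \<Psi> (1 / real (Suc n)) y) \<longlonglongrightarrow> indicator {a..b} y"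
proof -
  have Eint: "integrable lborel (\<lambda>z. exp \<bar>z\<bar> * heat 1 1 z)"
  proof (rule Bochner_Integration.integrable_bound)
    show "integrable lborel (\<lambda>z::real. exp 2 * gauss (1/8) z)"
      by (intro integrable_mult_right integrable_gauss) simp
    show "AE z in lborel. norm (exp \<bar>z\<bar> * heat 1 1 z) \<le> norm (exp 2 * gauss (1/8) z)"
    proof (rule AE_I2)
      fix z :: real
      \<comment> \<open>Half of the Gaussian exponent absorbs the factor
        \<open>exp \<bar>z\<bar>\<close>; completing the square around 4 costs only the constant exp
        2.\<close>
      have "0 \<le> (\<bar>z\<bar> - 4)\<^sup>2" by simp
      then have "\<bar>z\<bar> - z\<^sup>2 / 4 \<le> 2 - z\<^sup>2 / 8" by (simp add: power2_diff)
      then have le: "exp (\<bar>z\<bar> - z\<^sup>2 / 4) \<le> exp (2 - z\<^sup>2 / 8)" by (rule exp_le_cancel_iff[THEN iffD2])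
      have "1 / sqrt (4 * pi) \<le> 1" using pi_gt3 by simp
      then have "1 / sqrt (4 * pi) * exp (\<bar>z\<bar> - z\<^sup>2 / 4) \<le> 1 * exp (\<bar>z\<bar> - z\<^sup>2 / 4)" by (rule mult_right_mono) simp
      from order_trans[OF this[unfolded mult_1] le] have "1 / sqrt (4 * pi) * exp (\<bar>z\<bar> - z\<^sup>2 / 4) \<le> exp (2 - z\<^sup>2 / 8)" .
      moreover have "exp \<bar>z\<bar> * heat 1 1 z = 1 / sqrt (4 * pi) * exp (\<bar>z\<bar> - z\<^sup>2 / 4)"
      proof -
        have "exp (\<bar>z\<bar> - z\<^sup>2 / 4) = exp \<bar>z\<bar> * exp (- (z\<^sup>2 / 4))" by (simp flip: exp_add)
        then show ?thesis by (simp add: heat_def)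
      qed
      moreover have "exp 2 * gauss (1/8) z = exp (2 - z\<^sup>2 / 8)" by (simp flip: exp_add)
      moreover have "heat 1 1 z \<ge> 0" by (simp add: heat_nonneg)
      ultimately show "norm (exp \<bar>z\<bar> * heat 1 1 z) \<le> norm (exp 2 * gauss (1/8) z)" by simp
    qed
  qed measurable
  have eq: "\<Psi> \<epsilon> y = (LBINT z. indicator {a..b} (y + sqrt \<epsilon> * z) * heat 1 1 z)" if e: "\<epsilon> > 0" for \<epsilon> y
  proof -
    have h: "sqrt \<epsilon> * heat 1 \<epsilon> (sqrt \<epsilon> * z) = heat 1 1 z" for z
      using e by (simp add: heat_def real_sqrt_mult power_mult_distrib)
    have "\<Psi> \<epsilon> y = \<bar>sqrt \<epsilon>\<bar> *\<^sub>R (LBINT z. indicator {a..b} (y + sqrt \<epsilon> * z) * heat 1 \<epsilon> (y + sqrt \<epsilon> * z - y))"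
      unfolding \<Psi>_def using e by (intro lborel_integral_real_affine) auto
    also have "\<dots> = (LBINT z. indicator {a..b} (y + sqrt \<epsilon> * z) * (sqrt \<epsilon> * heat 1 \<epsilon> (sqrt \<epsilon> * z)))"
      using e by (simp add: mult.left_commute)
    finally show ?thesis unfolding h .
  qed
  show "\<bar>\<Psi> \<epsilon> y\<bar> \<le> exp A * E * exp (- \<bar>y\<bar>)" if e: "0 < \<epsilon>" "\<epsilon> \<le> 1" for \<epsilon> y
  proof -
    have "norm (\<Psi> \<epsilon> y) \<le> (LBINT z. exp A * exp (- \<bar>y\<bar>) * (exp \<bar>z\<bar> * heat 1 1 z))"
      unfolding eq[OF e(1)]
    proof (rule Bochner_Integration.integral_norm_bound_integral)
      show "integrable lborel (\<lambda>z. exp A * exp (- \<bar>y\<bar>) * (exp \<bar>z\<bar> * heat 1 1 z))" by (intro integrable_mult_right Eint)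
      show "integrable lborel (\<lambda>z. indicator {a..b} (y + sqrt \<epsilon> * z) * heat 1 1 z)"
        by (rule Bochner_Integration.integrable_bound[OF integrable_heat(1)[of 1 1]]) (auto simp: indicator_def)
      fix z
      have "indicator {a..b} (y + sqrt \<epsilon> * z) \<le> exp A * exp (- \<bar>y\<bar>) * exp \<bar>z\<bar>"
      proof (cases "y + sqrt \<epsilon> * z \<in> {a..b}")
        case True
        then have "\<bar>y + sqrt \<epsilon> * z\<bar> \<le> A" using A by auto
        moreover have "\<bar>sqrt \<epsilon> * z\<bar> \<le> 1 * \<bar>z\<bar>" unfolding abs_mult using e by (intro mult_right_mono) auto
        ultimately have "0 \<le> A + - \<bar>y\<bar> + \<bar>z\<bar>" by linarith
        then have "1 \<le> exp (A + - \<bar>y\<bar> + \<bar>z\<bar>)" by simp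
        then show ?thesis using True by (simp only: exp_add indicator_simps)
      qed auto
      then have "indicator {a..b} (y + sqrt \<epsilon> * z) * heat 1 1 z \<le> exp A * exp (- \<bar>y\<bar>) * exp \<bar>z\<bar> * heat 1 1 z"
        by (rule mult_right_mono) (simp add: heat_nonneg)
      then show "norm (indicator {a..b} (y + sqrt \<epsilon> * z) * heat 1 1 z) \<le> exp A * exp (- \<bar>y\<bar>) * (exp \<bar>z\<bar> * heat 1 1 z)"
        by (simp add: heat_nonneg mult.assoc)
    qed
    also have "\<dots> = exp A * exp (- \<bar>y\<bar>) * E" unfolding E_def by (rule integral_mult_right_zero)
    finally show ?thesis by (simp only: real_norm_def mult_ac)
  qed
  \<comment> \<open>At an endpoint of a proper interval the averages tend to 1/2, hence the
    exclusion; later the two points are a null set.\<close>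
  show "(\<lambda>n. \<Psi> (1 / real (Suc n)) y) \<longlonglongrightarrow> indicator {a..b} y" if y: "y \<noteq> a" "y \<noteq> b" for y
  proof -
    have "(\<lambda>n. LBINT z. indicator {a..b} (y + sqrt (1 / real (Suc n)) * z) * heat 1 1 z) \<longlonglongrightarrow> (LBINT z. indicator {a..b} y * heat 1 1 z)"
    proof (rule integral_dominated_convergence[where w = "heat 1 1"])
      show "AE z in lborel. (\<lambda>n. indicator {a..b} (y + sqrt (1 / real (Suc n)) * z) * heat 1 1 z) \<longlonglongrightarrow> indicator {a..b} y * heat 1 1 z"
      proof (rule AE_I2)
        fix z
        have "(\<lambda>n. 1 / real (Suc n)) \<longlonglongrightarrow> 0" using LIMSEQ_inverse_real_of_nat by (simp add: inverse_eq_divide)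
        then have "(\<lambda>n. y + sqrt (1 / real (Suc n)) * z) \<longlonglongrightarrow> y + sqrt 0 * z" by (intro tendsto_intros)
        then have lim: "(\<lambda>n. y + sqrt (1 / real (Suc n)) * z) \<longlonglongrightarrow> y" by simp
        have "\<forall>\<^sub>F n in sequentially. indicator {a..b} (y + sqrt (1 / real (Suc n)) * z) = (indicator {a..b} y :: real)"
        proof -
          consider "y \<in> {a<..<b}" | "y \<in> {..<a}" | "y \<in> {b<..}" using y by force
          then show ?thesis
          proof cases
            case 1
            then have "\<forall>\<^sub>F n in sequentially. y + sqrt (1 / real (Suc n)) * z \<in> {a<..<b}" by (intro topological_tendstoD[OF lim]) auto
            then show ?thesis by eventually_elim (use 1 in \<open>auto simp: indicator_def\<close>)
          next
            case 2
            then have "\<forall>\<^sub>F n in sequentially. y + sqrt (1 / real (Suc n)) * z \<in> {..<a}" by (intro topological_tendstoD[OF lim]) auto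
            then show ?thesis by eventually_elim (use 2 in \<open>auto simp: indicator_def\<close>)
          next
            case 3
            then have "\<forall>\<^sub>F n in sequentially. y + sqrt (1 / real (Suc n)) * z \<in> {b<..}" by (intro topological_tendstoD[OF lim]) auto
            then show ?thesis by eventually_elim (use 3 in \<open>auto simp: indicator_def\<close>)
          qed
        qed
        then have "\<forall>\<^sub>F n in sequentially. indicator {a..b} (y + sqrt (1 / real (Suc n)) * z) * heat 1 1 z = indicator {a..b} y * heat 1 1 z"
          by eventually_elim (simp only:)
        then show "(\<lambda>n. indicator {a..b} (y + sqrt (1 / real (Suc n)) * z) * heat 1 1 z) \<longlonglongrightarrow> indicator {a..b} y * heat 1 1 z"
          by (rule tendsto_eventually)
      qed
      show "AE z in lborel. norm (indicator {a..b} (y + sqrt (1 / real (Suc n)) * z) * heat 1 1 z) \<le> heat 1 1 z" for n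
        by (rule AE_I2) (auto simp: indicator_def heat_nonneg)
    qed (use integrable_heat[of 1 1] in \<open>auto\<close>)
    also have "(LBINT z. indicator {a..b} y * heat 1 1 z) = indicator {a..b} y" using integrable_heat(2)[of 1 1] by simp
    finally show ?thesis by (simp only: eq zero_less_divide_1_iff of_nat_0_less_iff zero_less_Suc)
  qed
qed

lemma L2sq_fourier_le:
  assumes f: "integrable lborel f"
  shows "L2sq (fourier f) \<le> L2sq f" "fourier f \<in> borel_measurable borel"
    "fourier f \<xi> = Cx (1 / sqrt (2 * pi)) * (LBINT x. iexp (- (\<xi> * x)) * f x)"
proof -
  have [measurable]: "f \<in> borel_measurable borel" using f by auto
  define \<Phi> where "\<Phi> = (\<lambda>y. LBINT x. iexp (y * x) * f x)"
  have \<Phi>m [measurable]: "\<Phi> \<in> borel_measurable borel" unfolding \<Phi>_def by (rule fourier_measurable) measurable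
  have eq: "fourier f \<xi> = Cx (1 / sqrt (2 * pi)) * (LBINT x. iexp (- (\<xi> * x)) * f x)" for \<xi>
    unfolding fourier_def by (simp add: mult_ac)
  then show "fourier f \<xi> = Cx (1 / sqrt (2 * pi)) * (LBINT x. iexp (- (\<xi> * x)) * f x)" .
  have eq2: "fourier f = (\<lambda>\<xi>. Cx (1 / sqrt (2 * pi)) * \<Phi> (- \<xi>))"
    unfolding eq[abs_def] \<Phi>_def by simp
  show "fourier f \<in> borel_measurable borel" unfolding eq2 by measurable
  have "L2sq (fourier f) = ennreal ((cmod (Cx (1 / sqrt (2 * pi))))\<^sup>2) * L2sq (\<lambda>\<xi>. \<Phi> (- \<xi>))"
    unfolding eq2 by (rule L2sq_cmult) measurable
  also have "L2sq (\<lambda>\<xi>. \<Phi> (- \<xi>)) = L2sq \<Phi>"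
    using nn_integral_real_affine[of "\<lambda>x. ennreal ((cmod (\<Phi> x))\<^sup>2)" "-1" 0] by simp
  also have "ennreal ((cmod (Cx (1 / sqrt (2 * pi))))\<^sup>2) * L2sq \<Phi> \<le> ennreal (1 / (2 * pi)) * (ennreal (2 * pi) * L2sq f)"
    unfolding \<Phi>_def norm_of_real by (intro mult_mono plancherel_le f) (auto simp: power_divide)
  also have "\<dots> = L2sq f" by (simp add: mult.assoc[symmetric] ennreal_mult[symmetric])
  finally show "L2sq (fourier f) \<le> L2sq f" .
qed

definition trunc :: "(real \<Rightarrow> real) \<Rightarrow> real \<Rightarrow> real \<Rightarrow> complex" where
  "trunc f R x = Cx (indicator {-R..R} x * f x)"

lemma square_integrable_locally:
  assumes [measurable]: "f \<in> borel_measurable borel" and f2: "integrable lborel (\<lambda>x. (f x)\<^sup>2)"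
  shows "integrable lborel (\<lambda>x. indicator {a..b::real} x * f x :: real)"
proof (rule Bochner_Integration.integrable_bound)
  show "integrable lborel (\<lambda>x. indicator {a..b} x + (f x)\<^sup>2)"
    by (intro Bochner_Integration.integrable_add f2 integrable_real_indicator) (auto simp: emeasure_lborel_Icc_eq)
  show "AE x in lborel. norm (indicator {a..b} x * f x) \<le> norm (indicator {a..b} x + (f x)\<^sup>2)"
  proof (rule AE_I2)
    fix x
    have "0 \<le> (\<bar>f x\<bar> - 1)\<^sup>2" by simp
    then have "\<bar>f x\<bar> \<le> 1 + (f x)\<^sup>2" by (simp add: power2_eq_square algebra_simps)
    then show "norm (indicator {a..b} x * f x) \<le> norm (indicator {a..b} x + (f x)\<^sup>2)"
      by (simp add: indicator_def)
  qed
qed measurable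

lemma square_integrable_mult:
  fixes f g :: "real \<Rightarrow> real"
  assumes [measurable]: "f \<in> borel_measurable borel" "g \<in> borel_measurable borel"
    and f2: "integrable lborel (\<lambda>x. (f x)\<^sup>2)" and g2: "integrable lborel (\<lambda>x. (g x)\<^sup>2)"
  shows "integrable lborel (\<lambda>x. g x * f x)"
proof (rule Bochner_Integration.integrable_bound)
  show "integrable lborel (\<lambda>x. (f x)\<^sup>2 + (g x)\<^sup>2)"
    by (intro Bochner_Integration.integrable_add f2 g2)
  show "AE x in lborel. norm (g x * f x) \<le> norm ((f x)\<^sup>2 + (g x)\<^sup>2)"
  proof (rule AE_I2)
    fix x
    have "0 \<le> (\<bar>f x\<bar> - \<bar>g x\<bar>)\<^sup>2" "0 \<le> \<bar>g x\<bar> * \<bar>f x\<bar>" by simp_all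
    moreover have "(\<bar>f x\<bar> - \<bar>g x\<bar>)\<^sup>2 = (f x)\<^sup>2 + (g x)\<^sup>2 - 2 * (\<bar>g x\<bar> * \<bar>f x\<bar>)" by (simp add: power2_diff)
    ultimately have "\<bar>g x\<bar> * \<bar>f x\<bar> \<le> (f x)\<^sup>2 + (g x)\<^sup>2" by linarith
    then show "norm (g x * f x) \<le> norm ((f x)\<^sup>2 + (g x)\<^sup>2)" by (simp add: abs_mult)
  qed
qed measurable

text \<open>The Riesz-Fischer argument, carried out directly. By Plancherel the transforms of the
  truncations are Cauchy in L^2, with the tail mass \<open>\<tau> R\<close> of f^2 as modulus. Along
  radii with rapidly decreasing tails they converge almost everywhere, and Fatou's lemma turns the
  pointwise limit into an L^2 limit along all real radii.\<close>

lemma is_fourier_L2_exists: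
  fixes f :: "real \<Rightarrow> real"
  assumes [measurable]: "f \<in> borel_measurable borel" and f2: "integrable lborel (\<lambda>x. (f x)\<^sup>2)"
  shows "\<exists>g. is_fourier_L2 f g"
proof -
  define F where "F R = fourier (trunc f R)" for R
  have tint: "integrable lborel (trunc f R)" for R
    unfolding trunc_def[abs_def] by (rule integrable_of_real, rule square_integrable_locally[OF _ f2]) simp
  have Fm [measurable]: "F R \<in> borel_measurable borel" for R unfolding F_def by (rule L2sq_fourier_le(2)[OF tint])
  define \<tau> where "\<tau> R = (LBINT x. indicator {x. \<bar>x\<bar> > R} x * (f x)\<^sup>2)" for R
  have \<tau>int: "integrable lborel (\<lambda>x. indicator {x. \<bar>x\<bar> > R} x * (f x)\<^sup>2)" for R
    by (rule Bochner_Integration.integrable_bound[OF f2]) (auto simp: indicator_def)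
  have \<tau>lim: "(\<tau> \<longlongrightarrow> 0) at_top"
  proof -
    have "(\<lambda>n. LBINT x. indicator {x. \<bar>x\<bar> > X n} x * (f x)\<^sup>2) \<longlonglongrightarrow> integral\<^sup>L lborel (\<lambda>x :: real. (0 :: real))"
      if X: "filterlim X at_top sequentially" for X :: "nat \<Rightarrow> real"
    proof (rule integral_dominated_convergence[where w = "\<lambda>x. (f x)\<^sup>2"])
      show "AE x in lborel. (\<lambda>n. indicator {x. \<bar>x\<bar> > X n} x * (f x)\<^sup>2) \<longlonglongrightarrow> (0 :: real)"
      proof (rule AE_I2)
        fix x
        have "\<forall>\<^sub>F n in sequentially. \<bar>x\<bar> \<le> X n" using X by (simp add: filterlim_at_top)
        then have "\<forall>\<^sub>F n in sequentially. indicator {x. \<bar>x\<bar> > X n} x * (f x)\<^sup>2 = (0 :: real)"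
          by eventually_elim (auto simp: indicator_def)
        then show "(\<lambda>n. indicator {x. \<bar>x\<bar> > X n} x * (f x)\<^sup>2) \<longlonglongrightarrow> (0 :: real)"
          by (rule tendsto_eventually)
      qed
    qed (use f2 in \<open>auto simp: indicator_def\<close>)
    then have "((\<lambda>R. LBINT x. indicator {x. \<bar>x\<bar> > R} x * (f x)\<^sup>2) \<longlongrightarrow> integral\<^sup>L lborel (\<lambda>x :: real. (0 :: real))) at_top"
      by (rule tendsto_at_topI_sequentially)
    then show ?thesis unfolding \<tau>_def by simp
  qed
  have diff: "L2sq (\<lambda>\<xi>. F S \<xi> - F R \<xi>) \<le> ennreal (\<tau> R)" if "R \<le> S" for R S
  proof -
    have eq: "(\<lambda>\<xi>. F S \<xi> - F R \<xi>) = fourier (\<lambda>x. trunc f S x - trunc f R x)"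
    proof
      fix \<xi>
      have i: "integrable lborel (\<lambda>x. iexp (- (\<xi> * x)) * trunc f R x)" for R by (rule integrable_iexp_mult[OF tint]) simp
      show "F S \<xi> - F R \<xi> = fourier (\<lambda>x. trunc f S x - trunc f R x) \<xi>"
        unfolding F_def L2sq_fourier_le(3)[OF tint] L2sq_fourier_le(3)[OF Bochner_Integration.integrable_diff[OF tint tint]]
        unfolding right_diff_distrib Bochner_Integration.integral_diff[OF i i] ..
    qed
    have "L2sq (\<lambda>\<xi>. F S \<xi> - F R \<xi>) \<le> L2sq (\<lambda>x. trunc f S x - trunc f R x)"
      using L2sq_fourier_le(1)[OF Bochner_Integration.integrable_diff[OF tint tint], of S R] unfolding eq[symmetric] .
    also have "\<dots> \<le> (NN x. indicator {x. \<bar>x\<bar> > R} x * (f x)\<^sup>2)"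
      using that by (intro nn_integral_mono ennreal_leI) (auto simp: trunc_def indicator_def)
    also have "\<dots> = ennreal (\<tau> R)" unfolding \<tau>_def by (rule nn_integral_eq_integral[OF \<tau>int]) auto
    finally show ?thesis .
  qed
  have "\<exists>\<rho>. \<forall>S\<ge>\<rho>. \<tau> S \<le> (1/4) ^ k" for k :: nat
  proof -
    have "\<forall>\<^sub>F S in at_top. \<tau> S < (1/4) ^ k" using \<tau>lim by (rule order_tendstoD) simp
    then show ?thesis unfolding eventually_at_top_linorder by (auto intro: less_imp_le)
  qed
  then obtain \<rho> where \<rho>: "\<And>k S. S \<ge> \<rho> k \<Longrightarrow> \<tau> S \<le> (1/4) ^ k" by metis
  \<comment> \<open>The summand k makes the radii unbounded, the sum makes them increasing in k, and
    its last term puts the k-th radius beyond \<open>\<rho> k\<close>.\<close>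
  define R where "R k = real k + (\<Sum>i\<le>k. \<bar>\<rho> i\<bar>)" for k
  have R\<rho>: "\<rho> k \<le> R k" for k
    using member_le_sum[of k "{..k}" "\<lambda>i. \<bar>\<rho> i\<bar>"] unfolding R_def by auto
  have Rk: "real k \<le> R k" for k unfolding R_def by (simp add: sum_nonneg)
  have RSuc: "R k \<le> R (Suc k)" for k unfolding R_def by simp
  define d where "d k \<xi> = F (R (Suc k)) \<xi> - F (R k) \<xi>" for k \<xi>
  have dm [measurable]: "d k \<in> borel_measurable borel" for k unfolding d_def[abs_def] by measurable
  have d: "L2sq (d k) \<le> ennreal ((1/4) ^ k)" for k
    unfolding d_def by (rule order_trans[OF diff[OF RSuc] ennreal_leI[OF \<rho>[OF R\<rho>]]])
  \<comment> \<open>The weight 2^k lies strictly between 1 and 4^k: the weighted series still has a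
    finite integral, yet where it is finite the increments decay like 2^(-k/2), so that they are
    summable and not merely square summable.\<close>
  have "(\<integral>\<^sup>+ \<xi>. (\<Sum>k. ennreal (2 ^ k * (cmod (d k \<xi>))\<^sup>2)) \<partial>lborel) = (\<Sum>k. \<integral>\<^sup>+ \<xi>. ennreal (2 ^ k * (cmod (d k \<xi>))\<^sup>2) \<partial>lborel)"
    by (rule nn_integral_suminf) measurable
  also have "\<dots> \<le> (\<Sum>k. ennreal ((1/2) ^ k))"
  proof (intro suminf_le summableI)
    fix k
    have "(NN \<xi>. 2 ^ k * (cmod (d k \<xi>))\<^sup>2) = (\<integral>\<^sup>+ \<xi>. ennreal (2 ^ k) * ennreal ((cmod (d k \<xi>))\<^sup>2) \<partial>lborel)"
      by (intro nn_integral_cong ennreal_mult) auto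
    also have "\<dots> = ennreal (2 ^ k) * L2sq (d k)" by (rule nn_integral_cmult) measurable
    also have "\<dots> \<le> ennreal (2 ^ k) * ennreal ((1/4) ^ k)" by (rule mult_left_mono[OF d]) simp
    also have "\<dots> = ennreal ((1/2) ^ k)" by (simp add: ennreal_mult[symmetric] power_mult_distrib[symmetric] del: ennreal_numeral)
    finally show "(NN \<xi>. 2 ^ k * (cmod (d k \<xi>))\<^sup>2) \<le> ennreal ((1/2) ^ k)" .
  qed
  also have "\<dots> = ennreal (\<Sum>k. (1/2) ^ k)" by (rule suminf_ennreal2) (auto intro: summable_geometric)
  finally have "(\<integral>\<^sup>+ \<xi>. (\<Sum>k. ennreal (2 ^ k * (cmod (d k \<xi>))\<^sup>2)) \<partial>lborel) \<noteq> \<infinity>"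
    by (auto simp: top_unique)
  then have ae: "AE \<xi> in lborel. (\<Sum>k. ennreal (2 ^ k * (cmod (d k \<xi>))\<^sup>2)) \<noteq> \<infinity>"
    by (intro nn_integral_noteq_infinite) measurable
  have conv: "convergent (\<lambda>k. F (R k) \<xi>)" if fin: "(\<Sum>k. ennreal (2 ^ k * (cmod (d k \<xi>))\<^sup>2)) \<noteq> \<infinity>" for \<xi>
  proof -
    define c where "c = enn2real (\<Sum>k. ennreal (2 ^ k * (cmod (d k \<xi>))\<^sup>2))"
    have c: "(\<Sum>k. ennreal (2 ^ k * (cmod (d k \<xi>))\<^sup>2)) = ennreal c" "c \<ge> 0"
      unfolding c_def by (rule ennreal_enn2real[symmetric], use fin in \<open>simp only: infinity_ennreal_def less_top\<close>) (rule enn2real_nonneg)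
    have bd: "cmod (d k \<xi>) \<le> sqrt c * (sqrt (1/2)) ^ k" for k
    proof -
      have "ennreal (2 ^ k * (cmod (d k \<xi>))\<^sup>2) = (\<Sum>i\<in>{k}. ennreal (2 ^ i * (cmod (d i \<xi>))\<^sup>2))" by simp
      also have "\<dots> \<le> ennreal c" unfolding c(1)[symmetric] by (intro sum_le_suminf summableI) auto
      finally have "2 ^ k * (cmod (d k \<xi>))\<^sup>2 \<le> c" using c(2) by (simp add: ennreal_le_iff)
      then have "(cmod (d k \<xi>))\<^sup>2 \<le> c * (1/2) ^ k" by (simp add: field_simps power_divide)
      then have "sqrt ((cmod (d k \<xi>))\<^sup>2) \<le> sqrt (c * (1/2) ^ k)" by (rule real_sqrt_le_mono)
      then show ?thesis unfolding real_sqrt_abs by (simp only: abs_norm_cancel real_sqrt_mult real_sqrt_power)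
    qed
    have "summable (\<lambda>k. sqrt c * (sqrt (1/2)) ^ k)"
      by (intro summable_mult summable_geometric) (simp add: real_sqrt_divide)
    then have "summable (\<lambda>k. d k \<xi>)" using bd by (rule summable_comparison_test'[where N=0])
    then have "convergent (\<lambda>n. \<Sum>k<n. d k \<xi>)" by (simp add: summable_iff_convergent)
    then have "convergent (\<lambda>n. F (R n) \<xi> - F (R 0) \<xi>)"
      unfolding d_def sum_lessThan_telescope[of "\<lambda>n. F (R n) \<xi>"] .
    then have "convergent (\<lambda>n. (F (R n) \<xi> - F (R 0) \<xi>) + F (R 0) \<xi>)" by (intro convergent_add convergent_const)
    then show ?thesis by simp
  qed
  define g where "g \<xi> = lim (\<lambda>k. F (R k) \<xi>)" for \<xi>
  have gm [measurable]: "g \<in> borel_measurable borel" unfolding g_def by (rule borel_measurable_lim_metric) measurable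
  have lim: "AE \<xi> in lborel. (\<lambda>k. F (R k) \<xi>) \<longlonglongrightarrow> g \<xi>"
    using ae by eventually_elim (use conv in \<open>auto simp: g_def convergent_LIMSEQ_iff\<close>)
  have final: "L2sq (\<lambda>\<xi>. g \<xi> - F S \<xi>) \<le> ennreal (\<tau> S)" for S
  proof -
    have "L2sq (\<lambda>\<xi>. g \<xi> - F S \<xi>) = (\<integral>\<^sup>+ \<xi>. liminf (\<lambda>k. ennreal ((cmod (F (R k) \<xi> - F S \<xi>))\<^sup>2)) \<partial>lborel)"
    proof (rule nn_integral_cong_AE)
      show "AE \<xi> in lborel. ennreal ((cmod (g \<xi> - F S \<xi>))\<^sup>2) = liminf (\<lambda>k. ennreal ((cmod (F (R k) \<xi> - F S \<xi>))\<^sup>2))"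
        using lim
      proof eventually_elim
        case (elim \<xi>)
        then have "(\<lambda>k. ennreal ((cmod (F (R k) \<xi> - F S \<xi>))\<^sup>2)) \<longlonglongrightarrow> ennreal ((cmod (g \<xi> - F S \<xi>))\<^sup>2)"
          by (intro tendsto_ennrealI tendsto_intros)
        then show ?case by (intro lim_imp_Liminf[symmetric]) auto
      qed
    qed
    also have "\<dots> \<le> liminf (\<lambda>k. L2sq (\<lambda>\<xi>. F (R k) \<xi> - F S \<xi>))" by (rule nn_integral_liminf) measurable
    also have "\<dots> \<le> liminf (\<lambda>k. ennreal (\<tau> S))"
    proof (rule Liminf_mono)
      have "\<forall>\<^sub>F k in sequentially. S \<le> real k" by (rule eventually_sequentiallyI[of "nat \<lceil>S\<rceil>"]) linarith
      then show "\<forall>\<^sub>F k in sequentially. L2sq (\<lambda>\<xi>. F (R k) \<xi> - F S \<xi>) \<le> ennreal (\<tau> S)"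
        by eventually_elim (rule diff, use Rk in \<open>auto intro: order_trans\<close>)
    qed
    also have "\<dots> = ennreal (\<tau> S)" by (rule Liminf_const) simp
    finally show ?thesis .
  qed
  have "((\<lambda>S. L2sq (\<lambda>\<xi>. g \<xi> - F S \<xi>)) \<longlongrightarrow> 0) at_top"
  proof (rule tendsto_sandwich[OF _ _ tendsto_const])
    show "((\<lambda>S. ennreal (\<tau> S)) \<longlongrightarrow> 0) at_top" using tendsto_ennrealI[OF \<tau>lim] by simp
  qed (auto intro: always_eventually final)
  then have "is_fourier_L2 f g" unfolding is_fourier_L2_def F_def trunc_def[abs_def] by simp
  then show ?thesis by blast
qed

text \<open>On a bounded interval the positive and the negative part of h are densities of two
  finite measures. They agree on all rays \<open>{y<..}\<close>, hence coincide, and uniqueness of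
  densities makes the two parts equal almost everywhere, which forces h = 0.\<close>

lemma AE_zero_if_interval_integrals_zero:
  fixes h :: "real \<Rightarrow> real"
  assumes [measurable]: "h \<in> borel_measurable borel"
    and li: "\<And>a b. integrable lborel (\<lambda>x. indicator {a..b} x * h x)"
    and z: "\<And>a b. (LBINT x. indicator {a..b} x * h x) = 0"
  shows "AE x in lborel. h x = 0"
proof -
  have "AE x in lborel. indicator {- real N..real N} x * h x = 0" for N :: nat
  proof -
    define k where "k x = indicator {- real N..real N} x * h x" for x
    have km [measurable]: "k \<in> borel_measurable borel" unfolding k_def[abs_def] by measurable
    have ki: "integrable lborel k" unfolding k_def[abs_def] by (rule li)
    let ?P = "density lborel (\<lambda>x. ennreal (k x))" and ?N = "density lborel (\<lambda>x. ennreal (- k x))"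
    have e: "emeasure ?P {y<..} = ennreal (LBINT x. indicator {y<..} x * max 0 (k x))"
            "emeasure ?N {y<..} = ennreal (LBINT x. indicator {y<..} x * max 0 (- k x))" for y
    proof -
      have i: "integrable lborel (\<lambda>x. indicator {y<..} x * max 0 (k x))" "integrable lborel (\<lambda>x. indicator {y<..} x * max 0 (- k x))"
        by (rule Bochner_Integration.integrable_bound[OF ki]; auto simp: indicator_def)+
      have "emeasure ?P {y<..} = (NN x. indicator {y<..} x * max 0 (k x))"
        by (subst emeasure_density) (auto intro!: nn_integral_cong simp: indicator_def max_def ennreal_neg)
      then show "emeasure ?P {y<..} = ennreal (LBINT x. indicator {y<..} x * max 0 (k x))"
        using nn_integral_eq_integral[OF i(1)] by (simp add: indicator_def)
      have "emeasure ?N {y<..} = (NN x. indicator {y<..} x * max 0 (- k x))"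
        by (subst emeasure_density) (auto intro!: nn_integral_cong simp: indicator_def max_def ennreal_neg)
      then show "emeasure ?N {y<..} = ennreal (LBINT x. indicator {y<..} x * max 0 (- k x))"
        using nn_integral_eq_integral[OF i(2)] by (simp add: indicator_def)
    qed
    have "?P = ?N"
    proof (rule measure_eqI_lessThan)
      fix y
      have i: "integrable lborel (\<lambda>x. indicator {y<..} x * max 0 (k x))" "integrable lborel (\<lambda>x. indicator {y<..} x * max 0 (- k x))"
        by (rule Bochner_Integration.integrable_bound[OF ki]; auto simp: indicator_def)+
      have "(LBINT x. indicator {y<..} x * max 0 (k x)) - (LBINT x. indicator {y<..} x * max 0 (- k x)) =
        (LBINT x. indicator {y<..} x * max 0 (k x) - indicator {y<..} x * max 0 (- k x))"
        by (rule Bochner_Integration.integral_diff[OF i, symmetric])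
      \<comment> \<open>The left side integrates over an open ray and the right side over a closed
        interval; they differ at most at the point y.\<close>
      also have "\<dots> = (LBINT x. indicator {max y (- real N)..real N} x * h x)"
      proof (rule integral_cong_AE)
        show "AE x in lborel. indicator {y<..} x * max 0 (k x) - indicator {y<..} x * max 0 (- k x) = indicator {max y (- real N)..real N} x * h x"
          using AE_lborel_singleton[of y] by eventually_elim (auto simp: indicator_def k_def max_def)
      qed measurable
      also have "\<dots> = 0" by (rule z)
      finally show "emeasure ?P {y<..} = emeasure ?N {y<..}" unfolding e by simp
      show "emeasure ?P {y<..} < \<infinity>" unfolding e by simp
    qed auto
    then have "AE x in lborel. ennreal (k x) = ennreal (- k x)"
      by (intro sigma_finite_measure.density_unique[OF sigma_finite_lborel]) auto
    then have "AE x in lborel. k x = 0"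
    proof eventually_elim
      case (elim x)
      show "k x = 0"
      proof (cases "k x \<ge> 0")
        case True
        then have "ennreal (k x) = 0" using elim by (simp add: ennreal_neg)
        then show ?thesis using True by (simp add: ennreal_eq_0_iff)
      next
        case False
        then have "ennreal (- k x) = 0" using elim by (simp add: ennreal_neg)
        then show ?thesis using False by (simp add: ennreal_eq_0_iff)
      qed
    qed
    then show ?thesis unfolding k_def .
  qed
  then have "AE x in lborel. \<forall>N :: nat. indicator {- real N..real N} x * h x = 0" by (subst AE_all_countable) auto
  then show ?thesis
  proof eventually_elim
    case (elim x)
    obtain N :: nat where "\<bar>x\<bar> \<le> real N" using real_arch_simple by blast
    then have "x \<in> {- real N..real N}" by auto
    then show ?case using elim[rule_format, of N] by simp
  qed
qed

lemma abs_le_square_add: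
  fixes s d :: real assumes "d > 0"
  shows "\<bar>s\<bar> \<le> s\<^sup>2 / (4 * d) + d"
proof -
  have "0 \<le> (\<bar>s\<bar> - 2 * d)\<^sup>2" by simp
  then have "\<bar>s\<bar> * (4 * d) \<le> s\<^sup>2 + d * (4 * d)" by (simp add: power2_diff power2_eq_square algebra_simps)
  then have "\<bar>s\<bar> \<le> (s\<^sup>2 + d * (4 * d)) / (4 * d)" using assms by (subst pos_le_divide_eq) auto
  then show ?thesis using assms by (simp add: add_divide_distrib)
qed

lemma sqrt_two_pi_le: "sqrt (2 * pi) \<le> 2 * pi"
proof (rule real_le_lsqrt)
  have "2 * pi * 1 \<le> 2 * pi * (2 * pi)" using pi_gt3 by (intro mult_left_mono) auto
  then show "2 * pi \<le> (2 * pi)\<^sup>2" by (simp add: power2_eq_square)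
qed auto

subsection \<open>Continuous representatives\<close>

text \<open>The factor \<open>sqrt (2 * pi)\<close> converts the unitary normalisation of
  \<open>fourier_L2\<close> into that of \<open>ift\<close>. For f in H^1 this inverse integral
  converges absolutely and gives the continuous representative of f.\<close>

definition rep :: "(real \<Rightarrow> real) \<Rightarrow> real \<Rightarrow> real" where
  "rep f x = Re (ift (\<lambda>\<xi>. Cx (sqrt (2 * pi)) * fourier_L2 f \<xi>) x)"

lemma Lq_norm_2_finite:
  assumes "f \<in> borel_measurable borel" "Lq_norm 2 f < \<infinity>"
  shows "integrable lborel (\<lambda>x. (f x)\<^sup>2)"
proof -
  have "(NN x. \<bar>f x\<bar> powr 2) \<noteq> \<infinity>"
    using assms(2) by (auto simp: Lq_norm_def root_ereal_def)
  moreover have "\<bar>f x\<bar> powr 2 = (f x)\<^sup>2" for x by (cases "f x = 0") (auto simp: powr_numeral)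
  ultimately show ?thesis using assms(1)
    by (intro integrableI_nonneg) (auto simp: top.not_eq_extremum)
qed

lemma Hs_norm_1_le:
  assumes "Hs_norm 1 f \<le> ereal h"
  shows "(NN \<xi>. (1 + \<xi>\<^sup>2) * (cmod (fourier_L2 f \<xi>))\<^sup>2) \<le> ennreal (h\<^sup>2)" "h \<ge> 0"
proof -
  define a where "a = (NN \<xi>. (1 + \<xi>\<^sup>2) powr 1 * (cmod (fourier_L2 f \<xi>))\<^sup>2)"
  have "root_ereal 2 a \<le> ereal h" using assms by (simp add: Hs_norm_def a_def)
  then have fin: "a \<noteq> \<infinity>" and le: "enn2real a powr (1/2) \<le> h" by (auto simp: root_ereal_def split: if_splits)
  have s: "sqrt (enn2real a) \<le> h" using le by (simp add: powr_half_sqrt)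
  show "h \<ge> 0" by (rule order_trans[OF real_sqrt_ge_zero[OF enn2real_nonneg] s])
  have "enn2real a = (sqrt (enn2real a))\<^sup>2" by simp
  also have "\<dots> \<le> h\<^sup>2" using s by (intro power_mono) auto
  finally have "a \<le> ennreal (h\<^sup>2)" using fin by (cases a) (auto simp: ennreal_leI)
  moreover have "a = (NN \<xi>. (1 + \<xi>\<^sup>2) * (cmod (fourier_L2 f \<xi>))\<^sup>2)"
  proof -
    have "(1 + \<xi>\<^sup>2) powr 1 = 1 + \<xi>\<^sup>2" for \<xi> :: real by (subst powr_one) (auto intro: add_nonneg_nonneg)
    then show ?thesis unfolding a_def by simp
  qed
  ultimately show "(NN \<xi>. (1 + \<xi>\<^sup>2) * (cmod (fourier_L2 f \<xi>))\<^sup>2) \<le> ennreal (h\<^sup>2)" by simp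
qed

text \<open>The L^2 norm of (1 + \<xi>^2)^(-1/2), which is the constant of the embedding of H^1 into
  the Fourier transforms of L^1.\<close>

definition sob_const :: real where "sob_const = sqrt (LBINT x. 1 / (1 + x\<^sup>2))"

lemma sob_const_nonneg: "sob_const \<ge> 0"
  unfolding sob_const_def by (intro real_sqrt_ge_zero integral_nonneg_AE) (auto intro!: AE_I2 divide_nonneg_pos add_pos_nonneg)

locale Hs1 =
  fixes f :: "real \<Rightarrow> real" and h :: real
  assumes f [measurable]: "f \<in> borel_measurable borel" and f2: "integrable lborel (\<lambda>x. (f x)\<^sup>2)"
    and h: "Hs_norm 1 f \<le> ereal h"
begin

abbreviation "g \<equiv> fourier_L2 f"

lemma g: "is_fourier_L2 f g"
  unfolding fourier_L2_def by (rule someI_ex[OF is_fourier_L2_exists[OF f f2]])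

lemma g_measurable [measurable]: "g \<in> borel_measurable borel"
  using g by (simp add: is_fourier_L2_def)

text \<open>Sobolev embedding in one dimension: split the transform as (1 + \<xi>^2)^(-1/2) times (1
  + \<xi>^2)^(1/2) \<open>g\<close> and apply Cauchy-Schwarz.\<close>

lemma nn_g: "(NN \<xi>. cmod (g \<xi>)) \<le> ennreal (sob_const * h)"
proof -
  let ?u = "\<lambda>\<xi>::real. Cx (1 / sqrt (1 + \<xi>\<^sup>2))"
  let ?v = "\<lambda>\<xi>. Cx (sqrt (1 + \<xi>\<^sup>2)) * g \<xi>"
  have pos: "1 + \<xi>\<^sup>2 > 0" for \<xi> :: real by (intro add_pos_nonneg) auto
  have "(NN \<xi>. cmod (?u \<xi>) * cmod (?v \<xi>)) \<le> ennreal (sob_const * h)"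
  proof (rule nn_integral_mult_le_L2)
    have "L2sq ?u = (NN \<xi>. 1 / (1 + \<xi>\<^sup>2))"
      using pos by (intro nn_integral_cong) (simp add: power_divide less_imp_le norm_divide)
    also have "\<dots> = ennreal (LBINT x. 1 / (1 + x\<^sup>2))"
      using pos by (intro nn_integral_eq_integral integrable_inverse_1_plus_square_lborel) (auto simp: less_imp_le)
    also have "\<dots> = ennreal (sob_const\<^sup>2)"
      unfolding sob_const_def by (subst real_sqrt_pow2) (auto intro!: integral_nonneg_AE AE_I2 simp: less_imp_le pos)
    finally show "L2sq ?u \<le> ennreal (sob_const\<^sup>2)" by simp
    have "L2sq ?v = (NN \<xi>. (1 + \<xi>\<^sup>2) * (cmod (g \<xi>))\<^sup>2)"
      using pos by (intro nn_integral_cong) (simp add: norm_mult power_mult_distrib less_imp_le)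
    then show "L2sq ?v \<le> ennreal (h\<^sup>2)" using Hs_norm_1_le(1)[OF h] by simp
  qed (use sob_const_nonneg Hs_norm_1_le(2)[OF h] in auto)
  moreover have "cmod (?u \<xi>) * cmod (?v \<xi>) = cmod (g \<xi>)" for \<xi>
    using pos[of \<xi>] by (simp add: norm_mult norm_divide)
  ultimately show ?thesis by simp
qed

lemma g_integrable: "integrable lborel g"
  using nn_g by (intro integrableI_bounded) (auto simp: le_less_trans)

abbreviation "G \<equiv> (\<lambda>\<xi>. Cx (sqrt (2 * pi)) * g \<xi>)"

lemma G_integrable: "integrable lborel G" by (intro integrable_mult_right g_integrable)

lemma rep_bound: "\<bar>rep f x\<bar> \<le> sob_const * h"
proof -
  have "\<bar>rep f x\<bar> \<le> cmod (ift G x)" unfolding rep_def by (rule abs_Re_le_cmod)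
  also have "\<dots> \<le> (1 / (2 * pi)) * (LBINT \<xi>. cmod (G \<xi>))" by (rule cmod_ift_le[OF G_integrable])
  also have "(LBINT \<xi>. cmod (G \<xi>)) = sqrt (2 * pi) * (LBINT \<xi>. cmod (g \<xi>))" by (simp add: norm_mult)
  also have "(LBINT \<xi>. cmod (g \<xi>)) \<le> sob_const * h"
  proof -
    have "ennreal (LBINT \<xi>. cmod (g \<xi>)) \<le> ennreal (sob_const * h)"
      using nn_g nn_integral_eq_integral[OF integrable_norm[OF g_integrable]] by simp
    then show ?thesis using sob_const_nonneg Hs_norm_1_le(2)[OF h] by (subst (asm) ennreal_le_iff) auto
  qed
  then have "(1 / (2 * pi)) * (sqrt (2 * pi) * (LBINT \<xi>. cmod (g \<xi>))) \<le> (1 / (2 * pi)) * (sqrt (2 * pi) * (sob_const * h))"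
    by (intro mult_left_mono) auto
  also have "\<dots> = (1 / (2 * pi) * sqrt (2 * pi)) * (sob_const * h)" by simp
  also have "\<dots> \<le> 1 * (sob_const * h)"
  proof (rule mult_right_mono)
    have "sqrt (2 * pi) \<le> 2 * pi" by (rule sqrt_two_pi_le)
    then show "1 / (2 * pi) * sqrt (2 * pi) \<le> 1" by (simp add: divide_le_eq)
  qed (use sob_const_nonneg Hs_norm_1_le(2)[OF h] in auto)
  finally show ?thesis by simp
qed

lemma continuous_ift_G: "continuous_on UNIV (ift G)"
  unfolding continuous_on_sequentially o_def
proof safe
  fix X :: "nat \<Rightarrow> real" and x assume X: "X \<longlonglongrightarrow> x"
  have "(\<lambda>n. LBINT \<xi>. iexp (X n * \<xi>) * G \<xi>) \<longlonglongrightarrow> (LBINT \<xi>. iexp (x * \<xi>) * G \<xi>)"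
  proof (rule integral_dominated_convergence[OF _ _ integrable_norm[OF G_integrable]])
    show "AE \<xi> in lborel. (\<lambda>n. iexp (X n * \<xi>) * G \<xi>) \<longlonglongrightarrow> iexp (x * \<xi>) * G \<xi>"
      by (intro AE_I2 tendsto_intros X)
  qed (auto simp: norm_mult)
  then show "(\<lambda>n. ift G (X n)) \<longlonglongrightarrow> ift G x" unfolding ift_def by (intro tendsto_intros)
qed

lemma continuous_rep: "continuous_on UNIV (rep f)"
  unfolding rep_def[abs_def] by (intro continuous_intros continuous_ift_G)

lemma trunc_integrable: "integrable lborel (trunc f R)"
  unfolding trunc_def[abs_def] by (rule integrable_of_real, rule square_integrable_locally[OF _ f2]) simp

text \<open>\<open>fourier_L2 f\<close> is known only as an L^2 limit of transforms of truncations,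
  so the convolution theorem is applied to the truncations. The left side converges by dominated
  convergence, since f and the heat kernel are in L^2; the right side converges by Cauchy-Schwarz,
  since the Gaussian symbol is in L^2.\<close>

lemma heat_conv:
  assumes e: "\<epsilon> > 0"
  shows "integrable lborel (\<lambda>y. heat 1 \<epsilon> (x - y) * f y)"
    "Cx (LBINT y. heat 1 \<epsilon> (x - y) * f y) = ift (\<lambda>\<xi>. Cx (gauss \<epsilon> \<xi>) * G \<xi>) x"
proof -
  let ?\<gamma> = "\<lambda>\<xi>. Cx (gauss \<epsilon> \<xi>)"
  have \<gamma>i: "integrable lborel ?\<gamma>" using integrable_gauss[OF e] by simp
  have heatx: "integrable lborel (\<lambda>y. (heat 1 \<epsilon> (x - y))\<^sup>2)"
  proof (rule Bochner_Integration.integrable_bound)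
    show "integrable lborel (\<lambda>y. 1 / sqrt (4 * pi * 1 * \<epsilon>) * heat 1 \<epsilon> (x + (-1) * y))"
      using e by (intro integrable_mult_right lborel_integrable_real_affine integrable_heat) auto
    show "AE y in lborel. norm ((heat 1 \<epsilon> (x - y))\<^sup>2) \<le> norm (1 / sqrt (4 * pi * 1 * \<epsilon>) * heat 1 \<epsilon> (x + (-1) * y))"
    proof (rule AE_I2)
      fix y
      have "heat 1 \<epsilon> (x - y) * heat 1 \<epsilon> (x - y) \<le> 1 / sqrt (4 * pi * 1 * \<epsilon>) * heat 1 \<epsilon> (x - y)"
        using e by (intro mult_right_mono heat_le heat_nonneg) auto
      moreover have "heat 1 \<epsilon> (x - y) \<ge> 0" using e by (simp add: heat_nonneg)
      ultimately show "norm ((heat 1 \<epsilon> (x - y))\<^sup>2) \<le> norm (1 / sqrt (4 * pi * 1 * \<epsilon>) * heat 1 \<epsilon> (x + (-1) * y))"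
        using e by (simp add: power2_eq_square)
    qed
  qed measurable
  show hf: "integrable lborel (\<lambda>y. heat 1 \<epsilon> (x - y) * f y)"
    by (rule square_integrable_mult[OF _ _ f2 heatx]) measurable
  let ?L = "\<lambda>R::nat. (LBINT y. heat 1 \<epsilon> (x - y) * (indicator {-real R..real R} y * f y))"
  have L1: "?L \<longlonglongrightarrow> (LBINT y. heat 1 \<epsilon> (x - y) * f y)"
  proof (rule integral_dominated_convergence[OF _ _ integrable_norm[OF hf]])
    show "AE y in lborel. (\<lambda>R. heat 1 \<epsilon> (x - y) * (indicator {-real R..real R} y * f y)) \<longlonglongrightarrow> heat 1 \<epsilon> (x - y) * f y"
    proof (rule AE_I2)
      fix y
      have "\<forall>\<^sub>F R in sequentially. \<bar>y\<bar> \<le> real R" by (rule eventually_sequentiallyI[of "nat \<lceil>\<bar>y\<bar>\<rceil>"]) linarith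
      then have "\<forall>\<^sub>F R in sequentially. heat 1 \<epsilon> (x - y) * (indicator {-real R..real R} y * f y) = heat 1 \<epsilon> (x - y) * f y"
        by eventually_elim (auto simp: indicator_def)
      then show "(\<lambda>R. heat 1 \<epsilon> (x - y) * (indicator {-real R..real R} y * f y)) \<longlonglongrightarrow> heat 1 \<epsilon> (x - y) * f y"
        by (rule tendsto_eventually)
    qed
  qed (auto simp: indicator_def)
  have LR: "Cx (?L R) = ift (\<lambda>\<xi>. ?\<gamma> \<xi> * (Cx (sqrt (2 * pi)) * fourier (trunc f (real R)) \<xi>)) x" for R
  proof -
    have "Cx (?L R) = conv (ift ?\<gamma>) (trunc f (real R)) x"
      unfolding conv_def trunc_def using heat_eq_ift[of 1 \<epsilon>] e by (simp flip: integral_complex_of_real)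
    also have "\<dots> = ift (\<lambda>\<xi>. ?\<gamma> \<xi> * (LBINT y. iexp (- (\<xi> * y)) * trunc f (real R) y)) x"
      by (rule conv_ift[OF \<gamma>i trunc_integrable])
    finally show ?thesis unfolding L2sq_fourier_le(3)[OF trunc_integrable] by (simp add: mult.assoc[symmetric])
  qed
  have Fm: "fourier (trunc f R) \<in> borel_measurable borel" for R by (rule L2sq_fourier_le(2)[OF trunc_integrable])
  have bnd: "\<exists>C\<ge>0. \<forall>e>0. \<forall>\<^sub>F R in sequentially. (NN \<xi>. cmod (?\<gamma> \<xi>) * cmod (g \<xi> - fourier (trunc f (real R)) \<xi>)) \<le> ennreal (C * e)"
  proof -
    obtain C where C: "C \<ge> 0" "L2sq ?\<gamma> \<le> ennreal (C\<^sup>2)"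
    proof
      have i: "integrable lborel (\<lambda>\<xi>::real. gauss (2 * \<epsilon>) \<xi>)" using e by (intro integrable_gauss) auto
      have "L2sq ?\<gamma> = (NN \<xi>. gauss (2 * \<epsilon>) \<xi>)"
        by (intro nn_integral_cong) (simp add: power2_eq_square[of "exp _"] flip: exp_add)
      also have "\<dots> = ennreal (LBINT \<xi>. gauss (2 * \<epsilon>) \<xi>)" by (rule nn_integral_eq_integral[OF i]) auto
      also have "\<dots> = ennreal ((sqrt (LBINT \<xi>. gauss (2 * \<epsilon>) \<xi>))\<^sup>2)"
        by (subst real_sqrt_pow2) (auto intro: integral_nonneg_AE)
      finally show "L2sq ?\<gamma> \<le> ennreal ((sqrt (LBINT \<xi>. gauss (2 * \<epsilon>) \<xi>))\<^sup>2)" by simp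
    qed (auto intro: integral_nonneg_AE)
    show ?thesis
    proof (intro exI[of _ C] conjI allI impI C(1))
      fix e :: real assume e: "e > 0"
      have "((\<lambda>R. L2sq (\<lambda>\<xi>. g \<xi> - fourier (trunc f R) \<xi>)) \<longlongrightarrow> 0) at_top"
        using g unfolding is_fourier_L2_def trunc_def[abs_def] by simp
      then have "(\<lambda>R. L2sq (\<lambda>\<xi>. g \<xi> - fourier (trunc f (real R)) \<xi>)) \<longlonglongrightarrow> 0"
        by (rule filterlim_compose[OF _ filterlim_real_sequentially])
      then have "\<forall>\<^sub>F R in sequentially. L2sq (\<lambda>\<xi>. g \<xi> - fourier (trunc f (real R)) \<xi>) < ennreal (e\<^sup>2)"
        using e by (intro order_tendstoD) auto
      then show "\<forall>\<^sub>F R in sequentially. (NN \<xi>. cmod (?\<gamma> \<xi>) * cmod (g \<xi> - fourier (trunc f (real R)) \<xi>)) \<le> ennreal (C * e)"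
      proof eventually_elim
        case (elim R)
        show ?case using elim e C Fm by (intro nn_integral_mult_le_L2 borel_measurable_diff) auto
      qed
    qed
  qed
  have L2: "(\<lambda>R. Cx (?L R)) \<longlonglongrightarrow> ift (\<lambda>\<xi>. ?\<gamma> \<xi> * G \<xi>) x"
  proof -
    obtain C where C: "C \<ge> 0" "\<And>e. e > 0 \<Longrightarrow> \<forall>\<^sub>F R in sequentially. (NN \<xi>. cmod (?\<gamma> \<xi>) * cmod (g \<xi> - fourier (trunc f (real R)) \<xi>)) \<le> ennreal (C * e)"
      using bnd by blast
    show ?thesis
    proof (rule tendstoI)
      fix e :: real assume e: "e > 0"
      define e' where "e' = e / (2 * (C + 1))"
      have e': "e' > 0" using e C(1) by (simp add: e'_def)
      have small: "1 * (C * e') < e" using e C(1) by (simp add: e'_def field_simps) (smt (verit) mult_nonneg_nonneg)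
      show "\<forall>\<^sub>F R in sequentially. dist (Cx (?L R)) (ift (\<lambda>\<xi>. ?\<gamma> \<xi> * G \<xi>) x) < e"
        using C(2)[OF e']
      proof eventually_elim
        case (elim R)
        let ?FR = "fourier (trunc f (real R))"
        have m [measurable]: "?FR \<in> borel_measurable borel" by (rule Fm)
        have di: "integrable lborel (\<lambda>\<xi>. ?\<gamma> \<xi> * (?FR \<xi> - g \<xi>))"
        proof (rule integrableI_bounded)
          show "(NN \<xi>. cmod (?\<gamma> \<xi> * (?FR \<xi> - g \<xi>))) < \<infinity>"
            using le_less_trans[OF elim ennreal_less_top] by (simp add: norm_mult norm_minus_commute)
        qed measurable
        have gi: "integrable lborel (\<lambda>\<xi>. ?\<gamma> \<xi> * g \<xi>)"
          by (rule Bochner_Integration.integrable_bound[OF g_integrable]) (use assms in \<open>auto simp: norm_mult mult_left_le_one_le\<close>)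
        have dl: "(LBINT \<xi>. cmod (?\<gamma> \<xi> * (?FR \<xi> - g \<xi>))) \<le> C * e'"
        proof -
          have "ennreal (LBINT \<xi>. cmod (?\<gamma> \<xi> * (?FR \<xi> - g \<xi>))) \<le> ennreal (C * e')"
            using nn_integral_eq_integral[OF integrable_norm[OF di]] elim by (simp add: norm_mult norm_minus_commute)
          then show ?thesis using C(1) e' by (subst (asm) ennreal_le_iff) auto
        qed
        have "Cx (?L R) - ift (\<lambda>\<xi>. ?\<gamma> \<xi> * G \<xi>) x = Cx (sqrt (2 * pi)) * ift (\<lambda>\<xi>. ?\<gamma> \<xi> * (?FR \<xi> - g \<xi>)) x"
        proof -
          have a: "integrable lborel (\<lambda>\<xi>. iexp (x * \<xi>) * (?\<gamma> \<xi> * g \<xi>))" by (rule integrable_iexp_mult[OF gi]) simp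
          have b: "integrable lborel (\<lambda>\<xi>. iexp (x * \<xi>) * (?\<gamma> \<xi> * (?FR \<xi> - g \<xi>)))" by (rule integrable_iexp_mult[OF di]) simp
          have s: "iexp (x * \<xi>) * (?\<gamma> \<xi> * (Cx (sqrt (2 * pi)) * ?FR \<xi>)) =
            Cx (sqrt (2 * pi)) * (iexp (x * \<xi>) * (?\<gamma> \<xi> * (?FR \<xi> - g \<xi>)) + iexp (x * \<xi>) * (?\<gamma> \<xi> * g \<xi>))" for \<xi>
            by (simp only: algebra_simps)
          have s2: "iexp (x * \<xi>) * (?\<gamma> \<xi> * (Cx (sqrt (2 * pi)) * g \<xi>)) =
            Cx (sqrt (2 * pi)) * (iexp (x * \<xi>) * (?\<gamma> \<xi> * g \<xi>))" for \<xi>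
            by (simp only: mult_ac)
          have gen: "p * (c * (A + D)) - p * (c * D) = c * (p * A)" for p c A D :: complex by (simp add: algebra_simps)
          show ?thesis unfolding LR ift_def s s2 integral_mult_right_zero Bochner_Integration.integral_add[OF b a] by (rule gen)
        qed
        then have "dist (Cx (?L R)) (ift (\<lambda>\<xi>. ?\<gamma> \<xi> * G \<xi>) x) = sqrt (2 * pi) * cmod (ift (\<lambda>\<xi>. ?\<gamma> \<xi> * (?FR \<xi> - g \<xi>)) x)"
          by (simp add: dist_norm norm_mult)
        also have "\<dots> \<le> sqrt (2 * pi) * ((1 / (2 * pi)) * (LBINT \<xi>. cmod (?\<gamma> \<xi> * (?FR \<xi> - g \<xi>))))"
          by (intro mult_left_mono cmod_ift_le[OF di]) auto
        also have "\<dots> = (sqrt (2 * pi) * (1 / (2 * pi))) * (LBINT \<xi>. cmod (?\<gamma> \<xi> * (?FR \<xi> - g \<xi>)))" by (rule mult.assoc[symmetric])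
        also have "\<dots> \<le> 1 * (C * e')"
        proof (intro mult_mono dl)
          have "sqrt (2 * pi) \<le> 2 * pi" by (rule sqrt_two_pi_le)
          then show "sqrt (2 * pi) * (1 / (2 * pi)) \<le> 1" by (simp add: divide_le_eq)
        qed (auto intro: integral_nonneg_AE)
        also have "\<dots> < e" by (rule small)
        finally show ?case .
      qed
    qed
  qed
  have "(\<lambda>R. Cx (?L R)) \<longlonglongrightarrow> Cx (LBINT y. heat 1 \<epsilon> (x - y) * f y)"
    using L1 by (rule tendsto_of_real)
  then show "Cx (LBINT y. heat 1 \<epsilon> (x - y) * f y) = ift (\<lambda>\<xi>. ?\<gamma> \<xi> * G \<xi>) x"
    using L2 by (rule LIMSEQ_unique)
qed

text \<open>The heat regularisation of f at time 1/(n+1). It tends to \<open>rep f\<close> pointwise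
  because of its Fourier formula, and to f when integrated over intervals because it is an average;
  comparing the two limits identifies \<open>rep f\<close> with f.\<close>

abbreviation "m n x \<equiv> (LBINT y. heat 1 (1 / real (Suc n)) (x - y) * f y)"

lemma m_bound: "\<bar>m n x\<bar> \<le> (1 / (2 * pi)) * (LBINT \<xi>. cmod (G \<xi>))"
proof -
  let ?\<gamma> = "\<lambda>\<xi>. Cx (gauss (1 / real (Suc n)) \<xi>)"
  have gi: "integrable lborel (\<lambda>\<xi>. ?\<gamma> \<xi> * G \<xi>)"
    by (rule Bochner_Integration.integrable_bound[OF G_integrable]) (auto simp: norm_mult mult_left_le_one_le)
  have "\<bar>m n x\<bar> = cmod (ift (\<lambda>\<xi>. ?\<gamma> \<xi> * G \<xi>) x)"
    by (subst heat_conv(2)[symmetric]) (auto simp del: of_nat_Suc)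
  also have "\<dots> \<le> (1 / (2 * pi)) * (LBINT \<xi>. cmod (?\<gamma> \<xi> * G \<xi>))" by (rule cmod_ift_le[OF gi])
  also have "\<dots> \<le> (1 / (2 * pi)) * (LBINT \<xi>. cmod (G \<xi>))"
    by (intro mult_left_mono integral_mono integrable_norm gi G_integrable) (auto simp: norm_mult mult_left_le_one_le)
  finally show ?thesis .
qed

lemma m_lim: "(\<lambda>n. m n x) \<longlonglongrightarrow> rep f x"
proof -
  let ?\<gamma> = "\<lambda>n \<xi>. Cx (gauss (1 / real (Suc n)) \<xi>)"
  have "(\<lambda>n. LBINT \<xi>. iexp (x * \<xi>) * (?\<gamma> n \<xi> * G \<xi>)) \<longlonglongrightarrow> (LBINT \<xi>. iexp (x * \<xi>) * G \<xi>)"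
  proof (rule integral_dominated_convergence[OF _ _ integrable_norm[OF G_integrable]])
    show "AE \<xi> in lborel. (\<lambda>n. iexp (x * \<xi>) * (?\<gamma> n \<xi> * G \<xi>)) \<longlonglongrightarrow> iexp (x * \<xi>) * G \<xi>"
    proof (rule AE_I2)
      fix \<xi> :: real
      have "(\<lambda>n. 1 / real (Suc n)) \<longlonglongrightarrow> 0" using LIMSEQ_inverse_real_of_nat by (simp add: inverse_eq_divide)
      then have "(\<lambda>n. iexp (x * \<xi>) * (?\<gamma> n \<xi> * G \<xi>)) \<longlonglongrightarrow> iexp (x * \<xi>) * (Cx (gauss 0 \<xi>) * G \<xi>)"
        by (intro tendsto_intros)
      then show "(\<lambda>n. iexp (x * \<xi>) * (?\<gamma> n \<xi> * G \<xi>)) \<longlonglongrightarrow> iexp (x * \<xi>) * G \<xi>" by simp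
    qed
  qed (auto simp: norm_mult mult_left_le_one_le)
  then have "(\<lambda>n. Re (ift (\<lambda>\<xi>. ?\<gamma> n \<xi> * G \<xi>) x)) \<longlonglongrightarrow> Re (ift G x)"
    unfolding ift_def by (intro tendsto_intros)
  moreover have "Re (ift (\<lambda>\<xi>. ?\<gamma> n \<xi> * G \<xi>) x) = m n x" for n
    by (subst heat_conv(2)[symmetric]) (auto simp del: of_nat_Suc)
  ultimately show ?thesis unfolding rep_def by simp
qed

lemma m_measurable [measurable]: "(\<lambda>x. m n x) \<in> borel_measurable borel"
proof -
  have "(\<lambda>x. m n x) \<in> borel_measurable lborel" by measurable
  then show ?thesis by simp
qed

lemma rep_measurable [measurable]: "rep f \<in> borel_measurable borel"
  by (rule borel_measurable_continuous_onI[OF continuous_rep])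

text \<open>Integrate the regularisation over the interval. On one side it converges to
  \<open>rep f\<close>, boundedly; on the other side Fubini and the symmetry of the roles of x and y
  move the heat kernel onto the indicator, whose averages return to the indicator.\<close>

lemma interval_integral_eq:
  "(LBINT x. indicator {a..b} x * rep f x) = (LBINT x. indicator {a..b} x * f x)"
proof -
  define A where "A = max \<bar>a\<bar> \<bar>b\<bar>"
  have A: "\<bar>a\<bar> \<le> A" "\<bar>b\<bar> \<le> A" by (auto simp: A_def)
  define K where "K = (1 / (2 * pi)) * (LBINT \<xi>. cmod (G \<xi>))"
  define \<Psi> where "\<Psi> \<epsilon> y = (LBINT x. indicator {a..b} x * heat 1 \<epsilon> (x - y))" for \<epsilon> y
  define E where "E = (LBINT z. exp \<bar>z\<bar> * heat 1 1 z)"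
  note \<Psi>1 = heat_average(1)[OF A, folded \<Psi>_def E_def] and \<Psi>2 = heat_average(2)[OF A, folded \<Psi>_def]
  have ind: "integrable lborel (indicator {a..b} :: real \<Rightarrow> real)" by (intro integrable_real_indicator) (auto simp: emeasure_lborel_Icc_eq)
  have L1: "(\<lambda>n. LBINT x. indicator {a..b} x * m n x) \<longlonglongrightarrow> (LBINT x. indicator {a..b} x * rep f x)"
  proof (rule integral_dominated_convergence[OF _ _ integrable_mult_left[OF ind, of K]])
    show "AE x in lborel. (\<lambda>n. indicator {a..b} x * m n x) \<longlonglongrightarrow> indicator {a..b} x * rep f x"
      by (intro AE_I2 tendsto_mult_left m_lim)
    show "AE x in lborel. norm (indicator {a..b} x * m n x) \<le> indicator {a..b} x * K" for n
      using m_bound unfolding K_def by (intro AE_I2) (auto simp: indicator_def)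
  qed measurable
  \<comment> \<open>A function in L^2 need not be integrable, but it is after multiplication by
    exp(-|y|). This one function dominates both the exchange of integrals and the limit n to
    infinity.\<close>
  have expf: "integrable lborel (\<lambda>y. exp (- \<bar>y\<bar>) * f y)"
  proof (rule square_integrable_mult[OF _ _ f2])
    show "integrable lborel (\<lambda>y::real. (exp (- \<bar>y\<bar>))\<^sup>2)"
    proof (rule Bochner_Integration.integrable_bound[OF integrable_mult_right[OF integrable_inverse_1_plus_square_lborel, of 2]])
      show "AE y in lborel. norm ((exp (- \<bar>y\<bar>))\<^sup>2) \<le> norm (2 * (1 / (1 + y\<^sup>2 :: real)))"
      proof (rule AE_I2)
        fix y :: real
        have "1 + \<bar>y\<bar> \<le> exp \<bar>y\<bar>" by (rule exp_ge_add_one_self)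
        then have "(1 + \<bar>y\<bar>)\<^sup>2 \<le> (exp \<bar>y\<bar>)\<^sup>2" by (intro power_mono) auto
        moreover have "1 + y\<^sup>2 \<le> (1 + \<bar>y\<bar>)\<^sup>2" by (simp add: power2_sum)
        ultimately have le: "1 + y\<^sup>2 \<le> (exp \<bar>y\<bar>)\<^sup>2" by linarith
        have pos: "1 + y\<^sup>2 > 0" by (intro add_pos_nonneg) auto
        have "(exp (- \<bar>y\<bar>))\<^sup>2 = 1 / (exp \<bar>y\<bar>)\<^sup>2" by (simp add: exp_minus power_divide inverse_eq_divide)
        also have "\<dots> \<le> 1 / (1 + y\<^sup>2)" using le pos by (intro divide_left_mono) auto
        also have "\<dots> \<le> 2 * (1 / (1 + y\<^sup>2))" using pos by (simp add: divide_simps)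
        finally show "norm ((exp (- \<bar>y\<bar>))\<^sup>2) \<le> norm (2 * (1 / (1 + y\<^sup>2)))" using pos by simp
      qed
    qed measurable
  qed measurable
  have swap: "(LBINT x. indicator {a..b} x * m n x) = (LBINT y. \<Psi> (1 / real (Suc n)) y * f y)" for n
  proof -
    let ?\<epsilon> = "1 / real (Suc n)"
    have e: "?\<epsilon> > 0" by simp
    have "(LBINT x. indicator {a..b} x * m n x) = (LBINT x. LBINT y. indicator {a..b} x * (heat 1 ?\<epsilon> (x - y) * f y))"
      by (simp only: integral_mult_right_zero)
    also have "\<dots> = (LBINT y. LBINT x. indicator {a..b} x * (heat 1 ?\<epsilon> (x - y) * f y))"
    proof (rule lborel_pair.Fubini_integral[symmetric])
      show "integrable (lborel \<Otimes>\<^sub>M lborel) (\<lambda>(x, y). indicator {a..b} x * (heat 1 ?\<epsilon> (x - y) * f y))"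
      proof (rule integrable_pair_bound[OF sigma_finite_lborel sigma_finite_lborel
            integrable_mult_left[OF ind, of "1 / sqrt (4 * pi * 1 * ?\<epsilon>) * exp (?\<epsilon> + A)"] expf])
        fix x y :: real
        show "norm (case (x, y) of (x, y) \<Rightarrow> indicator {a..b} x * (heat 1 ?\<epsilon> (x - y) * f y))
          \<le> norm (indicator {a..b} x * (1 / sqrt (4 * pi * 1 * ?\<epsilon>) * exp (?\<epsilon> + A))) * norm (exp (- \<bar>y\<bar>) * f y)"
        proof (cases "x \<in> {a..b}")
          case True
          then have xA: "\<bar>x\<bar> \<le> A" using A by auto
          have "\<bar>x - y\<bar> \<le> (x - y)\<^sup>2 / (4 * ?\<epsilon>) + ?\<epsilon>" by (rule abs_le_square_add) simp
          then have "- ((x - y)\<^sup>2 / (4 * 1 * ?\<epsilon>)) \<le> ?\<epsilon> + A + - \<bar>y\<bar>" using xA unfolding mult_1_right by linarith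
          then have "exp (- ((x - y)\<^sup>2 / (4 * 1 * ?\<epsilon>))) \<le> exp (?\<epsilon> + A + - \<bar>y\<bar>)" by (rule exp_le_cancel_iff[THEN iffD2])
          also have "\<dots> = exp (?\<epsilon> + A) * exp (- \<bar>y\<bar>)" by (rule exp_add)
          finally have "1 / sqrt (4 * pi * 1 * ?\<epsilon>) * exp (- ((x - y)\<^sup>2 / (4 * 1 * ?\<epsilon>))) \<le> 1 / sqrt (4 * pi * 1 * ?\<epsilon>) * (exp (?\<epsilon> + A) * exp (- \<bar>y\<bar>))"
            by (rule mult_left_mono) simp
          then have "heat 1 ?\<epsilon> (x - y) \<le> 1 / sqrt (4 * pi * 1 * ?\<epsilon>) * exp (?\<epsilon> + A) * exp (- \<bar>y\<bar>)"
            unfolding heat_def by (simp only: mult.assoc)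
          then have "heat 1 ?\<epsilon> (x - y) * \<bar>f y\<bar> \<le> 1 / sqrt (4 * pi * 1 * ?\<epsilon>) * exp (?\<epsilon> + A) * exp (- \<bar>y\<bar>) * \<bar>f y\<bar>"
            by (rule mult_right_mono) simp
          moreover have "heat 1 ?\<epsilon> (x - y) \<ge> 0" by (simp add: heat_nonneg)
          ultimately show ?thesis using True by (simp add: abs_mult)
        qed auto
      qed measurable
    qed
    also have "\<dots> = (LBINT y. \<Psi> ?\<epsilon> y * f y)"
    proof (rule Bochner_Integration.integral_cong[OF refl])
      fix y
      have "(LBINT x. indicator {a..b} x * (heat 1 ?\<epsilon> (x - y) * f y)) = (LBINT x. indicator {a..b} x * heat 1 ?\<epsilon> (x - y) * f y)"
        by (simp only: mult.assoc)
      also have "\<dots> = \<Psi> ?\<epsilon> y * f y" unfolding \<Psi>_def by (rule integral_mult_left_zero)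
      finally show "(LBINT x. indicator {a..b} x * (heat 1 ?\<epsilon> (x - y) * f y)) = \<Psi> ?\<epsilon> y * f y" .
    qed
    finally show ?thesis .
  qed
  have [measurable]: "\<Psi> \<epsilon> \<in> borel_measurable borel" for \<epsilon>
  proof -
    have "\<Psi> \<epsilon> \<in> borel_measurable lborel" unfolding \<Psi>_def by measurable
    then show ?thesis by simp
  qed
  have L2: "(\<lambda>n. LBINT y. \<Psi> (1 / real (Suc n)) y * f y) \<longlonglongrightarrow> (LBINT y. indicator {a..b} y * f y)"
  proof (rule integral_dominated_convergence[OF _ _ integrable_norm[OF integrable_mult_right[OF expf, of "exp A * E"]]])
    show "AE y in lborel. (\<lambda>n. \<Psi> (1 / real (Suc n)) y * f y) \<longlonglongrightarrow> indicator {a..b} y * f y"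
      using AE_lborel_singleton[of a] AE_lborel_singleton[of b]
      by eventually_elim (intro tendsto_mult_right \<Psi>2)
    show "AE y in lborel. norm (\<Psi> (1 / real (Suc n)) y * f y) \<le> norm (exp A * E * (exp (- \<bar>y\<bar>) * f y))" for n
    proof (rule AE_I2)
      fix y
      have "\<bar>\<Psi> (1 / real (Suc n)) y\<bar> \<le> exp A * E * exp (- \<bar>y\<bar>)" by (rule \<Psi>1) auto
      then have "\<bar>\<Psi> (1 / real (Suc n)) y\<bar> * \<bar>f y\<bar> \<le> exp A * E * exp (- \<bar>y\<bar>) * \<bar>f y\<bar>" by (rule mult_right_mono) simp
      moreover have "E \<ge> 0" unfolding E_def by (intro integral_nonneg_AE) (auto simp: heat_nonneg)
      ultimately show "norm (\<Psi> (1 / real (Suc n)) y * f y) \<le> norm (exp A * E * (exp (- \<bar>y\<bar>) * f y))"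
        by (simp add: abs_mult)
    qed
  qed measurable
  show ?thesis using L1 L2 unfolding swap by (rule LIMSEQ_unique)
qed

lemma rep_AE: "AE x in lborel. f x = rep f x"
proof -
  have i: "integrable lborel (\<lambda>x. indicator {a..b} x * rep f x)" for a b
  proof (rule Bochner_Integration.integrable_bound)
    show "integrable lborel (\<lambda>x. indicator {a..b} x * (sob_const * h))"
      by (intro integrable_mult_left integrable_real_indicator) (auto simp: emeasure_lborel_Icc_eq)
    show "AE x in lborel. norm (indicator {a..b} x * rep f x) \<le> norm (indicator {a..b} x * (sob_const * h))"
      by (intro AE_I2) (auto simp: indicator_def intro: order_trans[OF rep_bound abs_ge_self])
  qed measurable
  have "AE x in lborel. f x - rep f x = 0"
  proof (rule AE_zero_if_interval_integrals_zero)
    fix a b :: real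
    show "integrable lborel (\<lambda>x. indicator {a..b} x * (f x - rep f x))"
      unfolding right_diff_distrib by (intro Bochner_Integration.integrable_diff i square_integrable_locally f f2)
    show "(LBINT x. indicator {a..b} x * (f x - rep f x)) = 0"
      unfolding right_diff_distrib
      by (subst Bochner_Integration.integral_diff) (auto intro: i square_integrable_locally f f2 simp: interval_integral_eq)
  qed measurable
  then show ?thesis by eventually_elim simp
qed

end

text \<open>The set where the bound fails is open and null, hence empty.\<close>

lemma continuous_AE_bound:
  fixes f :: "real \<Rightarrow> real"
  assumes c: "continuous_on UNIV f" and ae: "AE x in lborel. \<bar>f x\<bar> \<le> K"
  shows "\<bar>f x\<bar> \<le> K"
proof (rule ccontr)
  assume "\<not> \<bar>f x\<bar> \<le> K"
  then have x: "x \<in> {y. \<bar>f y\<bar> > K}" by simp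
  have o: "open {y. \<bar>f y\<bar> > K}" by (intro open_Collect_less continuous_intros c)
  have "{y. \<bar>f y\<bar> > K} \<in> null_sets lborel"
    using ae o by (subst AE_iff_null_sets) (auto simp: not_less)
  then have "negligible {y. \<bar>f y\<bar> > K}" by (simp add: negligible_iff_null_sets null_sets_completionI)
  then show False using open_not_negligible[OF o] x by blast
qed

text \<open>The supremum of \<open>rep (u s) - rep (u t)\<close> is at most a constant times the H^1
  distance, so continuity in time is uniform in x and combines with the continuity of each
  \<open>rep (u t)\<close>.\<close>

lemma rep_jointly_continuous:
  fixes u :: "real \<Rightarrow> real \<Rightarrow> real"
  assumes mem: "\<And>t. t \<ge> 0 \<Longrightarrow> u t \<in> Hs_space 1"
    and cont: "\<And>t. t \<ge> 0 \<Longrightarrow> ((\<lambda>s. Hs_norm 1 (\<lambda>x. u s x - u t x)) \<longlongrightarrow> 0) (at t within {0..})"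
  shows "continuous_on ({0..} \<times> UNIV) (\<lambda>(t, x). rep (u t) x)"
    and "\<And>t. t \<ge> 0 \<Longrightarrow> AE x in lborel. u t x = rep (u t) x"
proof -
  have m [measurable]: "u t \<in> borel_measurable borel" and i: "integrable lborel (\<lambda>x. (u t x)\<^sup>2)" if "t \<ge> 0" for t
    using mem[OF that] by (auto simp: Hs_space_def intro!: Lq_norm_2_finite)
  have hs: "\<exists>h. Hs1 (u t) h" if "t \<ge> 0" for t
  proof -
    have "Hs_norm 1 (u t) < \<infinity>" using mem[OF that] by (simp add: Hs_space_def)
    moreover have "Hs_norm 1 (u t) \<ge> 0" by (simp add: Hs_norm_def root_ereal_def)
    ultimately obtain h where "Hs_norm 1 (u t) = ereal h" by (cases "Hs_norm 1 (u t)") auto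
    then show ?thesis using m[OF that] i[OF that] by (auto simp: Hs1_def)
  qed
  show ae: "AE x in lborel. u t x = rep (u t) x" if "t \<ge> 0" for t
    using hs[OF that] Hs1.rep_AE by blast
  have c: "continuous_on UNIV (rep (u t))" if "t \<ge> 0" for t
    using hs[OF that] Hs1.continuous_rep by blast
  have d: "\<bar>rep (u s) x - rep (u t) x\<bar> \<le> sob_const * h"
    if st: "s \<ge> 0" "t \<ge> 0" and h: "Hs_norm 1 (\<lambda>x. u s x - u t x) \<le> ereal h" for s t x h
  proof -
    have d2: "integrable lborel (\<lambda>x. (u s x - u t x)\<^sup>2)"
    proof (rule Bochner_Integration.integrable_bound)
      show "integrable lborel (\<lambda>x. 2 * (u s x)\<^sup>2 + 2 * (u t x)\<^sup>2)"
        by (intro Bochner_Integration.integrable_add integrable_mult_right i st)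
      show "AE x in lborel. norm ((u s x - u t x)\<^sup>2) \<le> norm (2 * (u s x)\<^sup>2 + 2 * (u t x)\<^sup>2)"
      proof (rule AE_I2)
        fix x
        have "0 \<le> (u s x + u t x)\<^sup>2" by simp
        then have "(u s x - u t x)\<^sup>2 \<le> 2 * (u s x)\<^sup>2 + 2 * (u t x)\<^sup>2" by (simp add: power2_sum power2_diff)
        then show "norm ((u s x - u t x)\<^sup>2) \<le> norm (2 * (u s x)\<^sup>2 + 2 * (u t x)\<^sup>2)" by simp
      qed
    qed (use m[OF st(1)] m[OF st(2)] in measurable)
    \<comment> \<open>\<open>fourier_L2\<close> is obtained by choice, so \<open>rep\<close> is not
      linear by definition. The representative of the difference is compared with the difference of
      the representatives almost everywhere, and continuity extends the resulting bound to every
      point.\<close>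
    interpret D: Hs1 "\<lambda>x. u s x - u t x" h
      by standard (use m[OF st(1)] m[OF st(2)] d2 h in auto)
    have "AE x in lborel. \<bar>rep (u s) x - rep (u t) x\<bar> \<le> sob_const * h"
      using ae[OF st(1)] ae[OF st(2)] D.rep_AE
    proof eventually_elim
      case (elim x)
      then show ?case using D.rep_bound[of x] by simp
    qed
    then show ?thesis by (intro continuous_AE_bound continuous_intros c st)
  qed
  have main: "((\<lambda>(t, x). rep (u t) x) \<longlongrightarrow> rep (u t) x) (at (t, x) within {0..} \<times> UNIV)" if t: "t \<in> {0..}" for t x :: real
  proof -
    have sc: "sob_const \<ge> 0" by (rule sob_const_nonneg)
    show ?thesis
    proof (rule tendstoI)
      fix e :: real assume e: "e > 0"
      define h where "h = e / (2 * (sob_const + 1))"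
      have h: "h > 0" using e sc by (simp add: h_def)
      have sh: "sob_const * h < e / 2"
      proof -
        have "sob_const * h < (sob_const + 1) * h" using h by simp
        also have "\<dots> = e / 2"
        proof -
          have "k * (e / (2 * k)) = e / 2" if "k > 0" for k :: real using that by simp
          then show ?thesis using sc by (simp only: h_def)
        qed
        finally show ?thesis .
      qed
      have "\<forall>\<^sub>F s in at t within {0..}. Hs_norm 1 (\<lambda>x. u s x - u t x) < ereal h"
        using cont[of t] t h by (intro order_tendstoD(2)) (auto simp: zero_ereal_def)
      then obtain d1 where d1: "d1 > 0" "\<And>s. s \<ge> 0 \<Longrightarrow> s \<noteq> t \<Longrightarrow> dist s t < d1 \<Longrightarrow> Hs_norm 1 (\<lambda>x. u s x - u t x) < ereal h"
        unfolding eventually_at by auto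
      have "isCont (rep (u t)) x" using c[of t] t by (simp add: continuous_on_eq_continuous_at)
      then obtain d2 where d2: "d2 > 0" "\<And>y. dist y x < d2 \<Longrightarrow> dist (rep (u t) y) (rep (u t) x) < e / 2"
        unfolding continuous_at_eps_delta using e by (metis half_gt_zero)
      show "\<forall>\<^sub>F z in at (t, x) within {0..} \<times> UNIV. dist (case z of (t, x) \<Rightarrow> rep (u t) x) (rep (u t) x) < e"
        unfolding eventually_at
      proof (intro exI[of _ "min d1 d2"] conjI ballI impI)
        show "min d1 d2 > 0" using d1 d2 by simp
        fix z assume z: "z \<in> {0..} \<times> (UNIV :: real set)" "z \<noteq> (t, x) \<and> dist z (t, x) < min d1 d2"
        obtain s y where sy: "z = (s, y)" by (cases z)
        have ds: "dist s t < d1" "dist y x < d2"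
          using z(2) dist_fst_le[of z "(t, x)"] dist_snd_le[of z "(t, x)"] unfolding sy by auto
        have "\<bar>rep (u s) y - rep (u t) y\<bar> < e / 2"
        proof (cases "s = t")
          case False
          then have "Hs_norm 1 (\<lambda>x. u s x - u t x) \<le> ereal h" using d1(2)[of s] ds z(1) sy by (auto intro: less_imp_le)
          then show ?thesis using d[of s t h y] sh z(1) sy t by auto
        qed (use e in auto)
        then show "dist (case z of (t, x) \<Rightarrow> rep (u t) x) (rep (u t) x) < e"
          using d2(2)[OF ds(2)] unfolding sy dist_real_def prod.case by linarith
      qed
    qed
  qed
  show "continuous_on ({0..} \<times> UNIV) (\<lambda>(t, x). rep (u t) x)"
    unfolding continuous_on_def by (auto intro!: main)
qed

subsection \<open>Duhamel integrals\<close>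

text \<open>Here s is the age of the kernel and t - s the time of the forcing, which has L^1 norm a
  and L^2 norm a (t - s)^(-1/4). Young's inequality with the L^1 norm of g settles L^2. For the
  supremum there are two bounds, L^\<infinity> times L^1 and L^2 times L^2, with the factors
  s^(-1/4) and (t - s)^(-1/4) besides the common s^(-1/4).\<close>

lemma small_conv:
  assumes t: "t > 0" and K [measurable]: "K \<in> borel_measurable borel" and s: "0 < s" "s < t"
    and sm: "small s K k" and g [measurable]: "g \<in> borel_measurable borel"
    and g1: "(NN y. cmod (g y)) \<le> ennreal a" and a: "a \<ge> 0"
    and g2: "L2sq g \<le> ennreal ((a * (t - s) powr (- (1/4)))\<^sup>2)"
  shows "small t (conv K g) (2 * t powr (1/4) * (k * s powr (- (1/4)) * a))"
proof -
  have k: "k \<ge> 0" using sm by (rule small_nonneg)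
  have sc: "small s (\<lambda>x. LBINT y. K (x - y) * g y) (k * a)"
  proof (rule small_integral[OF sigma_finite_lborel, where \<rho> = "\<lambda>_. k"])
    show "small s (\<lambda>x. K (x - z)) k" for z by (rule small_translate[OF sm])
    have "(NN y. k * cmod (g y)) = ennreal k * (NN y. cmod (g y))"
      using k by (subst nn_integral_cmult[symmetric]) (auto simp: ennreal_mult)
    also have "\<dots> \<le> ennreal k * ennreal a" by (intro mult_left_mono g1) simp
    also have "\<dots> = ennreal (k * a)" using k a by (simp add: ennreal_mult)
    finally show "(NN y. k * cmod (g y)) \<le> ennreal (k * a)" .
    show "k * a \<ge> 0" using k a by simp
  qed measurable
  then have sc': "small s (conv K g) (k * a)" by (simp add: conv_def[abs_def])
  have m [measurable]: "conv K g \<in> borel_measurable borel" using sc' by (rule small_measurable)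
  define \<rho> where "\<rho> = t powr (1/4) * (k * s powr (- (1/4)) * a)"
  have \<rho>0: "\<rho> \<ge> 0" using k a by (simp add: \<rho>_def)
  have t14: "t powr (1/4) * t powr (- (1/4)) = 1" using t by (simp flip: powr_add)
  have "L2sq (conv K g) \<le> ennreal ((2 * \<rho>)\<^sup>2 * t powr (- (1/2)))"
  proof -
    have "\<rho> * t powr (- (1/4)) = (t powr (1/4) * t powr (- (1/4))) * (k * s powr (- (1/4)) * a)" by (simp only: \<rho>_def mult_ac)
    then have e: "\<rho> * t powr (- (1/4)) = k * a * s powr (- (1/4))" unfolding t14 by simp
    have "L2sq (conv K g) \<le> ennreal ((k * a * s powr (- (1/4)))\<^sup>2)"
      using sc' unfolding small_def small_sq by blast
    also have "\<dots> = ennreal (\<rho>\<^sup>2 * t powr (- (1/2)))" unfolding small_sq e ..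
    also have "\<dots> \<le> ennreal ((2 * \<rho>)\<^sup>2 * t powr (- (1/2)))"
      using \<rho>0 by (intro ennreal_leI mult_right_mono power_mono) auto
    finally show ?thesis .
  qed
  moreover have "cmod (conv K g x) \<le> 2 * \<rho> * t powr (- (1/2))" for x
  proof -
    have base: "cmod (conv K g x) \<le> k * a * s powr (- (1/4)) * d powr (- (1/4))" if d: "d \<ge> t / 2" "d = s \<or> d = t - s" for d
      using d(2)
    proof
      assume "d = s"
      have "cmod (conv K g x) \<le> k * a * s powr (- (1/2))" using sc' unfolding small_def by blast
      also have "s powr (- (1/2)) = s powr (- (1/4)) * s powr (- (1/4))" by (simp flip: powr_add)
      finally show ?thesis using \<open>d = s\<close> by (simp only: mult.assoc)
    next
      assume ds: "d = t - s"
      have "ennreal (cmod (conv K g x)) \<le> (NN y. cmod (K (x - y)) * cmod (g y))"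
        unfolding conv_def using norm_integral_le_nn[of lborel "\<lambda>y. K (x - y) * g y"] by (simp add: norm_mult)
      also have "\<dots> \<le> ennreal ((k * s powr (- (1/4))) * (a * (t - s) powr (- (1/4))))"
      proof (rule nn_integral_mult_le_L2[OF _ _ _ g2])
        have "L2sq (\<lambda>y. K (x - y)) = L2sq K"
          using nn_integral_real_affine[of "\<lambda>y. ennreal ((cmod (K y))\<^sup>2)" "-1" x] by simp
        then show "L2sq (\<lambda>y. K (x - y)) \<le> ennreal ((k * s powr (- (1/4)))\<^sup>2)"
          using sm unfolding small_def small_sq by simp
      qed (use k a in auto)
      finally have "cmod (conv K g x) \<le> (k * s powr (- (1/4))) * (a * (t - s) powr (- (1/4)))"
        using k a by (subst (asm) ennreal_le_iff) auto
      then show ?thesis unfolding ds by (simp only: mult_ac)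
    qed
    \<comment> \<open>One of the two times is at least t/2, and the bound that belongs to it gives
      the factor t^(-1/4). The remaining singularity in s is then the same for both norms.\<close>
    obtain d where d: "d \<ge> t / 2" "d = s \<or> d = t - s"
    proof (cases "s \<ge> t / 2")
      case True
      then show ?thesis by (rule that) simp
    next
      case False
      then have "t - s \<ge> t / 2" by simp
      then show ?thesis by (rule that) simp
    qed
    have "d powr (- (1/4)) \<le> (t / 2) powr (- (1/4))" using d(1) t by (intro powr_mono2') auto
    also have "\<dots> = 2 powr (1/4) * t powr (- (1/4))" using t by (simp add: powr_divide powr_minus field_simps)
    also have "\<dots> \<le> 2 * t powr (- (1/4))"
      using powr_mono[of "1/4" 1 "2::real"] by (intro mult_right_mono) auto
    finally have dd: "d powr (- (1/4)) \<le> 2 * t powr (- (1/4))" .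
    have "cmod (conv K g x) \<le> k * a * s powr (- (1/4)) * d powr (- (1/4))" by (rule base[OF d])
    also have "\<dots> \<le> k * a * s powr (- (1/4)) * (2 * t powr (- (1/4)))" using k a by (intro mult_left_mono dd) auto
    also have "\<dots> = 2 * \<rho> * t powr (- (1/2))"
    proof -
      have e: "t powr (1/4) * t powr (- (1/2)) = t powr (- (1/4))" by (simp flip: powr_add)
      have "2 * \<rho> * t powr (- (1/2)) = 2 * (k * s powr (- (1/4)) * a) * (t powr (1/4) * t powr (- (1/2)))"
        unfolding \<rho>_def by (simp only: mult_ac)
      also have "\<dots> = 2 * (k * s powr (- (1/4)) * a) * t powr (- (1/4))" unfolding e ..
      finally show ?thesis by (simp only: mult_ac)
    qed
    finally show ?thesis .
  qed
  ultimately show ?thesis using \<rho>0 m unfolding small_def \<rho>_def by (auto simp: mult.assoc)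
qed

text \<open>The \<open>L\<^sup>2\<close> bound on the forcing is used near \<open>\<tau> = t\<close> and its \<open>L\<^sup>1\<close> bound near \<open>\<tau> = 0\<close>, so that
  a single scalar convolution controls both norms of the Duhamel term.\<close>

lemma small_duhamel:
  fixes K :: "real \<Rightarrow> real \<Rightarrow> complex" and g :: "real \<Rightarrow> real \<Rightarrow> complex"
  assumes t: "t > 0"
    and K [measurable]: "(\<lambda>(s, x). K s x) \<in> borel_measurable (borel \<Otimes>\<^sub>M borel)"
    and g [measurable]: "(\<lambda>(s, x). g s x) \<in> borel_measurable (borel \<Otimes>\<^sub>M borel)"
    and a [measurable]: "a \<in> borel_measurable borel" and C: "C \<ge> 0"
    and sm: "\<And>s. 0 < s \<Longrightarrow> s < t \<Longrightarrow> small s (K s) (C * s powr (- \<beta>))"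
    and g1: "\<And>\<tau>. 0 < \<tau> \<Longrightarrow> \<tau> < t \<Longrightarrow> (NN y. cmod (g \<tau> y)) \<le> ennreal (a \<tau>)"
    and a0: "\<And>\<tau>. 0 < \<tau> \<Longrightarrow> \<tau> < t \<Longrightarrow> a \<tau> \<ge> 0"
    and g2: "\<And>\<tau>. 0 < \<tau> \<Longrightarrow> \<tau> < t \<Longrightarrow> L2sq (g \<tau>) \<le> ennreal ((a \<tau> * \<tau> powr (- (1/4)))\<^sup>2)"
    and J: "(NN \<tau>. indicator {0<..<t} \<tau> * ((t - \<tau>) powr (- (1/4 + \<beta>)) * a \<tau>)) \<le> ennreal J" "J \<ge> 0"
  shows "small t (\<lambda>x. LBINT \<tau>:{0<..<t}. conv (K (t - \<tau>)) (g \<tau>) x) (2 * C * t powr (1/4) * J)"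
    and "set_integrable lborel {0<..<t} (\<lambda>\<tau>. conv (K (t - \<tau>)) (g \<tau>) x)"
proof -
  let ?f = "\<lambda>\<tau> x. if \<tau> \<in> {0<..<t} then conv (K (t - \<tau>)) (g \<tau>) x else 0"
  let ?\<rho> = "\<lambda>\<tau>. indicator {0<..<t} \<tau> * (2 * t powr (1/4) * (C * (t - \<tau>) powr (- \<beta>) * (t - \<tau>) powr (- (1/4)) * a \<tau>))"
  have Km [measurable]: "K s \<in> borel_measurable borel" for s
    using measurable_compose[OF measurable_Pair1' K, of s] by (simp add: split_beta')
  have gm [measurable]: "g s \<in> borel_measurable borel" for s
    using measurable_compose[OF measurable_Pair1' g, of s] by (simp add: split_beta')
  have fm: "(\<lambda>(\<tau>, x). ?f \<tau> x) \<in> borel_measurable (lborel \<Otimes>\<^sub>M borel)"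
  proof -
    have [measurable]: "(\<lambda>z. K (t - fst z) (snd z)) \<in> borel_measurable (borel \<Otimes>\<^sub>M borel)"
      using measurable_compose[of "\<lambda>z. (t - fst z, snd z)" "borel \<Otimes>\<^sub>M borel" "borel \<Otimes>\<^sub>M borel" "\<lambda>(s, x). K s x" borel] by simp
    have *: "(\<lambda>w. K (t - fst (fst w)) (snd (fst w) - snd w)) \<in> borel_measurable ((borel \<Otimes>\<^sub>M borel) \<Otimes>\<^sub>M lborel)"
      using measurable_compose[of "\<lambda>w. (t - fst (fst w), snd (fst w) - snd w)" "(borel \<Otimes>\<^sub>M borel) \<Otimes>\<^sub>M lborel" "borel \<Otimes>\<^sub>M borel" "\<lambda>(s, x). K s x" borel] by simp
    have **: "(\<lambda>w. g (fst (fst w)) (snd w)) \<in> borel_measurable ((borel \<Otimes>\<^sub>M borel) \<Otimes>\<^sub>M lborel)"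
      using measurable_compose[of "\<lambda>w. (fst (fst w), snd w)" "(borel \<Otimes>\<^sub>M borel) \<Otimes>\<^sub>M lborel" "borel \<Otimes>\<^sub>M borel" "\<lambda>(s, x). g s x" borel] by simp
    have "(\<lambda>z. LBINT y. K (t - fst z) (snd z - y) * g (fst z) y) \<in> borel_measurable (borel \<Otimes>\<^sub>M borel)"
      by (rule lborel.borel_measurable_lebesgue_integral) (use * ** in \<open>simp add: split_beta'\<close>)
    then have "(\<lambda>(\<tau>, x). ?f \<tau> x) \<in> borel_measurable (borel \<Otimes>\<^sub>M borel)"
      unfolding conv_def split_beta' by measurable
    then show ?thesis by (simp cong: measurable_cong_sets add: sets_pair_measure_cong[of lborel borel borel borel])
  qed
  have sf: "small t (\<lambda>x. ?f \<tau> x) (?\<rho> \<tau>)" for \<tau>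
  proof (cases "\<tau> \<in> {0<..<t}")
    case True
    have "small t (conv (K (t - \<tau>)) (g \<tau>)) (2 * t powr (1/4) * (C * (t - \<tau>) powr (- \<beta>) * (t - \<tau>) powr (- (1/4)) * a \<tau>))"
      by (rule small_conv[OF t]) (use True t in \<open>auto intro!: sm g1 a0 g2\<close>)
    then show ?thesis using True by simp
  next
    case False
    then show ?thesis by (auto simp: small_def)
  qed
  have R: "(NN \<tau>. ?\<rho> \<tau> * cmod 1) \<le> ennreal (2 * C * t powr (1/4) * J)"
  proof -
    have "(NN \<tau>. ?\<rho> \<tau> * cmod 1) = (\<integral>\<^sup>+ \<tau>. ennreal (2 * C * t powr (1/4)) * ennreal (indicator {0<..<t} \<tau> * ((t - \<tau>) powr (- (1/4 + \<beta>)) * a \<tau>)) \<partial>lborel)"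
    proof (rule nn_integral_cong)
      fix \<tau> :: real
      have "(t - \<tau>) powr (- \<beta>) * (t - \<tau>) powr (- (1/4)) = (t - \<tau>) powr (- (1/4 + \<beta>))" by (subst powr_add[symmetric]) (simp only: minus_add_distrib add.commute)
      then have "?\<rho> \<tau> = 2 * C * t powr (1/4) * (indicator {0<..<t} \<tau> * ((t - \<tau>) powr (- (1/4 + \<beta>)) * a \<tau>))"
        by (simp only: mult_ac)
      moreover have "0 \<le> indicator {0<..<t} \<tau> * ((t - \<tau>) powr (- (1/4 + \<beta>)) * a \<tau>)" using a0 by (auto simp: indicator_def)
      ultimately show "ennreal (?\<rho> \<tau> * cmod 1) = ennreal (2 * C * t powr (1/4)) * ennreal (indicator {0<..<t} \<tau> * ((t - \<tau>) powr (- (1/4 + \<beta>)) * a \<tau>))"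
        using C by (simp only: norm_one mult_1_right) (rule ennreal_mult, auto)
    qed
    also have "\<dots> = ennreal (2 * C * t powr (1/4)) * (NN \<tau>. indicator {0<..<t} \<tau> * ((t - \<tau>) powr (- (1/4 + \<beta>)) * a \<tau>))"
      by (rule nn_integral_cmult) measurable
    also have "\<dots> \<le> ennreal (2 * C * t powr (1/4)) * ennreal J" by (intro mult_left_mono J) simp
    also have "\<dots> = ennreal (2 * C * t powr (1/4) * J)" using C J by (simp add: ennreal_mult)
    finally show ?thesis .
  qed
  have "small t (\<lambda>x. LBINT \<tau>. ?f \<tau> x * 1) (2 * C * t powr (1/4) * J)"
    by (rule small_integral[OF sigma_finite_lborel fm _ _ sf R]) (use C J in auto)
  moreover have "(LBINT \<tau>. ?f \<tau> x * 1) = (LBINT \<tau>:{0<..<t}. conv (K (t - \<tau>)) (g \<tau>) x)" for x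
    unfolding set_lebesgue_integral_def by (intro Bochner_Integration.integral_cong) (auto simp: indicator_def)
  ultimately show "small t (\<lambda>x. LBINT \<tau>:{0<..<t}. conv (K (t - \<tau>)) (g \<tau>) x) (2 * C * t powr (1/4) * J)" by simp
  have "integrable lborel (\<lambda>\<tau>. ?f \<tau> x * 1)"
    by (rule integrable_small[OF _ _ _ sf R]) (use measurable_compose[OF measurable_Pair2', OF _ fm, of x] in \<open>simp_all only: case_prod_conv space_borel UNIV_I, simp_all\<close>)
  then show "set_integrable lborel {0<..<t} (\<lambda>\<tau>. conv (K (t - \<tau>)) (g \<tau>) x)"
    unfolding set_integrable_def by (rule Bochner_Integration.integrable_cong[THEN iffD1, rotated 2]) (auto simp: indicator_def)
qed

section \<open>Time integrals with algebraic weights\<close>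

lemma nn_integral_beta:
  fixes x y :: real
  assumes "x < 1" "y < 1"
  shows "\<exists>C\<ge>0. \<forall>t>0. (NN \<tau>. indicator {0<..<t} \<tau> * ((t - \<tau>) powr (- x) * \<tau> powr (- y))) \<le> ennreal (C * t powr (1 - x - y))"
proof -
  let ?f = "\<lambda>s::real. indicator {0..1} s * (s powr (- y) * (1 - s) powr (- x))"
  have i: "integrable lborel ?f"
    using integrable_Beta[of "1 - y" "1 - x"] assms by (simp add: set_integrable_def)
  show ?thesis
  proof (intro exI[of _ "LBINT s. ?f s"] conjI allI impI)
    show "(LBINT s. ?f s) \<ge> 0" by (intro integral_nonneg_AE) auto
    fix t :: real assume t: "t > 0"
    have "(NN s. indicator {0<..<t} (t * s) * ((t - t * s) powr (- x) * (t * s) powr (- y)))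
      \<le> (\<integral>\<^sup>+ s. ennreal (t powr (- x - y)) * ennreal (?f s) \<partial>lborel)"
    proof (rule nn_integral_mono)
      fix s
      have "indicator {0<..<t} (t * s) * ((t - t * s) powr (- x) * (t * s) powr (- y)) \<le> t powr (- x - y) * ?f s"
      proof (cases "0 < s \<and> s < 1")
        case True
        have "(t - t * s) powr (- x) * (t * s) powr (- y) = (t * (1 - s)) powr (- x) * (t * s) powr (- y)" by (simp add: algebra_simps)
        also have "\<dots> = (t powr (- x) * (1 - s) powr (- x)) * (t powr (- y) * s powr (- y))" using t True by (simp add: powr_mult)
        also have "\<dots> = (t powr (- x) * t powr (- y)) * (s powr (- y) * (1 - s) powr (- x))" by (simp only: mult_ac)
        also have "t powr (- x) * t powr (- y) = t powr (- x - y)" by (simp flip: powr_add)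
        finally show ?thesis using True t by (simp add: indicator_def)
      next
        case False
        then have "t * s \<notin> {0<..<t}" using t by (auto simp: zero_less_mult_iff)
        then show ?thesis by (auto simp: indicator_def)
      qed
      then show "ennreal (indicator {0<..<t} (t * s) * ((t - t * s) powr (- x) * (t * s) powr (- y))) \<le> ennreal (t powr (- x - y)) * ennreal (?f s)"
        by (subst ennreal_mult[symmetric]) (auto intro: ennreal_leI)
    qed
    also have "\<dots> = ennreal (t powr (- x - y)) * ennreal (LBINT s. ?f s)"
      by (subst nn_integral_cmult) (use nn_integral_eq_integral[OF i] in auto)
    finally have le: "(NN s. indicator {0<..<t} (t * s) * ((t - t * s) powr (- x) * (t * s) powr (- y))) \<le> ennreal (t powr (- x - y)) * ennreal (LBINT s. ?f s)" .
    have "(NN \<tau>. indicator {0<..<t} \<tau> * ((t - \<tau>) powr (- x) * \<tau> powr (- y)))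
      = ennreal t * (NN s. indicator {0<..<t} (t * s) * ((t - t * s) powr (- x) * (t * s) powr (- y)))"
      using nn_integral_real_affine[of "\<lambda>\<tau>. ennreal (indicator {0<..<t} \<tau> * ((t - \<tau>) powr (- x) * \<tau> powr (- y)))" t 0] t by simp
    also have "\<dots> \<le> ennreal t * (ennreal (t powr (- x - y)) * ennreal (LBINT s. ?f s))" by (intro mult_left_mono le) simp
    also have "\<dots> = ennreal (t * (t powr (- x - y) * (LBINT s. ?f s)))"
      using t by (simp add: ennreal_mult integral_nonneg_AE)
    also have "t * (t powr (- x - y) * (LBINT s. ?f s)) = (LBINT s. ?f s) * t powr (1 - x - y)"
    proof -
      have "t * t powr (- x - y) = t powr 1 * t powr (- x - y)" using t by simp
      also have "\<dots> = t powr (1 - x - y)" by (subst powr_add[symmetric]) (simp add: algebra_simps)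
      finally have e: "t * t powr (- x - y) = t powr (1 - x - y)" .
      show ?thesis by (simp only: mult.assoc[symmetric] e) (rule mult.commute)
    qed
    finally show "(NN \<tau>. indicator {0<..<t} \<tau> * ((t - \<tau>) powr (- x) * \<tau> powr (- y))) \<le> ennreal ((LBINT s. ?f s) * t powr (1 - x - y))"
      .
  qed
qed

lemma nn_integral_one_plus_powr:
  fixes y :: real assumes y: "y > 1"
  shows "(NN \<tau>. indicator {0<..} \<tau> * (1 + \<tau>) powr (- y)) \<le> ennreal (1 / (y - 1))"
proof -
  have "(NN \<tau>. indicator {0<..} \<tau> * (1 + \<tau>) powr (- y)) \<le> (\<integral>\<^sup>+ \<tau>. ennreal ((1 + \<tau>) powr (- y)) * indicator {0..} \<tau> \<partial>lborel)"
    by (intro nn_integral_mono) (auto simp: indicator_def)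
  also have "\<dots> = ennreal (0 - (- ((1 + 0) powr (1 - y) / (y - 1))))"
  proof (rule nn_integral_FTC_atLeast)
    show "((\<lambda>\<tau>. - ((1 + \<tau>) powr (1 - y) / (y - 1))) has_real_derivative (1 + x) powr (- y)) (at x)" if "0 \<le> x" for x
    proof -
      have "((\<lambda>\<tau>. (1 + \<tau>) powr (1 - y)) has_real_derivative (1 - y) * (1 + x) powr (1 - y - of_nat 1) * 1) (at x)"
        using that by (intro DERIV_fun_powr) (auto intro!: derivative_eq_intros)
      from DERIV_minus[OF DERIV_cdivide[OF this, of "y - 1"]]
      have "((\<lambda>\<tau>. - ((1 + \<tau>) powr (1 - y) / (y - 1))) has_real_derivative - ((1 - y) * (1 + x) powr (1 - y - of_nat 1) * 1 / (y - 1))) (at x)" .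
      moreover have "- ((1 - y) * (1 + x) powr (1 - y - of_nat 1) * 1 / (y - 1)) = (1 + x) powr (- y)"
      proof -
        have "- ((1 - y) * z / (y - 1)) = z" for z using y by (simp add: field_simps)
        then show ?thesis by simp
      qed
      ultimately show ?thesis by (simp only:)
    qed
    have "((\<lambda>\<tau>::real. (1 + \<tau>) powr (1 - y)) \<longlongrightarrow> 0) at_top"
      by (rule tendsto_neg_powr) (use y in \<open>auto intro: filterlim_tendsto_add_at_top filterlim_ident\<close>)
    then have "((\<lambda>\<tau>. - ((1 + \<tau>) powr (1 - y) / (y - 1))) \<longlongrightarrow> - (0 / (y - 1))) at_top" by (intro tendsto_intros) (use y in auto)
    then show "((\<lambda>\<tau>. - ((1 + \<tau>) powr (1 - y) / (y - 1))) \<longlongrightarrow> 0) at_top" by simp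
  qed auto
  finally show ?thesis by simp
qed

lemma nn_integral_near:
  fixes x y :: real
  assumes "x < 1" "0 \<le> y"
  shows "\<exists>C\<ge>0. \<forall>t>0. (NN \<tau>. indicator {t/2..<t} \<tau> * ((t - \<tau>) powr (- x) * (1 + \<tau>) powr (- y))) \<le> ennreal (C * t powr (1 - x - y))"
proof -
  obtain C where C: "C \<ge> 0" "\<And>t. t > 0 \<Longrightarrow> (NN \<tau>. indicator {0<..<t} \<tau> * ((t - \<tau>) powr (- x) * \<tau> powr (- 0))) \<le> ennreal (C * t powr (1 - x - 0))"
    using nn_integral_beta[of x 0] assms by auto
  show ?thesis
  proof (intro exI[of _ "2 powr y * C"] conjI allI impI)
    show "0 \<le> 2 powr y * C" using C by simp
    fix t :: real assume t: "t > 0"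
    have "(NN \<tau>. indicator {t/2..<t} \<tau> * ((t - \<tau>) powr (- x) * (1 + \<tau>) powr (- y)))
      \<le> (\<integral>\<^sup>+ \<tau>. ennreal (2 powr y * t powr (- y)) * ennreal (indicator {0<..<t} \<tau> * ((t - \<tau>) powr (- x) * \<tau> powr (- 0))) \<partial>lborel)"
    proof (rule nn_integral_mono)
      fix \<tau> :: real
      have "indicator {t/2..<t} \<tau> * ((t - \<tau>) powr (- x) * (1 + \<tau>) powr (- y)) \<le> 2 powr y * t powr (- y) * (indicator {0<..<t} \<tau> * ((t - \<tau>) powr (- x) * \<tau> powr (- 0)))"
      proof (cases "\<tau> \<in> {t/2..<t}")
        case True
        have "(1 + \<tau>) powr (- y) \<le> (t / 2) powr (- y)" using True t assms by (intro powr_mono2') auto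
        also have "\<dots> = 2 powr y * t powr (- y)" using t by (simp add: powr_divide powr_minus field_simps)
        finally have "(t - \<tau>) powr (- x) * (1 + \<tau>) powr (- y) \<le> (t - \<tau>) powr (- x) * (2 powr y * t powr (- y))" by (rule mult_left_mono) simp
        then show ?thesis using True t by (simp add: indicator_def mult_ac)
      qed auto
      then show "ennreal (indicator {t/2..<t} \<tau> * ((t - \<tau>) powr (- x) * (1 + \<tau>) powr (- y))) \<le> ennreal (2 powr y * t powr (- y)) * ennreal (indicator {0<..<t} \<tau> * ((t - \<tau>) powr (- x) * \<tau> powr (- 0)))"
        by (subst ennreal_mult[symmetric]) (auto intro: ennreal_leI)
    qed
    also have "\<dots> = ennreal (2 powr y * t powr (- y)) * (NN \<tau>. indicator {0<..<t} \<tau> * ((t - \<tau>) powr (- x) * \<tau> powr (- 0)))"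
      by (rule nn_integral_cmult) measurable
    also have "\<dots> \<le> ennreal (2 powr y * t powr (- y)) * ennreal (C * t powr (1 - x - 0))" by (intro mult_left_mono C t) simp
    also have "\<dots> = ennreal (2 powr y * t powr (- y) * (C * t powr (1 - x - 0)))" using C by (simp add: ennreal_mult)
    also have "2 powr y * t powr (- y) * (C * t powr (1 - x - 0)) = 2 powr y * C * (t powr (- y) * t powr (1 - x))" by simp
    also have "t powr (- y) * t powr (1 - x) = t powr (1 - x - y)" by (simp flip: powr_add)
    finally show "(NN \<tau>. indicator {t/2..<t} \<tau> * ((t - \<tau>) powr (- x) * (1 + \<tau>) powr (- y))) \<le> ennreal (2 powr y * C * t powr (1 - x - y))" .
  qed
qed

text \<open>Split at t/2. In the first half (t - \<tau>)^(-x) is comparable to t^(-x) and the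
  forcing weight is integrable; the second half gives t^(1 - x - y), which is at most t^(-x) since y
  > 1 and t \<ge> 1.\<close>

lemma nn_integral_integrable_forcing:
  fixes x y :: real
  assumes x: "0 \<le> x" "x < 1" and y: "y > 1"
  shows "\<exists>C\<ge>0. \<forall>t\<ge>1. (NN \<tau>. indicator {0<..<t} \<tau> * ((t - \<tau>) powr (- x) * (1 + \<tau>) powr (- y))) \<le> ennreal (C * t powr (- x))"
proof -
  obtain C where C: "C \<ge> 0" "\<And>t. t > 0 \<Longrightarrow> (NN \<tau>. indicator {t/2..<t} \<tau> * ((t - \<tau>) powr (- x) * (1 + \<tau>) powr (- y))) \<le> ennreal (C * t powr (1 - x - y))"
    using nn_integral_near[of x y] assms by auto
  show ?thesis
  proof (intro exI[of _ "2 powr x / (y - 1) + C"] conjI allI impI)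
    show "0 \<le> 2 powr x / (y - 1) + C" using C y by simp
    fix t :: real assume t: "t \<ge> 1"
    have "(NN \<tau>. indicator {0<..<t} \<tau> * ((t - \<tau>) powr (- x) * (1 + \<tau>) powr (- y)))
      \<le> (\<integral>\<^sup>+ \<tau>. ennreal (2 powr x * t powr (- x)) * ennreal (indicator {0<..} \<tau> * (1 + \<tau>) powr (- y)) + ennreal (indicator {t/2..<t} \<tau> * ((t - \<tau>) powr (- x) * (1 + \<tau>) powr (- y))) \<partial>lborel)"
    proof (rule nn_integral_mono)
      fix \<tau> :: real
      consider "\<tau> \<in> {t/2..<t}" | "0 < \<tau>" "\<tau> < t / 2" | "\<tau> \<notin> {0<..<t}" by force
      then show "ennreal (indicator {0<..<t} \<tau> * ((t - \<tau>) powr (- x) * (1 + \<tau>) powr (- y))) \<le> ennreal (2 powr x * t powr (- x)) * ennreal (indicator {0<..} \<tau> * (1 + \<tau>) powr (- y)) + ennreal (indicator {t/2..<t} \<tau> * ((t - \<tau>) powr (- x) * (1 + \<tau>) powr (- y)))"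
      proof cases
        case 1
        then have "\<tau> \<in> {0<..<t}" using t by auto
        then show ?thesis using 1 by (simp add: add_increasing)
      next
        case 2
        have "(t - \<tau>) powr (- x) \<le> (t / 2) powr (- x)" using 2 t x by (intro powr_mono2') auto
        also have "\<dots> = 2 powr x * t powr (- x)" using t by (simp add: powr_divide powr_minus field_simps)
        finally have "(t - \<tau>) powr (- x) * (1 + \<tau>) powr (- y) \<le> 2 powr x * t powr (- x) * (1 + \<tau>) powr (- y)" by (rule mult_right_mono) simp
        then have "ennreal ((t - \<tau>) powr (- x) * (1 + \<tau>) powr (- y)) \<le> ennreal (2 powr x * t powr (- x)) * ennreal ((1 + \<tau>) powr (- y))"
          by (subst ennreal_mult[symmetric]) (auto intro: ennreal_leI)
        moreover have "indicator {0<..<t} \<tau> = (1 :: real)" "indicator {0<..} \<tau> = (1 :: real)" "indicator {t/2..<t} \<tau> = (0 :: real)"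
          using 2 t by auto
        ultimately show ?thesis by simp
      next
        case 3
        then have "indicator {0<..<t} \<tau> = (0 :: real)" by simp
        then show ?thesis by (simp only: mult_zero_left ennreal_0 zero_le)
      qed
    qed
    also have "\<dots> = ennreal (2 powr x * t powr (- x)) * (NN \<tau>. indicator {0<..} \<tau> * (1 + \<tau>) powr (- y)) + (NN \<tau>. indicator {t/2..<t} \<tau> * ((t - \<tau>) powr (- x) * (1 + \<tau>) powr (- y)))"
      by (subst nn_integral_add, measurable, subst nn_integral_cmult, measurable)
    also have "\<dots> \<le> ennreal (2 powr x * t powr (- x)) * ennreal (1 / (y - 1)) + ennreal (C * t powr (1 - x - y))"
      using t by (intro add_mono mult_left_mono nn_integral_one_plus_powr y C) auto
    also have "\<dots> = ennreal (2 powr x * t powr (- x) * (1 / (y - 1))) + ennreal (C * t powr (1 - x - y))"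
      using y by (subst ennreal_mult[symmetric]) auto
    also have "\<dots> = ennreal (2 powr x * t powr (- x) * (1 / (y - 1)) + C * t powr (1 - x - y))"
      using y C by (intro ennreal_plus[symmetric]) auto
    also have "\<dots> \<le> ennreal ((2 powr x / (y - 1) + C) * t powr (- x))"
    proof (rule ennreal_leI)
      have "C * t powr (1 - x - y) \<le> C * t powr (- x)" using t y C by (intro mult_left_mono powr_mono) auto
      then show "2 powr x * t powr (- x) * (1 / (y - 1)) + C * t powr (1 - x - y) \<le> (2 powr x / (y - 1) + C) * t powr (- x)"
        by (simp add: algebra_simps)
    qed
    finally show "(NN \<tau>. indicator {0<..<t} \<tau> * ((t - \<tau>) powr (- x) * (1 + \<tau>) powr (- y))) \<le> ennreal ((2 powr x / (y - 1) + C) * t powr (- x))" .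
  qed
qed

subsection \<open>Leading order in Lebesgue norms\<close>

lemma Lq_norm_cong_AE:
  assumes [measurable]: "f \<in> borel_measurable borel" "g \<in> borel_measurable borel"
    and ae: "AE x in lborel. f x = g x"
  shows "Lq_norm q f = Lq_norm q g"
proof -
  have "esssup lborel (\<lambda>x. ereal \<bar>f x\<bar>) = esssup lborel (\<lambda>x. ereal \<bar>g x\<bar>)"
    by (rule esssup_AE_cong) (use ae in auto)
  moreover have "(NN x. \<bar>f x\<bar> powr r) = (NN x. \<bar>g x\<bar> powr r)" for r
    using ae by (intro nn_integral_cong_AE) auto
  ultimately show ?thesis unfolding Lq_norm_def by simp
qed

lemma Lq_norm_uminus: "Lq_norm q (\<lambda>x. - f x) = Lq_norm q f"
  by (simp add: Lq_norm_def)

lemma Lq_norm_nonneg: assumes "f \<in> borel_measurable borel" shows "0 \<le> Lq_norm q f"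
proof -
  have "esssup lborel (\<lambda>x::real. 0::ereal) \<le> esssup lborel (\<lambda>x. ereal \<bar>f x\<bar>)"
    using assms by (intro esssup_mono) auto
  moreover have "esssup lborel (\<lambda>x::real. 0::ereal) = 0" by (rule esssup_const) simp
  ultimately show ?thesis by (auto simp: Lq_norm_def root_ereal_def)
qed

lemma root_ereal_le:
  assumes "a \<le> ennreal b" "b \<ge> 0" "r > 0"
  shows "root_ereal r a \<le> ereal (b powr (1 / r))"
proof -
  have "a \<noteq> \<infinity>" using assms(1) by (auto simp: top_unique)
  moreover have "enn2real a \<le> b" using assms by (simp add: enn2real_leI)
  ultimately show ?thesis using assms by (auto simp: root_ereal_def intro!: powr_mono2)
qed

lemma root_ereal_leD:
  assumes "root_ereal r a \<le> ereal A" "r > 0"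
  shows "a \<le> ennreal (A powr r)" "A \<ge> 0"
proof -
  have fin: "a \<noteq> \<infinity>" and le: "enn2real a powr (1 / r) \<le> A" using assms by (auto simp: root_ereal_def split: if_splits)
  show "A \<ge> 0" by (rule order_trans[OF powr_ge_zero le])
  have "enn2real a = (enn2real a powr (1 / r)) powr r" using assms(2) by (simp add: powr_powr)
  also have "\<dots> \<le> A powr r" using le assms(2) by (intro powr_mono2) auto
  finally have "enn2real a \<le> A powr r" .
  moreover have "a = ennreal (enn2real a)" using fin by (simp add: less_top)
  ultimately show "a \<le> ennreal (A powr r)" by (metis ennreal_leI)
qed

lemma ereal_exponent_cases:
  fixes q :: ereal assumes "q \<ge> 2"
  obtains "q = \<infinity>" | r where "q = ereal r" "r \<ge> 2"
  using assms by (cases q) auto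

text \<open>Interpolation between the two norms: |f|^r \<le> B^(r-2) f^2, where B is the supremum
  bound. The powers of t combine to the decay rate of the heat kernel in L^q.\<close>

lemma Lq_norm_small:
  assumes q: "q \<ge> 2" and t: "t > 0" and sm: "small t (\<lambda>x. Cx (f x)) \<rho>"
    and f [measurable]: "f \<in> borel_measurable borel"
  shows "Lq_norm q f \<le> ereal (\<rho> * t powr (- (1 / 2 * (1 - real_of_ereal (1 / q)))))"
  using q
proof (cases rule: ereal_exponent_cases)
  case 1
  have "esssup lborel (\<lambda>x. ereal \<bar>f x\<bar>) \<le> ereal (\<rho> * t powr (- (1/2)))"
    using sm by (intro esssup_I) (auto simp: small_def)
  then show ?thesis using 1 by (simp add: Lq_norm_def)
next
  case (2 r)
  define B where "B = \<rho> * t powr (- (1/2))"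
  have fB: "\<bar>f x\<bar> \<le> B" for x using sm by (auto simp: small_def B_def)
  have \<rho>0: "\<rho> \<ge> 0" using sm by (rule small_nonneg)
  have L2: "(NN x. (f x)\<^sup>2) \<le> ennreal (\<rho>\<^sup>2 * t powr (- (1/2)))"
    using sm by (simp add: small_def)
  have "(NN x. \<bar>f x\<bar> powr r) \<le> (\<integral>\<^sup>+ x. ennreal (B powr (r - 2)) * ennreal ((f x)\<^sup>2) \<partial>lborel)"
  proof (rule nn_integral_mono)
    fix x
    have "\<bar>f x\<bar> powr r \<le> B powr (r - 2) * (f x)\<^sup>2"
    proof (cases "f x = 0")
      case False
      have "\<bar>f x\<bar> powr r = \<bar>f x\<bar> powr ((r - 2) + 2)" by simp
      also have "\<dots> = \<bar>f x\<bar> powr (r - 2) * \<bar>f x\<bar> powr 2" by (rule powr_add)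
      also have "\<bar>f x\<bar> powr 2 = (f x)\<^sup>2" using False by (simp add: powr_numeral)
      also have "\<bar>f x\<bar> powr (r - 2) * (f x)\<^sup>2 \<le> B powr (r - 2) * (f x)\<^sup>2"
        using fB 2 by (intro mult_right_mono powr_mono2) auto
      finally show ?thesis .
    qed auto
    then show "ennreal (\<bar>f x\<bar> powr r) \<le> ennreal (B powr (r - 2)) * ennreal ((f x)\<^sup>2)"
      by (subst ennreal_mult[symmetric]) (auto intro: ennreal_leI)
  qed
  also have "\<dots> = ennreal (B powr (r - 2)) * (NN x. (f x)\<^sup>2)" by (rule nn_integral_cmult) measurable
  also have "\<dots> \<le> ennreal (B powr (r - 2)) * ennreal (\<rho>\<^sup>2 * t powr (- (1/2)))" by (intro mult_left_mono L2) auto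
  also have "\<dots> = ennreal (B powr (r - 2) * (\<rho>\<^sup>2 * t powr (- (1/2))))" by (rule ennreal_mult[symmetric]) auto
  finally have le: "(NN x. \<bar>f x\<bar> powr r) \<le> ennreal (B powr (r - 2) * (\<rho>\<^sup>2 * t powr (- (1/2))))" .
  have "(B powr (r - 2) * (\<rho>\<^sup>2 * t powr (- (1/2)))) powr (1 / r) = \<rho> * t powr (- (1 / 2 * (1 - 1 / r)))"
  proof (cases "\<rho> = 0")
    case False
    then have \<rho>: "\<rho> > 0" using \<rho>0 by simp
    have "B powr (r - 2) * (\<rho>\<^sup>2 * t powr (- (1/2))) = \<rho> powr (r - 2) * t powr (- (1/2) * (r - 2)) * (\<rho> powr 2 * t powr (- (1/2)))"
      unfolding B_def using \<rho> t by (simp add: powr_mult powr_powr powr_numeral)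
    also have "\<dots> = (\<rho> powr (r - 2) * \<rho> powr 2) * (t powr (- (1/2) * (r - 2)) * t powr (- (1/2)))" by (simp only: mult_ac)
    also have "\<dots> = \<rho> powr r * t powr (- (1/2) * (r - 2) + - (1/2))" by (simp only: powr_add[symmetric]) simp
    also have "\<dots> powr (1 / r) = \<rho> powr (r * (1 / r)) * t powr ((- (1/2) * (r - 2) + - (1/2)) * (1 / r))"
      using \<rho> t by (simp only: powr_mult powr_ge_zero powr_powr)
    also have "r * (1 / r) = 1" using 2 by simp
    also have "(- (1/2) * (r - 2) + - (1/2)) * (1 / r) = - (1 / 2 * (1 - 1 / r))" using 2 by (simp add: field_simps)
    finally show ?thesis using \<rho> by simp
  qed simp
  moreover have "root_ereal r (NN x. \<bar>f x\<bar> powr r) \<le> ereal ((B powr (r - 2) * (\<rho>\<^sup>2 * t powr (- (1/2)))) powr (1 / r))"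
    using 2 by (intro root_ereal_le le) auto
  ultimately show ?thesis using 2 by (simp add: Lq_norm_def one_ereal_def)
qed

text \<open>Convexity of the power function. When one argument is 0 the claim reduces to l^r \<le>
  l.\<close>

lemma powr_convex_combination:
  fixes x y l :: real
  assumes "x \<ge> 0" "y \<ge> 0" "0 < l" "l < 1" "r \<ge> 1"
  shows "(l * x + (1 - l) * y) powr r \<le> l * x powr r + (1 - l) * y powr r"
proof -
  have aux: "(l * x) powr r \<le> l * x powr r" if "x \<ge> 0" "0 < l" "l < 1" for x l :: real
  proof -
    have "l powr r \<le> l powr 1" using that assms by (intro powr_mono') auto
    then have "l powr r * x powr r \<le> l * x powr r" using that by (intro mult_right_mono) auto
    then show ?thesis using that by (simp add: powr_mult)
  qed
  consider "x = 0" | "y = 0" | "x > 0" "y > 0" using assms by fastforce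
  then show ?thesis
  proof cases
    case 1
    then show ?thesis using aux[of y "1 - l"] assms by simp
  next
    case 2
    then show ?thesis using aux[of x l] assms by simp
  next
    case 3
    have "convex_on {0<..} (\<lambda>x. x powr r)" by (rule powr_convex) fact
    from convex_onD[OF this, of "1 - l" x y] 3 assms show ?thesis by simp
  qed
qed

text \<open>For finite exponents this is Minkowski's inequality by convexity: (|f| + |g|)/(a + b) is
  a convex combination of |f|/a and |g|/b with weights a/(a + b) and b/(a + b), and the integrals of
  the r-th powers of these two quotients are at most 1.\<close>

lemma Lq_norm_triangle:
  assumes q: "q \<ge> 2" and f [measurable]: "f \<in> borel_measurable borel" and g [measurable]: "g \<in> borel_measurable borel"
    and A: "Lq_norm q f \<le> ereal A" and B: "Lq_norm q g \<le> ereal B"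
  shows "Lq_norm q (\<lambda>x. f x + g x) \<le> ereal (A + B)"
  using q
proof (cases rule: ereal_exponent_cases)
  case 1
  have "AE x in lborel. \<bar>h x\<bar> \<le> K" if "Lq_norm q h \<le> ereal K" for h K
    using esssup_AE[of "\<lambda>x. ereal \<bar>h x\<bar>" lborel] that 1
    by (auto simp: Lq_norm_def elim!: eventually_mono dest: order_trans)
  from this[OF A] this[OF B] have "AE x in lborel. ereal \<bar>f x + g x\<bar> \<le> ereal (A + B)" by eventually_elim auto
  then have "esssup lborel (\<lambda>x. ereal \<bar>f x + g x\<bar>) \<le> ereal (A + B)" by (intro esssup_I) auto
  then show ?thesis using 1 by (simp add: Lq_norm_def)
next
  case (2 r)
  let ?F = "\<integral>\<^sup>+ x. ennreal (\<bar>f x\<bar> powr r) \<partial>lborel" and ?G = "\<integral>\<^sup>+ x. ennreal (\<bar>g x\<bar> powr r) \<partial>lborel"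
  have F: "?F \<le> ennreal (A powr r)" "A \<ge> 0" and G: "?G \<le> ennreal (B powr r)" "B \<ge> 0"
    using root_ereal_leD[of r ?F A] root_ereal_leD[of r ?G B] A B 2 by (auto simp: Lq_norm_def)
  have "Lq_norm q (\<lambda>x. f x + g x) \<le> ereal (A + B) + ereal e" if e: "e > 0" for e
  proof -
    \<comment> \<open>The bounds A and B may vanish; enlarging them by e/2 allows the division, and
      e is arbitrary.\<close>
    define a b where "a = A + e / 2" and "b = B + e / 2"
    have ab: "a > 0" "b > 0" "A \<le> a" "B \<le> b" using F G e by (auto simp: a_def b_def)
    define l where "l = a / (a + b)"
    have l: "0 < l" "l < 1" "1 - l = b / (a + b)" using ab by (auto simp: l_def field_simps)
    define c where "c = (a + b) powr r"
    have c: "c \<ge> 0" by (simp add: c_def)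
    have "(NN x. \<bar>f x + g x\<bar> powr r) \<le>
      (\<integral>\<^sup>+ x. ennreal (c * l / a powr r) * ennreal (\<bar>f x\<bar> powr r) + ennreal (c * (1 - l) / b powr r) * ennreal (\<bar>g x\<bar> powr r) \<partial>lborel)"
    proof (rule nn_integral_mono)
      fix x
      have "\<bar>f x + g x\<bar> powr r \<le> (\<bar>f x\<bar> + \<bar>g x\<bar>) powr r" using 2 by (intro powr_mono2) auto
      also have "\<bar>f x\<bar> + \<bar>g x\<bar> = (a + b) * (l * (\<bar>f x\<bar> / a) + (1 - l) * (\<bar>g x\<bar> / b))"
      proof -
        have "(a + b) * l = a" "(a + b) * (1 - l) = b" unfolding l(3) unfolding l_def using ab by auto
        moreover have "(a + b) * (l * (\<bar>f x\<bar> / a) + (1 - l) * (\<bar>g x\<bar> / b)) = (a + b) * l * (\<bar>f x\<bar> / a) + (a + b) * (1 - l) * (\<bar>g x\<bar> / b)"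
          by (simp only: distrib_left mult.assoc)
        ultimately show ?thesis using ab by simp
      qed
      also have "\<dots> powr r = c * (l * (\<bar>f x\<bar> / a) + (1 - l) * (\<bar>g x\<bar> / b)) powr r"
        unfolding c_def by (rule powr_mult)
      also have "\<dots> \<le> c * (l * (\<bar>f x\<bar> / a) powr r + (1 - l) * (\<bar>g x\<bar> / b) powr r)"
        using ab l 2 by (intro mult_left_mono powr_convex_combination c) auto
      also have "\<dots> = c * l / a powr r * (\<bar>f x\<bar> powr r) + c * (1 - l) / b powr r * (\<bar>g x\<bar> powr r)"
        using ab by (simp add: powr_divide distrib_left)
      finally have "ennreal (\<bar>f x + g x\<bar> powr r) \<le> ennreal (c * l / a powr r * (\<bar>f x\<bar> powr r) + c * (1 - l) / b powr r * (\<bar>g x\<bar> powr r))"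
        by (rule ennreal_leI)
      also have "\<dots> = ennreal (c * l / a powr r * (\<bar>f x\<bar> powr r)) + ennreal (c * (1 - l) / b powr r * (\<bar>g x\<bar> powr r))"
        using c l(1,2) by (intro ennreal_plus) auto
      also have "\<dots> = ennreal (c * l / a powr r) * ennreal (\<bar>f x\<bar> powr r) + ennreal (c * (1 - l) / b powr r) * ennreal (\<bar>g x\<bar> powr r)"
        using c l(1,2) by (intro arg_cong2[where f = "(+)"] ennreal_mult) auto
      finally show "ennreal (\<bar>f x + g x\<bar> powr r) \<le> \<dots>" .
    qed
    also have "\<dots> = ennreal (c * l / a powr r) * ?F + ennreal (c * (1 - l) / b powr r) * ?G"
      by (subst nn_integral_add, measurable, subst (1 2) nn_integral_cmult, measurable)
    also have "\<dots> \<le> ennreal (c * l / a powr r) * ennreal (a powr r) + ennreal (c * (1 - l) / b powr r) * ennreal (b powr r)"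
    proof (intro add_mono mult_left_mono)
      show "?F \<le> ennreal (a powr r)"
        by (rule order_trans[OF F(1)]) (use F ab 2 in \<open>intro ennreal_leI powr_mono2, auto\<close>)
      show "?G \<le> ennreal (b powr r)"
        by (rule order_trans[OF G(1)]) (use G ab 2 in \<open>intro ennreal_leI powr_mono2, auto\<close>)
    qed auto
    also have "\<dots> = ennreal (c * l / a powr r * a powr r) + ennreal (c * (1 - l) / b powr r * b powr r)"
      using c l(1,2) by (intro arg_cong2[where f = "(+)"] ennreal_mult[symmetric]) auto
    also have "\<dots> = ennreal (c * l / a powr r * a powr r + c * (1 - l) / b powr r * b powr r)"
      using c l(1,2) by (intro ennreal_plus[symmetric]) auto
    also have "c * l / a powr r * a powr r + c * (1 - l) / b powr r * b powr r = c"
    proof -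
      have "a powr r \<noteq> 0" "b powr r \<noteq> 0" using ab by auto
      then have "c * l / a powr r * a powr r + c * (1 - l) / b powr r * b powr r = c * l + c * (1 - l)" by simp
      then show ?thesis by (simp add: algebra_simps)
    qed
    finally have le: "(NN x. \<bar>f x + g x\<bar> powr r) \<le> ennreal c" .
    have "Lq_norm q (\<lambda>x. f x + g x) \<le> ereal (c powr (1 / r))"
      using 2 by (auto simp: Lq_norm_def intro!: root_ereal_le le c)
    also have "c powr (1 / r) = A + B + e" unfolding c_def using 2 ab by (simp add: powr_powr) (simp add: a_def b_def)
    finally show ?thesis by simp
  qed
  then show ?thesis by (rule ereal_le_epsilon2)
qed

lemma Lq_norm_scale_le:
  assumes q: "q \<ge> 2" and \<Phi> [measurable]: "\<Phi> \<in> borel_measurable borel" and s: "s > 0"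
    and c: "Lq_norm q \<Phi> \<le> ereal c"
  shows "Lq_norm q (\<lambda>x. k * \<Phi> ((x - v) / s)) \<le> ereal (\<bar>k\<bar> * s powr real_of_ereal (1 / q) * c)"
  using q
proof (cases rule: ereal_exponent_cases)
  case 1
  have "AE x in lborel. \<bar>\<Phi> x\<bar> \<le> c"
    using esssup_AE[of "\<lambda>x. ereal \<bar>\<Phi> x\<bar>" lborel] c 1
    by (auto simp: Lq_norm_def elim!: eventually_mono dest: order_trans)
  then have "AE x in lborel. \<bar>\<Phi> (- v / s + (1 / s) * x)\<bar> \<le> c"
    using s by (intro AE_borel_affine) auto
  moreover have "- v / s + (1 / s) * x = (x - v) / s" for x using s by (simp add: field_simps)
  ultimately have "AE x in lborel. \<bar>\<Phi> ((x - v) / s)\<bar> \<le> c" by simp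
  then have "AE x in lborel. ereal \<bar>k * \<Phi> ((x - v) / s)\<bar> \<le> ereal (\<bar>k\<bar> * c)"
    by eventually_elim (auto simp: abs_mult intro: mult_left_mono)
  then have "esssup lborel (\<lambda>x. ereal \<bar>k * \<Phi> ((x - v) / s)\<bar>) \<le> ereal (\<bar>k\<bar> * c)" by (intro esssup_I) auto
  then show ?thesis using 1 s by (simp add: Lq_norm_def)
next
  case (2 r)
  let ?F = "\<integral>\<^sup>+ x. ennreal (\<bar>\<Phi> x\<bar> powr r) \<partial>lborel"
  have F: "?F \<le> ennreal (c powr r)" "c \<ge> 0"
    using root_ereal_leD[of r ?F c] c 2 by (auto simp: Lq_norm_def)
  have "(NN x. \<bar>\<Phi> ((x - v) / s)\<bar> powr r) = ennreal s * (NN z. \<bar>\<Phi> (((v + s * z) - v) / s)\<bar> powr r)"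
    using nn_integral_real_affine[of "\<lambda>x. ennreal (\<bar>\<Phi> ((x - v) / s)\<bar> powr r)" s v] s by simp
  also have "\<dots> = ennreal s * ?F" using s by simp
  finally have e: "(NN x. \<bar>\<Phi> ((x - v) / s)\<bar> powr r) = ennreal s * ?F" .
  have "(NN x. \<bar>k * \<Phi> ((x - v) / s)\<bar> powr r) = (\<integral>\<^sup>+ x. ennreal (\<bar>k\<bar> powr r) * ennreal (\<bar>\<Phi> ((x - v) / s)\<bar> powr r) \<partial>lborel)"
    by (intro nn_integral_cong) (simp add: abs_mult powr_mult ennreal_mult)
  also have "\<dots> = ennreal (\<bar>k\<bar> powr r) * (ennreal s * ?F)" unfolding e[symmetric] by (rule nn_integral_cmult) measurable
  also have "\<dots> \<le> ennreal (\<bar>k\<bar> powr r) * (ennreal s * ennreal (c powr r))" using F by (intro mult_left_mono) auto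
  also have "\<dots> = ennreal (\<bar>k\<bar> powr r * (s * c powr r))" using s by (simp add: ennreal_mult)
  finally have le: "(NN x. \<bar>k * \<Phi> ((x - v) / s)\<bar> powr r) \<le> ennreal (\<bar>k\<bar> powr r * (s * c powr r))" .
  have "Lq_norm q (\<lambda>x. k * \<Phi> ((x - v) / s)) \<le> ereal ((\<bar>k\<bar> powr r * (s * c powr r)) powr (1 / r))"
    using 2 s by (auto simp: Lq_norm_def intro!: root_ereal_le le)
  also have "(\<bar>k\<bar> powr r * (s * c powr r)) powr (1 / r) = \<bar>k\<bar> * (s powr (1 / r) * c)"
    using 2 s F by (simp add: powr_mult powr_powr)
  finally show ?thesis using 2 by (simp add: one_ereal_def mult.assoc)
qed

lemma Lq_norm_zero: "Lq_norm q (\<lambda>x. 0) = 0"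
proof -
  have "esssup lborel (\<lambda>x::real. 0::ereal) = 0" by (rule esssup_const) simp
  then show ?thesis by (auto simp: Lq_norm_def root_ereal_def zero_ereal_def)
qed

text \<open>The inequality \<open>Lq_norm_scale_le\<close>, applied to the inverse dilation as well,
  gives equality.\<close>

lemma Lq_norm_scale:
  assumes q: "q \<ge> 2" and \<Phi> [measurable]: "\<Phi> \<in> borel_measurable borel" and s: "s > 0"
    and c: "Lq_norm q \<Phi> = ereal c"
  shows "Lq_norm q (\<lambda>x. k * \<Phi> ((x - v) / s)) = ereal (\<bar>k\<bar> * s powr real_of_ereal (1 / q) * c)"
proof (cases "k = 0")
  case True
  then show ?thesis by (simp add: Lq_norm_zero zero_ereal_def)
next
  case False
  let ?g = "\<lambda>x. k * \<Phi> ((x - v) / s)"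
  let ?p = "s powr real_of_ereal (1 / q)"
  have p: "?p > 0" using s by simp
  have le: "Lq_norm q ?g \<le> ereal (\<bar>k\<bar> * ?p * c)" using q \<Phi> s by (rule Lq_norm_scale_le) (simp add: c)
  moreover have "0 \<le> Lq_norm q ?g" by (rule Lq_norm_nonneg) measurable
  ultimately obtain d where d: "Lq_norm q ?g = ereal d" by (cases "Lq_norm q ?g") auto
  have "Lq_norm q (\<lambda>x. (1 / k) * ?g ((x - (- v / s)) / (1 / s))) \<le> ereal (\<bar>1 / k\<bar> * (1 / s) powr real_of_ereal (1 / q) * d)"
    using q s d by (intro Lq_norm_scale_le) auto
  moreover have "(\<lambda>x. (1 / k) * ?g ((x - (- v / s)) / (1 / s))) = \<Phi>"
    using False s by (auto simp: fun_eq_iff field_simps)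
  ultimately have "c \<le> \<bar>1 / k\<bar> * (1 / s) powr real_of_ereal (1 / q) * d" using c by simp
  also have "\<dots> = d / (\<bar>k\<bar> * ?p)" using s by (simp add: powr_divide)
  finally have "\<bar>k\<bar> * ?p * c \<le> d" using False p by (simp add: pos_le_divide_eq mult.commute)
  then show ?thesis using le d by simp
qed

text \<open>The travelling self-similar profile has exactly the norm c t^(-a) r(t), and the
  remainder R changes the norm by at most \<rho>(t) t^(-a), by the triangle inequality in both
  directions. Taking the equation of \<open>leading_order\<close> as the definition of \<epsilon>(t)
  therefore leaves |\<epsilon>(t)| \<le> \<rho>(t)/r(t).\<close>

lemma leading_order_main:
  fixes D :: "real \<Rightarrow> real \<Rightarrow> real" and \<Phi> :: "real \<Rightarrow> real" and r \<rho> :: "real \<Rightarrow> real" and V A :: real and q :: ereal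
  defines "a \<equiv> 1 / 2 * (1 - real_of_ereal (1 / q))"
  assumes q: "q \<ge> 2" and \<Phi> [measurable]: "\<Phi> \<in> borel_measurable borel"
    and \<Phi>s: "small 1 (\<lambda>x. Cx (\<Phi> x)) A"
    and ev: "\<forall>\<^sub>F t in at_top. D t \<in> borel_measurable borel \<and> 0 < r t \<and> (\<exists>R. small t R (\<rho> t) \<and>
       (AE x in lborel. Cx (D t x) = Cx (r t * t powr (- (1/2)) * \<Phi> ((x - V * t) / sqrt t)) + R x))"
    and lim: "((\<lambda>t. \<rho> t / r t) \<longlongrightarrow> 0) at_top"
  shows "leading_order (\<lambda>t. Lq_norm q (D t)) (Lq_norm q \<Phi>) (\<lambda>t. t powr (- a) * r t)"
proof -
  have "Lq_norm q \<Phi> \<le> ereal (A * 1 powr (- a))" unfolding a_def by (rule Lq_norm_small[OF q _ \<Phi>s \<Phi>]) simp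
  moreover have "0 \<le> Lq_norm q \<Phi>" by (rule Lq_norm_nonneg) fact
  ultimately obtain c where c: "Lq_norm q \<Phi> = ereal c" by (cases "Lq_norm q \<Phi>") auto
  define \<epsilon> where "\<epsilon> t = real_of_ereal (Lq_norm q (D t)) / (t powr (- a) * r t) - c" for t
  have main: "\<forall>\<^sub>F t in at_top. Lq_norm q (D t) = (ereal c + ereal (\<epsilon> t)) * ereal (t powr (- a) * r t) \<and> \<bar>\<epsilon> t\<bar> \<le> \<rho> t / r t"
    using ev eventually_gt_at_top[of 0]
  proof eventually_elim
    case (elim t)
    then have t: "t > 0" and r: "r t > 0" and Dm [measurable]: "D t \<in> borel_measurable borel" by auto
    from elim obtain R where R: "small t R (\<rho> t)" and
      ae: "AE x in lborel. Cx (D t x) = Cx (r t * t powr (- (1/2)) * \<Phi> ((x - V * t) / sqrt t)) + R x"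
      by auto
    \<comment> \<open>The function and its profile are real, so only the real part of the remainder
      enters, and it inherits both bounds.\<close>
    define R' where "R' x = Re (R x)" for x
    have [measurable]: "R \<in> borel_measurable borel" using R by (rule small_measurable)
    have R'm [measurable]: "R' \<in> borel_measurable borel" unfolding R'_def[abs_def] by measurable
    have R's: "small t (\<lambda>x. Cx (R' x)) (\<rho> t)"
    proof -
      have "L2sq (\<lambda>x. Cx (R' x)) \<le> L2sq R"
        unfolding R'_def norm_of_real by (intro nn_integral_mono ennreal_leI power_mono abs_Re_le_cmod) auto
      moreover have "cmod (Cx (R' x)) \<le> cmod (R x)" for x unfolding R'_def norm_of_real by (rule abs_Re_le_cmod)
      ultimately show ?thesis using R unfolding small_def by (auto intro: order_trans)
    qed
    have LR: "Lq_norm q R' \<le> ereal (\<rho> t * t powr (- a))" unfolding a_def by (rule Lq_norm_small[OF q t R's R'm])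
    let ?P = "\<lambda>x. r t * t powr (- (1/2)) * \<Phi> ((x - V * t) / sqrt t)"
    have ae': "AE x in lborel. D t x = ?P x + R' x"
      using ae
    proof eventually_elim
      case (elim x)
      then have "Re (Cx (D t x)) = Re (Cx (?P x) + R x)" by (rule arg_cong)
      then show ?case by (simp add: R'_def)
    qed
    have LP: "Lq_norm q ?P = ereal (t powr (- a) * r t * c)"
    proof -
      have "Lq_norm q ?P = ereal (\<bar>r t * t powr (- (1/2))\<bar> * sqrt t powr real_of_ereal (1 / q) * c)"
        using t by (intro Lq_norm_scale q \<Phi> c) auto
      also have "\<bar>r t * t powr (- (1/2))\<bar> = r t * t powr (- (1/2))" using r by simp
      also have "sqrt t powr real_of_ereal (1 / q) = t powr (1/2 * real_of_ereal (1 / q))"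
        using t by (simp add: powr_half_sqrt[symmetric] powr_powr)
      also have "r t * t powr (- (1/2)) * t powr (1/2 * real_of_ereal (1 / q)) = r t * t powr (- (1/2) + 1/2 * real_of_ereal (1 / q))"
        by (simp only: mult.assoc powr_add)
      also have "- (1/2) + 1/2 * real_of_ereal (1 / q) = - a" by (simp add: a_def algebra_simps)
      finally show ?thesis by (simp only: mult_ac)
    qed
    have "Lq_norm q (D t) = Lq_norm q (\<lambda>x. ?P x + R' x)" by (rule Lq_norm_cong_AE[OF _ _ ae']) measurable
    also have "\<dots> \<le> ereal (t powr (- a) * r t * c + \<rho> t * t powr (- a))"
      by (rule Lq_norm_triangle[OF q]) (measurable, simp_all add: LP LR)
    finally have up: "Lq_norm q (D t) \<le> ereal (t powr (- a) * r t * c + \<rho> t * t powr (- a))" .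
    moreover have "0 \<le> Lq_norm q (D t)" by (rule Lq_norm_nonneg) fact
    ultimately obtain d where d: "Lq_norm q (D t) = ereal d" by (cases "Lq_norm q (D t)") auto
    have "Lq_norm q ?P = Lq_norm q (\<lambda>x. D t x + - R' x)"
      by (rule Lq_norm_cong_AE) (use ae' in \<open>auto elim!: eventually_mono\<close>)
    also have "\<dots> \<le> ereal (d + \<rho> t * t powr (- a))"
      by (rule Lq_norm_triangle[OF q]) (measurable, simp_all add: d LR Lq_norm_uminus)
    finally have lo: "t powr (- a) * r t * c \<le> d + \<rho> t * t powr (- a)" unfolding LP by simp
    have up': "d \<le> t powr (- a) * r t * c + \<rho> t * t powr (- a)" using up unfolding d by simp
    have pos: "t powr (- a) * r t > 0" using t r by simp
    have \<epsilon>: "\<epsilon> t = d / (t powr (- a) * r t) - c" by (simp add: \<epsilon>_def d)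
    have "Lq_norm q (D t) = (ereal c + ereal (\<epsilon> t)) * ereal (t powr (- a) * r t)"
    proof -
      have "(c + (d / X - c)) * X = d" if "X > 0" for X using that by simp
      from this[OF pos] show ?thesis by (simp only: d \<epsilon> plus_ereal.simps times_ereal.simps)
    qed
    moreover have "\<bar>\<epsilon> t\<bar> \<le> \<rho> t / r t"
    proof -
      have "d / X - c = (d - X * c) / X" if "X > 0" for X using that by (simp add: diff_divide_distrib)
      from this[OF pos] have "\<epsilon> t = (d - t powr (- a) * r t * c) / (t powr (- a) * r t)" unfolding \<epsilon> .
      then have "\<bar>\<epsilon> t\<bar> = \<bar>d - t powr (- a) * r t * c\<bar> / (t powr (- a) * r t)" using pos by (simp add: abs_divide)
      also have "\<dots> \<le> (\<rho> t * t powr (- a)) / (t powr (- a) * r t)"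
        using lo up' pos by (intro divide_right_mono) (auto simp: abs_le_iff)
      also have "\<dots> = \<rho> t / r t" using t by simp
      finally show ?thesis .
    qed
    ultimately show ?case ..
  qed
  have "(\<epsilon> \<longlongrightarrow> 0) at_top"
  proof (rule Lim_null_comparison[OF _ lim])
    show "\<forall>\<^sub>F t in at_top. norm (\<epsilon> t) \<le> \<rho> t / r t" using main by eventually_elim simp
  qed
  then have "\<epsilon> \<in> o[at_top](\<lambda>_. 1 :: real)" by (intro smalloI_tendsto) auto
  moreover have "\<forall>\<^sub>F t in at_top. Lq_norm q (D t) = (Lq_norm q \<Phi> + ereal (\<epsilon> t)) * ereal (t powr (- a) * r t)"
    using main unfolding c by eventually_elim simp
  ultimately show ?thesis unfolding leading_order_def by blast
qed

subsection \<open>The linear evolution\<close>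

lemma ift_diff:
  assumes "integrable lborel g" "integrable lborel h"
  shows "ift (\<lambda>\<xi>. g \<xi> - h \<xi>) x = ift g x - ift h x"
proof -
  have i: "integrable lborel (\<lambda>\<xi>. iexp (x * \<xi>) * g \<xi>)" "integrable lborel (\<lambda>\<xi>. iexp (x * \<xi>) * h \<xi>)"
    by (rule integrable_iexp_mult; use assms in simp)+
  show ?thesis unfolding ift_def right_diff_distrib Bochner_Integration.integral_diff[OF i] ..
qed

lemma ift_add:
  assumes "integrable lborel g" "integrable lborel h"
  shows "ift (\<lambda>\<xi>. g \<xi> + h \<xi>) x = ift g x + ift h x"
proof -
  have i: "integrable lborel (\<lambda>\<xi>. iexp (x * \<xi>) * g \<xi>)" "integrable lborel (\<lambda>\<xi>. iexp (x * \<xi>) * h \<xi>)"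
    by (rule integrable_iexp_mult; use assms in simp)+
  show ?thesis unfolding ift_def distrib_left Bochner_Integration.integral_add[OF i] ..
qed

lemma ift_cmult: "ift (\<lambda>\<xi>. c * g \<xi>) x = c * ift g x"
proof -
  have "(LBINT \<xi>. iexp (x * \<xi>) * (c * g \<xi>)) = (LBINT \<xi>. c * (iexp (x * \<xi>) * g \<xi>))"
    by (intro Bochner_Integration.integral_cong refl) (simp only: mult_ac)
  then show ?thesis unfolding ift_def by (simp only: integral_mult_right_zero mult_ac)
qed

lemma ift_shift: "ift (\<lambda>\<xi>. k \<xi> * iexp (- (c * \<xi>))) x = ift k (x - c)"
proof -
  have "iexp (x * \<xi>) * (k \<xi> * iexp (- (c * \<xi>))) = iexp ((x - c) * \<xi>) * k \<xi>" for \<xi>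
  proof -
    have "iexp ((x - c) * \<xi>) = iexp (x * \<xi>) * iexp (- (c * \<xi>))" by (simp add: exp_add[symmetric] algebra_simps)
    then show ?thesis by (simp only: mult_ac)
  qed
  then show ?thesis unfolding ift_def by (simp only:)
qed

lemma ift_dilate:
  assumes "s > 0" shows "ift (\<lambda>\<xi>. k (s * \<xi>)) x = Cx (1 / s) * ift k (x / s)"
proof -
  have "(LBINT \<xi>. iexp (x / s * \<xi>) * k \<xi>) = \<bar>s\<bar> *\<^sub>R (LBINT \<xi>. iexp (x / s * (0 + s * \<xi>)) * k (0 + s * \<xi>))"
    using assms by (intro lborel_integral_real_affine) auto
  also have "(\<lambda>\<xi>. iexp (x / s * (0 + s * \<xi>)) * k (0 + s * \<xi>)) = (\<lambda>\<xi>. iexp (x * \<xi>) * k (s * \<xi>))"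
    using assms by (simp add: fun_eq_iff)
  finally have "(LBINT \<xi>. iexp (x / s * \<xi>) * k \<xi>) = Cx s * (LBINT \<xi>. iexp (x * \<xi>) * k (s * \<xi>))"
    using assms by (simp add: scaleR_conv_of_real)
  then show ?thesis unfolding ift_def using assms by simp
qed

lemma ift_scale:
  assumes t: "t > 0"
  shows "ift (\<lambda>\<xi>. k (sqrt t * \<xi>) * iexp (- (c * \<xi>))) x = Cx (t powr (- (1/2))) * ift k ((x - c) / sqrt t)"
proof -
  have "t powr (- (1/2)) = 1 / sqrt t" using t by (simp add: powr_minus powr_half_sqrt inverse_eq_divide)
  then show ?thesis using ift_shift[of "\<lambda>\<xi>. k (sqrt t * \<xi>)" c x] ift_dilate[of "sqrt t" k "x - c"] t by simp
qed

text \<open>The derivative of \<open>ift g\<close> is the complex integral on the right; its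
  imaginary part is the derivative of a function that is constantly 0, so the value is real and
  equals the derivative of F.\<close>

lemma ift_real_derivative:
  fixes F :: "real \<Rightarrow> real"
  assumes F: "\<And>x. Cx (F x) = ift g x"
    and g: "integrable lborel g" and g1: "integrable lborel (\<lambda>\<xi>. Cx \<xi> * g \<xi>)"
  shows "Cx (deriv F x) = ift (\<lambda>\<xi>. \<i> * Cx \<xi> * g \<xi>) x"
    and "F differentiable (at x)"
proof -
  let ?d = "ift (\<lambda>\<xi>. \<i> * Cx \<xi> * g \<xi>) x"
  have d: "(ift g has_vector_derivative ?d) (at x)" by (rule ift_has_derivative[OF g g1])
  have "((\<lambda>x. Re (ift g x)) has_vector_derivative Re ?d) (at x)"
    by (rule bounded_linear.has_vector_derivative[OF bounded_linear_Re d])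
  then have "(F has_vector_derivative Re ?d) (at x)" unfolding F[symmetric] by simp
  then have "(F has_real_derivative Re ?d) (at x)" by (simp add: has_real_derivative_iff_has_vector_derivative)
  then have 1: "deriv F x = Re ?d" and 2: "F differentiable (at x)"
    by (auto intro: DERIV_imp_deriv simp: real_differentiable_def)
  have "((\<lambda>x. Im (ift g x)) has_vector_derivative Im ?d) (at x)"
    by (rule bounded_linear.has_vector_derivative[OF bounded_linear_Im d])
  then have "((\<lambda>x::real. 0::real) has_vector_derivative Im ?d) (at x)" unfolding F[symmetric] by simp
  then have "Im ?d = 0" by (rule vector_derivative_unique_at) (rule has_vector_derivative_const)
  then show "Cx (deriv F x) = ?d" using 1 by (simp add: complex_eq_iff)
  show "F differentiable (at x)" by (rule 2)
qed

lemma ift_measurable_pair: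
  fixes k :: "'a::second_countable_topology \<Rightarrow> real \<Rightarrow> complex"
  assumes [measurable]: "(\<lambda>(s, \<xi>). k s \<xi>) \<in> borel_measurable (borel \<Otimes>\<^sub>M borel)"
  shows "(\<lambda>(s, x). ift (k s) x) \<in> borel_measurable (borel \<Otimes>\<^sub>M borel)"
proof -
  have *: "(\<lambda>w. k (fst (fst w)) (snd w)) \<in> borel_measurable ((borel \<Otimes>\<^sub>M borel) \<Otimes>\<^sub>M lborel)"
    using measurable_compose[of "\<lambda>w. (fst (fst w), snd w)" "(borel \<Otimes>\<^sub>M borel) \<Otimes>\<^sub>M lborel" "borel \<Otimes>\<^sub>M borel" "\<lambda>(s, x). k s x" borel] by simp
  have "(\<lambda>z. LBINT \<xi>. iexp (snd z * \<xi>) * k (fst z) \<xi>) \<in> borel_measurable (borel \<Otimes>\<^sub>M borel)"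
    by (rule lborel.borel_measurable_lebesgue_integral) (use * in \<open>simp add: split_beta'\<close>)
  then show ?thesis unfolding ift_def split_beta' by measurable
qed

lemma iexp_diff_le: "cmod (iexp x - iexp y) \<le> \<bar>x - y\<bar>"
proof -
  have "iexp x = iexp y * iexp (x - y)" by (simp add: exp_add[symmetric] algebra_simps)
  then have "iexp x - iexp y = iexp y * (iexp (x - y) - 1)" by (simp only: right_diff_distrib mult_1_right)
  then have "cmod (iexp x - iexp y) = cmod (iexp (x - y) - 1)" by (simp only: norm_mult norm_exp_i_times mult_1)
  also have "\<dots> \<le> \<bar>x - y\<bar>" using iexp_approx1[of "x - y" 0] by simp
  finally show ?thesis .
qed

lemma powr_half_sqrt_pow:
  assumes "t > 0" shows "\<bar>sqrt t * \<xi>\<bar> = t powr (1/2) * \<bar>\<xi>\<bar>"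
  using assms by (simp add: abs_mult powr_half_sqrt)

locale params =
  fixes B b \<mu> :: real
  assumes B0: "B > 0" and b0: "b > 0" and \<mu>0: "\<mu> > 0"
begin

text \<open>V and W are the first Taylor coefficients of the dispersion relation:
  \<open>disp \<xi>\<close> = V \<xi> - W \<xi>^3 + O(\<xi>^5). The linear term moves the heat
  kernel at speed V, and the cubic one produces the third derivative in the case p > 3.\<close>

definition "V = 2 * B / b"
definition "W = 2 * B / b ^ 3"
definition "disp \<xi> = 2 * B * b * \<xi> / (b\<^sup>2 + \<xi>\<^sup>2)"
definition "smb s \<xi> = Cx (gauss (\<mu> * s) \<xi>) * iexp (- (s * disp \<xi>))"
definition "smb0 s \<xi> = Cx (gauss (\<mu> * s) \<xi>) * iexp (- (V * s * \<xi>))"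
text \<open>The kernel and its approximation by a drifting heat kernel, both differentiated in \<open>x\<close>.\<close>

definition "K1 s = ift (\<lambda>\<xi>. \<i> * Cx \<xi> * smb s \<xi>)"
definition "K0 s = ift (\<lambda>\<xi>. \<i> * Cx \<xi> * smb0 s \<xi>)"

lemma V0: "V > 0" and W0: "W > 0" using B0 b0 by (auto simp: V_def W_def)

lemma bxi: "b\<^sup>2 + \<xi>\<^sup>2 > 0" using b0 by (intro add_pos_nonneg) auto

lemma disp_measurable [measurable]: "disp \<in> borel_measurable borel"
  unfolding disp_def[abs_def] by measurable

lemma smb_measurable_pair [measurable]: "(\<lambda>(s, \<xi>). smb s \<xi>) \<in> borel_measurable (borel \<Otimes>\<^sub>M borel)"
  unfolding smb_def split_beta' by measurable

lemma smb0_measurable_pair [measurable]: "(\<lambda>(s, \<xi>). smb0 s \<xi>) \<in> borel_measurable (borel \<Otimes>\<^sub>M borel)"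
  unfolding smb0_def split_beta' by measurable

lemma smb_measurable [measurable]: "smb s \<in> borel_measurable borel"
  unfolding smb_def[abs_def] by measurable

lemma smb0_measurable [measurable]: "smb0 s \<in> borel_measurable borel"
  unfolding smb0_def[abs_def] by measurable

lemma cmod_smb: "cmod (smb s \<xi>) = gauss (\<mu> * s) \<xi>" "cmod (smb0 s \<xi>) = gauss (\<mu> * s) \<xi>"
  by (simp_all add: smb_def smb0_def norm_mult)

lemma exp_sqrt: "s \<ge> 0 \<Longrightarrow> gauss (c * s) \<xi> = gauss c (sqrt s * \<xi>)"
  by (simp add: power_mult_distrib mult.assoc)

lemma disp_le: "\<bar>disp \<xi>\<bar> \<le> V * \<bar>\<xi>\<bar>"
proof -
  have "\<bar>disp \<xi>\<bar> = 2 * B * b * \<bar>\<xi>\<bar> / (b\<^sup>2 + \<xi>\<^sup>2)" using B0 b0 bxi[of \<xi>] by (simp add: disp_def abs_mult)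
  also have "\<dots> \<le> 2 * B * b * \<bar>\<xi>\<bar> / b\<^sup>2" using B0 b0 by (intro divide_left_mono) (auto simp: bxi)
  also have "\<dots> = V * \<bar>\<xi>\<bar>" using b0 by (simp add: V_def power2_eq_square)
  finally show ?thesis .
qed

lemma disp_diff: "V * \<xi> - disp \<xi> = 2 * B * \<xi> ^ 3 / (b * (b\<^sup>2 + \<xi>\<^sup>2))"
proof -
  have "V * \<xi> = 2 * B * \<xi> * (b\<^sup>2 + \<xi>\<^sup>2) / (b * (b\<^sup>2 + \<xi>\<^sup>2))" using b0 bxi[of \<xi>] by (simp add: V_def)
  moreover have "disp \<xi> = 2 * B * \<xi> * b\<^sup>2 / (b * (b\<^sup>2 + \<xi>\<^sup>2))" using b0 bxi[of \<xi>] by (simp add: disp_def power2_eq_square)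
  ultimately have "V * \<xi> - disp \<xi> = (2 * B * \<xi> * (b\<^sup>2 + \<xi>\<^sup>2) - 2 * B * \<xi> * b\<^sup>2) / (b * (b\<^sup>2 + \<xi>\<^sup>2))"
    by (simp only: diff_divide_distrib)
  also have "2 * B * \<xi> * (b\<^sup>2 + \<xi>\<^sup>2) - 2 * B * \<xi> * b\<^sup>2 = 2 * B * \<xi> ^ 3" by (simp add: algebra_simps power3_eq_cube power2_eq_square)
  finally show ?thesis .
qed

lemma disp_diff_le: "\<bar>V * \<xi> - disp \<xi>\<bar> \<le> W * \<bar>\<xi>\<bar> ^ 3"
proof -
  have "\<bar>V * \<xi> - disp \<xi>\<bar> = 2 * B * \<bar>\<xi>\<bar> ^ 3 / (b * (b\<^sup>2 + \<xi>\<^sup>2))"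
    unfolding disp_diff using B0 b0 bxi[of \<xi>] by (simp add: abs_mult power_abs)
  also have "\<dots> \<le> 2 * B * \<bar>\<xi>\<bar> ^ 3 / (b * b\<^sup>2)" using B0 b0 by (intro divide_left_mono mult_left_mono mult_pos_pos) (auto simp: bxi)
  also have "\<dots> = W * \<bar>\<xi>\<bar> ^ 3" by (simp add: W_def power3_eq_cube power2_eq_square)
  finally show ?thesis .
qed

lemma disp_diff3_le: "\<bar>W * \<xi> ^ 3 - (V * \<xi> - disp \<xi>)\<bar> \<le> W / b\<^sup>2 * \<bar>\<xi>\<bar> ^ 5"
proof -
  have "W * \<xi> ^ 3 = 2 * B * \<xi> ^ 3 * (b\<^sup>2 + \<xi>\<^sup>2) / (b ^ 3 * (b\<^sup>2 + \<xi>\<^sup>2))" using b0 bxi[of \<xi>] by (simp add: W_def)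
  moreover have "V * \<xi> - disp \<xi> = 2 * B * \<xi> ^ 3 * b\<^sup>2 / (b ^ 3 * (b\<^sup>2 + \<xi>\<^sup>2))"
    unfolding disp_diff using b0 bxi[of \<xi>] by (simp add: power2_eq_square power3_eq_cube)
  ultimately have "W * \<xi> ^ 3 - (V * \<xi> - disp \<xi>) = (2 * B * \<xi> ^ 3 * (b\<^sup>2 + \<xi>\<^sup>2) - 2 * B * \<xi> ^ 3 * b\<^sup>2) / (b ^ 3 * (b\<^sup>2 + \<xi>\<^sup>2))"
    by (simp only: diff_divide_distrib)
  also have "2 * B * \<xi> ^ 3 * (b\<^sup>2 + \<xi>\<^sup>2) - 2 * B * \<xi> ^ 3 * b\<^sup>2 = 2 * B * \<xi> ^ 5"
    by (simp add: algebra_simps power2_eq_square flip: power_add power_Suc)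
  finally have "\<bar>W * \<xi> ^ 3 - (V * \<xi> - disp \<xi>)\<bar> = 2 * B * \<bar>\<xi>\<bar> ^ 5 / (b ^ 3 * (b\<^sup>2 + \<xi>\<^sup>2))"
    using B0 b0 bxi[of \<xi>] by (simp add: abs_mult power_abs)
  also have "\<dots> \<le> 2 * B * \<bar>\<xi>\<bar> ^ 5 / (b ^ 3 * b\<^sup>2)" using B0 b0 by (intro divide_left_mono mult_left_mono mult_pos_pos) (auto simp: bxi)
  also have "\<dots> = W / b\<^sup>2 * \<bar>\<xi>\<bar> ^ 5" by (simp add: W_def)
  finally show ?thesis .
qed

lemma smb_diff_le: "s \<ge> 0 \<Longrightarrow> cmod (smb s \<xi> - smb0 s \<xi>) \<le> gauss (\<mu> * s) \<xi> * (s * (W * \<bar>\<xi>\<bar> ^ 3))"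
proof -
  assume s: "s \<ge> 0"
  have "smb s \<xi> - smb0 s \<xi> = Cx (gauss (\<mu> * s) \<xi>) * (iexp (- (s * disp \<xi>)) - iexp (- (V * s * \<xi>)))"
    by (simp only: smb_def smb0_def right_diff_distrib)
  then have "cmod (smb s \<xi> - smb0 s \<xi>) = gauss (\<mu> * s) \<xi> * cmod (iexp (- (s * disp \<xi>)) - iexp (- (V * s * \<xi>)))"
    by (simp only: norm_mult norm_of_real abs_exp_cancel)
  also have "\<dots> \<le> gauss (\<mu> * s) \<xi> * (s * (W * \<bar>\<xi>\<bar> ^ 3))"
  proof (rule mult_left_mono)
    have "cmod (iexp (- (s * disp \<xi>)) - iexp (- (V * s * \<xi>))) \<le> \<bar>- (s * disp \<xi>) - (- (V * s * \<xi>))\<bar>" by (rule iexp_diff_le)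
    also have "- (s * disp \<xi>) - (- (V * s * \<xi>)) = s * (V * \<xi> - disp \<xi>)" by (simp add: algebra_simps)
    also have "\<bar>s * (V * \<xi> - disp \<xi>)\<bar> \<le> s * (W * \<bar>\<xi>\<bar> ^ 3)" using s disp_diff_le by (simp add: abs_mult mult_left_mono)
    finally show "cmod (iexp (- (s * disp \<xi>)) - iexp (- (V * s * \<xi>))) \<le> s * (W * \<bar>\<xi>\<bar> ^ 3)" .
  qed simp
  finally show ?thesis .
qed

lemma kernel_T_eq: "kernel_T B b \<mu> s = ift (smb s)"
proof
  fix x
  have "exp (Cx (- (\<mu> * s * \<xi>\<^sup>2)) - \<i> * Cx (2 * B * b * s * \<xi> / (b\<^sup>2 + \<xi>\<^sup>2))) = smb s \<xi>" for \<xi>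
  proof -
    have "exp (Cx A - \<i> * Cx C) = Cx (exp A) * iexp (- C)" for A C
      by (simp add: exp_diff exp_minus exp_of_real divide_inverse)
    moreover have "2 * B * b * s * \<xi> / (b\<^sup>2 + \<xi>\<^sup>2) = s * disp \<xi>" by (simp add: disp_def)
    ultimately show ?thesis unfolding smb_def by (simp only:)
  qed
  moreover have "Cx (1 / sqrt (2 * pi)) * Cx (1 / sqrt (2 * pi)) = Cx (1 / (2 * pi))"
    by (simp flip: of_real_mult)
  ultimately show "kernel_T B b \<mu> s x = ift (smb s) x"
    unfolding kernel_T_def inv_fourier_def ift_def mult.assoc[symmetric] by (simp add: mult.assoc)
qed

lemma xi_smb_bound:
  assumes s: "s > 0"
  shows "cmod (\<i> * Cx \<xi> * smb s \<xi>) \<le> s powr (- (1/2)) * (\<bar>sqrt s * \<xi>\<bar> ^ 1 * gauss \<mu> (sqrt s * \<xi>))"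
    and "cmod (\<i> * Cx \<xi> * smb0 s \<xi>) \<le> s powr (- (1/2)) * (\<bar>sqrt s * \<xi>\<bar> ^ 1 * gauss \<mu> (sqrt s * \<xi>))"
proof -
  have "s powr (- (1/2)) * \<bar>sqrt s * \<xi>\<bar> = \<bar>\<xi>\<bar>"
    using s by (simp add: powr_half_sqrt_pow mult.assoc[symmetric] flip: powr_add)
  then have *: "s powr (- (1/2)) * (\<bar>sqrt s * \<xi>\<bar> ^ 1 * z) = \<bar>\<xi>\<bar> * z" for z by (simp only: mult.assoc[symmetric] power_one_right)
  show "cmod (\<i> * Cx \<xi> * smb s \<xi>) \<le> s powr (- (1/2)) * (\<bar>sqrt s * \<xi>\<bar> ^ 1 * gauss \<mu> (sqrt s * \<xi>))"
    unfolding * using s by (simp add: norm_mult cmod_smb exp_sqrt)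
  show "cmod (\<i> * Cx \<xi> * smb0 s \<xi>) \<le> s powr (- (1/2)) * (\<bar>sqrt s * \<xi>\<bar> ^ 1 * gauss \<mu> (sqrt s * \<xi>))"
    unfolding * using s by (simp add: norm_mult cmod_smb exp_sqrt)
qed

lemma smb_integrable:
  assumes s: "s > 0"
  shows "integrable lborel (smb s)" "integrable lborel (smb0 s)"
    "integrable lborel (\<lambda>\<xi>. \<i> * Cx \<xi> * smb s \<xi>)" "integrable lborel (\<lambda>\<xi>. \<i> * Cx \<xi> * smb0 s \<xi>)"
proof -
  show "integrable lborel (smb s)"
    by (rule small_ift_gauss(1)[OF _ s \<mu>0, of _ 1 0]) (use s in \<open>auto simp: cmod_smb exp_sqrt\<close>)
  show "integrable lborel (smb0 s)"
    by (rule small_ift_gauss(1)[OF _ s \<mu>0, of _ 1 0]) (use s in \<open>auto simp: cmod_smb exp_sqrt\<close>)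
  show "integrable lborel (\<lambda>\<xi>. \<i> * Cx \<xi> * smb s \<xi>)"
    by (rule small_ift_gauss(1)[OF _ s \<mu>0 _ xi_smb_bound(1)[OF s]]) auto
  show "integrable lborel (\<lambda>\<xi>. \<i> * Cx \<xi> * smb0 s \<xi>)"
    by (rule small_ift_gauss(1)[OF _ s \<mu>0 _ xi_smb_bound(2)[OF s]]) auto
qed

lemma small_K:
  assumes s: "s > 0"
  shows "small s (K1 s) (gauss_const 1 \<mu> * s powr (- (1/2)))" "small s (K0 s) (gauss_const 1 \<mu> * s powr (- (1/2)))"
  using small_ift_gauss(2)[OF _ s \<mu>0 _ xi_smb_bound(1)[OF s]] small_ift_gauss(2)[OF _ s \<mu>0 _ xi_smb_bound(2)[OF s]]
  unfolding K1_def K0_def by (auto simp: mult.commute)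

lemma kernel_T_dx_eq:
  assumes s: "s > 0" shows "kernel_T_dx B b \<mu> s = K1 s"
proof
  fix x
  have "integrable lborel (\<lambda>\<xi>. - \<i> * (\<i> * Cx \<xi> * smb s \<xi>))" by (intro integrable_mult_right smb_integrable s)
  then have "integrable lborel (\<lambda>\<xi>. Cx \<xi> * smb s \<xi>)" by (simp add: mult.assoc[symmetric])
  from ift_has_derivative[OF smb_integrable(1)[OF s] this, of x]
  show "kernel_T_dx B b \<mu> s x = K1 s x"
    unfolding kernel_T_dx_def kernel_T_eq K1_def by (rule vector_derivative_at)
qed

text \<open>Two bounds are interpolated: the trivial one, of order s^(-1/2), for s \<le> 1, and the
  gain from the cubic phase error s |\<xi>|^3, of order s^(-1), for s \<ge> 1. The exponent 5/8 lies
  strictly between 1/2 and 3/4: it is better than the kernel itself for large s, while s^(-1/4 -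
  5/8) remains integrable at s = 0.\<close>

lemma small_K_diff:
  assumes s: "s > 0"
  shows "small s (\<lambda>x. K1 s x - K0 s x) ((2 * gauss_const 1 \<mu> + W * gauss_const 4 \<mu>) * s powr (- (5/8)))"
proof -
  have eq: "(\<lambda>x. K1 s x - K0 s x) = ift (\<lambda>\<xi>. \<i> * Cx \<xi> * smb s \<xi> - \<i> * Cx \<xi> * smb0 s \<xi>)"
    unfolding K1_def K0_def using ift_diff[OF smb_integrable(3,4)[OF s]] by (simp add: fun_eq_iff)
  have 1: "small s (\<lambda>x. K1 s x - K0 s x) (2 * gauss_const 1 \<mu> * s powr (- (1/2)))"
    using small_diff[OF small_K[OF s]] by (simp add: mult.assoc)
  have 2: "small s (\<lambda>x. K1 s x - K0 s x) (W * s powr (-1) * gauss_const 4 \<mu>)"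
    unfolding eq
  proof (rule small_ift_gauss(2)[OF _ s \<mu>0])
    show "0 \<le> W * s powr (- 1)" using W0 by simp
    fix \<xi>
    have "cmod (\<i> * Cx \<xi> * smb s \<xi> - \<i> * Cx \<xi> * smb0 s \<xi>) = \<bar>\<xi>\<bar> * cmod (smb s \<xi> - smb0 s \<xi>)"
      unfolding right_diff_distrib[symmetric] by (simp add: norm_mult)
    also have "\<dots> \<le> \<bar>\<xi>\<bar> * (gauss (\<mu> * s) \<xi> * (s * (W * \<bar>\<xi>\<bar> ^ 3)))"
      using s by (intro mult_left_mono smb_diff_le) auto
    also have "\<dots> = W * (s * \<bar>\<xi>\<bar> ^ 4) * gauss (\<mu> * s) \<xi>" by (simp add: eval_nat_numeral mult_ac)
    also have "s * \<bar>\<xi>\<bar> ^ 4 = s powr (- 1) * \<bar>sqrt s * \<xi>\<bar> ^ 4"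
    proof -
      have "sqrt s ^ 4 = (sqrt s)\<^sup>2 * (sqrt s)\<^sup>2" by (simp flip: power_add)
      then have "sqrt s ^ 4 = s\<^sup>2" using s by (simp add: power2_eq_square)
      then have "\<bar>sqrt s * \<xi>\<bar> ^ 4 = s\<^sup>2 * \<bar>\<xi>\<bar> ^ 4" using s by (simp add: abs_mult power_mult_distrib)
      then show ?thesis using s by (simp add: powr_minus power2_eq_square)
    qed
    finally show "cmod (\<i> * Cx \<xi> * smb s \<xi> - \<i> * Cx \<xi> * smb0 s \<xi>) \<le> W * s powr (- 1) * (\<bar>sqrt s * \<xi>\<bar> ^ 4 * gauss \<mu> (sqrt s * \<xi>))"
      unfolding exp_sqrt[OF less_imp_le[OF s]] by (simp only: mult.assoc)
  qed measurable
  show ?thesis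
  proof (cases "s \<le> 1")
    case True
    have "s powr (- (1/2)) \<le> s powr (- (5/8))" using s True by (intro powr_mono') auto
    then have "2 * gauss_const 1 \<mu> * s powr (- (1/2)) \<le> (2 * gauss_const 1 \<mu> + W * gauss_const 4 \<mu>) * s powr (- (5/8))"
      using W0 gauss_const_nonneg by (intro mult_mono) (auto intro: mult_nonneg_nonneg add_nonneg_nonneg simp: less_imp_le)
    with 1 show ?thesis by (rule small_mono)
  next
    case False
    have "s powr (- 1) \<le> s powr (- (5/8))" using s False by (intro powr_mono) auto
    then have "W * gauss_const 4 \<mu> * s powr (- 1) \<le> (2 * gauss_const 1 \<mu> + W * gauss_const 4 \<mu>) * s powr (- (5/8))"
      using W0 gauss_const_nonneg by (intro mult_mono) (auto intro: mult_nonneg_nonneg add_nonneg_nonneg simp: less_imp_le)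
    moreover have "W * s powr (-1) * gauss_const 4 \<mu> = W * gauss_const 4 \<mu> * s powr (- 1)" by (simp only: mult_ac)
    ultimately have "W * s powr (-1) * gauss_const 4 \<mu> \<le> (2 * gauss_const 1 \<mu> + W * gauss_const 4 \<mu>) * s powr (- (5/8))" by linarith
    with 2 show ?thesis by (rule small_mono)
  qed
qed

lemma K_measurable [measurable]:
  "(\<lambda>(s, x). K1 s x) \<in> borel_measurable (borel \<Otimes>\<^sub>M borel)"
  "(\<lambda>(s, x). K0 s x) \<in> borel_measurable (borel \<Otimes>\<^sub>M borel)"
proof -
  have 1: "(\<lambda>(s, \<xi>). \<i> * Cx \<xi> * smb s \<xi>) \<in> borel_measurable (borel \<Otimes>\<^sub>M borel)"
    using smb_measurable_pair unfolding split_beta' by measurable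
  have 2: "(\<lambda>(s, \<xi>). \<i> * Cx \<xi> * smb0 s \<xi>) \<in> borel_measurable (borel \<Otimes>\<^sub>M borel)"
    using smb0_measurable_pair unfolding split_beta' by measurable
  show "(\<lambda>(s, x). K1 s x) \<in> borel_measurable (borel \<Otimes>\<^sub>M borel)" "(\<lambda>(s, x). K0 s x) \<in> borel_measurable (borel \<Otimes>\<^sub>M borel)"
    unfolding K1_def K0_def by (rule ift_measurable_pair[OF 1], rule ift_measurable_pair[OF 2])
qed

text \<open>The symbol of the k-th x-derivative of the heat kernel at time 1.\<close>

definition "gk k \<zeta> = (\<i> * Cx \<zeta>) ^ k * Cx (gauss \<mu> \<zeta>)"

lemma gk_measurable [measurable]: "gk k \<in> borel_measurable borel"
  unfolding gk_def[abs_def] by measurable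

lemma cmod_gk: "cmod (gk k \<zeta>) = \<bar>\<zeta>\<bar> ^ k * gauss \<mu> \<zeta>"
  by (simp add: gk_def norm_mult norm_power)

lemma gk_integrable: "integrable lborel (gk k)"
  by (rule small_ift_gauss(1)[OF _ zero_less_one \<mu>0, of _ 1 k]) (auto simp: cmod_gk)

lemma small_gk: "small 1 (ift (gk k)) (gauss_const k \<mu>)"
  using small_ift_gauss(2)[OF _ zero_less_one \<mu>0, of "gk k" 1 k] by (auto simp: cmod_gk)

lemma heat_deriv: "Cx ((deriv ^^ k) (heat \<mu> 1) x) = ift (gk k) x"
proof (induction k arbitrary: x)
  case 0
  have "gk 0 = (\<lambda>\<xi>. Cx (gauss (\<mu> * 1) \<xi>))" by (simp add: gk_def fun_eq_iff)
  then show ?case using heat_eq_ift[of \<mu> 1 x] \<mu>0 by simp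
next
  case (Suc k)
  have s: "\<i> * Cx \<zeta> * gk k \<zeta> = gk (Suc k) \<zeta>" for \<zeta> by (simp add: gk_def mult.assoc)
  have "integrable lborel (\<lambda>\<zeta>. - \<i> * gk (Suc k) \<zeta>)" by (intro integrable_mult_right gk_integrable)
  then have "integrable lborel (\<lambda>\<zeta>. Cx \<zeta> * gk k \<zeta>)" unfolding s[symmetric] by (simp add: mult.assoc[symmetric])
  from ift_real_derivative(1)[OF Suc.IH gk_integrable this, of x] show ?case unfolding s by simp
qed

lemma heat_drift_eq:
  assumes "t > 0" shows "Cx (heat_drift B b \<mu> t x) = ift (smb0 t) x"
proof -
  have "ift (smb0 t) x = ift (\<lambda>\<xi>. Cx (gauss (\<mu> * t) \<xi>)) (x - V * t)"
    unfolding smb0_def by (rule ift_shift)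
  also have "\<dots> = Cx (heat \<mu> t (x - V * t))" using heat_eq_ift[of \<mu> t] assms \<mu>0 by simp
  also have "heat \<mu> t (x - V * t) = heat_drift B b \<mu> t x" by (simp add: heat_drift_def V_def)
  finally show ?thesis by simp
qed

lemma small_heat_drift:
  assumes "t > 0" shows "small t (\<lambda>x. Cx (heat_drift B b \<mu> t x)) (gauss_const 0 \<mu>)"
proof -
  have "small t (ift (smb0 t)) (1 * gauss_const 0 \<mu>)"
    by (rule small_ift_gauss(2)[OF _ assms \<mu>0]) (use assms in \<open>auto simp: cmod_smb exp_sqrt\<close>)
  then show ?thesis by (simp add: heat_drift_eq[OF assms])
qed

text \<open>Self-similarity of the drifting heat kernel: its k-th derivative is a fixed profile in
  the moving variable (x - V t)/sqrt t, and every derivative costs a factor t^(-1/2).\<close>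

lemma ift_xi_smb0:
  assumes t: "t > 0"
  shows "ift (\<lambda>\<xi>. (\<i> * Cx \<xi>) ^ k * smb0 t \<xi>) x = Cx (t powr (- (real k / 2)) * t powr (- (1/2))) * ift (gk k) ((x - V * t) / sqrt t)"
proof -
  have "(\<i> * Cx \<xi>) ^ k * smb0 t \<xi> = Cx (t powr (- (real k / 2))) * (gk k (sqrt t * \<xi>) * iexp (- (V * t * \<xi>)))" for \<xi>
  proof -
    have "t powr (- (real k / 2)) * (sqrt t) ^ k = 1"
    proof -
      have "(sqrt t) ^ k = (t powr (1/2)) powr real k" using t by (simp add: powr_half_sqrt powr_realpow)
      also have "\<dots> = t powr (real k / 2)" by (simp add: powr_powr)
      finally show ?thesis using t by (simp flip: powr_add)
    qed
    then have c: "Cx (t powr (- (real k / 2))) * Cx (sqrt t) ^ k = 1" by (simp flip: of_real_power of_real_mult)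
    have "gk k (sqrt t * \<xi>) = Cx (sqrt t) ^ k * ((\<i> * Cx \<xi>) ^ k * Cx (gauss (\<mu> * t) \<xi>))"
      unfolding gk_def using t by (simp add: power_mult_distrib mult_ac)
    then have "Cx (t powr (- (real k / 2))) * (gk k (sqrt t * \<xi>) * iexp (- (V * t * \<xi>))) =
      (Cx (t powr (- (real k / 2))) * Cx (sqrt t) ^ k) * ((\<i> * Cx \<xi>) ^ k * smb0 t \<xi>)"
      unfolding smb0_def by (simp only: mult_ac)
    then show ?thesis unfolding c by simp
  qed
  then show ?thesis using ift_scale[OF t, of "gk k" "V * t" x] by (simp add: ift_cmult)
qed

end

text \<open>Power counting for symbols with Gaussian decay: each factor |\<xi>| is worth t^(-1/2),
  whatever the powers of t in front.\<close>

lemma small_ift_rate_gen: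
  assumes g [measurable]: "g \<in> borel_measurable borel" and t: "t > 0" and C: "C \<ge> 0" and c: "c > 0"
    and le: "\<And>\<xi>. cmod (g \<xi>) \<le> C * t powr e * \<bar>\<xi>\<bar> ^ k * gauss (c * t) \<xi>"
  shows "integrable lborel g \<and> small t (ift g) (C * gauss_const k c * t powr (e - real k / 2))"
proof -
  have C': "0 \<le> C * t powr (e - real k / 2)" using C by simp
  have le': "cmod (g \<xi>) \<le> C * t powr (e - real k / 2) * (\<bar>sqrt t * \<xi>\<bar> ^ k * gauss c (sqrt t * \<xi>))" for \<xi>
  proof -
    have s: "(sqrt t) ^ k = t powr (real k / 2)"
    proof -
      have "(sqrt t) ^ k = (t powr (1/2)) powr real k" using t by (simp add: powr_half_sqrt powr_realpow)
      then show ?thesis by (simp add: powr_powr)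
    qed
    have "\<bar>sqrt t * \<xi>\<bar> ^ k = t powr (real k / 2) * \<bar>\<xi>\<bar> ^ k" using t s by (simp add: abs_mult power_mult_distrib)
    then have "C * t powr (e - real k / 2) * (\<bar>sqrt t * \<xi>\<bar> ^ k * gauss c (sqrt t * \<xi>))
      = C * (t powr (e - real k / 2) * t powr (real k / 2)) * \<bar>\<xi>\<bar> ^ k * gauss c (sqrt t * \<xi>)" by (simp only: mult_ac)
    also have "t powr (e - real k / 2) * t powr (real k / 2) = t powr e" by (simp flip: powr_add)
    finally have eq: "C * t powr (e - real k / 2) * (\<bar>sqrt t * \<xi>\<bar> ^ k * gauss c (sqrt t * \<xi>)) = C * t powr e * \<bar>\<xi>\<bar> ^ k * gauss c (sqrt t * \<xi>)" .
    have "(sqrt t * \<xi>)\<^sup>2 = t * \<xi>\<^sup>2" using t by (simp add: power_mult_distrib)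
    then show ?thesis using le[of \<xi>] unfolding eq by (simp only: mult.assoc)
  qed
  from small_ift_gauss[OF g t c C' le'] show ?thesis by (simp only: mult_ac)
qed

section \<open>Low-frequency expansion of the initial data and of the linear evolution\<close>

locale initial_data = params +
  fixes u\<^sub>0 :: "real \<Rightarrow> real"
  assumes u0: "integrable lborel u\<^sub>0" and xu0: "integrable lborel (\<lambda>x. x * u\<^sub>0 x)"
begin

definition "uh \<xi> = (LBINT y. iexp (- (\<xi> * y)) * Cx (u\<^sub>0 y))"
definition "m1 = (LBINT y. \<bar>y * u\<^sub>0 y\<bar>)"
abbreviation "M \<equiv> mass u\<^sub>0"
abbreviation "mm \<equiv> moment u\<^sub>0"
definition "rem \<xi> = uh \<xi> - Cx M + \<i> * Cx (\<xi> * mm)"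

lemma u0_measurable [measurable]: "u\<^sub>0 \<in> borel_measurable borel" using u0 by auto

lemma m1_nonneg: "m1 \<ge> 0" unfolding m1_def by (intro integral_nonneg_AE) auto

lemma uh_measurable [measurable]: "uh \<in> borel_measurable borel"
proof -
  have "(\<lambda>x. LBINT y. iexp (x * y) * Cx (u\<^sub>0 y)) \<in> borel_measurable borel" by (rule fourier_measurable) measurable
  then have "(\<lambda>\<xi>. LBINT y. iexp ((- \<xi>) * y) * Cx (u\<^sub>0 y)) \<in> borel_measurable borel"
    by (rule measurable_compose[rotated]) measurable
  then show ?thesis unfolding uh_def[abs_def] by simp
qed

lemma rem_measurable [measurable]: "rem \<in> borel_measurable borel"
  unfolding rem_def[abs_def] by measurable

lemma i_u0: "integrable lborel (\<lambda>y. Cx (u\<^sub>0 y))" using u0 by simp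
lemma i_iu: "integrable lborel (\<lambda>y. iexp (- (\<xi> * y)) * Cx (u\<^sub>0 y))"
  by (rule integrable_iexp_mult[OF i_u0]) simp

lemma uh_M: "uh \<xi> - Cx M = (LBINT y. (iexp (- (\<xi> * y)) - 1) * Cx (u\<^sub>0 y))"
proof -
  have "Cx M = (LBINT y. Cx (u\<^sub>0 y))" by (simp add: mass_def)
  then show ?thesis unfolding uh_def left_diff_distrib mult_1 using Bochner_Integration.integral_diff[OF i_iu i_u0, of \<xi>] by simp
qed

lemma uh_M_le: "cmod (uh \<xi> - Cx M) \<le> \<bar>\<xi>\<bar> * m1"
proof -
  have "cmod (uh \<xi> - Cx M) \<le> (LBINT y. \<bar>\<xi>\<bar> * \<bar>y * u\<^sub>0 y\<bar>)"
    unfolding uh_M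
  proof (rule Bochner_Integration.integral_norm_bound_integral)
    show "integrable lborel (\<lambda>y. (iexp (- (\<xi> * y)) - 1) * Cx (u\<^sub>0 y))"
      unfolding left_diff_distrib mult_1 by (intro Bochner_Integration.integrable_diff i_iu i_u0)
    show "integrable lborel (\<lambda>y. \<bar>\<xi>\<bar> * \<bar>y * u\<^sub>0 y\<bar>)" using xu0 by (intro integrable_mult_right integrable_abs)
    fix y
    have "cmod (iexp (- (\<xi> * y)) - 1) \<le> \<bar>\<xi> * y\<bar>" using iexp_approx1[of "- (\<xi> * y)" 0] by simp
    then have "cmod (iexp (- (\<xi> * y)) - 1) * \<bar>u\<^sub>0 y\<bar> \<le> \<bar>\<xi> * y\<bar> * \<bar>u\<^sub>0 y\<bar>" by (rule mult_right_mono) simp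
    then show "cmod ((iexp (- (\<xi> * y)) - 1) * Cx (u\<^sub>0 y)) \<le> \<bar>\<xi>\<bar> * \<bar>y * u\<^sub>0 y\<bar>"
      by (simp add: norm_mult abs_mult mult.assoc)
  qed
  also have "\<dots> = \<bar>\<xi>\<bar> * m1" unfolding m1_def by (rule integral_mult_right_zero)
  finally show ?thesis .
qed

lemma rem_le: "cmod (rem \<xi>) \<le> 2 * m1 * \<bar>\<xi>\<bar>"
proof -
  have "\<bar>mm\<bar> \<le> m1" unfolding moment_def m1_def using integral_norm_bound[of lborel "\<lambda>x. x * u\<^sub>0 x"] by simp
  then have "\<bar>\<xi>\<bar> * \<bar>mm\<bar> \<le> \<bar>\<xi>\<bar> * m1" by (rule mult_left_mono) simp
  then have "cmod (\<i> * Cx (\<xi> * mm)) \<le> \<bar>\<xi>\<bar> * m1" by (simp add: norm_mult abs_mult)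
  then have "cmod (rem \<xi>) \<le> \<bar>\<xi>\<bar> * m1 + \<bar>\<xi>\<bar> * m1"
    unfolding rem_def by (rule order_trans[OF norm_triangle_ineq add_mono[OF uh_M_le]])
  then show ?thesis by (simp add: mult_ac)
qed

text \<open>With only one finite moment the Taylor remainder of \<open>uh\<close> is o(\<xi>) and
  has no rate; this is one source of the o(1) in the final result. The second-order Taylor bound
  gives pointwise convergence in y, and the integrable function 2 |\<zeta>| |y u_0(y)|
  dominates.\<close>

lemma rem_limit:
  assumes X: "filterlim X at_top sequentially"
  shows "(\<lambda>n. Cx (sqrt (X n)) * rem (\<zeta> / sqrt (X n))) \<longlonglongrightarrow> 0"
proof -
  let ?h = "\<lambda>n y. Cx (sqrt (X n)) * (iexp (- (\<zeta> / sqrt (X n) * y)) - 1 + \<i> * Cx (\<zeta> / sqrt (X n) * y)) * Cx (u\<^sub>0 y)"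
  have pos: "\<forall>\<^sub>F n in sequentially. X n > 0" using X by (simp add: filterlim_at_top_dense)
  have eq: "Cx s * rem (\<zeta> / s) = (LBINT y. Cx s * (iexp (- (\<zeta> / s * y)) - 1 + \<i> * Cx (\<zeta> / s * y)) * Cx (u\<^sub>0 y))" for s
  proof -
    have i: "integrable lborel (\<lambda>y. \<i> * Cx (\<zeta> / s) * Cx (y * u\<^sub>0 y))"
      using xu0 by (intro integrable_mult_right integrable_of_real)
    have j: "integrable lborel (\<lambda>y. (iexp (- (\<zeta> / s * y)) - 1) * Cx (u\<^sub>0 y))"
      unfolding left_diff_distrib mult_1 by (intro Bochner_Integration.integrable_diff i_iu i_u0)
    have "\<i> * Cx (\<zeta> / s * mm) = (LBINT y. \<i> * Cx (\<zeta> / s) * Cx (y * u\<^sub>0 y))"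
      unfolding integral_mult_right_zero integral_complex_of_real moment_def by (simp only: of_real_mult mult.assoc)
    then have "rem (\<zeta> / s) = (LBINT y. (iexp (- (\<zeta> / s * y)) - 1) * Cx (u\<^sub>0 y) + \<i> * Cx (\<zeta> / s) * Cx (y * u\<^sub>0 y))"
      unfolding rem_def uh_M Bochner_Integration.integral_add[OF j i] by (simp only:)
    also have "\<dots> = (LBINT y. (iexp (- (\<zeta> / s * y)) - 1 + \<i> * Cx (\<zeta> / s * y)) * Cx (u\<^sub>0 y))"
      by (intro Bochner_Integration.integral_cong refl) (simp only: distrib_right of_real_mult mult.assoc)
    finally show ?thesis by (simp only: mult.assoc integral_mult_right_zero)
  qed
  have "(\<lambda>n. LBINT y. ?h n y) \<longlonglongrightarrow> (LBINT y::real. 0)"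
  proof (rule integral_dominated_convergence[where w = "\<lambda>y. 2 * \<bar>\<zeta>\<bar> * \<bar>y * u\<^sub>0 y\<bar>"])
    show "integrable lborel (\<lambda>y. 2 * \<bar>\<zeta>\<bar> * \<bar>y * u\<^sub>0 y\<bar>)" using xu0 by (intro integrable_mult_right integrable_abs)
    show "AE y in lborel. (\<lambda>n. ?h n y) \<longlonglongrightarrow> 0"
    proof (rule AE_I2)
      fix y
      have "(\<lambda>n. (\<zeta> * y)\<^sup>2 * \<bar>u\<^sub>0 y\<bar> * inverse (sqrt (X n))) \<longlonglongrightarrow> (\<zeta> * y)\<^sup>2 * \<bar>u\<^sub>0 y\<bar> * 0"
        by (intro tendsto_intros tendsto_inverse_0_at_top filterlim_compose[OF sqrt_at_top X])
      then have lim: "(\<lambda>n. (\<zeta> * y)\<^sup>2 * \<bar>u\<^sub>0 y\<bar> * inverse (sqrt (X n))) \<longlonglongrightarrow> 0" by simp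
      show "(\<lambda>n. ?h n y) \<longlonglongrightarrow> 0"
      proof (rule Lim_null_comparison[OF _ lim])
        show "\<forall>\<^sub>F n in sequentially. norm (?h n y) \<le> (\<zeta> * y)\<^sup>2 * \<bar>u\<^sub>0 y\<bar> * inverse (sqrt (X n))"
          using pos
        proof eventually_elim
          case (elim n)
          define s where "s = sqrt (X n)"
          have s: "s > 0" using elim by (simp add: s_def)
          define \<theta> where "\<theta> = - (\<zeta> / s * y)"
          have "cmod (iexp \<theta> - (1 + \<i> * Cx \<theta>)) \<le> \<theta>\<^sup>2 / 2"
            using iexp_approx1[of \<theta> 1] by (simp add: numeral_2_eq_2)
          also have "\<dots> \<le> \<theta>\<^sup>2" by simp
          also have "iexp \<theta> - (1 + \<i> * Cx \<theta>) = iexp \<theta> - 1 + \<i> * Cx (\<zeta> / s * y)"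
          proof -
            have "E - (1 + \<i> * (- Z)) = E - 1 + \<i> * Z" for E Z :: complex by simp
            then show ?thesis unfolding \<theta>_def of_real_minus .
          qed
          finally have t: "cmod (iexp \<theta> - 1 + \<i> * Cx (\<zeta> / s * y)) \<le> \<theta>\<^sup>2" .
          have "norm (?h n y) = s * cmod (iexp \<theta> - 1 + \<i> * Cx (\<zeta> / s * y)) * \<bar>u\<^sub>0 y\<bar>"
            unfolding s_def[symmetric] \<theta>_def norm_mult norm_of_real using s by simp
          also have "\<dots> \<le> s * \<theta>\<^sup>2 * \<bar>u\<^sub>0 y\<bar>" using s t by (intro mult_right_mono mult_left_mono) auto
          also have "s * \<theta>\<^sup>2 * \<bar>u\<^sub>0 y\<bar> = (\<zeta> * y)\<^sup>2 * \<bar>u\<^sub>0 y\<bar> * inverse s"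
            using s by (simp add: \<theta>_def power2_eq_square divide_inverse)
          finally show ?case unfolding s_def .
        qed
      qed
    qed
    show "AE y in lborel. norm (?h n y) \<le> 2 * \<bar>\<zeta>\<bar> * \<bar>y * u\<^sub>0 y\<bar>" for n
    proof (rule AE_I2)
      fix y
      \<comment> \<open>The majorant must hold for every n, also before X n becomes positive: a
        negative root is covered by the absolute value, and for s = 0 the integrand vanishes because
        of its factor s.\<close>
      define s where "s = sqrt (X n)"
      show "norm (?h n y) \<le> 2 * \<bar>\<zeta>\<bar> * \<bar>y * u\<^sub>0 y\<bar>"
      proof (cases "s = 0")
        case False
        have "cmod (iexp (- (\<zeta> / s * y)) - 1 + \<i> * Cx (\<zeta> / s * y)) \<le> \<bar>\<zeta> / s * y\<bar> + \<bar>\<zeta> / s * y\<bar>"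
        proof (rule order_trans[OF norm_triangle_ineq add_mono])
          show "cmod (iexp (- (\<zeta> / s * y)) - 1) \<le> \<bar>\<zeta> / s * y\<bar>" using iexp_approx1[of "- (\<zeta> / s * y)" 0] by simp
          show "cmod (\<i> * Cx (\<zeta> / s * y)) \<le> \<bar>\<zeta> / s * y\<bar>" by (simp only: norm_mult norm_ii norm_of_real mult_1)
        qed
        then have "\<bar>s\<bar> * cmod (iexp (- (\<zeta> / s * y)) - 1 + \<i> * Cx (\<zeta> / s * y)) * \<bar>u\<^sub>0 y\<bar> \<le> \<bar>s\<bar> * (\<bar>\<zeta> / s * y\<bar> + \<bar>\<zeta> / s * y\<bar>) * \<bar>u\<^sub>0 y\<bar>"
          by (intro mult_right_mono mult_left_mono) auto
        also have "\<dots> = 2 * \<bar>\<zeta>\<bar> * \<bar>y * u\<^sub>0 y\<bar>" using False by (simp add: abs_mult abs_divide)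
        finally show ?thesis unfolding s_def[symmetric] norm_mult norm_of_real .
      qed (simp add: s_def)
    qed
  qed measurable
  then show ?thesis unfolding eq by simp
qed

lemma conv_T: "t > 0 \<Longrightarrow> conv (kernel_T B b \<mu> t) (\<lambda>y. Cx (u\<^sub>0 y)) x = ift (\<lambda>\<xi>. smb t \<xi> * uh \<xi>) x"
  unfolding kernel_T_eq uh_def by (rule conv_ift[OF smb_integrable(1) i_u0])

lemma uh_le: "cmod (uh \<xi>) \<le> (LBINT y. \<bar>u\<^sub>0 y\<bar>)"
  unfolding uh_def using integral_norm_bound[of lborel "\<lambda>y. iexp (- (\<xi> * y)) * Cx (u\<^sub>0 y)"] by (simp add: norm_mult)

lemma smb_uh_integrable:
  assumes "t > 0" shows "integrable lborel (\<lambda>\<xi>. smb t \<xi> * uh \<xi>)"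
proof (rule Bochner_Integration.integrable_bound[OF integrable_mult_right[OF integrable_norm[OF smb_integrable(1)[OF assms]], of "LBINT y. \<bar>u\<^sub>0 y\<bar>"]])
  show "AE \<xi> in lborel. norm (smb t \<xi> * uh \<xi>) \<le> norm ((LBINT y. \<bar>u\<^sub>0 y\<bar>) * norm (smb t \<xi>))"
  proof (rule AE_I2)
    fix \<xi>
    have "cmod (uh \<xi>) * cmod (smb t \<xi>) \<le> (LBINT y. \<bar>u\<^sub>0 y\<bar>) * cmod (smb t \<xi>)" by (intro mult_right_mono uh_le) simp
    moreover have "0 \<le> (LBINT y. \<bar>u\<^sub>0 y\<bar>)" by (intro integral_nonneg_AE) auto
    ultimately show "norm (smb t \<xi> * uh \<xi>) \<le> norm ((LBINT y. \<bar>u\<^sub>0 y\<bar>) * norm (smb t \<xi>))"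
      by (simp add: norm_mult mult.commute)
  qed
qed measurable

lemmas small_ift_rate = small_ift_rate_gen[OF _ _ _ \<mu>0]

text \<open>Replacing the transform of the data by M costs a factor |\<xi>|, and replacing the phase
  by the drift costs t |\<xi>|^3; both are worth t^(-1/2).\<close>

lemma linear_zero_order:
  "\<exists>C\<ge>0. \<forall>t>0. small t (\<lambda>x. ift (\<lambda>\<xi>. smb t \<xi> * uh \<xi>) x - Cx M * ift (smb0 t) x) (C * t powr (- (1/2)))"
proof (intro exI[of _ "m1 * gauss_const 1 \<mu> + \<bar>M\<bar> * W * gauss_const 3 \<mu>"] conjI allI impI)
  show "0 \<le> m1 * gauss_const 1 \<mu> + \<bar>M\<bar> * W * gauss_const 3 \<mu>"
    using W0 by (intro add_nonneg_nonneg mult_nonneg_nonneg gauss_const_nonneg m1_nonneg) auto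
  fix t :: real assume t: "t > 0"
  let ?g1 = "\<lambda>\<xi>. smb t \<xi> * (uh \<xi> - Cx M)" and ?g2 = "\<lambda>\<xi>. Cx M * (smb t \<xi> - smb0 t \<xi>)"
  have 1: "integrable lborel ?g1 \<and> small t (ift ?g1) (m1 * gauss_const 1 \<mu> * t powr (0 - real 1 / 2))"
  proof (rule small_ift_rate[OF _ t m1_nonneg])
    fix \<xi>
    have "cmod (?g1 \<xi>) \<le> gauss (\<mu> * t) \<xi> * (\<bar>\<xi>\<bar> * m1)" unfolding norm_mult cmod_smb by (intro mult_left_mono uh_M_le) simp
    then show "cmod (?g1 \<xi>) \<le> m1 * t powr 0 * \<bar>\<xi>\<bar> ^ 1 * gauss (\<mu> * t) \<xi>" using t by (simp add: mult_ac)
  qed measurable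
  have 2: "integrable lborel ?g2 \<and> small t (ift ?g2) ((\<bar>M\<bar> * W) * gauss_const 3 \<mu> * t powr (1 - real 3 / 2))"
  proof (rule small_ift_rate[OF _ t])
    show "0 \<le> \<bar>M\<bar> * W" using W0 by simp
    fix \<xi>
    have "cmod (?g2 \<xi>) \<le> \<bar>M\<bar> * (gauss (\<mu> * t) \<xi> * (t * (W * \<bar>\<xi>\<bar> ^ 3)))"
      unfolding norm_mult norm_of_real using t by (intro mult_left_mono smb_diff_le) auto
    then show "cmod (?g2 \<xi>) \<le> \<bar>M\<bar> * W * t powr 1 * \<bar>\<xi>\<bar> ^ 3 * gauss (\<mu> * t) \<xi>" using t by (simp add: mult_ac)
  qed measurable
  have i1: "integrable lborel (\<lambda>\<xi>. Cx M * smb t \<xi>)" "integrable lborel (\<lambda>\<xi>. Cx M * smb0 t \<xi>)"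
    by (intro integrable_mult_right smb_integrable t)+
  have "ift ?g1 x + ift ?g2 x = ift (\<lambda>\<xi>. smb t \<xi> * uh \<xi>) x - Cx M * ift (smb0 t) x" for x
  proof -
    have "ift ?g1 x = ift (\<lambda>\<xi>. smb t \<xi> * uh \<xi>) x - ift (\<lambda>\<xi>. Cx M * smb t \<xi>) x"
      using ift_diff[OF smb_uh_integrable[OF t] i1(1), of x] by (simp only: right_diff_distrib mult.commute)
    moreover have "ift ?g2 x = ift (\<lambda>\<xi>. Cx M * smb t \<xi>) x - ift (\<lambda>\<xi>. Cx M * smb0 t \<xi>) x"
      using ift_diff[OF i1, of x] by (simp only: right_diff_distrib)
    ultimately show ?thesis by (simp add: ift_cmult)
  qed
  then show "small t (\<lambda>x. ift (\<lambda>\<xi>. smb t \<xi> * uh \<xi>) x - Cx M * ift (smb0 t) x) ((m1 * gauss_const 1 \<mu> + \<bar>M\<bar> * W * gauss_const 3 \<mu>) * t powr (- (1/2)))"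
    using small_add[OF 1[THEN conjunct2] 2[THEN conjunct2]] by (simp add: distrib_right)
qed

text \<open>What remains of the linear evolution after its terms of relative size t^(-1/2) are
  removed. Expanding \<open>uh \<xi>\<close> as M - i m \<xi> and the phase factor as 1 + i t W
  \<xi>^3, with i \<xi>^3 = -(i \<xi>)^3, produces -m and -M W t in front of the first and third
  derivatives; they are added back here.\<close>

definition "lin_rem t x = ift (\<lambda>\<xi>. smb t \<xi> * uh \<xi>) x - Cx M * ift (smb0 t) x
    + Cx mm * ift (\<lambda>\<xi>. (\<i> * Cx \<xi>) ^ 1 * smb0 t \<xi>) x
    + Cx (M * W * t) * ift (\<lambda>\<xi>. (\<i> * Cx \<xi>) ^ 3 * smb0 t \<xi>) x"

text \<open>The expression in brackets is the \<open>small_ift\<close> constant of the symbol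
  \<open>rem\<close>, seen at frequencies \<zeta>/sqrt t; the claim is that it is o(t^(-1/2)).
  Multiplied by sqrt t, the integrands tend to 0 by \<open>rem_limit\<close> and stay below a
  multiple of |\<zeta>| times a Gaussian.\<close>

lemma rem_integral_limit:
  "((\<lambda>t. sqrt t * ((LBINT \<zeta>. cmod (rem (\<zeta> / sqrt t)) * gauss \<mu> \<zeta>) + sqrt (LBINT \<zeta>. (cmod (rem (\<zeta> / sqrt t)) * gauss \<mu> \<zeta>)\<^sup>2))) \<longlongrightarrow> 0) at_top"
proof (rule tendsto_at_topI_sequentially)
  fix X :: "nat \<Rightarrow> real" assume X: "filterlim X at_top sequentially"
  define h where "h n \<zeta> = cmod (Cx (sqrt (X n)) * rem (\<zeta> / sqrt (X n))) * gauss \<mu> \<zeta>" for n \<zeta>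
  have pos: "\<forall>\<^sub>F n in sequentially. X n > 0" using X by (simp add: filterlim_at_top_dense)
  have lim0: "(\<lambda>n. h n \<zeta>) \<longlonglongrightarrow> 0" for \<zeta>
    unfolding h_def using tendsto_mult_left_zero[OF tendsto_norm_zero[OF rem_limit[OF X]]] .
  have hb: "\<bar>h n \<zeta>\<bar> \<le> 2 * m1 * (\<bar>\<zeta>\<bar> ^ 1 * gauss \<mu> \<zeta>)" for n \<zeta>
  proof (cases "sqrt (X n) = 0")
    case True
    then show ?thesis using m1_nonneg by (simp add: h_def)
  next
    case False
    have "\<bar>sqrt (X n)\<bar> * cmod (rem (\<zeta> / sqrt (X n))) \<le> \<bar>sqrt (X n)\<bar> * (2 * m1 * \<bar>\<zeta> / sqrt (X n)\<bar>)"
      by (intro mult_left_mono rem_le) simp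
    also have "\<dots> = 2 * m1 * \<bar>\<zeta>\<bar>" using False by (simp add: abs_divide)
    finally have "\<bar>sqrt (X n)\<bar> * cmod (rem (\<zeta> / sqrt (X n))) * gauss \<mu> \<zeta> \<le> 2 * m1 * \<bar>\<zeta>\<bar> * gauss \<mu> \<zeta>" by (rule mult_right_mono) simp
    then show ?thesis by (simp add: h_def norm_mult abs_mult mult.assoc)
  qed
  have [measurable]: "h n \<in> borel_measurable borel" for n unfolding h_def[abs_def] by measurable
  have l1: "(\<lambda>n. LBINT \<zeta>. h n \<zeta>) \<longlonglongrightarrow> (LBINT \<zeta>::real. 0)"
  proof (rule integral_dominated_convergence[where w = "\<lambda>\<zeta>. 2 * m1 * (\<bar>\<zeta>\<bar> ^ 1 * gauss \<mu> \<zeta>)"])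
    show "integrable lborel (\<lambda>\<zeta>. 2 * m1 * (\<bar>\<zeta>\<bar> ^ 1 * gauss \<mu> \<zeta>))" by (intro integrable_mult_right integrable_abs_pow_gauss \<mu>0)
  qed (use lim0 hb in auto)
  have l2: "(\<lambda>n. LBINT \<zeta>. (h n \<zeta>)\<^sup>2) \<longlonglongrightarrow> (LBINT \<zeta>::real. 0)"
  proof (rule integral_dominated_convergence[where w = "\<lambda>\<zeta>. (2 * m1)\<^sup>2 * (\<bar>\<zeta>\<bar> ^ 1 * gauss \<mu> \<zeta>)\<^sup>2"])
    show "integrable lborel (\<lambda>\<zeta>. (2 * m1)\<^sup>2 * (\<bar>\<zeta>\<bar> ^ 1 * gauss \<mu> \<zeta>)\<^sup>2)" by (intro integrable_mult_right integrable_abs_pow_gauss_sq \<mu>0)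
    show "AE \<zeta> in lborel. (\<lambda>n. (h n \<zeta>)\<^sup>2) \<longlonglongrightarrow> 0" using tendsto_power[OF lim0, of _ 2] by simp
    show "AE \<zeta> in lborel. norm ((h n \<zeta>)\<^sup>2) \<le> (2 * m1)\<^sup>2 * (\<bar>\<zeta>\<bar> ^ 1 * gauss \<mu> \<zeta>)\<^sup>2" for n
    proof (rule AE_I2)
      fix \<zeta>
      have "\<bar>h n \<zeta>\<bar>\<^sup>2 \<le> (2 * m1 * (\<bar>\<zeta>\<bar> ^ 1 * gauss \<mu> \<zeta>))\<^sup>2" by (intro power_mono hb) simp
      then show "norm ((h n \<zeta>)\<^sup>2) \<le> (2 * m1)\<^sup>2 * (\<bar>\<zeta>\<bar> ^ 1 * gauss \<mu> \<zeta>)\<^sup>2" by (simp add: power_mult_distrib)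
    qed
  qed measurable
  have l: "(\<lambda>n. (LBINT \<zeta>. h n \<zeta>) + sqrt (LBINT \<zeta>. (h n \<zeta>)\<^sup>2)) \<longlonglongrightarrow> 0"
    using tendsto_add[OF l1 tendsto_real_sqrt[OF l2]] by simp
  show "(\<lambda>n. sqrt (X n) * ((LBINT \<zeta>. cmod (rem (\<zeta> / sqrt (X n))) * gauss \<mu> \<zeta>) + sqrt (LBINT \<zeta>. (cmod (rem (\<zeta> / sqrt (X n))) * gauss \<mu> \<zeta>)\<^sup>2))) \<longlonglongrightarrow> 0"
  proof (rule Lim_transform_eventually[OF l])
    show "\<forall>\<^sub>F n in sequentially. (LBINT \<zeta>. h n \<zeta>) + sqrt (LBINT \<zeta>. (h n \<zeta>)\<^sup>2) = sqrt (X n) * ((LBINT \<zeta>. cmod (rem (\<zeta> / sqrt (X n))) * gauss \<mu> \<zeta>) + sqrt (LBINT \<zeta>. (cmod (rem (\<zeta> / sqrt (X n))) * gauss \<mu> \<zeta>)\<^sup>2))"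
      using pos
    proof eventually_elim
      case (elim n)
      define s where "s = sqrt (X n)"
      have s: "s > 0" using elim by (simp add: s_def)
      have h: "h n \<zeta> = s * (cmod (rem (\<zeta> / s)) * gauss \<mu> \<zeta>)" for \<zeta>
        unfolding h_def s_def[symmetric] norm_mult norm_of_real using s by simp
      show ?case unfolding s_def[symmetric] h power_mult_distrib[of s] integral_mult_right_zero real_sqrt_mult
        using s by (simp add: distrib_left)
    qed
  qed
qed

lemma linear_first_order:
  "\<exists>\<rho>. (\<forall>t\<ge>1. small t (lin_rem t) (\<rho> t)) \<and> ((\<lambda>t. \<rho> t / t powr (- (1/2))) \<longlongrightarrow> 0) at_top"
proof -
  define \<rho>0 where "\<rho>0 t = (LBINT \<zeta>. cmod (rem (\<zeta> / sqrt t)) * gauss \<mu> \<zeta>) + sqrt (LBINT \<zeta>. (cmod (rem (\<zeta> / sqrt t)) * gauss \<mu> \<zeta>)\<^sup>2)" for t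
  define C where "C = \<bar>M\<bar> * W\<^sup>2 * gauss_const 6 \<mu> + \<bar>M\<bar> * (W / b\<^sup>2) * gauss_const 5 \<mu> + W * m1 * gauss_const 4 \<mu>"
  have C0: "C \<ge> 0" unfolding C_def using W0 by (intro add_nonneg_nonneg mult_nonneg_nonneg gauss_const_nonneg m1_nonneg) auto
  have key: "small t (lin_rem t) (C * t powr (- 1) + \<rho>0 t)" if t1: "t \<ge> 1" for t
  proof -
    have t: "t > 0" using t1 by simp
    define \<phi> where "\<phi> \<xi> = t * (V * \<xi> - disp \<xi>)" for \<xi>
    have [measurable]: "\<phi> \<in> borel_measurable borel" unfolding \<phi>_def[abs_def] by measurable
    have s: "smb t \<xi> = smb0 t \<xi> * iexp (\<phi> \<xi>)" for \<xi>
    proof -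
      have "iexp (- (t * disp \<xi>)) = iexp (- (V * t * \<xi>)) * iexp (\<phi> \<xi>)" by (simp add: exp_add[symmetric] \<phi>_def algebra_simps)
      then show ?thesis unfolding smb_def smb0_def by (simp only: mult.assoc)
    qed
    have \<phi>le: "\<bar>\<phi> \<xi>\<bar> \<le> t * (W * \<bar>\<xi>\<bar> ^ 3)" for \<xi>
      unfolding \<phi>_def abs_mult using t disp_diff_le[of \<xi>] by (simp add: mult_left_mono)
    \<comment> \<open>The exact symbol error splits into the second-order remainder of the phase
      factor, the quintic error of the phase, the product of the phase error and the deviation of
      \<open>uh\<close> from M, and the Taylor remainder of \<open>uh\<close>. The first three are
      of order t^2 |\<xi>|^6, t |\<xi>|^5 and t |\<xi>|^4, hence t^(-1) or better; only the last is
      limited to o(t^(-1/2)).\<close>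
    let ?A = "\<lambda>\<xi>. smb0 t \<xi> * (Cx M * (iexp (\<phi> \<xi>) - (1 + \<i> * Cx (\<phi> \<xi>))))"
    let ?B = "\<lambda>\<xi>. smb0 t \<xi> * (Cx M * (\<i> * Cx (\<phi> \<xi> - t * (W * \<xi> ^ 3))))"
    let ?C = "\<lambda>\<xi>. smb0 t \<xi> * ((iexp (\<phi> \<xi>) - 1) * (uh \<xi> - Cx M))"
    let ?D = "\<lambda>\<xi>. smb0 t \<xi> * rem \<xi>"
    have A: "integrable lborel ?A \<and> small t (ift ?A) ((\<bar>M\<bar> * W\<^sup>2) * gauss_const 6 \<mu> * t powr (2 - real 6 / 2))"
    proof (rule small_ift_rate[OF _ t])
      show "0 \<le> \<bar>M\<bar> * W\<^sup>2" by simp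
      fix \<xi>
      have "cmod (iexp (\<phi> \<xi>) - (1 + \<i> * Cx (\<phi> \<xi>))) \<le> (\<phi> \<xi>)\<^sup>2 / 2"
        using iexp_approx1[of "\<phi> \<xi>" 1] by (simp add: numeral_2_eq_2)
      also have "\<dots> \<le> \<bar>\<phi> \<xi>\<bar>\<^sup>2" by simp
      also have "\<dots> \<le> (t * (W * \<bar>\<xi>\<bar> ^ 3))\<^sup>2" by (intro power_mono \<phi>le) simp
      also have "\<dots> = W\<^sup>2 * t powr 2 * \<bar>\<xi>\<bar> ^ 6" using t by (simp add: power_mult_distrib powr_numeral flip: power_mult)
      finally have "cmod (?A \<xi>) \<le> gauss (\<mu> * t) \<xi> * (\<bar>M\<bar> * (W\<^sup>2 * t powr 2 * \<bar>\<xi>\<bar> ^ 6))"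
        unfolding norm_mult cmod_smb norm_of_real by (intro mult_left_mono) auto
      also have "\<dots> = \<bar>M\<bar> * W\<^sup>2 * t powr 2 * \<bar>\<xi>\<bar> ^ 6 * gauss (\<mu> * t) \<xi>" by (simp only: mult_ac)
      finally show "cmod (?A \<xi>) \<le> \<bar>M\<bar> * W\<^sup>2 * t powr 2 * \<bar>\<xi>\<bar> ^ 6 * gauss (\<mu> * t) \<xi>" .
    qed measurable
    have Bs: "integrable lborel ?B \<and> small t (ift ?B) ((\<bar>M\<bar> * (W / b\<^sup>2)) * gauss_const 5 \<mu> * t powr (1 - real 5 / 2))"
    proof (rule small_ift_rate[OF _ t])
      show "0 \<le> \<bar>M\<bar> * (W / b\<^sup>2)" using W0 by simp
      fix \<xi>
      have "\<phi> \<xi> - t * (W * \<xi> ^ 3) = - (t * (W * \<xi> ^ 3 - (V * \<xi> - disp \<xi>)))" by (simp add: \<phi>_def algebra_simps)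
      then have "\<bar>\<phi> \<xi> - t * (W * \<xi> ^ 3)\<bar> = t * \<bar>W * \<xi> ^ 3 - (V * \<xi> - disp \<xi>)\<bar>" using t by (simp only: abs_minus_cancel abs_mult abs_of_pos)
      also have "\<dots> \<le> t * (W / b\<^sup>2 * \<bar>\<xi>\<bar> ^ 5)" using t by (intro mult_left_mono disp_diff3_le) simp
      finally have "cmod (?B \<xi>) \<le> gauss (\<mu> * t) \<xi> * (\<bar>M\<bar> * (1 * (t * (W / b\<^sup>2 * \<bar>\<xi>\<bar> ^ 5))))"
        unfolding norm_mult cmod_smb norm_of_real norm_ii by (intro mult_left_mono) auto
      also have "\<dots> = \<bar>M\<bar> * (W / b\<^sup>2) * t powr 1 * \<bar>\<xi>\<bar> ^ 5 * gauss (\<mu> * t) \<xi>" using t by simp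
      finally show "cmod (?B \<xi>) \<le> \<bar>M\<bar> * (W / b\<^sup>2) * t powr 1 * \<bar>\<xi>\<bar> ^ 5 * gauss (\<mu> * t) \<xi>" .
    qed measurable
    have Cs: "integrable lborel ?C \<and> small t (ift ?C) ((W * m1) * gauss_const 4 \<mu> * t powr (1 - real 4 / 2))"
    proof (rule small_ift_rate[OF _ t])
      show "0 \<le> W * m1" using W0 m1_nonneg by simp
      fix \<xi>
      have "cmod (iexp (\<phi> \<xi>) - 1) \<le> \<bar>\<phi> \<xi>\<bar>" using iexp_approx1[of "\<phi> \<xi>" 0] by simp
      then have "cmod (iexp (\<phi> \<xi>) - 1) \<le> t * (W * \<bar>\<xi>\<bar> ^ 3)" using \<phi>le[of \<xi>] by linarith
      then have "cmod (?C \<xi>) \<le> gauss (\<mu> * t) \<xi> * ((t * (W * \<bar>\<xi>\<bar> ^ 3)) * (\<bar>\<xi>\<bar> * m1))"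
        unfolding norm_mult cmod_smb using t W0 by (intro mult_left_mono mult_mono uh_M_le) auto
      also have "\<dots> = W * m1 * t powr 1 * \<bar>\<xi>\<bar> ^ 4 * gauss (\<mu> * t) \<xi>" using t by (simp add: eval_nat_numeral)
      finally show "cmod (?C \<xi>) \<le> W * m1 * t powr 1 * \<bar>\<xi>\<bar> ^ 4 * gauss (\<mu> * t) \<xi>" .
    qed measurable
    have bd: "cmod (rem (\<zeta> / sqrt t)) * gauss \<mu> \<zeta> \<le> 2 * m1 * (\<bar>\<zeta>\<bar> ^ 1 * gauss \<mu> \<zeta>)" for \<zeta>
    proof -
      have "\<bar>\<zeta> / sqrt t\<bar> \<le> \<bar>\<zeta>\<bar>"
      proof -
        have "\<bar>\<zeta>\<bar> * 1 \<le> \<bar>\<zeta>\<bar> * sqrt t" using t1 by (intro mult_left_mono) auto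
        then show ?thesis using t by (simp add: abs_divide divide_le_eq)
      qed
      then have "2 * m1 * \<bar>\<zeta> / sqrt t\<bar> \<le> 2 * m1 * \<bar>\<zeta>\<bar>" using m1_nonneg by (intro mult_left_mono) auto
      with rem_le[of "\<zeta> / sqrt t"] have "cmod (rem (\<zeta> / sqrt t)) \<le> 2 * m1 * \<bar>\<zeta>\<bar>" by (rule order_trans)
      then have "cmod (rem (\<zeta> / sqrt t)) * gauss \<mu> \<zeta> \<le> 2 * m1 * \<bar>\<zeta>\<bar> * gauss \<mu> \<zeta>" by (rule mult_right_mono) simp
      then show ?thesis by (simp add: mult.assoc)
    qed
    have I1: "integrable lborel (\<lambda>\<zeta>. cmod (rem (\<zeta> / sqrt t)) * gauss \<mu> \<zeta>)"
      by (rule Bochner_Integration.integrable_bound[OF integrable_mult_right[OF integrable_abs_pow_gauss[OF \<mu>0, of 1], of "2 * m1"]])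
        (use bd m1_nonneg in \<open>auto simp: abs_mult\<close>)
    have I2: "integrable lborel (\<lambda>\<zeta>. (cmod (rem (\<zeta> / sqrt t)) * gauss \<mu> \<zeta>)\<^sup>2)"
    proof (rule Bochner_Integration.integrable_bound[OF integrable_mult_right[OF integrable_abs_pow_gauss_sq[OF \<mu>0, of 1], of "(2 * m1)\<^sup>2"]])
      show "AE \<zeta> in lborel. norm ((cmod (rem (\<zeta> / sqrt t)) * gauss \<mu> \<zeta>)\<^sup>2) \<le> norm ((2 * m1)\<^sup>2 * (\<bar>\<zeta>\<bar> ^ 1 * gauss \<mu> \<zeta>)\<^sup>2)"
      proof (rule AE_I2)
        fix \<zeta>
        have "(cmod (rem (\<zeta> / sqrt t)) * gauss \<mu> \<zeta>)\<^sup>2 \<le> (2 * m1 * (\<bar>\<zeta>\<bar> ^ 1 * gauss \<mu> \<zeta>))\<^sup>2"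
          by (intro power_mono bd) auto
        then show "norm ((cmod (rem (\<zeta> / sqrt t)) * gauss \<mu> \<zeta>)\<^sup>2) \<le> norm ((2 * m1)\<^sup>2 * (\<bar>\<zeta>\<bar> ^ 1 * gauss \<mu> \<zeta>)\<^sup>2)"
          unfolding power_mult_distrib[of "2 * m1", symmetric] real_norm_def abs_power2 .
      qed
    qed measurable
    have Dle: "cmod (?D \<xi>) \<le> cmod (rem (sqrt t * \<xi> / sqrt t)) * gauss \<mu> (sqrt t * \<xi>)" for \<xi>
      using t by (simp add: norm_mult cmod_smb power_mult_distrib mult_ac)
    have Dd: "integrable lborel ?D" "small t (ift ?D) (\<rho>0 t)"
      using small_ift[OF _ t I1 I2 Dle] unfolding \<rho>0_def by auto
    have e: "lin_rem t x = ift ?A x + ift ?B x + ift ?C x + ift ?D x" for x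
    proof -
      have iA: "integrable lborel ?A" "integrable lborel ?B" "integrable lborel ?C" "integrable lborel ?D"
        using A Bs Cs Dd by auto
      have i1: "integrable lborel (\<lambda>\<xi>. Cx M * smb0 t \<xi>)" by (intro integrable_mult_right smb_integrable t)
      have ik: "integrable lborel (\<lambda>\<xi>. c * ((\<i> * Cx \<xi>) ^ k * smb0 t \<xi>))" for c k
        by (rule integrable_mult_right, rule small_ift_rate[of _ t 1 0 k, THEN conjunct1]) (use t in \<open>auto simp: norm_mult norm_power cmod_smb\<close>)
      have "ift ?A x + ift ?B x + ift ?C x + ift ?D x = ift (\<lambda>\<xi>. ?A \<xi> + ?B \<xi> + ?C \<xi> + ?D \<xi>) x"
        by (simp only: ift_add iA Bochner_Integration.integrable_add)
      also have "(\<lambda>\<xi>. ?A \<xi> + ?B \<xi> + ?C \<xi> + ?D \<xi>) = (\<lambda>\<xi>. smb t \<xi> * uh \<xi> - Cx M * smb0 t \<xi>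
          + Cx mm * ((\<i> * Cx \<xi>) ^ 1 * smb0 t \<xi>) + Cx (M * W * t) * ((\<i> * Cx \<xi>) ^ 3 * smb0 t \<xi>))"
      proof
        fix \<xi>
        have i3: "(\<i> * Cx \<xi>) ^ 3 = - \<i> * Cx (\<xi> ^ 3)"
        proof -
          have "\<i> ^ 3 = - \<i>" by (simp add: power3_eq_cube)
          then show ?thesis by (simp only: power_mult_distrib of_real_power)
        qed
        show "?A \<xi> + ?B \<xi> + ?C \<xi> + ?D \<xi> = smb t \<xi> * uh \<xi> - Cx M * smb0 t \<xi>
          + Cx mm * ((\<i> * Cx \<xi>) ^ 1 * smb0 t \<xi>) + Cx (M * W * t) * ((\<i> * Cx \<xi>) ^ 3 * smb0 t \<xi>)"
          unfolding s i3 rem_def by (simp add: algebra_simps)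
      qed
      also have "ift \<dots> x = lin_rem t x"
        unfolding lin_rem_def
        by (simp only: ift_add ift_diff ift_cmult ik i1 smb_uh_integrable[OF t] Bochner_Integration.integrable_add Bochner_Integration.integrable_diff)
      finally show ?thesis by simp
    qed
    have ee: "(2 - real 6 / 2) = - (1::real)" "(1 - real 4 / 2) = - (1::real)" by auto
    have le: "t powr (1 - real 5 / 2) \<le> t powr (- 1)" using t1 by (intro powr_mono) auto
    have "small t (ift ?B) ((\<bar>M\<bar> * (W / b\<^sup>2)) * gauss_const 5 \<mu> * t powr (- 1))"
      by (rule small_mono[OF Bs[THEN conjunct2]], rule mult_left_mono[OF le], intro mult_nonneg_nonneg gauss_const_nonneg) (use W0 in auto)
    from small_add[OF small_add[OF small_add[OF A[THEN conjunct2, unfolded ee] this] Cs[THEN conjunct2, unfolded ee]] Dd(2)]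
    show ?thesis unfolding e[abs_def] C_def distrib_right .
  qed
  show ?thesis
  proof (intro exI[of _ "\<lambda>t. C * t powr (- 1) + \<rho>0 t"] conjI allI impI key)
    have "((\<lambda>t. C * t powr (- (1/2)) + sqrt t * \<rho>0 t) \<longlongrightarrow> C * 0 + 0) at_top"
      using rem_integral_limit unfolding \<rho>0_def[symmetric]
      by (intro tendsto_add tendsto_mult_left tendsto_neg_powr filterlim_ident) auto
    then have l: "((\<lambda>t. C * t powr (- (1/2)) + sqrt t * \<rho>0 t) \<longlongrightarrow> 0) at_top" by simp
    show "((\<lambda>t. (C * t powr (- 1) + \<rho>0 t) / t powr (- (1/2))) \<longlongrightarrow> 0) at_top"
    proof (rule Lim_transform_eventually[OF l])
      show "\<forall>\<^sub>F t in at_top. C * t powr (- (1/2)) + sqrt t * \<rho>0 t = (C * t powr (- 1) + \<rho>0 t) / t powr (- (1/2))"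
        using eventually_gt_at_top[of 0]
      proof eventually_elim
        case (elim t)
        have "1 / t powr (- (1/2)) = sqrt t" using elim by (simp add: powr_minus powr_half_sqrt inverse_eq_divide)
        moreover have "t powr (- 1) / t powr (- (1/2)) = t powr (- (1/2))" by (subst powr_diff[symmetric]) simp
        moreover have "(C * t powr (- 1) + \<rho>0 t) / t powr (- (1/2)) = C * (t powr (- 1) / t powr (- (1/2))) + \<rho>0 t * (1 / t powr (- (1/2)))"
          by (simp add: add_divide_distrib)
        ultimately show ?case by (simp only: mult.commute)
      qed
    qed
  qed auto
qed

end

lemma powr_pred_mult:
  fixes x e :: real
  assumes "x \<ge> 0" shows "x powr (e - 1) * x = x powr e"
  using powr_mult_base[OF assms, of "e - 1"] by (simp add: mult.commute)

lemma abs_powr_diff_le: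
  fixes x y p :: real
  assumes "x \<ge> 0" "y \<ge> 0" "p \<ge> 1" "x \<le> m" "y \<le> m"
  shows "\<bar>x powr p - y powr p\<bar> \<le> p * m powr (p - 1) * \<bar>x - y\<bar>"
proof -
  have main: "\<bar>x powr p - y powr p\<bar> \<le> p * m powr (p - 1) * \<bar>x - y\<bar>" if "y < x" "0 \<le> y" "x \<le> m" for x y
  proof (cases "y = 0")
    case True
    have "x powr p = x powr (p - 1) * x" using that by (intro powr_pred_mult[symmetric]) auto
    also have "\<dots> \<le> m powr (p - 1) * x" using that assms by (intro mult_right_mono powr_mono2) auto
    also have "\<dots> \<le> p * (m powr (p - 1) * x)" using assms that mult_right_mono[of 1 p "m powr (p - 1) * x"] by simp
    finally show ?thesis using True that by (simp add: mult.assoc)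
  next
    case False
    then have y: "y > 0" using that by simp
    have "\<exists>z. y < z \<and> z < x \<and> x powr p - y powr p = (x - y) * (p * z powr (p - 1))"
      by (rule MVT2[OF that(1)]) (use y in \<open>auto intro!: derivative_eq_intros simp: powr_diff\<close>)
    then obtain z where z: "y < z" "z < x" "x powr p - y powr p = (x - y) * (p * z powr (p - 1))" by blast
    have "z powr (p - 1) \<le> m powr (p - 1)" using z y that assms by (intro powr_mono2) auto
    then have "(x - y) * (p * z powr (p - 1)) \<le> (x - y) * (p * m powr (p - 1))"
      using that assms by (intro mult_left_mono) auto
    moreover have "x powr p - y powr p \<ge> 0" using that assms by (simp add: powr_mono2)
    ultimately show ?thesis using z that by (simp add: mult_ac)
  qed
  consider "x = y" | "y < x" | "x < y" by linarith
  then show ?thesis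
  proof cases
    case 3
    then show ?thesis using main[of x y] assms by (simp add: abs_minus_commute)
  qed (use main[of y x] assms in auto)
qed

subsection \<open>The nonlinear term\<close>

lemma nonlin_eq: "nonlin p f x = sgn (f x) * \<bar>f x\<bar> powr p"
proof -
  have "\<bar>f x\<bar> powr p = \<bar>f x\<bar> powr (p - 1) * \<bar>f x\<bar>" by (rule powr_pred_mult[symmetric]) simp
  then show ?thesis by (simp add: nonlin_def mult_sgn_abs mult.left_commute[of "sgn (f x)"])
qed

text \<open>For equal signs this is the mean value bound for the power function. For opposite signs
  |f| + |g| = |f - g|, so it suffices to estimate the two values separately.\<close>

lemma nonlin_diff_le:
  assumes p: "p \<ge> 1" and m: "\<bar>f x\<bar> \<le> m" "\<bar>g x\<bar> \<le> m"
  shows "\<bar>nonlin p f x - nonlin p g x\<bar> \<le> p * m powr (p - 1) * \<bar>f x - g x\<bar>"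
proof -
  have *: "\<bar>nonlin p h x\<bar> \<le> m powr (p - 1) * \<bar>h x\<bar>" if "\<bar>h x\<bar> \<le> m" for h
    using that p by (auto simp: nonlin_def abs_mult intro!: mult_right_mono powr_mono2)
  consider "f x \<ge> 0" "g x \<ge> 0" | "f x \<le> 0" "g x \<le> 0" | "f x > 0" "g x < 0" | "f x < 0" "g x > 0" by linarith
  then show ?thesis
  proof cases
    case 1
    then have "nonlin p f x = f x powr p" "nonlin p g x = g x powr p" by (auto simp: nonlin_eq sgn_if)
    then show ?thesis using abs_powr_diff_le[of "f x" "g x" p m] 1 m p by simp
  next
    case 2
    then have "nonlin p f x = - ((- f x) powr p)" "nonlin p g x = - ((- g x) powr p)" by (auto simp: nonlin_eq sgn_if)
    then show ?thesis using abs_powr_diff_le[of "- f x" "- g x" p m] 2 m p by (simp add: abs_minus_commute)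
  next
    case 3
    have "\<bar>nonlin p f x - nonlin p g x\<bar> \<le> m powr (p - 1) * \<bar>f x\<bar> + m powr (p - 1) * \<bar>g x\<bar>"
      using *[of f] *[of g] m by linarith
    also have "\<dots> = m powr (p - 1) * \<bar>f x - g x\<bar>" using 3 by (simp add: algebra_simps)
    also have "\<dots> \<le> p * (m powr (p - 1) * \<bar>f x - g x\<bar>)" using p mult_right_mono[of 1 p "m powr (p - 1) * \<bar>f x - g x\<bar>"] by simp
    finally show ?thesis by (simp add: mult.assoc)
  next
    case 4
    have "\<bar>nonlin p f x - nonlin p g x\<bar> \<le> m powr (p - 1) * \<bar>f x\<bar> + m powr (p - 1) * \<bar>g x\<bar>"
      using *[of f] *[of g] m by linarith
    also have "\<dots> = m powr (p - 1) * \<bar>f x - g x\<bar>" using 4 by (simp add: algebra_simps)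
    also have "\<dots> \<le> p * (m powr (p - 1) * \<bar>f x - g x\<bar>)" using p mult_right_mono[of 1 p "m powr (p - 1) * \<bar>f x - g x\<bar>"] by simp
    finally show ?thesis by (simp add: mult.assoc)
  qed
qed

lemma nonlin_measurable [measurable]:
  "f \<in> borel_measurable N \<Longrightarrow> (\<lambda>x. nonlin p f x) \<in> borel_measurable N"
  unfolding nonlin_def by measurable

text \<open>The L^2 bound puts p - 1 factors into the supremum norm and R into L^2. For the L^1
  bound one factor f or g is kept outside and paired with R by Cauchy-Schwarz, which leaves p - 2
  factors in the supremum norm; keeping both f and g produces the factor 2. The resulting weights
  are those of \<open>forcing\<close>.\<close>

lemma nonlin_small_diff:
  fixes f g :: "real \<Rightarrow> real"
  assumes p: "p > 2" and s: "s > 0"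
    and f: "small s (\<lambda>x. Cx (f x)) k" and g: "small s (\<lambda>x. Cx (g x)) k"
    and fm [measurable]: "f \<in> borel_measurable borel" and gm [measurable]: "g \<in> borel_measurable borel"
    and R: "small s R d" and ae: "AE x in lborel. Cx (f x - g x) = R x"
  defines "A \<equiv> 2 * p * k powr (p - 1) * d * s powr (- ((p - 1) / 2))"
  shows "(NN x. cmod (Cx (nonlin p f x) - Cx (nonlin p g x))) \<le> ennreal A"
    and "L2sq (\<lambda>x. Cx (nonlin p f x) - Cx (nonlin p g x)) \<le> ennreal ((A * s powr (- (1/4)))\<^sup>2)"
proof -
  have k: "k \<ge> 0" and d: "d \<ge> 0" using f R by (auto simp: small_def)
  have [measurable]: "R \<in> borel_measurable borel" using R by (rule small_measurable)
  define m where "m = k * s powr (- (1/2))"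
  have m0: "m \<ge> 0" using k by (simp add: m_def)
  have fb: "\<bar>f x\<bar> \<le> m" and gb: "\<bar>g x\<bar> \<le> m" for x using f g by (auto simp: small_def m_def)
  have mp: "m powr e = k powr e * s powr (- (e / 2))" for e
    unfolding m_def using k s by (simp add: powr_mult powr_powr)
  define D where "D x = Cx (nonlin p f x) - Cx (nonlin p g x)" for x
  have Dm [measurable]: "D \<in> borel_measurable borel" unfolding D_def[abs_def] by measurable
  have L2: "AE x in lborel. cmod (D x) \<le> p * m powr (p - 1) * cmod (R x)"
    using ae
  proof eventually_elim
    case (elim x)
    have "cmod (D x) = \<bar>nonlin p f x - nonlin p g x\<bar>" unfolding D_def by (simp flip: of_real_diff)
    also have "\<dots> \<le> p * m powr (p - 1) * \<bar>f x - g x\<bar>" using p fb gb by (intro nonlin_diff_le) auto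
    also have "\<bar>f x - g x\<bar> = cmod (R x)" unfolding elim[symmetric] by (simp only: norm_of_real)
    finally show ?case .
  qed
  have L1: "AE x in lborel. cmod (D x) \<le> p * m powr (p - 2) * (cmod (Cx (f x)) * cmod (R x) + cmod (Cx (g x)) * cmod (R x))"
    using ae
  proof eventually_elim
    case (elim x)
    define \<nu> where "\<nu> = max \<bar>f x\<bar> \<bar>g x\<bar>"
    have \<nu>: "0 \<le> \<nu>" "\<nu> \<le> m" "\<nu> \<le> \<bar>f x\<bar> + \<bar>g x\<bar>" using fb gb by (auto simp: \<nu>_def)
    have "cmod (D x) = \<bar>nonlin p f x - nonlin p g x\<bar>" unfolding D_def by (simp flip: of_real_diff)
    also have "\<dots> \<le> p * \<nu> powr (p - 1) * \<bar>f x - g x\<bar>" using p by (intro nonlin_diff_le) (auto simp: \<nu>_def)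
    also have "\<nu> powr (p - 1) = \<nu> powr (p - 2) * \<nu>"
      using powr_pred_mult[OF \<nu>(1), of "p - 1"] by simp
    also have "p * (\<nu> powr (p - 2) * \<nu>) * \<bar>f x - g x\<bar> \<le> p * (m powr (p - 2) * (\<bar>f x\<bar> + \<bar>g x\<bar>)) * \<bar>f x - g x\<bar>"
      using \<nu> p m0 by (intro mult_right_mono mult_left_mono mult_mono powr_mono2) auto
    also have "\<bar>f x - g x\<bar> = cmod (R x)" unfolding elim[symmetric] by (simp only: norm_of_real)
    finally show ?case by (simp add: algebra_simps)
  qed
  have "L2sq D \<le> L2sq (\<lambda>x. Cx (p * m powr (p - 1)) * R x)"
  proof (rule nn_integral_mono_AE)
    show "AE x in lborel. ennreal ((cmod (D x))\<^sup>2) \<le> ennreal ((cmod (Cx (p * m powr (p - 1)) * R x))\<^sup>2)"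
      using L2
    proof eventually_elim
      case (elim x)
      then show ?case using p by (intro ennreal_leI power_mono) (auto simp: norm_mult abs_mult)
    qed
  qed
  also have "\<dots> = ennreal ((p * m powr (p - 1))\<^sup>2) * L2sq R" by (subst L2sq_cmult, measurable) (simp only: norm_of_real power2_abs)
  also have "\<dots> \<le> ennreal ((p * m powr (p - 1))\<^sup>2) * ennreal ((d * s powr (- (1/4)))\<^sup>2)"
    using R unfolding small_def small_sq by (intro mult_left_mono) auto
  also have "\<dots> = ennreal ((p * m powr (p - 1) * (d * s powr (- (1/4))))\<^sup>2)" by (simp add: ennreal_mult power_mult_distrib)
  also have "\<dots> \<le> ennreal ((A * s powr (- (1/4)))\<^sup>2)"
  proof (intro ennreal_leI power_mono)
    have "p * m powr (p - 1) * (d * s powr (- (1/4))) = p * k powr (p - 1) * d * s powr (- ((p - 1) / 2)) * s powr (- (1/4))"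
      unfolding mp by (simp only: mult_ac)
    also have "\<dots> \<le> 2 * p * k powr (p - 1) * d * s powr (- ((p - 1) / 2)) * s powr (- (1/4))"
      using p d by (intro mult_right_mono) auto
    finally show "p * m powr (p - 1) * (d * s powr (- (1/4))) \<le> A * s powr (- (1/4))" unfolding A_def .
    show "0 \<le> p * m powr (p - 1) * (d * s powr (- (1/4)))" using p d by simp
  qed
  finally show "L2sq (\<lambda>x. Cx (nonlin p f x) - Cx (nonlin p g x)) \<le> ennreal ((A * s powr (- (1/4)))\<^sup>2)"
    unfolding D_def .
  have b: "(NN x. cmod (Cx (h x)) * cmod (R x)) \<le> ennreal ((k * s powr (- (1/4))) * (d * s powr (- (1/4))))"
    if "small s (\<lambda>x. Cx (h x)) k" and [measurable]: "h \<in> borel_measurable borel" for h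
    using that R k d unfolding small_def small_sq by (intro nn_integral_mult_le_L2) auto
  have "(NN x. cmod (D x)) \<le> (\<integral>\<^sup>+ x. ennreal (p * m powr (p - 2)) * (ennreal (cmod (Cx (f x)) * cmod (R x)) + ennreal (cmod (Cx (g x)) * cmod (R x))) \<partial>lborel)"
  proof (rule nn_integral_mono_AE)
    show "AE x in lborel. ennreal (cmod (D x)) \<le> ennreal (p * m powr (p - 2)) * (ennreal (cmod (Cx (f x)) * cmod (R x)) + ennreal (cmod (Cx (g x)) * cmod (R x)))"
      using L1
    proof eventually_elim
      case (elim x)
      have "ennreal (p * m powr (p - 2)) * (ennreal (cmod (Cx (f x)) * cmod (R x)) + ennreal (cmod (Cx (g x)) * cmod (R x)))
        = ennreal (p * m powr (p - 2) * (cmod (Cx (f x)) * cmod (R x) + cmod (Cx (g x)) * cmod (R x)))"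
        using p by (subst ennreal_plus[symmetric], simp, simp, subst ennreal_mult[symmetric]) auto
      then show ?case using elim by (simp only: ennreal_leI)
    qed
  qed
  also have "\<dots> = ennreal (p * m powr (p - 2)) * ((NN x. cmod (Cx (f x)) * cmod (R x)) + (NN x. cmod (Cx (g x)) * cmod (R x)))"
    by (subst nn_integral_cmult, measurable, subst nn_integral_add, measurable)
  also have "\<dots> \<le> ennreal (p * m powr (p - 2)) * (ennreal ((k * s powr (- (1/4))) * (d * s powr (- (1/4)))) + ennreal ((k * s powr (- (1/4))) * (d * s powr (- (1/4)))))"
    by (intro mult_left_mono add_mono b f g fm gm) auto
  also have "\<dots> = ennreal (p * m powr (p - 2) * ((k * s powr (- (1/4))) * (d * s powr (- (1/4))) + (k * s powr (- (1/4))) * (d * s powr (- (1/4)))))"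
    using k d p by (subst ennreal_plus[symmetric], simp, simp, subst ennreal_mult[symmetric]) auto
  also have "p * m powr (p - 2) * ((k * s powr (- (1/4))) * (d * s powr (- (1/4))) + (k * s powr (- (1/4))) * (d * s powr (- (1/4)))) = A"
  proof -
    have s1: "s powr (- ((p - 2) / 2)) * (s powr (- (1/4)) * s powr (- (1/4))) = s powr (- ((p - 1) / 2))"
      unfolding powr_add[symmetric] by (rule arg_cong[where f = "\<lambda>e. s powr e"]) (simp add: field_simps)
    have k1: "k powr (p - 2) * k = k powr (p - 1)"
      using powr_pred_mult[OF k, of "p - 1"] by simp
    have "p * m powr (p - 2) * ((k * s powr (- (1/4))) * (d * s powr (- (1/4))) + (k * s powr (- (1/4))) * (d * s powr (- (1/4))))
      = 2 * p * (k powr (p - 2) * k) * d * (s powr (- ((p - 2) / 2)) * (s powr (- (1/4)) * s powr (- (1/4))))"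
      unfolding mp by (simp add: mult_ac)
    then show ?thesis unfolding s1 k1 A_def .
  qed
  finally show "(NN x. cmod (Cx (nonlin p f x) - Cx (nonlin p g x))) \<le> ennreal A"
    unfolding D_def .
qed

lemma small_zero: "small s (\<lambda>x. 0) 0"
  by (simp add: small_def)

lemma nonlin_small:
  fixes f :: "real \<Rightarrow> real"
  assumes p: "p > 2" and s: "s > 0"
    and f: "small s (\<lambda>x. Cx (f x)) k" and fm [measurable]: "f \<in> borel_measurable borel"
  defines "A \<equiv> 2 * p * k powr p * s powr (- ((p - 1) / 2))"
  shows "(NN x. cmod (Cx (nonlin p f x))) \<le> ennreal A"
    and "L2sq (\<lambda>x. Cx (nonlin p f x)) \<le> ennreal ((A * s powr (- (1/4)))\<^sup>2)"
proof -
  have k: "k \<ge> 0" using f by (rule small_nonneg)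
  have k1: "k powr (p - 1) * k = k powr p"
    by (rule powr_pred_mult[OF k])
  have z: "small s (\<lambda>x. Cx ((\<lambda>x. 0) x)) k" using small_mono[OF small_zero k] by simp
  have "2 * p * k powr (p - 1) * k * s powr (- ((p - 1) / 2)) = A" unfolding A_def k1[symmetric] by (simp only: mult.assoc)
  with nonlin_small_diff[OF p s f z fm _ f]
  show "(NN x. cmod (Cx (nonlin p f x))) \<le> ennreal A"
    "L2sq (\<lambda>x. Cx (nonlin p f x)) \<le> ennreal ((A * s powr (- (1/4)))\<^sup>2)"
    by (auto simp: nonlin_def)
qed

lemma one_plus_powr_le:
  fixes \<tau> y y' :: real
  assumes "\<tau> > 0" "0 \<le> y" "y \<le> y'"
  shows "(1 + \<tau>) powr (- y') \<le> \<tau> powr (- y)"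
proof -
  have "(1 + \<tau>) powr (- y') \<le> (1 + \<tau>) powr (- y)" using assms by (intro powr_mono) auto
  also have "\<dots> \<le> \<tau> powr (- y)" using assms by (intro powr_mono2') auto
  finally show ?thesis .
qed

abbreviation duh :: "(real \<Rightarrow> real \<Rightarrow> complex) \<Rightarrow> (real \<Rightarrow> real \<Rightarrow> complex) \<Rightarrow> real \<Rightarrow> real \<Rightarrow> complex" where
  "duh K g t \<equiv> \<lambda>x. LBINT \<tau>:{0<..<t}. conv (K (t - \<tau>)) (g \<tau>) x"

text \<open>The second bound is the L^2 norm of a bump of mass a(\<tau>) spread over the diffusive
  width sqrt \<tau>, so that one scalar weight describes the forcing in both norms.\<close>

definition forcing :: "(real \<Rightarrow> real \<Rightarrow> complex) \<Rightarrow> (real \<Rightarrow> real) \<Rightarrow> bool" where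
  "forcing g a \<longleftrightarrow> (\<forall>\<tau>>0. (NN y. cmod (g \<tau> y)) \<le> ennreal (a \<tau>) \<and> L2sq (g \<tau>) \<le> ennreal ((a \<tau> * \<tau> powr (- (1/4)))\<^sup>2))"

lemma forcingD:
  assumes "forcing g a" "\<tau> > 0"
  shows "(NN y. cmod (g \<tau> y)) \<le> ennreal (a \<tau>)" "L2sq (g \<tau>) \<le> ennreal ((a \<tau> * \<tau> powr (- (1/4)))\<^sup>2)"
  using assms by (auto simp: forcing_def)

lemma duhamel_weight:
  fixes K :: "real \<Rightarrow> real \<Rightarrow> complex" and g :: "real \<Rightarrow> real \<Rightarrow> complex"
  assumes K: "(\<lambda>(s, x). K s x) \<in> borel_measurable (borel \<Otimes>\<^sub>M borel)"
    and g: "(\<lambda>(s, x). g s x) \<in> borel_measurable (borel \<Otimes>\<^sub>M borel)"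
    and C: "C \<ge> 0" and A: "A \<ge> 0"
    and sm: "\<And>s. 0 < s \<Longrightarrow> small s (K s) (C * s powr (- \<kappa>))"
    and f: "forcing g (\<lambda>\<tau>. A * w \<tau>)"
    and w: "w \<in> borel_measurable borel" "\<And>\<tau>. 0 \<le> w \<tau>"
    and J: "(NN \<tau>. indicator {0<..<t} \<tau> * ((t - \<tau>) powr (- (1/4 + \<kappa>)) * w \<tau>)) \<le> ennreal (J * t powr e)" "J \<ge> 0"
    and t: "t > 0"
  shows "small t (duh K g t) (2 * C * (A * J) * t powr (1/4 + e))"
    and "set_integrable lborel {0<..<t} (\<lambda>\<tau>. conv (K (t - \<tau>)) (g \<tau>) x)"
proof -
  note [measurable] = w(1)
  have "(NN \<tau>. indicator {0<..<t} \<tau> * ((t - \<tau>) powr (- (1/4 + \<kappa>)) * (A * w \<tau>)))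
    = (\<integral>\<^sup>+ \<tau>. ennreal A * ennreal (indicator {0<..<t} \<tau> * ((t - \<tau>) powr (- (1/4 + \<kappa>)) * w \<tau>)) \<partial>lborel)"
    using A w(2) by (intro nn_integral_cong) (subst ennreal_mult[symmetric], auto simp: mult_ac)
  also have "\<dots> = ennreal A * (NN \<tau>. indicator {0<..<t} \<tau> * ((t - \<tau>) powr (- (1/4 + \<kappa>)) * w \<tau>))"
    by (rule nn_integral_cmult) measurable
  also have "\<dots> \<le> ennreal A * ennreal (J * t powr e)" by (intro mult_left_mono J) simp
  also have "\<dots> = ennreal (A * (J * t powr e))" using A J by (simp add: ennreal_mult)
  finally have Jt: "(NN \<tau>. indicator {0<..<t} \<tau> * ((t - \<tau>) powr (- (1/4 + \<kappa>)) * (A * w \<tau>))) \<le> ennreal (A * (J * t powr e))" .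
  have am: "(\<lambda>\<tau>. A * w \<tau>) \<in> borel_measurable borel" by measurable
  have D: "small t (duh K g t) (2 * C * t powr (1/4) * (A * (J * t powr e)))"
    and si: "set_integrable lborel {0<..<t} (\<lambda>\<tau>. conv (K (t - \<tau>)) (g \<tau>) x)"
    by (rule small_duhamel[OF t K g am C sm forcingD(1)[OF f] _ forcingD(2)[OF f] Jt]; use A J(2) w(2) in simp)+
  show "set_integrable lborel {0<..<t} (\<lambda>\<tau>. conv (K (t - \<tau>)) (g \<tau>) x)" by (rule si)
  have "2 * C * t powr (1/4) * (A * (J * t powr e)) = 2 * C * (A * J) * (t powr (1/4) * t powr e)" by (simp only: mult_ac)
  then show "small t (duh K g t) (2 * C * (A * J) * t powr (1/4 + e))" using D by (simp only: powr_add)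
qed

text \<open>The forcing weight is weakened to \<tau>^(-y) with y < 1, for which the time integral is
  a Beta integral and hence an exact power of t. The bound \<kappa> < 3/4 leaves room for the extra
  exponent 1/4 that comes from the L^2 norm of the kernel. The freedom in y is used both to select a
  rate and, with y = 1/2, merely to have integrability in \<tau>.\<close>

lemma duhamel_rate:
  fixes K :: "real \<Rightarrow> real \<Rightarrow> complex" and g :: "real \<Rightarrow> real \<Rightarrow> complex"
  assumes K: "(\<lambda>(s, x). K s x) \<in> borel_measurable (borel \<Otimes>\<^sub>M borel)"
    and g: "(\<lambda>(s, x). g s x) \<in> borel_measurable (borel \<Otimes>\<^sub>M borel)"
    and C: "C \<ge> 0" and A: "A \<ge> 0"
    and sm: "\<And>s. 0 < s \<Longrightarrow> small s (K s) (C * s powr (- \<kappa>))"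
    and f: "forcing g (\<lambda>\<tau>. A * (1 + \<tau>) powr (- y'))"
    and y: "0 \<le> y" "y \<le> y'" "y < 1" and \<kappa>: "\<kappa> < 3 / 4"
  shows "\<exists>C'\<ge>0. \<forall>t>0. small t (duh K g t) (C' * t powr (1 - \<kappa> - y)) \<and>
    (\<forall>x. set_integrable lborel {0<..<t} (\<lambda>\<tau>. conv (K (t - \<tau>)) (g \<tau>) x))"
proof -
  obtain J where J: "J \<ge> 0" "\<And>t. t > 0 \<Longrightarrow> (NN \<tau>. indicator {0<..<t} \<tau> * ((t - \<tau>) powr (- (1/4 + \<kappa>)) * \<tau> powr (- y))) \<le> ennreal (J * t powr (1 - (1/4 + \<kappa>) - y))"
    using nn_integral_beta[of "1/4 + \<kappa>" y] y \<kappa> by auto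
  show ?thesis
  proof (intro exI[of _ "2 * C * (A * J)"] conjI allI impI)
    show "0 \<le> 2 * C * (A * J)" using C A J by simp
    fix t :: real assume t: "t > 0"
    have "(NN \<tau>. indicator {0<..<t} \<tau> * ((t - \<tau>) powr (- (1/4 + \<kappa>)) * (1 + \<tau>) powr (- y')))
      \<le> (NN \<tau>. indicator {0<..<t} \<tau> * ((t - \<tau>) powr (- (1/4 + \<kappa>)) * \<tau> powr (- y)))"
      by (intro nn_integral_mono ennreal_leI) (use y in \<open>auto simp: indicator_def intro!: mult_left_mono one_plus_powr_le\<close>)
    also note J(2)[OF t]
    finally have Jt: "(NN \<tau>. indicator {0<..<t} \<tau> * ((t - \<tau>) powr (- (1/4 + \<kappa>)) * (1 + \<tau>) powr (- y'))) \<le> ennreal (J * t powr (1 - (1/4 + \<kappa>) - y))" .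
    note d = duhamel_weight[OF K g C A sm f _ _ Jt J(1) t]
    have e: "1/4 + (1 - (1/4 + \<kappa>) - y) = 1 - \<kappa> - y" by simp
    show "small t (duh K g t) (2 * C * (A * J) * t powr (1 - \<kappa> - y))" by (rule d(1)[unfolded e]) auto
    show "set_integrable lborel {0<..<t} (\<lambda>\<tau>. conv (K (t - \<tau>)) (g \<tau>) x)" for x by (rule d(2)) auto
  qed
qed

text \<open>For forcing that is integrable in time the Duhamel term decays like the kernel itself,
  with neither a power nor a logarithm lost.\<close>

lemma duhamel_rate_integrable:
  fixes K :: "real \<Rightarrow> real \<Rightarrow> complex" and g :: "real \<Rightarrow> real \<Rightarrow> complex"
  assumes K: "(\<lambda>(s, x). K s x) \<in> borel_measurable (borel \<Otimes>\<^sub>M borel)"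
    and g: "(\<lambda>(s, x). g s x) \<in> borel_measurable (borel \<Otimes>\<^sub>M borel)"
    and C: "C \<ge> 0" and A: "A \<ge> 0"
    and sm: "\<And>s. 0 < s \<Longrightarrow> small s (K s) (C * s powr (- \<kappa>))"
    and f: "forcing g (\<lambda>\<tau>. A * (1 + \<tau>) powr (- y))"
    and y: "1 < y" and \<kappa>: "0 \<le> \<kappa>" "\<kappa> < 3 / 4"
  shows "\<exists>C'\<ge>0. \<forall>t\<ge>1. small t (duh K g t) (C' * t powr (- \<kappa>))"
proof -
  obtain J where J: "J \<ge> 0" "\<And>t. t \<ge> 1 \<Longrightarrow> (NN \<tau>. indicator {0<..<t} \<tau> * ((t - \<tau>) powr (- (1/4 + \<kappa>)) * (1 + \<tau>) powr (- y))) \<le> ennreal (J * t powr (- (1/4 + \<kappa>)))"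
    using nn_integral_integrable_forcing[of "1/4 + \<kappa>" y] y \<kappa> by auto
  have e: "1/4 + - (1/4 + \<kappa>) = - \<kappa>" by simp
  have "small t (duh K g t) (2 * C * (A * J) * t powr (- \<kappa>))" if "t \<ge> 1" for t
    by (rule duhamel_weight(1)[OF K g C A sm f _ _ J(2)[OF that] J(1), unfolded e]) (use that in auto)
  then show ?thesis using C A J(1) by (intro exI[of _ "2 * C * (A * J)"]) auto
qed

section \<open>The solution, its forcing and a first comparison with the drifting heat
  kernel\<close>

locale solution = initial_data +
  fixes p :: real and u :: "real \<Rightarrow> real \<Rightarrow> real"
  assumes p2: "p > 2" and mild: "global_mild_solution p B b \<mu> u\<^sub>0 u"
    and dec: "decay_estimates u\<^sub>0 u" and init: "initial_size u\<^sub>0 \<le> 1"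
begin

abbreviation "dev t x \<equiv> u t x - M * heat_drift B b \<mu> t x"

definition "\<alpha> = (p - 1) / 2"
text \<open>Negative times are sent to 0, so that U is continuous, hence Borel, on the whole
  plane.\<close>

definition "U \<tau> = rep (u (max 0 \<tau>))"
definition "g \<tau> y = Cx (nonlin p (U \<tau>) y)"
definition "Dh t x = (LBINT \<tau>:{0<..<t}. conv (K1 (t - \<tau>)) (g \<tau>) x)"

lemma \<alpha>: "\<alpha> > 1 / 2" using p2 by (simp add: \<alpha>_def)

lemma u_Hs: "t \<ge> 0 \<Longrightarrow> u t \<in> Hs_space 1"
  using mild by (simp add: global_mild_solution_def)

lemma u_measurable: "t \<ge> 0 \<Longrightarrow> u t \<in> borel_measurable borel"
  using u_Hs by (simp add: Hs_space_def)

lemma u_cont: "t \<ge> 0 \<Longrightarrow> ((\<lambda>s. Hs_norm 1 (\<lambda>x. u s x - u t x)) \<longlongrightarrow> 0) (at t within {0..})"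
  using mild by (simp add: global_mild_solution_def)

lemma U_AE: "t \<ge> 0 \<Longrightarrow> AE x in lborel. u t x = U t x"
  using rep_jointly_continuous(2)[of u t, OF u_Hs u_cont] by (simp add: U_def)

lemma U_continuous: "continuous_on UNIV (\<lambda>z. U (fst z) (snd z))"
proof -
  have c: "continuous_on ({0..} \<times> UNIV) (\<lambda>(t, x). rep (u t) x)"
    by (rule rep_jointly_continuous(1)[OF u_Hs u_cont])
  have "continuous_on UNIV (\<lambda>z :: real \<times> real. (\<lambda>(t, x). rep (u t) x) (max 0 (fst z), snd z))"
    by (rule continuous_on_compose2[OF c]) (auto intro!: continuous_intros)
  then show ?thesis by (simp add: U_def)
qed

lemma U_measurable_pair [measurable]: "(\<lambda>(t, x). U t x) \<in> borel_measurable (borel \<Otimes>\<^sub>M borel)"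
  unfolding split_beta' borel_prod by (rule borel_measurable_continuous_onI[OF U_continuous])

lemma U_measurable [measurable]: "U t \<in> borel_measurable borel"
  using measurable_compose[OF measurable_Pair1' U_measurable_pair, of t] by simp

lemma g_measurable_pair [measurable]: "(\<lambda>(t, x). g t x) \<in> borel_measurable (borel \<Otimes>\<^sub>M borel)"
  using U_measurable_pair unfolding g_def nonlin_def split_beta' by measurable

lemma g_measurable [measurable]: "g t \<in> borel_measurable borel"
  using measurable_compose[OF measurable_Pair1' g_measurable_pair, of t] by simp

text \<open>The decay estimates for q = 2 and q = \<infinity> are exactly the two parts of
  \<open>small\<close> at time 1 + t; \<open>initial_size u\<^sub>0\<close> is at most 1, so the
  constant depends only on C. The essential supremum bound becomes a pointwise one because U t is
  continuous.\<close>

lemma U_small: "\<exists>K\<ge>0. \<forall>t\<ge>0. small (1 + t) (\<lambda>x. Cx (U t x)) K"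
proof -
  from dec obtain C where C: "C > 0"
    and d: "\<And>t q. t \<ge> 0 \<Longrightarrow> q \<ge> 2 \<Longrightarrow> Lq_norm q (u t) \<le> ereal C * initial_size u\<^sub>0 * ereal ((1 + t) powr (- (1/2) * (1 - real_of_ereal (1 / q))))"
    unfolding decay_estimates_def by blast
  have d': "Lq_norm q (u t) \<le> ereal (C * (1 + t) powr (- (1/2) * (1 - real_of_ereal (1 / q))))" if "t \<ge> 0" "q \<ge> 2" for t q
  proof -
    have "ereal C * initial_size u\<^sub>0 \<le> ereal C * 1" using C init by (intro ereal_mult_left_mono) auto
    then have "ereal C * initial_size u\<^sub>0 * ereal ((1 + t) powr (- (1/2) * (1 - real_of_ereal (1 / q)))) \<le> ereal C * 1 * ereal ((1 + t) powr (- (1/2) * (1 - real_of_ereal (1 / q))))"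
      by (rule ereal_mult_right_mono) simp
    with d[OF that] have "Lq_norm q (u t) \<le> ereal C * 1 * ereal ((1 + t) powr (- (1/2) * (1 - real_of_ereal (1 / q))))" by (rule order_trans)
    then show ?thesis by simp
  qed
  show ?thesis
  proof (intro exI[of _ C] conjI allI impI)
    show "0 \<le> C" using C by simp
    fix t :: real assume t: "t \<ge> 0"
    have [measurable]: "u t \<in> borel_measurable borel" by (rule u_measurable[OF t])
    have Uc: "continuous_on UNIV (U t)"
    proof -
      have "continuous_on UNIV (\<lambda>x. (\<lambda>z. U (fst z) (snd z)) (t, x))"
        by (rule continuous_on_compose2[OF U_continuous]) (auto intro!: continuous_intros)
      then show ?thesis by simp
    qed
    have "esssup lborel (\<lambda>x. ereal \<bar>u t x\<bar>) \<le> ereal (C * (1 + t) powr (- (1/2)))"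
      using d'[OF t, of \<infinity>] by (simp add: Lq_norm_def)
    moreover have "AE x in lborel. ereal \<bar>u t x\<bar> \<le> esssup lborel (\<lambda>x. ereal \<bar>u t x\<bar>)" by (rule esssup_AE)
    ultimately have "AE x in lborel. ereal \<bar>u t x\<bar> \<le> ereal (C * (1 + t) powr (- (1/2)))"
      by (auto elim!: eventually_mono dest: order_trans)
    then have "AE x in lborel. \<bar>U t x\<bar> \<le> C * (1 + t) powr (- (1/2))"
      using U_AE[OF t] by eventually_elim simp
    then have sup: "\<bar>U t x\<bar> \<le> C * (1 + t) powr (- (1/2))" for x by (rule continuous_AE_bound[OF Uc])
    have two: "real_of_ereal (1 / 2) = 1 / 2" "real_of_ereal 2 = 2"
      unfolding numeral_eq_ereal one_ereal_def ereal_divide by simp_all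
    have "root_ereal 2 (NN x. \<bar>u t x\<bar> powr 2) \<le> ereal (C * (1 + t) powr (- (1/4)))"
      using d'[OF t order_refl] unfolding Lq_norm_def two by simp
    then have "(NN x. \<bar>u t x\<bar> powr 2) \<le> ennreal ((C * (1 + t) powr (- (1/4))) powr 2)"
      by (rule root_ereal_leD) simp
    also have "(C * (1 + t) powr (- (1/4))) powr 2 = (C * (1 + t) powr (- (1/4)))\<^sup>2" using C t by (simp add: powr_numeral)
    also have "(NN x. \<bar>u t x\<bar> powr 2) = L2sq (\<lambda>x. Cx (U t x))"
    proof (rule nn_integral_cong_AE)
      show "AE x in lborel. ennreal (\<bar>u t x\<bar> powr 2) = ennreal ((cmod (Cx (U t x)))\<^sup>2)"
        using U_AE[OF t]
      proof eventually_elim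
        case (elim x)
        have "\<bar>u t x\<bar> powr 2 = \<bar>u t x\<bar>\<^sup>2" by (cases "u t x = 0") (auto simp: powr_numeral)
        then show ?case using elim by simp
      qed
    qed
    finally show "small (1 + t) (\<lambda>x. Cx (U t x)) C"
      using sup C unfolding small_def small_sq by auto
  qed
qed

lemma g_bounds:
  "\<exists>A\<ge>0. forcing g (\<lambda>\<tau>. A * (1 + \<tau>) powr (- \<alpha>))"
proof -
  obtain K where K: "K \<ge> 0" "\<And>t. t \<ge> 0 \<Longrightarrow> small (1 + t) (\<lambda>x. Cx (U t x)) K" using U_small by blast
  show ?thesis unfolding forcing_def
  proof (intro exI[of _ "2 * p * K powr p"] conjI allI impI)
    show "0 \<le> 2 * p * K powr p" using p2 by simp
    fix \<tau> :: real assume \<tau>: "\<tau> > 0"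
    have s: "1 + \<tau> > 0" using \<tau> by simp
    note b = nonlin_small[OF p2 s K(2)[OF less_imp_le[OF \<tau>]] U_measurable, folded \<alpha>_def]
    show "(NN y. cmod (g \<tau> y)) \<le> ennreal (2 * p * K powr p * (1 + \<tau>) powr (- \<alpha>))"
      using b(1) unfolding g_def .
    have "L2sq (g \<tau>) \<le> ennreal ((2 * p * K powr p * (1 + \<tau>) powr (- \<alpha>) * (1 + \<tau>) powr (- (1/4)))\<^sup>2)"
      using b(2) unfolding g_def .
    also have "\<dots> \<le> ennreal ((2 * p * K powr p * (1 + \<tau>) powr (- \<alpha>) * \<tau> powr (- (1/4)))\<^sup>2)"
      using \<tau> p2 by (intro ennreal_leI power_mono mult_left_mono powr_mono2') auto
    finally show "L2sq (g \<tau>) \<le> ennreal ((2 * p * K powr p * (1 + \<tau>) powr (- \<alpha>) * \<tau> powr (- (1/4)))\<^sup>2)" .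
  qed
qed

lemma conv_cong_AE:
  assumes "K \<in> borel_measurable borel" "f \<in> borel_measurable borel" "h \<in> borel_measurable borel"
    and "AE y in lborel. f y = h y"
  shows "conv K f x = conv K (h :: real \<Rightarrow> complex) x"
  unfolding conv_def
proof (rule integral_cong_AE)
  note [measurable] = assms(1-3)
  show "(\<lambda>y. K (x - y) * f y) \<in> borel_measurable lborel" "(\<lambda>y. K (x - y) * h y) \<in> borel_measurable lborel"
    by measurable
  show "AE y in lborel. K (x - y) * f y = K (x - y) * h y" using assms(4) by eventually_elim simp
qed

lemma K1_measurable [measurable]: "K1 s \<in> borel_measurable borel"
  using measurable_compose[OF measurable_Pair1' K_measurable(1), of s] by simp

lemma K0_measurable [measurable]: "K0 s \<in> borel_measurable borel"
  using measurable_compose[OF measurable_Pair1' K_measurable(2), of s] by simp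

lemma nonlin_AE:
  assumes "t \<ge> 0" shows "AE y in lborel. nonlin p (u t) y = nonlin p (U t) y"
  using U_AE[OF assms] by eventually_elim (simp add: nonlin_def)

lemma duhamel:
  assumes t: "t > 0"
  shows "AE x in lborel. Cx (u t x) = ift (\<lambda>\<xi>. smb t \<xi> * uh \<xi>) x - Dh t x"
proof -
  have "AE x in lborel. Cx (u t x) =
        conv (kernel_T B b \<mu> t) (\<lambda>y. Cx (u\<^sub>0 y)) x
        - (LBINT \<tau>:{0<..<t}. conv (kernel_T_dx B b \<mu> (t - \<tau>)) (\<lambda>y. Cx (nonlin p (u \<tau>) y)) x)"
    using mild t unfolding global_mild_solution_def by blast
  moreover have "(LBINT \<tau>:{0<..<t}. conv (kernel_T_dx B b \<mu> (t - \<tau>)) (\<lambda>y. Cx (nonlin p (u \<tau>) y)) x) = Dh t x" for x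
    unfolding Dh_def
  proof (rule set_lebesgue_integral_cong)
    show "\<forall>\<tau>. \<tau> \<in> {0<..<t} \<longrightarrow> conv (kernel_T_dx B b \<mu> (t - \<tau>)) (\<lambda>y. Cx (nonlin p (u \<tau>) y)) x = conv (K1 (t - \<tau>)) (g \<tau>) x"
    proof (intro allI impI)
      fix \<tau> assume \<tau>: "\<tau> \<in> {0<..<t}"
      have [measurable]: "u \<tau> \<in> borel_measurable borel" using \<tau> by (intro u_measurable) auto
      have "AE y in lborel. Cx (nonlin p (u \<tau>) y) = g \<tau> y"
        unfolding g_def using nonlin_AE[of \<tau>] \<tau> by auto
      then show "conv (kernel_T_dx B b \<mu> (t - \<tau>)) (\<lambda>y. Cx (nonlin p (u \<tau>) y)) x = conv (K1 (t - \<tau>)) (g \<tau>) x"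
        using \<tau> by (subst kernel_T_dx_eq) (auto intro!: conv_cong_AE)
    qed
  qed simp
  ultimately show ?thesis by (simp add: conv_T[OF t])
qed

text \<open>The first rate in \<open>zero_order\<close>. It comes from (p - 2)/2 = \<alpha> - 1/2,
  the excess of the decay of the forcing over \<tau>^(-1/2); the cap 1/4 keeps 1/2 + \<beta>0 below
  1, as the Beta integral requires.\<close>

definition "\<beta>0 = min ((p - 2) / 2) (1 / 4)"

lemma \<beta>0: "\<beta>0 > 0" "\<beta>0 \<le> 1 / 4" using p2 by (auto simp: \<beta>0_def)

lemma \<beta>0_\<alpha>: "1/2 + \<beta>0 \<le> \<alpha>"
proof -
  have "\<beta>0 \<le> (p - 2) / 2" unfolding \<beta>0_def by (rule min.cobounded1)
  then show ?thesis by (simp add: \<alpha>_def field_simps)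
qed

text \<open>No cancellation is used: the linear part is off by t^(-1/2), and the whole Duhamel term
  counts as error, of order t^(1 - 1/2 - (1/2 + \<beta>0)). Any positive power suffices to improve
  the forcing afterwards.\<close>

lemma zero_order:
  "\<exists>C\<ge>0. \<forall>t\<ge>1. \<exists>R. small t R (C * t powr (- \<beta>0)) \<and>
     (AE x in lborel. Cx (dev t x) = R x)"
proof -
  obtain C1 where C1: "C1 \<ge> 0" "\<And>t. t > 0 \<Longrightarrow> small t (\<lambda>x. ift (\<lambda>\<xi>. smb t \<xi> * uh \<xi>) x - Cx M * ift (smb0 t) x) (C1 * t powr (- (1/2)))"
    using linear_zero_order by blast
  obtain A where A: "A \<ge> 0" "forcing g (\<lambda>\<tau>. A * (1 + \<tau>) powr (- \<alpha>))"
    using g_bounds by blast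
  have y: "0 \<le> 1/2 + \<beta>0" "1/2 + \<beta>0 \<le> \<alpha>" "1/2 + \<beta>0 < 1" using \<beta>0 \<beta>0_\<alpha> by auto
  obtain C2 where C2: "C2 \<ge> 0" "\<And>t. t > 0 \<Longrightarrow> small t (Dh t) (C2 * t powr (1 - 1/2 - (1/2 + \<beta>0)))"
    using duhamel_rate[OF K_measurable(1) g_measurable_pair gauss_const_nonneg A(1) small_K(1) A(2) y] unfolding Dh_def by auto
  show ?thesis
  proof (intro exI[of _ "C1 + C2"] conjI allI impI)
    show "0 \<le> C1 + C2" using C1 C2 by simp
    fix t :: real assume t1: "t \<ge> 1"
    then have t: "t > 0" by simp
    let ?R = "\<lambda>x. (ift (\<lambda>\<xi>. smb t \<xi> * uh \<xi>) x - Cx M * ift (smb0 t) x) - Dh t x"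
    have "t powr (- (1/2)) \<le> t powr (- \<beta>0)" using t1 \<beta>0 by (intro powr_mono) auto
    then have "C1 * t powr (- (1/2)) \<le> C1 * t powr (- \<beta>0)" by (rule mult_left_mono) (rule C1)
    from small_diff[OF small_mono[OF C1(2)[OF t] this] C2(2)[OF t]]
    have "small t ?R ((C1 + C2) * t powr (- \<beta>0))" by (simp add: distrib_right)
    moreover have "AE x in lborel. Cx (dev t x) = ?R x"
      using duhamel[OF t] by eventually_elim (simp add: heat_drift_eq[OF t, symmetric])
    ultimately show "\<exists>R. small t R ((C1 + C2) * t powr (- \<beta>0)) \<and> (AE x in lborel. Cx (dev t x) = R x)"
      by blast
  qed
qed

end

lemma square_exp_le:
  fixes a z :: real assumes a: "a > 0" shows "z\<^sup>2 * gauss a z \<le> 1 / a"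
proof -
  have "a * z\<^sup>2 \<le> exp (a * z\<^sup>2)" using exp_ge_add_one_self[of "a * z\<^sup>2"] by linarith
  then have "a * z\<^sup>2 * gauss a z \<le> exp (a * z\<^sup>2) * gauss a z" by (rule mult_right_mono) simp
  then have "a * (z\<^sup>2 * gauss a z) \<le> 1" by (simp add: exp_minus mult.assoc)
  then show ?thesis using a by (simp add: pos_le_divide_eq mult.commute)
qed

lemma exp_diff_le:
  fixes a b :: real assumes "0 \<le> a" "a \<le> b"
  shows "\<bar>exp (- a) - exp (- b)\<bar> \<le> exp (- a) * (b - a)"
proof -
  have "1 - (b - a) \<le> exp (- (b - a))" using exp_ge_add_one_self[of "- (b - a)"] by linarith
  then have "exp (- a) * (1 - exp (- (b - a))) \<le> exp (- a) * (b - a)" by (intro mult_left_mono) auto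
  moreover have "exp (- a) * exp (- (b - a)) = exp (- b)" by (simp flip: exp_add)
  ultimately have "exp (- a) - exp (- b) \<le> exp (- a) * (b - a)" by (simp add: right_diff_distrib)
  moreover have "exp (- b) \<le> exp (- a)" using assms by simp
  ultimately show ?thesis by simp
qed

section \<open>The differentiated kernel away from its singular time\<close>

context params
begin

text \<open>Symbol of the far part of the Duhamel term, for \<open>\<tau> < t / 2\<close>: it is a bounded multiple of the
  leading symbol, and small if \<open>\<tau>\<close> and \<open>y\<close> are small on the diffusive scale.\<close>

definition "far \<tau> y t \<xi> = \<i> * Cx \<xi> * smb (t - \<tau>) \<xi> * iexp (- (y * \<xi>)) - \<i> * Cx \<xi> * smb0 t \<xi>"

lemma far_bound1:
  assumes t: "t > 0" and \<tau>: "0 \<le> \<tau>" "\<tau> \<le> t / 2"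
  shows "cmod (far \<tau> y t \<xi>) \<le> 2 * \<bar>\<xi>\<bar> * gauss (\<mu> / 2 * t) \<xi>"
proof -
  have "\<mu> / 2 * t * \<xi>\<^sup>2 \<le> \<mu> * (t - \<tau>) * \<xi>\<^sup>2" using \<mu>0 \<tau> by (intro mult_right_mono) (auto simp: field_simps)
  then have 1: "gauss (\<mu> * (t - \<tau>)) \<xi> \<le> gauss (\<mu> / 2 * t) \<xi>" by simp
  have "\<mu> / 2 * t * \<xi>\<^sup>2 \<le> \<mu> * t * \<xi>\<^sup>2" using \<mu>0 t by (intro mult_right_mono) auto
  then have 2: "gauss (\<mu> * t) \<xi> \<le> gauss (\<mu> / 2 * t) \<xi>" by simp
  have "cmod (far \<tau> y t \<xi>) \<le> cmod (\<i> * Cx \<xi> * smb (t - \<tau>) \<xi> * iexp (- (y * \<xi>))) + cmod (\<i> * Cx \<xi> * smb0 t \<xi>)"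
    unfolding far_def by (rule norm_triangle_ineq4)
  also have "\<dots> = \<bar>\<xi>\<bar> * gauss (\<mu> * (t - \<tau>)) \<xi> + \<bar>\<xi>\<bar> * gauss (\<mu> * t) \<xi>"
    by (simp only: norm_mult cmod_smb norm_ii norm_of_real norm_exp_i_times mult_1 mult_1_right)
  also have "\<dots> \<le> \<bar>\<xi>\<bar> * gauss (\<mu> / 2 * t) \<xi> + \<bar>\<xi>\<bar> * gauss (\<mu> / 2 * t) \<xi>"
    by (intro add_mono mult_left_mono 1 2) auto
  finally show ?thesis by simp
qed

text \<open>The symbols differ in modulus and in phase. The time shift changes the Gaussian by \<mu>
  \<tau> \<xi>^2 and the phase by at most V \<tau> |\<xi>|, the translation changes the phase by |y
  \<xi>|, and the dispersive correction contributes t W |\<xi>|^3. Each is paid with one Gaussian of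
  at least half the exponent, since \<tau> \<le> t/2.\<close>

lemma far_bound2:
  assumes t: "t > 0" and \<tau>: "0 \<le> \<tau>" "\<tau> \<le> t / 2"
  shows "cmod (far \<tau> y t \<xi>) \<le> \<bar>\<xi>\<bar> * gauss (\<mu> / 2 * t) \<xi> * (\<mu> * \<tau> * \<xi>\<^sup>2 + (V * \<tau> + \<bar>y\<bar>) * \<bar>\<xi>\<bar> + t * (W * \<bar>\<xi>\<bar> ^ 3))"
proof -
  define e1 e2 where "e1 = gauss (\<mu> * (t - \<tau>)) \<xi>" and "e2 = gauss (\<mu> * t) \<xi>"
  define \<theta>1 \<theta>2 where "\<theta>1 = - ((t - \<tau>) * disp \<xi>) - y * \<xi>" and "\<theta>2 = - (V * t * \<xi>)"
  have le: "\<mu> / 2 * t * \<xi>\<^sup>2 \<le> \<mu> * (t - \<tau>) * \<xi>\<^sup>2" using \<mu>0 \<tau> by (intro mult_right_mono) (auto simp: field_simps)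
  then have e1: "e1 \<le> gauss (\<mu> / 2 * t) \<xi>" by (simp add: e1_def)
  have tm: "iexp (- ((t - \<tau>) * disp \<xi>)) * iexp (- (y * \<xi>)) = iexp \<theta>1" by (simp add: \<theta>1_def exp_add[symmetric] algebra_simps)
  have "far \<tau> y t \<xi> = \<i> * Cx \<xi> * (Cx e1 * (iexp (- ((t - \<tau>) * disp \<xi>)) * iexp (- (y * \<xi>))) - Cx e2 * iexp \<theta>2)"
    unfolding far_def smb_def smb0_def e1_def e2_def \<theta>2_def by (simp only: right_diff_distrib mult.assoc)
  also have "\<dots> = \<i> * Cx \<xi> * (Cx e1 * (iexp \<theta>1 - iexp \<theta>2) + Cx (e1 - e2) * iexp \<theta>2)"
    unfolding tm by (simp add: algebra_simps)
  finally have "cmod (far \<tau> y t \<xi>) = \<bar>\<xi>\<bar> * cmod (Cx e1 * (iexp \<theta>1 - iexp \<theta>2) + Cx (e1 - e2) * iexp \<theta>2)"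
    by (simp only: norm_mult norm_ii norm_of_real mult_1)
  also have "\<dots> \<le> \<bar>\<xi>\<bar> * (e1 * \<bar>\<theta>1 - \<theta>2\<bar> + \<bar>e1 - e2\<bar>)"
  proof (rule mult_left_mono)
    have "cmod (Cx e1 * (iexp \<theta>1 - iexp \<theta>2)) \<le> e1 * \<bar>\<theta>1 - \<theta>2\<bar>"
      unfolding norm_mult norm_of_real using iexp_diff_le[of \<theta>1 \<theta>2] by (intro mult_mono) (auto simp: e1_def)
    moreover have "cmod (Cx (e1 - e2) * iexp \<theta>2) = \<bar>e1 - e2\<bar>" by (simp only: norm_mult norm_of_real norm_exp_i_times mult_1_right)
    ultimately show "cmod (Cx e1 * (iexp \<theta>1 - iexp \<theta>2) + Cx (e1 - e2) * iexp \<theta>2) \<le> e1 * \<bar>\<theta>1 - \<theta>2\<bar> + \<bar>e1 - e2\<bar>"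
      by (intro order_trans[OF norm_triangle_ineq]) simp
  qed simp
  also have "\<dots> \<le> \<bar>\<xi>\<bar> * (gauss (\<mu> / 2 * t) \<xi> * ((V * \<tau> + \<bar>y\<bar>) * \<bar>\<xi>\<bar> + t * (W * \<bar>\<xi>\<bar> ^ 3)) + gauss (\<mu> / 2 * t) \<xi> * (\<mu> * \<tau> * \<xi>\<^sup>2))"
  proof (intro mult_left_mono add_mono)
    have "\<theta>1 - \<theta>2 = t * (V * \<xi> - disp \<xi>) + \<tau> * disp \<xi> - y * \<xi>" by (simp add: \<theta>1_def \<theta>2_def algebra_simps)
    then have "\<bar>\<theta>1 - \<theta>2\<bar> \<le> \<bar>t * (V * \<xi> - disp \<xi>)\<bar> + \<bar>\<tau> * disp \<xi>\<bar> + \<bar>y * \<xi>\<bar>" by linarith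
    also have "\<dots> \<le> t * (W * \<bar>\<xi>\<bar> ^ 3) + \<tau> * (V * \<bar>\<xi>\<bar>) + \<bar>y\<bar> * \<bar>\<xi>\<bar>"
      unfolding abs_mult using t \<tau> disp_diff_le[of \<xi>] disp_le[of \<xi>] by (intro add_mono mult_mono) auto
    also have "\<dots> = (V * \<tau> + \<bar>y\<bar>) * \<bar>\<xi>\<bar> + t * (W * \<bar>\<xi>\<bar> ^ 3)" by (simp add: algebra_simps)
    finally show "e1 * \<bar>\<theta>1 - \<theta>2\<bar> \<le> gauss (\<mu> / 2 * t) \<xi> * ((V * \<tau> + \<bar>y\<bar>) * \<bar>\<xi>\<bar> + t * (W * \<bar>\<xi>\<bar> ^ 3))"
      by (intro mult_mono e1) (auto simp: e1_def)
    have "\<bar>e1 - e2\<bar> \<le> e1 * (\<mu> * t * \<xi>\<^sup>2 - \<mu> * (t - \<tau>) * \<xi>\<^sup>2)"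
      unfolding e1_def e2_def using \<mu>0 t \<tau> by (intro exp_diff_le mult_nonneg_nonneg mult_right_mono mult_left_mono) auto
    also have "\<mu> * t * \<xi>\<^sup>2 - \<mu> * (t - \<tau>) * \<xi>\<^sup>2 = \<mu> * \<tau> * \<xi>\<^sup>2" by (simp add: algebra_simps)
    also have "e1 * (\<mu> * \<tau> * \<xi>\<^sup>2) \<le> gauss (\<mu> / 2 * t) \<xi> * (\<mu> * \<tau> * \<xi>\<^sup>2)" using \<mu>0 \<tau> by (intro mult_right_mono e1) auto
    finally show "\<bar>e1 - e2\<bar> \<le> gauss (\<mu> / 2 * t) \<xi> * (\<mu> * \<tau> * \<xi>\<^sup>2)" .
  qed simp
  finally show ?thesis by (simp add: algebra_simps)
qed

lemma far_measurable [measurable]: "far \<tau> y t \<in> borel_measurable borel"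
  unfolding far_def[abs_def] by measurable

lemma ift_far:
  assumes "0 < t" "\<tau> < t"
  shows "ift (far \<tau> y t) x = K1 (t - \<tau>) (x - y) - K0 t x"
proof -
  have i: "integrable lborel (\<lambda>\<xi>. \<i> * Cx \<xi> * smb (t - \<tau>) \<xi> * iexp (- (y * \<xi>)))"
    by (subst mult.commute, rule integrable_iexp_mult[OF smb_integrable(3)]) (use assms in auto)
  have "ift (far \<tau> y t) x = ift (\<lambda>\<xi>. \<i> * Cx \<xi> * smb (t - \<tau>) \<xi> * iexp (- (y * \<xi>))) x - K0 t x"
    unfolding far_def K0_def by (rule ift_diff[OF i smb_integrable(4)[OF assms(1)]])
  also have "ift (\<lambda>\<xi>. \<i> * Cx \<xi> * smb (t - \<tau>) \<xi> * iexp (- (y * \<xi>))) x = K1 (t - \<tau>) (x - y)"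
    unfolding K1_def by (rule ift_shift)
  finally show ?thesis .
qed

text \<open>Power counting applied to the two symbol bounds. The minimum with 1 keeps the bound
  uniform, so that forcing with no moments in \<tau> or y can be handled by dominated convergence;
  the second entry tends to 0 for fixed \<tau> and y. The summand 1 in 1 + \<tau> + |y| accounts for
  the dispersive correction, which is present even for \<tau> = y = 0.\<close>

lemma small_far:
  "\<exists>C\<ge>0. \<forall>t\<ge>1. \<forall>\<tau> y. 0 \<le> \<tau> \<longrightarrow> \<tau> \<le> t / 2 \<longrightarrow>
     small t (\<lambda>x. K1 (t - \<tau>) (x - y) - K0 t x) (C * t powr (- (1/2)) * min 1 ((1 + \<tau> + \<bar>y\<bar>) * t powr (- (1/2))))"
proof -
  define L where "L = 2 * (\<mu> + V + 1 + W) * (1 + 4 / \<mu>)"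
  have L0: "L \<ge> 0" using \<mu>0 V0 W0 by (simp add: L_def)
  define C where "C = 2 * gauss_const 1 (\<mu> / 2) + L * gauss_const 2 (\<mu> / 4)"
  have C0: "C \<ge> 0" unfolding C_def using L0 gauss_const_nonneg by (intro add_nonneg_nonneg mult_nonneg_nonneg) auto
  show ?thesis
  proof (intro exI[of _ C] conjI allI impI C0)
    fix t \<tau> y :: real assume t1: "t \<ge> 1" and \<tau>: "0 \<le> \<tau>" "\<tau> \<le> t / 2"
    have t: "t > 0" using t1 by simp
    define X where "X = 1 + \<tau> + \<bar>y\<bar>"
    have X: "X \<ge> 1" "\<tau> \<le> X" "\<bar>y\<bar> \<le> X" using \<tau> by (auto simp: X_def)
    have f: "(\<lambda>x. K1 (t - \<tau>) (x - y) - K0 t x) = ift (far \<tau> y t)" using ift_far[of t \<tau> y] t \<tau> by (simp add: fun_eq_iff)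
    have 1: "small t (ift (far \<tau> y t)) (2 * gauss_const 1 (\<mu> / 2) * t powr (0 - real 1 / 2))"
      by (rule small_ift_rate_gen[THEN conjunct2, OF _ t]) (use \<mu>0 far_bound1[OF t \<tau>] t in \<open>auto\<close>)
    have 2: "small t (ift (far \<tau> y t)) (L * X * gauss_const 2 (\<mu> / 4) * t powr (0 - real 2 / 2))"
    proof (rule small_ift_rate_gen[THEN conjunct2, OF _ t])
      show "0 \<le> L * X" using L0 X by simp
      show "\<mu> / 4 > 0" using \<mu>0 by simp
      fix \<xi>
      define \<zeta> where "\<zeta> = sqrt t * \<bar>\<xi>\<bar>"
      have \<zeta>2: "t * \<xi>\<^sup>2 = \<zeta>\<^sup>2" using t by (simp add: \<zeta>_def power_mult_distrib)
      have \<zeta>0: "\<zeta> \<ge> 0" using t by (simp add: \<zeta>_def)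
      have x1: "\<bar>\<xi>\<bar> \<le> \<zeta>" using mult_right_mono[of 1 "sqrt t" "\<bar>\<xi>\<bar>"] t1 by (simp add: \<zeta>_def)
      have "\<mu> * \<tau> * \<xi>\<^sup>2 + (V * \<tau> + \<bar>y\<bar>) * \<bar>\<xi>\<bar> + t * (W * \<bar>\<xi>\<bar> ^ 3) = \<bar>\<xi>\<bar> * (\<mu> * \<tau> * \<bar>\<xi>\<bar> + (V * \<tau> + \<bar>y\<bar>) + W * (t * \<xi>\<^sup>2))"
        by (simp add: algebra_simps power2_eq_square power3_eq_cube abs_mult_self_eq)
      also have "\<dots> \<le> \<bar>\<xi>\<bar> * (\<mu> * X * \<zeta> + (V * X + X) + W * \<zeta>\<^sup>2)"
        unfolding \<zeta>2 using \<mu>0 V0 W0 X x1 \<tau> by (intro mult_left_mono add_mono mult_mono) auto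
      also have "\<dots> \<le> \<bar>\<xi>\<bar> * (2 * (\<mu> + V + 1 + W) * X * (1 + \<zeta>\<^sup>2))"
      proof (rule mult_left_mono)
        have z: "\<zeta> \<le> 1 + \<zeta>\<^sup>2" using abs_le_square_add[of "1/4" \<zeta>] \<zeta>0 by simp
        have "\<mu> * X * \<zeta> \<le> \<mu> * X * (1 + \<zeta>\<^sup>2)" using \<mu>0 X z by (intro mult_left_mono) auto
        moreover have "(V * X + X) * 1 \<le> (V * X + X) * (1 + \<zeta>\<^sup>2)" using V0 X by (intro mult_left_mono) auto
        moreover have "W * \<zeta>\<^sup>2 \<le> W * X * (1 + \<zeta>\<^sup>2)"
        proof -
          have "1 * \<zeta>\<^sup>2 \<le> X * (1 + \<zeta>\<^sup>2)" using X by (intro mult_mono) auto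
          then show ?thesis using W0 mult_left_mono[of "1 * \<zeta>\<^sup>2" "X * (1 + \<zeta>\<^sup>2)" W] by (simp add: mult.assoc)
        qed
        ultimately have "\<mu> * X * \<zeta> + (V * X + X) + W * \<zeta>\<^sup>2 \<le> (\<mu> + V + 1 + W) * X * (1 + \<zeta>\<^sup>2)" by (simp add: algebra_simps)
        also have "\<dots> \<le> 2 * ((\<mu> + V + 1 + W) * X * (1 + \<zeta>\<^sup>2))"
        proof -
          have "0 \<le> (\<mu> + V + 1 + W) * X * (1 + \<zeta>\<^sup>2)" using \<mu>0 V0 W0 X by (intro mult_nonneg_nonneg add_nonneg_nonneg) auto
          then show ?thesis by linarith
        qed
        finally show "\<mu> * X * \<zeta> + (V * X + X) + W * \<zeta>\<^sup>2 \<le> 2 * (\<mu> + V + 1 + W) * X * (1 + \<zeta>\<^sup>2)" by (simp only: mult.assoc)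
      qed simp
      finally have p1: "\<mu> * \<tau> * \<xi>\<^sup>2 + (V * \<tau> + \<bar>y\<bar>) * \<bar>\<xi>\<bar> + t * (W * \<bar>\<xi>\<bar> ^ 3) \<le> \<bar>\<xi>\<bar> * (2 * (\<mu> + V + 1 + W) * X * (1 + \<zeta>\<^sup>2))" .
      \<comment> \<open>Half of the remaining Gaussian absorbs the polynomial factor; this is the
        origin of 4/\<mu> in L and of the exponent \<mu>/4.\<close>
      have p2: "(1 + \<zeta>\<^sup>2) * gauss (\<mu> / 2) \<zeta> \<le> (1 + 4 / \<mu>) * gauss (\<mu> / 4) \<zeta>"
      proof -
        have "gauss (\<mu> / 2) \<zeta> = gauss (\<mu> / 4) \<zeta> * gauss (\<mu> / 4) \<zeta>" by (simp flip: exp_add)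
        then have "(1 + \<zeta>\<^sup>2) * gauss (\<mu> / 2) \<zeta> = (gauss (\<mu> / 4) \<zeta> + \<zeta>\<^sup>2 * gauss (\<mu> / 4) \<zeta>) * gauss (\<mu> / 4) \<zeta>"
          by (simp add: algebra_simps)
        also have "\<dots> \<le> (1 + 4 / \<mu>) * gauss (\<mu> / 4) \<zeta>"
          using square_exp_le[of "\<mu> / 4" \<zeta>] \<mu>0 by (intro mult_right_mono add_mono) auto
        finally show ?thesis .
      qed
      have "cmod (far \<tau> y t \<xi>) \<le> \<bar>\<xi>\<bar> * gauss (\<mu> / 2) \<zeta> * (\<bar>\<xi>\<bar> * (2 * (\<mu> + V + 1 + W) * X * (1 + \<zeta>\<^sup>2)))"
        using far_bound2[OF t \<tau>, of y \<xi>] unfolding mult.assoc[of "\<mu> / 2"] \<zeta>2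
        by (rule order_trans) (intro mult_left_mono p1, simp)
      also have "\<dots> = \<bar>\<xi>\<bar> ^ 2 * (2 * (\<mu> + V + 1 + W) * X) * ((1 + \<zeta>\<^sup>2) * gauss (\<mu> / 2) \<zeta>)" by (simp add: power2_eq_square mult_ac)
      also have "\<dots> \<le> \<bar>\<xi>\<bar> ^ 2 * (2 * (\<mu> + V + 1 + W) * X) * ((1 + 4 / \<mu>) * gauss (\<mu> / 4) \<zeta>)"
        using \<mu>0 V0 W0 X by (intro mult_left_mono p2) auto
      also have "\<dots> = L * X * t powr 0 * \<bar>\<xi>\<bar> ^ 2 * gauss (\<mu> / 4 * t) \<xi>"
        unfolding L_def mult.assoc[of "\<mu> / 4"] \<zeta>2 using t by (simp only: powr_zero_eq_one) (simp add: mult_ac)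
      finally show "cmod (far \<tau> y t \<xi>) \<le> L * X * t powr 0 * \<bar>\<xi>\<bar> ^ 2 * gauss (\<mu> / 4 * t) \<xi>" .
    qed measurable
    show "small t (\<lambda>x. K1 (t - \<tau>) (x - y) - K0 t x) (C * t powr (- (1/2)) * min 1 ((1 + \<tau> + \<bar>y\<bar>) * t powr (- (1/2))))"
      unfolding f X_def[symmetric]
    proof (cases "1 \<le> X * t powr (- (1/2))")
      case True
      have "2 * gauss_const 1 (\<mu> / 2) * t powr (0 - real 1 / 2) \<le> C * t powr (- (1/2)) * 1"
        unfolding C_def using L0 gauss_const_nonneg[of 2 "\<mu> / 4"] by (simp add: mult_right_mono)
      then show "small t (ift (far \<tau> y t)) (C * t powr (- (1/2)) * min 1 (X * t powr (- (1/2))))"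
        using True by (intro small_mono[OF 1]) (simp add: min_absorb1)
    next
      case False
      have "L * X * gauss_const 2 (\<mu> / 4) * t powr (0 - real 2 / 2) = L * gauss_const 2 (\<mu> / 4) * t powr (- (1/2)) * (X * t powr (- (1/2)))"
      proof -
        have "t powr (- (1/2)) * t powr (- (1/2)) = t powr (0 - real 2 / 2)" by (subst powr_add[symmetric]) simp
        then have "L * gauss_const 2 (\<mu> / 4) * X * (t powr (- (1/2)) * t powr (- (1/2))) = L * gauss_const 2 (\<mu> / 4) * X * t powr (0 - real 2 / 2)" by (simp only:)
        then show ?thesis by (simp only: mult_ac)
      qed
      also have "\<dots> \<le> C * t powr (- (1/2)) * (X * t powr (- (1/2)))"
        unfolding C_def using gauss_const_nonneg[of 1 "\<mu> / 2"] X by (intro mult_right_mono) auto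
      finally have "L * X * gauss_const 2 (\<mu> / 4) * t powr (0 - real 2 / 2) \<le> C * t powr (- (1/2)) * min 1 (X * t powr (- (1/2)))"
        using False by (simp add: min_absorb2)
      then show "small t (ift (far \<tau> y t)) (C * t powr (- (1/2)) * min 1 (X * t powr (- (1/2))))" by (rule small_mono[OF 2])
    qed
  qed
qed

end

subsection \<open>Integrable forcing\<close>

locale solution_supercritical = solution +
  assumes p3: "p > 3"
begin

lemma \<alpha>1: "\<alpha> > 1" using p3 by (simp add: \<alpha>_def)

abbreviation "LL \<equiv> (lborel :: real measure) \<Otimes>\<^sub>M (lborel :: real measure)"

text \<open>The forcing as one function on space-time, extended by 0 to negative times. Its
  integrability over the product, which uses \<alpha> > 1, turns \<open>nonlinear_mass\<close> into
  an absolutely convergent double integral.\<close>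

definition "gp z = indicator {0<..} (fst z) *\<^sub>R g (fst z) (snd z)"

lemma g_LL [measurable]: "(\<lambda>z. g (fst z) (snd z)) \<in> borel_measurable LL"
proof -
  have "(\<lambda>z. g (fst z) (snd z)) \<in> borel_measurable (borel \<Otimes>\<^sub>M borel)" using g_measurable_pair by (simp add: split_beta')
  then show ?thesis by (simp cong: measurable_cong_sets add: sets_pair_measure_cong[of lborel borel lborel borel])
qed

lemma gp_integrable: "integrable LL gp"
proof (rule integrableI_bounded)
  show m: "gp \<in> borel_measurable LL" unfolding gp_def[abs_def] by measurable
  obtain A where A: "A \<ge> 0" "forcing g (\<lambda>\<tau>. A * (1 + \<tau>) powr (- \<alpha>))"
    using g_bounds by blast
  have "(\<integral>\<^sup>+ z. ennreal (norm (gp z)) \<partial>LL) = (\<integral>\<^sup>+ \<tau>. \<integral>\<^sup>+ y. ennreal (norm (gp (\<tau>, y))) \<partial>lborel \<partial>lborel)"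
    by (rule lborel.nn_integral_fst[symmetric]) (use m in measurable)
  also have "\<dots> \<le> (\<integral>\<^sup>+ \<tau>. ennreal A * ennreal (indicator {0<..} \<tau> * (1 + \<tau>) powr (- \<alpha>)) \<partial>lborel)"
  proof (rule nn_integral_mono)
    fix \<tau> :: real
    show "(NN y. norm (gp (\<tau>, y))) \<le> ennreal A * ennreal (indicator {0<..} \<tau> * (1 + \<tau>) powr (- \<alpha>))"
    proof (cases "\<tau> > 0")
      case True
      then show ?thesis using forcingD(1)[OF A(2), of \<tau>] A(1) by (simp add: gp_def ennreal_mult)
    qed (simp add: gp_def)
  qed
  also have "\<dots> = ennreal A * (NN \<tau>. indicator {0<..} \<tau> * (1 + \<tau>) powr (- \<alpha>))"
    by (rule nn_integral_cmult) measurable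
  also have "\<dots> \<le> ennreal A * ennreal (1 / (\<alpha> - 1))" by (intro mult_left_mono nn_integral_one_plus_powr \<alpha>1) auto
  also have "\<dots> < \<infinity>" by (simp add: ennreal_mult_less_top)
  finally show "(\<integral>\<^sup>+ z. ennreal (norm (gp z)) \<partial>LL) < \<infinity>" .
qed

lemma nonlinear_mass_eq: "Cx (nonlinear_mass p u) = (\<integral>z. gp z \<partial>LL)"
proof -
  have "Cx (nonlinear_mass p u) = Cx (LBINT \<tau>. indicator {0<..} \<tau> * (LBINT y. nonlin p (U \<tau>) y))"
    unfolding nonlinear_mass_def set_lebesgue_integral_def real_scaleR_def
  proof (rule arg_cong[where f = Cx], rule Bochner_Integration.integral_cong[OF refl])
    fix \<tau> :: real
    show "indicator {0<..} \<tau> * (LBINT y. nonlin p (u \<tau>) y) = indicator {0<..} \<tau> * (LBINT y. nonlin p (U \<tau>) y)"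
    proof (cases "\<tau> > 0")
      case True
      have [measurable]: "u \<tau> \<in> borel_measurable borel" using True by (intro u_measurable) auto
      have "(LBINT y. nonlin p (u \<tau>) y) = (LBINT y. nonlin p (U \<tau>) y)"
        by (rule integral_cong_AE) (use nonlin_AE[of \<tau>] True in auto)
      then show ?thesis by simp
    qed simp
  qed
  also have "\<dots> = (LBINT \<tau>. LBINT y. gp (\<tau>, y))"
    unfolding gp_def g_def by (simp add: scaleR_conv_of_real flip: integral_complex_of_real)
  also have "\<dots> = (\<integral>z. gp z \<partial>LL)"
    using lborel_pair.integral_fst'[OF gp_integrable] by simp
  finally show ?thesis .
qed

definition "I t = (\<integral>z. indicator {0<..<t/2} (fst z) *\<^sub>R g (fst z) (snd z) \<partial>LL)"

lemma I_limit: "((\<lambda>t. cmod (I t - Cx (nonlinear_mass p u))) \<longlongrightarrow> 0) at_top"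
proof (rule tendsto_norm_zero, rule LIM_zero, rule tendsto_at_topI_sequentially)
  fix X :: "nat \<Rightarrow> real" assume X: "filterlim X at_top sequentially"
  show "(\<lambda>n. I (X n)) \<longlonglongrightarrow> Cx (nonlinear_mass p u)"
    unfolding I_def nonlinear_mass_eq
  proof (rule integral_dominated_convergence[OF _ _ integrable_norm[OF gp_integrable]])
    show "gp \<in> borel_measurable LL" using gp_integrable by auto
    show "AE z in LL. (\<lambda>n. indicator {0<..<X n / 2} (fst z) *\<^sub>R g (fst z) (snd z)) \<longlonglongrightarrow> gp z"
    proof (rule AE_I2)
      fix z :: "real \<times> real"
      have "\<forall>\<^sub>F n in sequentially. 2 * fst z < X n" using X by (simp add: filterlim_at_top_dense)
      then have "\<forall>\<^sub>F n in sequentially. indicator {0<..<X n / 2} (fst z) *\<^sub>R g (fst z) (snd z) = gp z"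
        by eventually_elim (auto simp: gp_def indicator_def)
      then show "(\<lambda>n. indicator {0<..<X n / 2} (fst z) *\<^sub>R g (fst z) (snd z)) \<longlonglongrightarrow> gp z" by (rule tendsto_eventually)
    qed
  qed (auto simp: gp_def indicator_def)
qed

lemma K1_bounded: "s > 0 \<Longrightarrow> cmod (K1 s x) \<le> gauss_const 1 \<mu> * s powr (- 1)"
proof -
  assume s: "s > 0"
  have "cmod (K1 s x) \<le> gauss_const 1 \<mu> * s powr (- (1/2)) * s powr (- (1/2))" using small_K(1)[OF s] by (simp add: small_def)
  also have "\<dots> = gauss_const 1 \<mu> * (s powr (- (1/2)) * s powr (- (1/2)))" by (rule mult.assoc)
  also have "s powr (- (1/2)) * s powr (- (1/2)) = s powr (- 1)" by (subst powr_add[symmetric]) simp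
  finally show ?thesis .
qed

text \<open>The early half of the Duhamel integral, after subtraction of the value it would have if
  all forcing before t/2 acted at time 0 and at the origin with the kernel K0.\<close>

definition "farD t x = (\<integral>z. (indicator {0<..<t/2} (fst z) *\<^sub>R (K1 (t - fst z) (x - snd z) - K0 t x)) * g (fst z) (snd z) \<partial>LL)"

lemma K1_LL [measurable]: "(\<lambda>w. K1 (t - fst (fst w)) (snd w - snd (fst w))) \<in> borel_measurable (LL \<Otimes>\<^sub>M borel)"
  "(\<lambda>z. K1 (t - fst z) (x - snd z)) \<in> borel_measurable LL"
  using measurable_compose[of "\<lambda>w. (t - fst (fst w), snd w - snd (fst w))" "LL \<Otimes>\<^sub>M borel" "borel \<Otimes>\<^sub>M borel" "\<lambda>(s, x). K1 s x" borel]
    measurable_compose[of "\<lambda>z. (t - fst z, x - snd z)" LL "borel \<Otimes>\<^sub>M borel" "\<lambda>(s, x). K1 s x" borel] K_measurable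
  by simp_all

text \<open>Minkowski's inequality with \<open>small_far\<close> bounds the error by t^(-1/2) times
  the integral of \<open>h t\<close>. This integrand is at most C |gp| and tends to 0 pointwise, so
  dominated convergence gives o(t^(-1/2)); the forcing is only known to be integrable, hence no
  rate.\<close>

lemma small_farD: "\<exists>\<rho>. (\<forall>t\<ge>1. small t (farD t) (\<rho> t)) \<and> ((\<lambda>t. \<rho> t / t powr (- (1/2))) \<longlongrightarrow> 0) at_top"
proof -
  obtain C where C: "C \<ge> 0" "\<And>t \<tau> y. t \<ge> 1 \<Longrightarrow> 0 \<le> \<tau> \<Longrightarrow> \<tau> \<le> t / 2 \<Longrightarrow>
     small t (\<lambda>x. K1 (t - \<tau>) (x - y) - K0 t x) (C * t powr (- (1/2)) * min 1 ((1 + \<tau> + \<bar>y\<bar>) * t powr (- (1/2))))"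
    using small_far by blast
  define h where "h t z = indicator {0<..<t/2} (fst z) * (C * min 1 ((1 + \<bar>fst z\<bar> + \<bar>snd z\<bar>) * t powr (- (1/2)))) * cmod (gp z)" for t and z :: "real \<times> real"
  have gpm [measurable]: "gp \<in> borel_measurable LL" using gp_integrable by auto
  have hm [measurable]: "h t \<in> borel_measurable LL" for t unfolding h_def[abs_def] by measurable
  have h0: "0 \<le> h t z" for t z using C(1) by (auto simp: h_def intro!: mult_nonneg_nonneg)
  have hle: "h t z \<le> C * cmod (gp z)" for t z
    unfolding h_def using C(1) by (intro mult_right_mono) (auto simp: indicator_def mult_left_le)
  have hi: "integrable LL (h t)" for t
    by (rule Bochner_Integration.integrable_bound[OF integrable_mult_right[OF integrable_norm[OF gp_integrable], of C]])
      (use h0 hle C(1) in auto)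
  define \<rho> where "\<rho> t = t powr (- (1/2)) * (\<integral>z. h t z \<partial>LL)" for t
  have sm: "small t (farD t) (\<rho> t)" if t1: "t \<ge> 1" for t
    unfolding farD_def
  proof (rule small_integral[where \<rho> = "\<lambda>z. indicator {0<..<t/2} (fst z) * (C * t powr (- (1/2)) * min 1 ((1 + \<bar>fst z\<bar> + \<bar>snd z\<bar>) * t powr (- (1/2))))"])
    show "sigma_finite_measure LL" by (rule lborel_pair.sigma_finite_measure_axioms)
    have [measurable]: "(\<lambda>w. K0 t (snd w)) \<in> borel_measurable (LL \<Otimes>\<^sub>M borel)" by measurable
    show "(\<lambda>(z, x). indicator {0<..<t/2} (fst z) *\<^sub>R (K1 (t - fst z) (x - snd z) - K0 t x)) \<in> borel_measurable (LL \<Otimes>\<^sub>M borel)"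
      unfolding split_beta' by measurable
    show "small t (\<lambda>x. indicator {0<..<t/2} (fst z) *\<^sub>R (K1 (t - fst z) (x - snd z) - K0 t x))
      (indicator {0<..<t/2} (fst z) * (C * t powr (- (1/2)) * min 1 ((1 + \<bar>fst z\<bar> + \<bar>snd z\<bar>) * t powr (- (1/2)))))" for z
      using C(2)[OF t1, of "fst z" "snd z"] small_zero[of t] by (cases "fst z \<in> {0<..<t/2}") auto
    have "(\<integral>\<^sup>+ z. ennreal (indicator {0<..<t/2} (fst z) * (C * t powr (- (1/2)) * min 1 ((1 + \<bar>fst z\<bar> + \<bar>snd z\<bar>) * t powr (- (1/2)))) * cmod (g (fst z) (snd z))) \<partial>LL)
      = (\<integral>\<^sup>+ z. ennreal (t powr (- (1/2)) * h t z) \<partial>LL)"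
      by (intro nn_integral_cong) (auto simp: h_def gp_def indicator_def mult_ac)
    also have "\<dots> = ennreal (\<integral>z. t powr (- (1/2)) * h t z \<partial>LL)"
      by (rule nn_integral_eq_integral) (use hi h0 in auto)
    finally show "(\<integral>\<^sup>+ z. ennreal (indicator {0<..<t/2} (fst z) * (C * t powr (- (1/2)) * min 1 ((1 + \<bar>fst z\<bar> + \<bar>snd z\<bar>) * t powr (- (1/2)))) * cmod (g (fst z) (snd z))) \<partial>LL) \<le> ennreal (\<rho> t)"
      by (simp add: \<rho>_def)
    show "0 \<le> \<rho> t" unfolding \<rho>_def by (intro mult_nonneg_nonneg integral_nonneg_AE) (auto simp: h0)
  qed measurable
  have lim: "((\<lambda>t. \<integral>z. h t z \<partial>LL) \<longlongrightarrow> 0) at_top"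
  proof (rule tendsto_at_topI_sequentially)
    fix X :: "nat \<Rightarrow> real" assume X: "filterlim X at_top sequentially"
    have "(\<lambda>n. \<integral>z. h (X n) z \<partial>LL) \<longlonglongrightarrow> (\<integral>z. 0 \<partial>LL)"
    proof (rule integral_dominated_convergence[where w = "\<lambda>z. C * cmod (gp z)"])
      show "integrable LL (\<lambda>z. C * cmod (gp z))" by (intro integrable_mult_right integrable_norm gp_integrable)
      show "AE z in LL. (\<lambda>n. h (X n) z) \<longlonglongrightarrow> 0"
      proof (rule AE_I2)
        fix z :: "real \<times> real"
        have "(\<lambda>n. C * ((1 + \<bar>fst z\<bar> + \<bar>snd z\<bar>) * X n powr (- (1/2))) * cmod (gp z)) \<longlonglongrightarrow> C * ((1 + \<bar>fst z\<bar> + \<bar>snd z\<bar>) * 0) * cmod (gp z)"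
          by (intro tendsto_intros tendsto_neg_powr[OF _ X]) simp
        then have l: "(\<lambda>n. C * ((1 + \<bar>fst z\<bar> + \<bar>snd z\<bar>) * X n powr (- (1/2))) * cmod (gp z)) \<longlonglongrightarrow> 0" by simp
        show "(\<lambda>n. h (X n) z) \<longlonglongrightarrow> 0"
        proof (rule Lim_null_comparison[OF _ l], intro always_eventually allI)
          fix n
          have "h (X n) z \<le> 1 * (C * ((1 + \<bar>fst z\<bar> + \<bar>snd z\<bar>) * X n powr (- (1/2)))) * cmod (gp z)"
            unfolding h_def using C(1) by (intro mult_right_mono mult_mono mult_left_mono) (auto simp: indicator_def)
          then show "norm (h (X n) z) \<le> C * ((1 + \<bar>fst z\<bar> + \<bar>snd z\<bar>) * X n powr (- (1/2))) * cmod (gp z)" using h0 by simp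
        qed
      qed
      show "AE z in LL. norm (h (X n) z) \<le> C * cmod (gp z)" for n using h0 hle by simp
    qed measurable
    then show "(\<lambda>n. \<integral>z. h (X n) z \<partial>LL) \<longlonglongrightarrow> 0" by simp
  qed
  show ?thesis
  proof (intro exI[of _ \<rho>] conjI allI impI sm)
    show "((\<lambda>t. \<rho> t / t powr (- (1/2))) \<longlongrightarrow> 0) at_top"
    proof (rule Lim_transform_eventually[OF lim])
      show "\<forall>\<^sub>F t in at_top. (\<integral>z. h t z \<partial>LL) = \<rho> t / t powr (- (1/2))"
        using eventually_gt_at_top[of 0] by eventually_elim (simp add: \<rho>_def)
    qed
  qed
qed

definition "nearD t x = (LBINT \<tau>:{t/2..<t}. conv (K1 (t - \<tau>)) (g \<tau>) x)"

text \<open>Cutting the forcing off before t/2 turns this into a Duhamel integral over the whole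
  interval (0, t), to which \<open>duhamel_weight\<close> applies. Since \<alpha> > 1 the rate
  t^(1/2 - \<alpha>) is o(t^(-1/2)).\<close>

lemma small_nearD: "\<exists>C\<ge>0. \<forall>t>0. small t (nearD t) (C * t powr (1/2 - \<alpha>))"
proof -
  obtain A where A: "A \<ge> 0" "forcing g (\<lambda>\<tau>. A * (1 + \<tau>) powr (- \<alpha>))" using g_bounds by blast
  obtain J where J: "J \<ge> 0" "\<And>t. t > 0 \<Longrightarrow> (NN \<tau>. indicator {t/2..<t} \<tau> * ((t - \<tau>) powr (- (3/4)) * (1 + \<tau>) powr (- \<alpha>))) \<le> ennreal (J * t powr (1 - 3/4 - \<alpha>))"
    using nn_integral_near[of "3/4" \<alpha>] \<alpha>1 by auto
  show ?thesis
  proof (intro exI[of _ "2 * gauss_const 1 \<mu> * (A * J)"] conjI allI impI)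
    show "0 \<le> 2 * gauss_const 1 \<mu> * (A * J)" using A J gauss_const_nonneg by (intro mult_nonneg_nonneg) auto
    fix t :: real assume t: "t > 0"
    define w where "w \<tau> = indicator {t/2..} \<tau> * (1 + \<tau>) powr (- \<alpha>)" for \<tau> :: real
    define g2 where "g2 \<tau> y = indicator {t/2..} \<tau> *\<^sub>R g \<tau> y" for \<tau> y
    have wm: "w \<in> borel_measurable borel" "\<And>\<tau>. 0 \<le> w \<tau>" unfolding w_def[abs_def] by measurable
    have g2m: "(\<lambda>(\<tau>, y). g2 \<tau> y) \<in> borel_measurable (borel \<Otimes>\<^sub>M borel)"
      using g_measurable_pair unfolding g2_def split_beta' by measurable
    have f: "forcing g2 (\<lambda>\<tau>. A * w \<tau>)"
      using A(2) unfolding forcing_def g2_def w_def by (auto simp: indicator_def)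
    have "(NN \<tau>. indicator {0<..<t} \<tau> * ((t - \<tau>) powr (- (1/4 + 1/2)) * w \<tau>))
      = (NN \<tau>. indicator {t/2..<t} \<tau> * ((t - \<tau>) powr (- (3/4)) * (1 + \<tau>) powr (- \<alpha>)))"
      using t by (intro nn_integral_cong arg_cong[where f = ennreal]) (auto simp: w_def indicator_def)
    also note J(2)[OF t]
    finally have Jt: "(NN \<tau>. indicator {0<..<t} \<tau> * ((t - \<tau>) powr (- (1/4 + 1/2)) * w \<tau>)) \<le> ennreal (J * t powr (1 - 3/4 - \<alpha>))" .
    have e: "1/4 + (1 - 3/4 - \<alpha>) = 1/2 - \<alpha>" by simp
    have "duh K1 g2 t = nearD t"
    proof
      fix x
      have "indicator {0<..<t} \<tau> *\<^sub>R conv (K1 (t - \<tau>)) (g2 \<tau>) x = indicator {t/2..<t} \<tau> *\<^sub>R conv (K1 (t - \<tau>)) (g \<tau>) x" for \<tau>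
        using t by (auto simp: indicator_def g2_def conv_def)
      then show "duh K1 g2 t x = nearD t x" unfolding nearD_def set_lebesgue_integral_def by (simp only:)
    qed
    then show "small t (nearD t) (2 * gauss_const 1 \<mu> * (A * J) * t powr (1/2 - \<alpha>))"
      using duhamel_weight(1)[OF K_measurable(1) g2m gauss_const_nonneg A(1) small_K(1) f wm Jt J(1) t] unfolding e by (simp only:)
  qed
qed

lemma Dh_split:
  assumes t1: "t \<ge> 1" shows "Dh t x = farD t x + K0 t x * I t + nearD t x"
proof -
  have t: "t > 0" using t1 by simp
  obtain A where A: "A \<ge> 0" "forcing g (\<lambda>\<tau>. A * (1 + \<tau>) powr (- \<alpha>))"
    using g_bounds by blast
  have y: "(0::real) \<le> 1/2" "1/2 \<le> \<alpha>" "(1/2::real) < 1" using \<alpha>1 by auto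
  have si: "set_integrable lborel {0<..<t} (\<lambda>\<tau>. conv (K1 (t - \<tau>)) (g \<tau>) x)"
    using duhamel_rate[OF K_measurable(1) g_measurable_pair gauss_const_nonneg A(1) small_K(1) A(2) y] t by auto
  have s1: "set_integrable lborel {0<..<t/2} (\<lambda>\<tau>. conv (K1 (t - \<tau>)) (g \<tau>) x)"
    by (rule set_integrable_subset[OF si]) (use t in auto)
  have s2: "set_integrable lborel {t/2..<t} (\<lambda>\<tau>. conv (K1 (t - \<tau>)) (g \<tau>) x)"
    by (rule set_integrable_subset[OF si]) (use t in auto)
  have "{0<..<t} = {0<..<t/2} \<union> {t/2..<t}" using t by auto
  then have "Dh t x = (LBINT \<tau>:{0<..<t/2}. conv (K1 (t - \<tau>)) (g \<tau>) x) + nearD t x"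
    unfolding Dh_def nearD_def by (simp only:) (rule set_integral_Un[OF _ s1 s2], auto)
  also have "(LBINT \<tau>:{0<..<t/2}. conv (K1 (t - \<tau>)) (g \<tau>) x) = farD t x + K0 t x * I t"
  proof -
    let ?k = "\<lambda>z. indicator {0<..<t/2} (fst z) *\<^sub>R (K1 (t - fst z) (x - snd z) * g (fst z) (snd z))"
    let ?lead = "\<lambda>z. K0 t x * (indicator {0<..<t/2} (fst z) *\<^sub>R g (fst z) (snd z))"
    have ik: "integrable LL ?k"
    proof (rule Bochner_Integration.integrable_bound[OF integrable_mult_right[OF integrable_norm[OF gp_integrable], of "gauss_const 1 \<mu> * (t / 2) powr (- 1)"]])
      show "AE z in LL. norm (?k z) \<le> norm (gauss_const 1 \<mu> * (t / 2) powr (- 1) * norm (gp z))"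
      proof (rule AE_I2)
        fix z :: "real \<times> real"
        show "norm (?k z) \<le> norm (gauss_const 1 \<mu> * (t / 2) powr (- 1) * norm (gp z))"
        proof (cases "fst z \<in> {0<..<t/2}")
          case True
          have "cmod (K1 (t - fst z) (x - snd z)) \<le> gauss_const 1 \<mu> * (t - fst z) powr (- 1)" using True t by (intro K1_bounded) auto
          also have "\<dots> \<le> gauss_const 1 \<mu> * (t / 2) powr (- 1)" using True t gauss_const_nonneg by (intro mult_left_mono powr_mono2') auto
          finally have "cmod (K1 (t - fst z) (x - snd z)) * cmod (g (fst z) (snd z)) \<le> gauss_const 1 \<mu> * (t / 2) powr (- 1) * cmod (g (fst z) (snd z))"
            by (rule mult_right_mono) simp
          moreover have "gauss_const 1 \<mu> * (t / 2) powr (- 1) \<ge> 0" using gauss_const_nonneg by simp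
          ultimately show ?thesis using True by (simp add: norm_mult gp_def abs_mult del: powr_minus)
        qed simp
      qed
    qed measurable
    have ik0: "integrable LL ?lead"
      by (rule integrable_mult_right, rule Bochner_Integration.integrable_bound[OF gp_integrable]) (auto simp: gp_def indicator_def)
    have "(LBINT \<tau>:{0<..<t/2}. conv (K1 (t - \<tau>)) (g \<tau>) x) = (LBINT \<tau>. LBINT y. ?k (\<tau>, y))"
      unfolding set_lebesgue_integral_def conv_def by simp
    also have "\<dots> = (\<integral>z. ?k z \<partial>LL)" using lborel_pair.integral_fst'[OF ik] by simp
    also have "\<dots> = (\<integral>z. (?k z - ?lead z) \<partial>LL) + (\<integral>z. ?lead z \<partial>LL)"
      using Bochner_Integration.integral_diff[OF ik ik0] by (simp only: diff_add_cancel)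
    also have "(\<integral>z. (?k z - ?lead z) \<partial>LL) = farD t x"
      unfolding farD_def by (intro Bochner_Integration.integral_cong refl) (auto simp: indicator_def algebra_simps)
    also have "(\<integral>z. ?lead z \<partial>LL) = K0 t x * I t" unfolding I_def by (rule integral_mult_right_zero)
    finally show ?thesis .
  qed
  finally show ?thesis by simp
qed

lemma supercritical:
  assumes q: "q \<ge> 2"
  shows "leading_order (\<lambda>t. Lq_norm q (\<lambda>x. dev t x))
    (Lq_norm q (\<lambda>x. (mm + nonlinear_mass p u) * deriv (heat \<mu> 1) x + 2 * B * M / b ^ 3 * (deriv ^^ 3) (heat \<mu> 1) x))
    (\<lambda>t. t powr (- (1 / 2 * (1 - real_of_ereal (1 / q)))) * t powr (- (1/2)))"
proof -
  define N where "N = nonlinear_mass p u"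
  \<comment> \<open>The sign is real: the moment enters the transform as -i m \<xi>, the Duhamel
    term is subtracted, and the cubic phase gives -(i \<xi>)^3. The norm does not see it.\<close>
  define \<Phi> where "\<Phi> x = - ((mm + N) * deriv (heat \<mu> 1) x + M * W * (deriv ^^ 3) (heat \<mu> 1) x)" for x
  obtain \<rho>1 where \<rho>1: "\<And>t. t \<ge> 1 \<Longrightarrow> small t (lin_rem t) (\<rho>1 t)" "((\<lambda>t. \<rho>1 t / t powr (- (1/2))) \<longlongrightarrow> 0) at_top"
    using linear_first_order by blast
  obtain \<rho>2 where \<rho>2: "\<And>t. t \<ge> 1 \<Longrightarrow> small t (farD t) (\<rho>2 t)" "((\<lambda>t. \<rho>2 t / t powr (- (1/2))) \<longlongrightarrow> 0) at_top"
    using small_farD by blast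
  obtain C where C: "C \<ge> 0" "\<And>t. t > 0 \<Longrightarrow> small t (nearD t) (C * t powr (1/2 - \<alpha>))" using small_nearD by blast
  define \<rho> where "\<rho> t = \<rho>1 t + (\<rho>2 t + C * t powr (1/2 - \<alpha>) + cmod (I t - Cx N) * (gauss_const 1 \<mu> * t powr (- (1/2))))" for t
  have h1: "Cx (deriv (heat \<mu> 1) x) = ift (gk 1) x" for x using heat_deriv[of 1 x] by simp
  have h3: "Cx ((deriv ^^ 3) (heat \<mu> 1) x) = ift (gk 3) x" for x by (rule heat_deriv)
  have \<Phi>c: "Cx (\<Phi> x) = - (Cx (mm + N) * ift (gk 1) x + Cx (M * W) * ift (gk 3) x)" for x
    unfolding \<Phi>_def h1[symmetric] h3[symmetric] by simp
  have \<Phi>s: "small 1 (\<lambda>x. Cx (\<Phi> x)) (cmod (- 1) * (cmod (Cx (mm + N)) * gauss_const 1 \<mu> + cmod (Cx (M * W)) * gauss_const 3 \<mu>))"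
    using small_cmult[OF small_add[OF small_cmult[OF small_gk[of 1], of "Cx (mm + N)"] small_cmult[OF small_gk[of 3], of "Cx (M * W)"]], of "- 1"]
    unfolding \<Phi>c by simp
  have \<Phi>m: "\<Phi> \<in> borel_measurable borel"
  proof -
    have "(\<lambda>x. Re (Cx (\<Phi> x))) \<in> borel_measurable borel" using small_measurable[OF \<Phi>s] by measurable
    then show ?thesis by simp
  qed
  have "leading_order (\<lambda>t. Lq_norm q (\<lambda>x. dev t x)) (Lq_norm q \<Phi>)
    (\<lambda>t. t powr (- (1 / 2 * (1 - real_of_ereal (1 / q)))) * t powr (- (1/2)))"
  proof (rule leading_order_main[where V = V and \<rho> = \<rho>, OF q \<Phi>m \<Phi>s])
    show "\<forall>\<^sub>F t in at_top. (\<lambda>x. dev t x) \<in> borel_measurable borel \<and> 0 < t powr (- (1/2)) \<and>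
       (\<exists>R. small t R (\<rho> t) \<and> (AE x in lborel. Cx (dev t x) =
          Cx (t powr (- (1/2)) * t powr (- (1/2)) * \<Phi> ((x - V * t) / sqrt t)) + R x))"
      using eventually_ge_at_top[of 1]
    proof eventually_elim
      case (elim t)
      then have t: "t > 0" by simp
      have [measurable]: "u t \<in> borel_measurable borel" using t by (intro u_measurable) simp
      have hd [measurable]: "heat_drift B b \<mu> t \<in> borel_measurable borel" unfolding heat_drift_def[abs_def] by measurable
      \<comment> \<open>Four errors: the linear remainder, the two parts of the Duhamel integral,
        and the forcing mass that has not been collected by time t/2.\<close>
      let ?R = "\<lambda>x. lin_rem t x - (farD t x + nearD t x + (I t - Cx N) * K0 t x)"
      have "small t ?R (\<rho> t)" unfolding \<rho>_def
        by (intro small_diff small_add small_cmult \<rho>1 \<rho>2 C small_K elim t)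
      moreover have "AE x in lborel. Cx (dev t x) =
          Cx (t powr (- (1/2)) * t powr (- (1/2)) * \<Phi> ((x - V * t) / sqrt t)) + ?R x"
        using duhamel[OF t]
      proof eventually_elim
        case (elim x)
        define z where "z = (x - V * t) / sqrt t"
        define T where "T = Cx (t powr (- (1/2)) * t powr (- (1/2)))"
        have k0: "K0 t x = T * ift (gk 1) z"
          using ift_xi_smb0[OF t, of 1 x] unfolding K0_def T_def z_def by (simp del: of_real_mult)
        have k1: "ift (\<lambda>\<xi>. (\<i> * Cx \<xi>) ^ 1 * smb0 t \<xi>) x = T * ift (gk 1) z"
          using ift_xi_smb0[OF t, of 1 x] unfolding T_def z_def by (simp del: of_real_mult)
        have k3: "Cx t * ift (\<lambda>\<xi>. (\<i> * Cx \<xi>) ^ 3 * smb0 t \<xi>) x = T * ift (gk 3) z"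
        proof -
          have "t * (t powr (- (real 3 / 2)) * t powr (- (1/2))) = t powr (- (1/2)) * t powr (- (1/2))"
          proof -
            have "t * (t powr (- (real 3 / 2)) * t powr (- (1/2))) = t powr 1 * (t powr (- (real 3 / 2)) * t powr (- (1/2)))" using t by simp
            then show ?thesis unfolding powr_add[symmetric] by simp
          qed
          then have "Cx t * Cx (t powr (- (real 3 / 2)) * t powr (- (1/2))) = T"
            unfolding T_def by (simp only: of_real_mult[symmetric])
          then show ?thesis unfolding ift_xi_smb0[OF t] z_def mult.assoc[symmetric] by (simp only:)
        qed
        have lr: "ift (\<lambda>\<xi>. smb t \<xi> * uh \<xi>) x - Cx M * Cx (heat_drift B b \<mu> t x) = lin_rem t x - Cx mm * (T * ift (gk 1) z) - Cx (M * W) * (T * ift (gk 3) z)"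
        proof -
          have "Cx (M * W * t) * ift (\<lambda>\<xi>. (\<i> * Cx \<xi>) ^ 3 * smb0 t \<xi>) x = Cx (M * W) * (T * ift (gk 3) z)"
            unfolding k3[symmetric] by (simp only: of_real_mult mult.assoc)
          then show ?thesis unfolding lin_rem_def k1 heat_drift_eq[OF t] by simp
        qed
        have \<Phi>z: "Cx (t powr (- (1/2)) * t powr (- (1/2)) * \<Phi> z) = - (T * (Cx (mm + N) * ift (gk 1) z + Cx (M * W) * ift (gk 3) z))"
          unfolding of_real_mult[of _ "\<Phi> z"] \<Phi>c T_def by (simp only: mult_minus_right)
        have "Cx (dev t x) = (ift (\<lambda>\<xi>. smb t \<xi> * uh \<xi>) x - Cx M * Cx (heat_drift B b \<mu> t x)) - Dh t x"
          using elim by simp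
        also have "\<dots> = Cx (t powr (- (1/2)) * t powr (- (1/2)) * \<Phi> z) + ?R x"
          unfolding lr \<Phi>z Dh_split[OF \<open>1 \<le> t\<close>] k0 by (simp add: algebra_simps)
        finally show ?case unfolding z_def .
      qed
      ultimately show ?case using t by auto
    qed
    have l3: "((\<lambda>t. C * t powr (1 - \<alpha>)) \<longlongrightarrow> C * 0) at_top"
    proof (intro tendsto_mult_left)
      have "((\<lambda>t. t powr (- (\<alpha> - 1))) \<longlongrightarrow> 0) at_top" by (rule tendsto_neg_powr[OF _ filterlim_ident]) (use \<alpha>1 in simp)
      then show "((\<lambda>t. t powr (1 - \<alpha>)) \<longlongrightarrow> 0) at_top" by simp
    qed
    have "((\<lambda>t. \<rho>1 t / t powr (- (1/2)) + (\<rho>2 t / t powr (- (1/2)) + C * t powr (1 - \<alpha>) + cmod (I t - Cx N) * gauss_const 1 \<mu>)) \<longlongrightarrow> 0 + (0 + C * 0 + 0 * gauss_const 1 \<mu>)) at_top"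
      unfolding N_def by (intro tendsto_intros \<rho>1 \<rho>2 l3 I_limit)
    then have l: "((\<lambda>t. \<rho>1 t / t powr (- (1/2)) + (\<rho>2 t / t powr (- (1/2)) + C * t powr (1 - \<alpha>) + cmod (I t - Cx N) * gauss_const 1 \<mu>)) \<longlongrightarrow> 0) at_top" by simp
    show "((\<lambda>t. \<rho> t / t powr (- (1/2))) \<longlongrightarrow> 0) at_top"
    proof (rule Lim_transform_eventually[OF l])
      show "\<forall>\<^sub>F t in at_top. \<rho>1 t / t powr (- (1/2)) + (\<rho>2 t / t powr (- (1/2)) + C * t powr (1 - \<alpha>) + cmod (I t - Cx N) * gauss_const 1 \<mu>) = \<rho> t / t powr (- (1/2))"
        using eventually_gt_at_top[of 0]
      proof eventually_elim
        case (elim t)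
        have n: "t powr (- (1/2)) \<noteq> 0" using elim by simp
        have "t powr (1/2 - \<alpha>) / t powr (- (1/2)) = t powr (1 - \<alpha>)" by (subst powr_diff[symmetric]) simp
        then have e: "C * t powr (1 - \<alpha>) = C * t powr (1/2 - \<alpha>) / t powr (- (1/2))" by (simp only: times_divide_eq_right[symmetric])
        have e2: "cmod (I t - Cx N) * (gauss_const 1 \<mu> * t powr (- (1/2))) / t powr (- (1/2)) = cmod (I t - Cx N) * gauss_const 1 \<mu>" using n by (simp del: powr_minus)
        show ?case unfolding \<rho>_def add_divide_distrib e e2 by (simp only: add.assoc)
      qed
    qed
  qed
  moreover have "Lq_norm q \<Phi> = Lq_norm q (\<lambda>x. (mm + nonlinear_mass p u) * deriv (heat \<mu> 1) x + 2 * B * M / b ^ 3 * (deriv ^^ 3) (heat \<mu> 1) x)"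
  proof -
    have "M * W = 2 * B * M / b ^ 3" by (simp add: W_def)
    then show ?thesis unfolding \<Phi>_def[abs_def] Lq_norm_uminus N_def by (simp only:)
  qed
  ultimately show ?thesis by simp
qed

end

subsection \<open>Self-similar forcing\<close>

lemma small_time:
  assumes "small s f k" "0 < t" "t \<le> s" shows "small t f k"
  unfolding small_def
proof (intro conjI allI)
  have le: "s powr (- (1/2)) \<le> t powr (- (1/2))" using assms by (intro powr_mono2') auto
  have k: "k \<ge> 0" by (rule small_nonneg[OF assms(1)])
  show "f \<in> borel_measurable borel" by (rule small_measurable[OF assms(1)])
  show "0 \<le> k" by (rule k)
  fix x
  have "cmod (f x) \<le> k * s powr (- (1/2))" using assms(1) by (simp add: small_def)
  also have "\<dots> \<le> k * t powr (- (1/2))" by (rule mult_left_mono[OF le k])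
  finally show "cmod (f x) \<le> k * t powr (- (1/2))" .
next
  have le: "s powr (- (1/2)) \<le> t powr (- (1/2))" using assms by (intro powr_mono2') auto
  have "L2sq f \<le> ennreal (k\<^sup>2 * s powr (- (1/2)))" using assms(1) by (simp add: small_def)
  also have "\<dots> \<le> ennreal (k\<^sup>2 * t powr (- (1/2)))" by (intro ennreal_leI mult_left_mono[OF le]) simp
  finally show "L2sq f \<le> ennreal (k\<^sup>2 * t powr (- (1/2)))" .
qed

lemma conv_integrable:
  assumes K: "small s K k" and [measurable]: "f \<in> borel_measurable borel"
    and f: "(NN y. cmod (f y)) \<le> ennreal a"
  shows "integrable lborel (\<lambda>y. K (x - y) * f y)"
proof -
  have [measurable]: "K \<in> borel_measurable borel" by (rule small_measurable[OF K])
  have fi: "integrable lborel f"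
    by (rule integrableI_bounded) (use f in \<open>auto intro: le_less_trans\<close>)
  show ?thesis
  proof (rule Bochner_Integration.integrable_bound[OF integrable_mult_right[OF fi, of "Cx (k * s powr (- (1/2)))"]])
    show "AE y in lborel. norm (K (x - y) * f y) \<le> norm (Cx (k * s powr (- (1/2))) * f y)"
    proof (rule AE_I2)
      fix y
      have "cmod (K (x - y)) \<le> k * s powr (- (1/2))" using K by (simp add: small_def)
      also have "\<dots> \<le> cmod (Cx (k * s powr (- (1/2))))" unfolding norm_of_real by (rule abs_ge_self)
      finally show "norm (K (x - y) * f y) \<le> norm (Cx (k * s powr (- (1/2))) * f y)"
        unfolding norm_mult by (rule mult_right_mono) simp
    qed
  qed measurable
qed

lemma heat_fourier:
  assumes s: "\<mu> * s > 0"
  shows "(LBINT y. iexp (- (\<xi> * y)) * Cx (heat \<mu> s (y - c)))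
    = iexp (- (\<xi> * c)) * Cx (gauss (\<mu> * s) \<xi>)"
proof -
  have pos: "1 / (4 * \<mu> * s) > 0" using s by (simp add: mult.assoc)
  have "(LBINT y. iexp (- (\<xi> * y)) * Cx (heat \<mu> s (y - c)))
    = (LBINT y. iexp (- (\<xi> * (c + 1 * y))) * Cx (heat \<mu> s (c + 1 * y - c)))"
    using lborel_integral_real_affine[of 1 "\<lambda>y. iexp (- (\<xi> * y)) * Cx (heat \<mu> s (y - c))" c] by simp
  also have "\<dots> = (LBINT y. (iexp (- (\<xi> * c)) * Cx (1 / sqrt (4 * pi * \<mu> * s))) *
       (iexp ((- \<xi>) * y) * Cx (gauss (1 / (4 * \<mu> * s)) y)))"
  proof (rule Bochner_Integration.integral_cong[OF refl])
    fix y
    have e: "iexp (- (\<xi> * (c + 1 * y))) = iexp (- (\<xi> * c)) * iexp ((- \<xi>) * y)"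
      by (simp add: exp_add[symmetric] algebra_simps)
    have h: "heat \<mu> s (c + 1 * y - c) = 1 / sqrt (4 * pi * \<mu> * s) * gauss (1 / (4 * \<mu> * s)) y" by (simp add: heat_def)
    show "iexp (- (\<xi> * (c + 1 * y))) * Cx (heat \<mu> s (c + 1 * y - c)) = (iexp (- (\<xi> * c)) * Cx (1 / sqrt (4 * pi * \<mu> * s))) *
       (iexp ((- \<xi>) * y) * Cx (gauss (1 / (4 * \<mu> * s)) y))"
      unfolding e h of_real_mult by (simp only: mult_ac)
  qed
  also have "\<dots> = (iexp (- (\<xi> * c)) * Cx (1 / sqrt (4 * pi * \<mu> * s))) *
       Cx (sqrt (pi / (1 / (4 * \<mu> * s))) * exp (- ((- \<xi>)\<^sup>2 / (4 * (1 / (4 * \<mu> * s))))))"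
    unfolding integral_mult_right_zero fourier_gauss[OF pos] ..
  also have "\<dots> = iexp (- (\<xi> * c)) * Cx (1 / sqrt (4 * pi * \<mu> * s) * (sqrt (pi / (1 / (4 * \<mu> * s))) * exp (- ((- \<xi>)\<^sup>2 / (4 * (1 / (4 * \<mu> * s)))))))"
    by (simp only: of_real_mult mult.assoc)
  also have "1 / sqrt (4 * pi * \<mu> * s) * (sqrt (pi / (1 / (4 * \<mu> * s))) * exp (- ((- \<xi>)\<^sup>2 / (4 * (1 / (4 * \<mu> * s)))))) = gauss (\<mu> * s) \<xi>"
  proof -
    have 1: "pi / (1 / (4 * \<mu> * s)) = 4 * pi * \<mu> * s" "(- \<xi>)\<^sup>2 / (4 * (1 / (4 * \<mu> * s))) = \<mu> * s * \<xi>\<^sup>2" by simp_all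
    have "4 * pi * \<mu> * s > 0" using s by (simp add: mult.assoc)
    then have "sqrt (4 * pi * \<mu> * s) \<noteq> 0" by (simp only: real_sqrt_eq_zero_cancel_iff)
    moreover have "1 / c * (c * e) = e" if "c \<noteq> 0" for c e :: real using that by simp
    ultimately show ?thesis unfolding 1 by blast
  qed
  finally show ?thesis .
qed

lemma heat_shift_integrable:
  assumes "\<mu> * s > 0" shows "integrable lborel (\<lambda>y. Cx (heat \<mu> s (y - c)))"
  using lborel_integrable_real_affine[OF integrable_heat(1)[OF assms], of 1 "- c"] by simp

lemma heat_powr:
  assumes "\<mu> > 0" "\<tau> > 0" "p > 0"
  shows "heat \<mu> \<tau> z powr p = (4 * pi * \<mu>) powr (- ((p - 1) / 2)) * p powr (- (1/2)) * \<tau> powr (- ((p - 1) / 2)) * heat \<mu> (\<tau> / p) z"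
proof -
  define A where "A = 4 * pi * \<mu> * \<tau>"
  have A: "A > 0" using assms by (simp add: A_def)
  have r: "1 / sqrt X = X powr (- (1/2))" if "X > 0" for X :: real using that by (simp add: powr_minus_divide powr_half_sqrt)
  have L: "heat \<mu> \<tau> z powr p = A powr (- (p / 2)) * exp (- (p * z\<^sup>2 / (4 * \<mu> * \<tau>)))"
  proof -
    have "heat \<mu> \<tau> z = A powr (- (1/2)) * exp (- (z\<^sup>2 / (4 * \<mu> * \<tau>)))" unfolding heat_def A_def[symmetric] r[OF A] ..
    then have "heat \<mu> \<tau> z powr p = A powr (- (1/2) * p) * exp (- (z\<^sup>2 / (4 * \<mu> * \<tau>)) * p)"
      by (simp only: powr_mult powr_powr exp_powr_real)
    moreover have "- (1/2) * p = - (p / 2)" "- (z\<^sup>2 / (4 * \<mu> * \<tau>)) * p = - (p * z\<^sup>2 / (4 * \<mu> * \<tau>))" by simp_all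
    ultimately show ?thesis by (simp only:)
  qed
  have "4 * pi * \<mu> * (\<tau> / p) = A / p" by (simp add: A_def)
  then have "heat \<mu> (\<tau> / p) z = 1 / sqrt (A / p) * exp (- (z\<^sup>2 / (4 * \<mu> * (\<tau> / p))))" unfolding heat_def by (simp only:)
  also have "z\<^sup>2 / (4 * \<mu> * (\<tau> / p)) = p * z\<^sup>2 / (4 * \<mu> * \<tau>)" by simp
  also have "1 / sqrt (A / p) = A powr (- (1/2)) / p powr (- (1/2))" using A assms by (subst r) (simp_all only: powr_divide, simp_all)
  finally have R: "heat \<mu> (\<tau> / p) z = A powr (- (1/2)) / p powr (- (1/2)) * exp (- (p * z\<^sup>2 / (4 * \<mu> * \<tau>)))" .
  have m: "(4 * pi * \<mu>) powr (- ((p - 1) / 2)) * \<tau> powr (- ((p - 1) / 2)) = A powr (- ((p - 1) / 2))" unfolding A_def by (rule powr_mult[symmetric])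
  have n: "p powr (- (1/2)) \<noteq> 0" using assms by simp
  have "(4 * pi * \<mu>) powr (- ((p - 1) / 2)) * p powr (- (1/2)) * \<tau> powr (- ((p - 1) / 2)) * (A powr (- (1/2)) / p powr (- (1/2)) * exp (- (p * z\<^sup>2 / (4 * \<mu> * \<tau>))))
    = ((4 * pi * \<mu>) powr (- ((p - 1) / 2)) * \<tau> powr (- ((p - 1) / 2))) * A powr (- (1/2)) * (p powr (- (1/2)) / p powr (- (1/2))) * exp (- (p * z\<^sup>2 / (4 * \<mu> * \<tau>)))"
    by (simp only: times_divide_eq_right times_divide_eq_left mult_ac)
  also have "\<dots> = (A powr (- ((p - 1) / 2)) * A powr (- (1/2))) * exp (- (p * z\<^sup>2 / (4 * \<mu> * \<tau>)))" unfolding m by (simp only: divide_self[OF n] mult_1_right)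
  also have "A powr (- ((p - 1) / 2)) * A powr (- (1/2)) = A powr (- (p / 2))" unfolding powr_add[symmetric] by (rule arg_cong[where f = "\<lambda>e. A powr e"]) (simp add: diff_divide_distrib)
  finally show ?thesis unfolding L R by (rule sym)
qed

text \<open>A superposition of kernels is the kernel of the superposed symbols, provided the symbols
  have a common integrable majorant in \<xi> and the weights are integrable.\<close>

lemma ift_integral_swap:
  fixes w :: "real \<Rightarrow> complex" and \<gamma> :: "real \<Rightarrow> real"
  assumes w: "integrable lborel w" and \<gamma>: "integrable lborel \<gamma>"
    and k [measurable]: "(\<lambda>(s, \<xi>). k s \<xi>) \<in> borel_measurable (borel \<Otimes>\<^sub>M borel)"
    and bd: "\<And>s \<xi>. cmod (w s * k s \<xi>) \<le> cmod (w s) * \<gamma> \<xi>"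
  shows "integrable lborel (\<lambda>\<xi>. LBINT s. w s * k s \<xi>)"
    and "(LBINT s. w s * ift (k s) x) = ift (\<lambda>\<xi>. LBINT s. w s * k s \<xi>) x"
proof -
  have wm [measurable]: "w \<in> borel_measurable borel" using w by auto
  have km: "(\<lambda>(s, \<xi>). k s \<xi>) \<in> borel_measurable (lborel \<Otimes>\<^sub>M lborel)"
    using k by (simp cong: measurable_cong_sets add: sets_pair_measure_cong[of lborel borel lborel borel])
  have bd': "norm (w s * k s \<xi>) \<le> norm (w s) * norm (\<gamma> \<xi>)" for s \<xi>
    by (rule order_trans[OF bd]) (intro mult_left_mono, auto)
  have m1: "(\<lambda>(s, \<xi>). w s * k s \<xi>) \<in> borel_measurable (lborel \<Otimes>\<^sub>M lborel)"
    using km unfolding split_beta' by measurable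
  have m2: "(\<lambda>(s, \<xi>). iexp (x * \<xi>) * (w s * k s \<xi>)) \<in> borel_measurable (lborel \<Otimes>\<^sub>M lborel)"
    using km unfolding split_beta' by measurable
  have i1: "integrable (lborel \<Otimes>\<^sub>M lborel) (\<lambda>(s, \<xi>). w s * k s \<xi>)"
    by (rule integrable_pair_bound[OF sigma_finite_lborel sigma_finite_lborel w \<gamma> m1]) (simp only: split bd')
  have i2: "integrable (lborel \<Otimes>\<^sub>M lborel) (\<lambda>(s, \<xi>). iexp (x * \<xi>) * (w s * k s \<xi>))"
    by (rule integrable_pair_bound[OF sigma_finite_lborel sigma_finite_lborel w \<gamma> m2])
      (simp only: split norm_mult[of "iexp _"] norm_exp_i_times mult_1 bd')
  show "integrable lborel (\<lambda>\<xi>. LBINT s. w s * k s \<xi>)" by (rule lborel_pair.integrable_snd[OF i1])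
  have "(LBINT s. w s * ift (k s) x) = (LBINT s. Cx (1 / (2 * pi)) * (LBINT \<xi>. iexp (x * \<xi>) * (w s * k s \<xi>)))"
  proof (rule Bochner_Integration.integral_cong[OF refl])
    fix s
    have "(LBINT \<xi>. iexp (x * \<xi>) * (w s * k s \<xi>)) = (LBINT \<xi>. w s * (iexp (x * \<xi>) * k s \<xi>))" by (simp only: mult_ac)
    then show "w s * ift (k s) x = Cx (1 / (2 * pi)) * (LBINT \<xi>. iexp (x * \<xi>) * (w s * k s \<xi>))"
      unfolding ift_def integral_mult_right_zero by (simp only: mult_ac)
  qed
  also have "\<dots> = Cx (1 / (2 * pi)) * (LBINT \<xi>. LBINT s. iexp (x * \<xi>) * (w s * k s \<xi>))"
    unfolding integral_mult_right_zero lborel_pair.Fubini_integral[OF i2, symmetric] ..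
  also have "\<dots> = ift (\<lambda>\<xi>. LBINT s. w s * k s \<xi>) x" unfolding ift_def integral_mult_right_zero ..
  finally show "(LBINT s. w s * ift (k s) x) = ift (\<lambda>\<xi>. LBINT s. w s * k s \<xi>) x" .
qed

context solution
begin

text \<open>Convolving \<open>\<partial>\<^sub>xG(t - \<tau>)\<close> with \<open>G(\<tau>)\<^sup>p\<close> gives a multiple of \<open>\<partial>\<^sub>xG\<close> at time \<open>(t - \<tau>) + \<tau>/p = t - \<kappa>\<tau>\<close>.\<close>

definition "\<kappa> = 1 - 1 / p"
definition "cp = (4 * pi * \<mu>) powr (- \<alpha>) * p powr (- (1/2))"
definition "Pk s = ift (\<lambda>\<xi>. \<i> * Cx \<xi> * Cx (gauss (\<mu> * s) \<xi>))"
text \<open>In the frame that moves with the drift, the Duhamel integral of the explicit forcing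
  over times in S is a constant times \<open>J S t\<close>.\<close>

definition "J S t z = (LBINT \<tau>. Pk (t - \<kappa> * \<tau>) z * Cx (indicator S \<tau> * \<tau> powr (- \<alpha>)))"

lemma \<kappa>: "0 < \<kappa>" "\<kappa> < 1" using p2 by (auto simp: \<kappa>_def)

lemma \<kappa>_time: "0 \<le> \<tau> \<Longrightarrow> \<tau> \<le> t \<Longrightarrow> t / p \<le> t - \<kappa> * \<tau>"
  using mult_left_mono[of \<tau> t \<kappa>] \<kappa> by (simp add: \<kappa>_def algebra_simps)

lemma heat_power: "\<tau> > 0 \<Longrightarrow> heat \<mu> \<tau> z powr p = cp * \<tau> powr (- \<alpha>) * heat \<mu> (\<tau> / p) z"
  using heat_powr[of \<mu> \<tau> p z] \<mu>0 p2 by (simp add: cp_def \<alpha>_def mult_ac)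

lemma Pk_symbol_measurable: "(\<lambda>(s, \<xi>). \<i> * Cx \<xi> * Cx (gauss (\<mu> * s) \<xi>)) \<in> borel_measurable (borel \<Otimes>\<^sub>M borel)"
  unfolding split_beta' by measurable

lemma Pk_measurable: "(\<lambda>(s, x). Pk s x) \<in> borel_measurable (borel \<Otimes>\<^sub>M borel)"
  unfolding Pk_def by (rule ift_measurable_pair[OF Pk_symbol_measurable])

lemma Pk_measurable_time [measurable]: "(\<lambda>(\<tau>, x). Pk (t - \<kappa> * \<tau>) x) \<in> borel_measurable (borel \<Otimes>\<^sub>M borel)"
proof -
  have "(\<lambda>w. (\<lambda>(s, x). Pk s x) (t - \<kappa> * fst w, snd w)) \<in> borel_measurable (borel \<Otimes>\<^sub>M borel)"
    by (rule measurable_compose[OF _ Pk_measurable]) measurable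
  then show ?thesis by (simp only: split_beta' fst_conv snd_conv)
qed

lemma Pk_measurable_fst [measurable]: "(\<lambda>\<tau>. Pk (t - \<kappa> * \<tau>) x) \<in> borel_measurable borel"
  using measurable_compose[of "\<lambda>\<tau>. (\<tau>, x)" borel "borel \<Otimes>\<^sub>M borel" "\<lambda>(\<tau>, x). Pk (t - \<kappa> * \<tau>) x" borel] Pk_measurable_time by simp

lemma Pk_symbol_integrable:
  assumes "s > 0" shows "integrable lborel (\<lambda>\<xi>. \<i> * Cx \<xi> * Cx (gauss (\<mu> * s) \<xi>))"
  by (rule small_ift_rate_gen[where t = 1 and C = 1 and c = "\<mu> * s" and e = 0 and k = 1, THEN conjunct1])
    (use \<mu>0 assms in \<open>auto simp: norm_mult\<close>)

lemma Pk_scale: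
  assumes t: "t > 0" shows "Pk (t * s) z = Cx (1 / t) * Pk s (z / sqrt t)"
proof -
  let ?k = "\<lambda>\<zeta>. \<i> * Cx \<zeta> * Cx (gauss (\<mu> * s) \<zeta>)"
  have n: "sqrt t \<noteq> 0" "sqrt t > 0" using t by auto
  have "(\<lambda>\<xi>. \<i> * Cx \<xi> * Cx (gauss (\<mu> * (t * s)) \<xi>)) = (\<lambda>\<xi>. Cx (1 / sqrt t) * ?k (sqrt t * \<xi>))"
  proof
    fix \<xi>
    have "\<mu> * s * (sqrt t * \<xi>)\<^sup>2 = \<mu> * (t * s) * \<xi>\<^sup>2" using t by (simp add: power_mult_distrib)
    moreover have "Cx (1 / sqrt t) * (\<i> * Cx (sqrt t * \<xi>) * E) = \<i> * Cx \<xi> * E" for E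
      using n by simp
    ultimately show "\<i> * Cx \<xi> * Cx (gauss (\<mu> * (t * s)) \<xi>) = Cx (1 / sqrt t) * ?k (sqrt t * \<xi>)"
      by (simp only:)
  qed
  then have "Pk (t * s) z = Cx (1 / sqrt t) * (Cx (1 / sqrt t) * Pk s (z / sqrt t))"
    unfolding Pk_def by (simp only: ift_cmult ift_dilate[OF n(2), of ?k])
  moreover have "1 / sqrt t * (1 / sqrt t) = 1 / t" using t by simp
  ultimately show ?thesis by (simp only: mult.assoc[symmetric] of_real_mult[symmetric])
qed

lemma Pk_heat: "t > 0 \<Longrightarrow> Pk t z = Cx (t powr (- (1/2)) * t powr (- (1/2)) * deriv (heat \<mu> 1) (z / sqrt t))"
proof -
  assume t: "t > 0"
  have "Pk t z = Cx (1 / t) * Pk 1 (z / sqrt t)" using Pk_scale[OF t, of 1 z] by simp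
  also have "Pk 1 (z / sqrt t) = Cx (deriv (heat \<mu> 1) (z / sqrt t))"
    using heat_deriv[of 1 "z / sqrt t"] by (simp add: Pk_def gk_def[abs_def])
  also have "1 / t = t powr (- (1/2)) * t powr (- (1/2))" unfolding powr_add[symmetric] using t by (simp add: powr_minus_divide)
  finally show ?thesis by (simp only: of_real_mult)
qed

definition "GP = gauss_const 1 (\<mu> / p)"

text \<open>The combined time t - \<kappa> \<tau> never falls below t/p, because the forcing kernel
  has already spread for the time \<tau>/p. So there is no singularity at \<tau> = t, and the only
  delicate point of \<open>J\<close> is \<tau> = 0.\<close>

lemma Pk_small:
  assumes t: "t > 0" and \<tau>: "0 \<le> \<tau>" "\<tau> \<le> t"
  shows "small t (Pk (t - \<kappa> * \<tau>)) (GP * t powr (- (1/2)))"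
proof -
  have "small t (Pk (t - \<kappa> * \<tau>)) (1 * gauss_const 1 (\<mu> / p) * t powr (0 - real 1 / 2))"
    unfolding Pk_def
  proof (rule small_ift_rate_gen[THEN conjunct2, OF _ t])
    fix \<xi>
    have "\<mu> / p * t * \<xi>\<^sup>2 \<le> \<mu> * (t - \<kappa> * \<tau>) * \<xi>\<^sup>2"
      using mult_left_mono[OF \<kappa>_time[OF \<tau>], of \<mu>] \<mu>0 by (intro mult_right_mono) auto
    then have "gauss (\<mu> * (t - \<kappa> * \<tau>)) \<xi> \<le> gauss (\<mu> / p * t) \<xi>" by simp
    then have "\<bar>\<xi>\<bar> * gauss (\<mu> * (t - \<kappa> * \<tau>)) \<xi> \<le> \<bar>\<xi>\<bar> * gauss (\<mu> / p * t) \<xi>" by (rule mult_left_mono) simp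
    then show "cmod (\<i> * Cx \<xi> * Cx (gauss (\<mu> * (t - \<kappa> * \<tau>)) \<xi>)) \<le> 1 * t powr 0 * \<bar>\<xi>\<bar> ^ 1 * gauss (\<mu> / p * t) \<xi>"
      using t by (simp add: norm_mult)
  qed (use \<mu>0 p2 in auto)
  then show ?thesis by (simp add: GP_def)
qed

lemma GP_nonneg: "GP \<ge> 0" unfolding GP_def by (rule gauss_const_nonneg)

lemma J_small:
  assumes t: "t > 0" and S [measurable]: "S \<in> sets borel" and Ss: "S \<subseteq> {0..t}"
    and R: "(NN \<tau>. indicator S \<tau> * \<tau> powr (- \<alpha>)) \<le> ennreal R" "R \<ge> 0"
  shows "small t (J S t) (GP * t powr (- (1/2)) * R)"
    and "integrable lborel (\<lambda>\<tau>. Pk (t - \<kappa> * \<tau>) z * Cx (indicator S \<tau> * \<tau> powr (- \<alpha>)))"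
proof -
  define f where "f \<tau> x = indicator {0..t} \<tau> *\<^sub>R Pk (t - \<kappa> * \<tau>) x" for \<tau> x
  define \<rho> where "\<rho> \<tau> = indicator {0..t} \<tau> * (GP * t powr (- (1/2)))" for \<tau> :: real
  define w where "w \<tau> = Cx (indicator S \<tau> * \<tau> powr (- \<alpha>))" for \<tau>
  have sm: "small t (f \<tau>) (\<rho> \<tau>)" for \<tau>
  proof (cases "\<tau> \<in> {0..t}")
    case True
    then have "f \<tau> = Pk (t - \<kappa> * \<tau>)" "\<rho> \<tau> = GP * t powr (- (1/2))" by (auto simp: f_def \<rho>_def fun_eq_iff)
    then show ?thesis using Pk_small[OF t, of \<tau>] True by simp
  next
    case False
    then have "f \<tau> = (\<lambda>x. 0)" "\<rho> \<tau> = 0" by (auto simp: f_def \<rho>_def fun_eq_iff)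
    then show ?thesis by (simp add: small_zero)
  qed
  have fm: "(\<lambda>(\<tau>, x). f \<tau> x) \<in> borel_measurable (lborel \<Otimes>\<^sub>M borel)"
  proof -
    have "(\<lambda>(\<tau>, x). f \<tau> x) \<in> borel_measurable (borel \<Otimes>\<^sub>M borel)"
      using Pk_measurable_time unfolding f_def split_beta' by measurable
    then show ?thesis by (simp cong: measurable_cong_sets add: sets_pair_measure_cong[of lborel borel borel borel])
  qed
  have fm1: "(\<lambda>\<tau>. f \<tau> z) \<in> borel_measurable lborel" unfolding f_def by measurable
  have wm: "w \<in> borel_measurable lborel" unfolding w_def[abs_def] by measurable
  have \<rho>m: "\<rho> \<in> borel_measurable lborel" unfolding \<rho>_def[abs_def] by measurable
  have k0: "0 \<le> GP * t powr (- (1/2))" using GP_nonneg by simp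
  have "(NN \<tau>. \<rho> \<tau> * cmod (w \<tau>)) \<le> (\<integral>\<^sup>+ \<tau>. ennreal (GP * t powr (- (1/2))) * ennreal (indicator S \<tau> * \<tau> powr (- \<alpha>)) \<partial>lborel)"
  proof (intro nn_integral_mono)
    fix \<tau>
    have "cmod (w \<tau>) = indicator S \<tau> * \<tau> powr (- \<alpha>)" unfolding w_def norm_of_real by (rule abs_of_nonneg) simp
    then have "\<rho> \<tau> * cmod (w \<tau>) \<le> (GP * t powr (- (1/2))) * (indicator S \<tau> * \<tau> powr (- \<alpha>))"
      unfolding \<rho>_def using k0 by (auto simp: indicator_def)
    then show "ennreal (\<rho> \<tau> * cmod (w \<tau>)) \<le> ennreal (GP * t powr (- (1/2))) * ennreal (indicator S \<tau> * \<tau> powr (- \<alpha>))"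
      by (subst ennreal_mult[symmetric]) (use k0 in \<open>auto intro: ennreal_leI\<close>)
  qed
  also have "\<dots> = ennreal (GP * t powr (- (1/2))) * (NN \<tau>. indicator S \<tau> * \<tau> powr (- \<alpha>))"
    by (rule nn_integral_cmult) measurable
  also have "\<dots> \<le> ennreal (GP * t powr (- (1/2))) * ennreal R" by (intro mult_left_mono R) simp
  also have "\<dots> = ennreal (GP * t powr (- (1/2)) * R)" using k0 R(2) by (simp only: ennreal_mult)
  finally have RR: "(NN \<tau>. \<rho> \<tau> * cmod (w \<tau>)) \<le> ennreal (GP * t powr (- (1/2)) * R)" .
  have e: "f \<tau> x * w \<tau> = Pk (t - \<kappa> * \<tau>) x * Cx (indicator S \<tau> * \<tau> powr (- \<alpha>))" for \<tau> x
    using Ss by (auto simp: f_def w_def indicator_def)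
  have "small t (\<lambda>x. \<integral>\<tau>. f \<tau> x * w \<tau> \<partial>lborel) (GP * t powr (- (1/2)) * R)"
    by (rule small_integral[OF sigma_finite_lborel fm wm \<rho>m sm RR]) (use k0 R(2) in simp)
  then show "small t (J S t) (GP * t powr (- (1/2)) * R)" unfolding e J_def[abs_def] .
  show "integrable lborel (\<lambda>\<tau>. Pk (t - \<kappa> * \<tau>) z * Cx (indicator S \<tau> * \<tau> powr (- \<alpha>)))"
    using integrable_small[OF fm1 wm \<rho>m sm RR] unfolding e .
qed

lemma weight_bound:
  assumes "\<alpha> < 1"
  shows "\<exists>C\<ge>0. \<forall>t>0. (NN \<tau>. indicator {0<..<t} \<tau> * \<tau> powr (- \<alpha>)) \<le> ennreal (C * t powr (1 - \<alpha>))"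
proof -
  obtain C where C: "C \<ge> 0" "\<And>t. t > 0 \<Longrightarrow> (NN \<tau>. indicator {0<..<t} \<tau> * ((t - \<tau>) powr (- 0) * \<tau> powr (- \<alpha>))) \<le> ennreal (C * t powr (1 - 0 - \<alpha>))"
    using nn_integral_beta[of 0 \<alpha>] assms by auto
  have "(NN \<tau>. indicator {0<..<t} \<tau> * \<tau> powr (- \<alpha>)) \<le> ennreal (C * t powr (1 - \<alpha>))" if "t > 0" for t
  proof -
    have "(NN \<tau>. indicator {0<..<t} \<tau> * \<tau> powr (- \<alpha>)) = (NN \<tau>. indicator {0<..<t} \<tau> * ((t - \<tau>) powr (- 0) * \<tau> powr (- \<alpha>)))"
      by (intro nn_integral_cong) (auto simp: indicator_def)
    also have "\<dots> \<le> ennreal (C * t powr (1 - 0 - \<alpha>))" by (rule C(2)[OF that])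
    finally show ?thesis by simp
  qed
  with C(1) show ?thesis by blast
qed

text \<open>Under \<tau> = t s the measure gives t, the kernel 1/t and the weight
  t^(-\<alpha>).\<close>

lemma J_scale:
  assumes t: "t > 0"
  shows "J {0<..<t} t z = Cx (t powr (- \<alpha>)) * J {0<..<1} 1 (z / sqrt t)"
proof -
  have "J {0<..<t} t z = \<bar>t\<bar> *\<^sub>R (LBINT s. Pk (t - \<kappa> * (0 + t * s)) z * Cx (indicator {0<..<t} (0 + t * s) * (0 + t * s) powr (- \<alpha>)))"
    unfolding J_def by (rule lborel_integral_real_affine) (use t in simp)
  also have "\<dots> = \<bar>t\<bar> *\<^sub>R (LBINT s. Cx (1 / t * t powr (- \<alpha>)) * (Pk (1 - \<kappa> * s) (z / sqrt t) * Cx (indicator {0<..<1} s * s powr (- \<alpha>))))"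
  proof (rule arg_cong[where f = "\<lambda>x. \<bar>t\<bar> *\<^sub>R x"], rule Bochner_Integration.integral_cong[OF refl])
    fix s :: real
    have a: "t - \<kappa> * (0 + t * s) = t * (1 - \<kappa> * s)" by (simp add: algebra_simps)
    have i: "indicator {0<..<t} (0 + t * s) = (indicator {0<..<1} s :: real)" using t by (auto simp: indicator_def zero_less_mult_iff)
    have w: "indicator {0<..<t} (0 + t * s) * (0 + t * s) powr (- \<alpha>) = t powr (- \<alpha>) * (indicator {0<..<1} s * s powr (- \<alpha>))"
      unfolding i using t by (auto simp: indicator_def powr_mult)
    show "Pk (t - \<kappa> * (0 + t * s)) z * Cx (indicator {0<..<t} (0 + t * s) * (0 + t * s) powr (- \<alpha>))
      = Cx (1 / t * t powr (- \<alpha>)) * (Pk (1 - \<kappa> * s) (z / sqrt t) * Cx (indicator {0<..<1} s * s powr (- \<alpha>)))"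
      unfolding a Pk_scale[OF t] w of_real_mult by (simp only: mult_ac)
  qed
  also have "\<dots> = \<bar>t\<bar> *\<^sub>R (Cx (1 / t * t powr (- \<alpha>)) * J {0<..<1} 1 (z / sqrt t))"
    unfolding J_def integral_mult_right_zero ..
  also have "\<dots> = Cx (t * (1 / t * t powr (- \<alpha>))) * J {0<..<1} 1 (z / sqrt t)"
    using t by (simp only: abs_of_pos scaleR_conv_of_real of_real_mult mult.assoc)
  also have "t * (1 / t * t powr (- \<alpha>)) = t powr (- \<alpha>)" using t by simp
  finally show ?thesis .
qed

lemma conv_heat_power:
  assumes s: "0 < s" "s < 1"
  shows "Cx (conv (heat \<mu> (1 - s)) (\<lambda>y. heat \<mu> s y powr p) z)
    = Cx (cp * s powr (- \<alpha>)) * ift (\<lambda>\<xi>. Cx (gauss (\<mu> * (1 - \<kappa> * s)) \<xi>)) z"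
proof -
  let ?E = "\<lambda>s \<xi>. Cx (gauss (\<mu> * s) \<xi>)"
  let ?c = "Cx (cp * s powr (- \<alpha>))"
  have p0: "\<mu> * (1 - s) > 0" "\<mu> * (s / p) > 0" using s \<mu>0 p2 by auto
  have iE: "integrable lborel (?E (1 - s))"
    using integrable_gauss(1)[OF p0(1)] by simp
  have "Cx (conv (heat \<mu> (1 - s)) (\<lambda>y. heat \<mu> s y powr p) z) = (LBINT y. Cx (heat \<mu> (1 - s) (z - y) * heat \<mu> s y powr p))"
    unfolding conv_def by (rule integral_complex_of_real[symmetric])
  also have "\<dots> = (LBINT y. ?c * (ift (?E (1 - s)) (z - y) * Cx (heat \<mu> (s / p) (y - 0))))"
    unfolding heat_power[OF s(1)] of_real_mult heat_eq_ift[OF p0(1)] diff_0_right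
    by (rule Bochner_Integration.integral_cong[OF refl]) (simp only: mult_ac)
  also have "\<dots> = ?c * conv (ift (?E (1 - s))) (\<lambda>y. Cx (heat \<mu> (s / p) (y - 0))) z"
    unfolding conv_def integral_mult_right_zero ..
  also have "conv (ift (?E (1 - s))) (\<lambda>y. Cx (heat \<mu> (s / p) (y - 0))) z
    = ift (\<lambda>\<xi>. ?E (1 - s) \<xi> * (iexp (- (\<xi> * 0)) * ?E (s / p) \<xi>)) z"
    unfolding conv_ift[OF iE heat_shift_integrable[OF p0(2)]] heat_fourier[OF p0(2)] ..
  also have "(\<lambda>\<xi>. ?E (1 - s) \<xi> * (iexp (- (\<xi> * 0)) * ?E (s / p) \<xi>)) = ?E (1 - \<kappa> * s)"
  proof
    fix \<xi>
    have "- (\<mu> * (1 - s) * \<xi>\<^sup>2) + - (\<mu> * (s / p) * \<xi>\<^sup>2) = - (\<mu> * (1 - \<kappa> * s) * \<xi>\<^sup>2)" by (simp add: \<kappa>_def algebra_simps)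
    then have "gauss (\<mu> * (1 - s)) \<xi> * gauss (\<mu> * (s / p)) \<xi> = gauss (\<mu> * (1 - \<kappa> * s)) \<xi>" by (simp only: exp_add[symmetric])
    then have "?E (1 - s) \<xi> * ?E (s / p) \<xi> = ?E (1 - \<kappa> * s) \<xi>" by (simp only: of_real_mult[symmetric])
    then show "?E (1 - s) \<xi> * (iexp (- (\<xi> * 0)) * ?E (s / p) \<xi>) = ?E (1 - \<kappa> * s) \<xi>" by simp
  qed
  finally show ?thesis .
qed

text \<open>Written as one inverse Fourier integral, the time integral that defines w_p can be
  differentiated under the integral sign by multiplying its symbol by i \<xi>. This is legitimate
  because all Gaussians with s in (0,1) are dominated by the one with exponent \<mu>/p, and \<alpha>
  < 1 makes the weight s^(-\<alpha>) integrable.\<close>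

lemma w_profile_eq:
  assumes \<alpha>1: "\<alpha> < 1"
  shows "Cx (w_profile p \<mu> z) = Cx cp * J {0<..<1} 1 z"
proof -
  define w where "w s = Cx (indicator {0<..<1} s * s powr (- \<alpha>))" for s :: real
  let ?E = "\<lambda>s \<xi>. Cx (gauss (\<mu> * (1 - \<kappa> * s)) \<xi>)"
  obtain C where C: "C \<ge> 0" "(NN \<tau>. indicator {0<..<1} \<tau> * \<tau> powr (- \<alpha>)) \<le> ennreal (C * 1 powr (1 - \<alpha>))"
    using weight_bound[OF \<alpha>1] zero_less_one by blast
  have w: "integrable lborel w"
  proof (rule integrableI_bounded)
    show "w \<in> borel_measurable lborel" unfolding w_def[abs_def] by measurable
    have "cmod (w s) = indicator {0<..<1} s * s powr (- \<alpha>)" for s unfolding w_def norm_of_real by (rule abs_of_nonneg) simp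
    then show "(NN s. norm (w s)) < \<infinity>" using C(2) by (auto intro: le_less_trans)
  qed
  have c: "\<mu> / p > 0" using \<mu>0 p2 by simp
  have le: "gauss (\<mu> * (1 - \<kappa> * s)) \<xi> \<le> gauss (\<mu> / p) \<xi>" if "0 < s" "s < 1" for s \<xi>
  proof -
    have "\<mu> / p * \<xi>\<^sup>2 \<le> \<mu> * (1 - \<kappa> * s) * \<xi>\<^sup>2"
      using mult_left_mono[OF \<kappa>_time[of s 1], of \<mu>] \<mu>0 that by (intro mult_right_mono) auto
    then show ?thesis by simp
  qed
  have m0: "(\<lambda>(s, \<xi>). ?E s \<xi>) \<in> borel_measurable (borel \<Otimes>\<^sub>M borel)" unfolding split_beta' by measurable
  have m1: "(\<lambda>(s, \<xi>). \<i> * Cx \<xi> * ?E s \<xi>) \<in> borel_measurable (borel \<Otimes>\<^sub>M borel)" unfolding split_beta' by measurable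
  have b0: "cmod (w s * ?E s \<xi>) \<le> cmod (w s) * gauss (\<mu> / p) \<xi>" for s \<xi>
    using le[of s \<xi>] unfolding norm_mult norm_of_real by (cases "s \<in> {0<..<1}") (auto simp: w_def intro!: mult_left_mono)
  have b1: "cmod (w s * (\<i> * Cx \<xi> * ?E s \<xi>)) \<le> cmod (w s) * (\<bar>\<xi>\<bar> ^ 1 * gauss (\<mu> / p) \<xi>)" for s \<xi>
    using le[of s \<xi>] unfolding norm_mult norm_of_real by (cases "s \<in> {0<..<1}") (auto simp: w_def intro!: mult_left_mono)
  note s0 = ift_integral_swap[OF w integrable_gauss(1)[OF c] m0 b0]
  note s1 = ift_integral_swap[OF w integrable_abs_pow_gauss[OF c, of 1] m1 b1]
  define F where "F z = (LBINT s:{0<..<1}. conv (heat \<mu> (1 - s)) (\<lambda>y. heat \<mu> s y powr p) z)" for z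
  define G where "G \<xi> = Cx cp * (LBINT s. w s * ?E s \<xi>)" for \<xi>
  have FG: "Cx (F z) = ift G z" for z
  proof -
    have "Cx (F z) = (LBINT s. Cx (indicator {0<..<1} s * conv (heat \<mu> (1 - s)) (\<lambda>y. heat \<mu> s y powr p) z))"
      unfolding F_def set_lebesgue_integral_def real_scaleR_def by (rule integral_complex_of_real[symmetric])
    also have "\<dots> = (LBINT s. Cx cp * (w s * ift (?E s) z))"
    proof (rule Bochner_Integration.integral_cong[OF refl])
      fix s
      show "Cx (indicator {0<..<1} s * conv (heat \<mu> (1 - s)) (\<lambda>y. heat \<mu> s y powr p) z) = Cx cp * (w s * ift (?E s) z)"
      proof (cases "s \<in> {0<..<1}")
        case True
        then have "Cx (indicator {0<..<1} s * conv (heat \<mu> (1 - s)) (\<lambda>y. heat \<mu> s y powr p) z)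
          = Cx (conv (heat \<mu> (1 - s)) (\<lambda>y. heat \<mu> s y powr p) z)" by simp
        also have "\<dots> = Cx (cp * s powr (- \<alpha>)) * ift (?E s) z" using True by (intro conv_heat_power) auto
        also have "\<dots> = Cx cp * (Cx (s powr (- \<alpha>)) * ift (?E s) z)" by (simp only: of_real_mult mult.assoc)
        also have "Cx (s powr (- \<alpha>)) = w s" using True by (simp add: w_def)
        finally show ?thesis .
      qed (simp add: w_def)
    qed
    also have "\<dots> = Cx cp * ift (\<lambda>\<xi>. LBINT s. w s * ?E s \<xi>) z" unfolding integral_mult_right_zero s0(2) ..
    also have "\<dots> = ift G z" unfolding G_def[abs_def] by (rule ift_cmult[symmetric])
    finally show ?thesis .
  qed
  have iG: "integrable lborel G" unfolding G_def[abs_def] by (rule integrable_mult_right[OF s0(1)])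
  have inner: "(LBINT s. w s * (\<i> * Cx \<xi> * ?E s \<xi>)) = \<i> * Cx \<xi> * (LBINT s. w s * ?E s \<xi>)" for \<xi>
  proof -
    have "(LBINT s. w s * (\<i> * Cx \<xi> * ?E s \<xi>)) = (LBINT s. (\<i> * Cx \<xi>) * (w s * ?E s \<xi>))" by (simp only: mult_ac)
    then show ?thesis by (simp only: integral_mult_right_zero)
  qed
  have "(\<lambda>\<xi>. Cx \<xi> * G \<xi>) = (\<lambda>\<xi>. (- \<i> * Cx cp) * (LBINT s. w s * (\<i> * Cx \<xi> * ?E s \<xi>)))"
    unfolding inner G_def by (simp add: fun_eq_iff algebra_simps)
  then have iG1: "integrable lborel (\<lambda>\<xi>. Cx \<xi> * G \<xi>)" using integrable_mult_right[OF s1(1)] by (simp only:)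
  have "Cx (w_profile p \<mu> z) = Cx (deriv F z)" unfolding w_profile_def F_def[abs_def] ..
  also have "\<dots> = ift (\<lambda>\<xi>. \<i> * Cx \<xi> * G \<xi>) z" by (rule ift_real_derivative(1)[OF FG iG iG1])
  also have "(\<lambda>\<xi>. \<i> * Cx \<xi> * G \<xi>) = (\<lambda>\<xi>. Cx cp * (LBINT s. w s * (\<i> * Cx \<xi> * ?E s \<xi>)))"
    unfolding inner G_def by (simp only: mult_ac)
  also have "ift \<dots> z = Cx cp * (LBINT s. w s * ift (\<lambda>\<xi>. \<i> * Cx \<xi> * ?E s \<xi>) z)" unfolding ift_cmult s1(2) ..
  also have "(LBINT s. w s * ift (\<lambda>\<xi>. \<i> * Cx \<xi> * ?E s \<xi>) z) = J {0<..<1} 1 z"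
    unfolding J_def Pk_def w_def by (simp only: mult.commute[of "ift _ _"])
  finally show ?thesis .
qed

end

lemma Lq_norm_cmult:
  assumes q: "q \<ge> 2" and \<Phi>: "\<Phi> \<in> borel_measurable borel" and sm: "small 1 (\<lambda>x. Cx (\<Phi> x)) A"
  shows "Lq_norm q (\<lambda>x. k * \<Phi> x) = ereal \<bar>k\<bar> * Lq_norm q \<Phi>"
proof -
  have "Lq_norm q \<Phi> \<le> ereal (A * 1 powr (- (1 / 2 * (1 - real_of_ereal (1 / q)))))" by (rule Lq_norm_small[OF q _ sm \<Phi>]) simp
  moreover have "0 \<le> Lq_norm q \<Phi>" by (rule Lq_norm_nonneg[OF \<Phi>])
  ultimately obtain c where c: "Lq_norm q \<Phi> = ereal c" by (cases "Lq_norm q \<Phi>") auto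
  have "Lq_norm q (\<lambda>x. k * \<Phi> ((x - 0) / 1)) = ereal (\<bar>k\<bar> * 1 powr real_of_ereal (1 / q) * c)"
    by (rule Lq_norm_scale[OF q \<Phi> _ c]) simp
  then show ?thesis by (simp add: c)
qed

lemma weight_compare:
  fixes \<tau> e e' :: real
  assumes "\<tau> \<ge> 1" "0 \<le> e'" "e' \<le> e"
  shows "\<tau> powr (- e) \<le> 2 powr e * (1 + \<tau>) powr (- e')"
proof -
  have "\<tau> powr (- e) \<le> ((1 + \<tau>) / 2) powr (- e)" using assms by (intro powr_mono2') auto
  also have "\<dots> = 2 powr e * (1 + \<tau>) powr (- e)" using assms by (simp add: powr_divide powr_minus field_simps)
  also have "\<dots> \<le> 2 powr e * (1 + \<tau>) powr (- e')" using assms by (intro mult_left_mono powr_mono) auto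
  finally show ?thesis .
qed

lemma forcing_bound_mono:
  assumes "(NN y. cmod (f y)) \<le> ennreal a" "L2sq f \<le> ennreal ((a * c)\<^sup>2)"
    and "0 \<le> a" "a \<le> a'" "0 \<le> c"
  shows "(NN y. cmod (f y)) \<le> ennreal a' \<and> L2sq f \<le> ennreal ((a' * c)\<^sup>2)"
proof
  show "(NN y. cmod (f y)) \<le> ennreal a'" by (rule order_trans[OF assms(1) ennreal_leI[OF assms(4)]])
  have "(a * c)\<^sup>2 \<le> (a' * c)\<^sup>2" using assms by (intro power_mono mult_right_mono) auto
  then show "L2sq f \<le> ennreal ((a' * c)\<^sup>2)" by (rule order_trans[OF assms(2) ennreal_leI])
qed

lemma integral_inverse_indicator:
  fixes t :: real assumes t: "t \<ge> 1"
  shows "integrable lborel (\<lambda>\<tau>. indicator {1..<t} \<tau> * \<tau> powr (- 1))"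
    and "(LBINT \<tau>. indicator {1..<t} \<tau> * \<tau> powr (- 1)) = ln t"
proof -
  have "has_bochner_integral lborel (\<lambda>x. inverse x * indicator {1..t} x) (ln t - ln 1)"
    by (rule has_bochner_integral_FTC_Icc_real[OF t]) (auto intro!: DERIV_ln continuous_intros)
  moreover have "has_bochner_integral lborel (\<lambda>x. inverse x * indicator {1..t} x) (ln t - ln 1)
    \<longleftrightarrow> has_bochner_integral lborel (\<lambda>\<tau>. indicator {1..<t} \<tau> * \<tau> powr (- 1)) (ln t - ln 1)"
  proof (rule has_bochner_integral_cong_AE)
    show "AE x in lborel. inverse x * indicator {1..t} x = indicator {1..<t} x * x powr (- 1)"
      using AE_lborel_singleton[of t] by eventually_elim (auto simp: indicator_def powr_minus)
  qed measurable
  ultimately have "has_bochner_integral lborel (\<lambda>\<tau>. indicator {1..<t} \<tau> * \<tau> powr (- 1)) (ln t)" by simp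
  then show "integrable lborel (\<lambda>\<tau>. indicator {1..<t} \<tau> * \<tau> powr (- 1))"
    "(LBINT \<tau>. indicator {1..<t} \<tau> * \<tau> powr (- 1)) = ln t"
    by (auto simp only: has_bochner_integral_iff)
qed

section \<open>The cases p < 3 and p = 3\<close>

locale solution_subcritical = solution +
  assumes p3: "p \<le> 3"
begin

lemma \<alpha>_le: "\<alpha> \<le> 1" using p3 by (simp add: \<alpha>_def)

text \<open>The value |M|^(p-1) M, written with the sign separated so that |sM| = |M|^p also for M =
  0.\<close>

definition "sM = sgn M * \<bar>M\<bar> powr p"
definition "h0 \<tau> y = Cx (nonlin p (\<lambda>y. M * heat_drift B b \<mu> \<tau> y) y)"
text \<open>The cutoff removes the singularity of \<open>h0\<close> at \<open>\<tau> = 0\<close>.\<close>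

definition "g0 \<tau> y = indicator {1..} \<tau> *\<^sub>R h0 \<tau> y"
definition "g1 \<tau> y = g \<tau> y - g0 \<tau> y"
definition "KD s x = K1 s x - K0 s x"

lemma abs_sM: "\<bar>sM\<bar> = \<bar>M\<bar> powr p"
  by (simp add: sM_def abs_mult abs_sgn_eq)

lemma h0_eq:
  assumes \<tau>: "\<tau> > 0"
  shows "h0 \<tau> y = Cx (sM * cp * \<tau> powr (- \<alpha>)) * Cx (heat \<mu> (\<tau> / p) (y - V * \<tau>))"
proof -
  define G where "G = heat \<mu> \<tau> (y - V * \<tau>)"
  have G0: "G \<ge> 0" unfolding G_def by (rule heat_nonneg) (use \<mu>0 \<tau> in simp)
  have "nonlin p (\<lambda>y. M * heat_drift B b \<mu> \<tau> y) y = sgn (M * G) * \<bar>M * G\<bar> powr p"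
    unfolding nonlin_eq by (simp add: heat_drift_def G_def V_def)
  also have "\<dots> = sM * (sgn G * \<bar>G\<bar> powr p)" by (simp add: sM_def sgn_mult abs_mult powr_mult)
  also have "sgn G * \<bar>G\<bar> powr p = G powr p" using G0 by (cases "G = 0") auto
  also have "G powr p = cp * \<tau> powr (- \<alpha>) * heat \<mu> (\<tau> / p) (y - V * \<tau>)" unfolding G_def by (rule heat_power[OF \<tau>])
  finally show ?thesis unfolding h0_def by (simp only: of_real_mult mult.assoc)
qed

lemma g0_measurable_pair [measurable]: "(\<lambda>(\<tau>, y). g0 \<tau> y) \<in> borel_measurable (borel \<Otimes>\<^sub>M borel)"
  unfolding g0_def h0_def nonlin_def heat_drift_def heat_def split_beta' by measurable

lemma g1_measurable_pair [measurable]: "(\<lambda>(\<tau>, y). g1 \<tau> y) \<in> borel_measurable (borel \<Otimes>\<^sub>M borel)"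
  using g0_measurable_pair g_measurable_pair unfolding g1_def split_beta' by measurable

lemma g0_measurable [measurable]: "g0 \<tau> \<in> borel_measurable borel"
  using measurable_compose[OF measurable_Pair1' g0_measurable_pair, of \<tau>] by simp

lemma KD_measurable: "(\<lambda>(s, x). KD s x) \<in> borel_measurable (borel \<Otimes>\<^sub>M borel)"
  using K_measurable unfolding KD_def split_beta' by measurable

lemma g0_bounds:
  "\<exists>A\<ge>0. forcing g0 (\<lambda>\<tau>. A * (1 + \<tau>) powr (- \<alpha>))"
proof -
  define k where "k = cmod (Cx M) * gauss_const 0 \<mu>"
  have A0: "0 \<le> 2 * p * k powr p" using p2 by simp
  show ?thesis unfolding forcing_def
  proof (intro exI[of _ "2 * p * k powr p * 2 powr \<alpha>"] conjI allI impI)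
    show "0 \<le> 2 * p * k powr p * 2 powr \<alpha>" using p2 by simp
    fix \<tau> :: real assume \<tau>: "\<tau> > 0"
    have "(NN y. cmod (g0 \<tau> y)) \<le> ennreal (2 * p * k powr p * 2 powr \<alpha> * (1 + \<tau>) powr (- \<alpha>)) \<and>
      L2sq (g0 \<tau>) \<le> ennreal ((2 * p * k powr p * 2 powr \<alpha> * (1 + \<tau>) powr (- \<alpha>) * \<tau> powr (- (1/4)))\<^sup>2)"
    proof (cases "\<tau> \<ge> 1")
      case True
      have sm: "small \<tau> (\<lambda>x. Cx (M * heat_drift B b \<mu> \<tau> x)) k"
        using small_cmult[OF small_heat_drift[OF \<tau>], of "Cx M"] by (simp add: k_def)
      have m: "(\<lambda>x. M * heat_drift B b \<mu> \<tau> x) \<in> borel_measurable borel" unfolding heat_drift_def by measurable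
      have e: "Cx (nonlin p (\<lambda>x. M * heat_drift B b \<mu> \<tau> x) y) = g0 \<tau> y" for y
        using True by (simp add: g0_def h0_def)
      note b = nonlin_small[OF p2 \<tau> sm m, folded \<alpha>_def, unfolded e]
      show ?thesis
      proof (rule forcing_bound_mono[OF b])
        have "\<tau> powr (- \<alpha>) \<le> 2 powr \<alpha> * (1 + \<tau>) powr (- \<alpha>)" using True \<alpha> by (intro weight_compare) auto
        then show "2 * p * k powr p * \<tau> powr (- \<alpha>) \<le> 2 * p * k powr p * 2 powr \<alpha> * (1 + \<tau>) powr (- \<alpha>)"
          using mult_left_mono[OF _ A0] by (simp only: mult.assoc)
      qed (use A0 in auto)
    next
      case False
      then have "g0 \<tau> = (\<lambda>y. 0)" by (simp add: g0_def fun_eq_iff)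
      then show ?thesis by simp
    qed
    then show "(NN y. cmod (g0 \<tau> y)) \<le> ennreal (2 * p * k powr p * 2 powr \<alpha> * (1 + \<tau>) powr (- \<alpha>))"
      "L2sq (g0 \<tau>) \<le> ennreal ((2 * p * k powr p * 2 powr \<alpha> * (1 + \<tau>) powr (- \<alpha>) * \<tau> powr (- (1/4)))\<^sup>2)" by blast+
  qed
qed

text \<open>Replacing u by its leading term gains the rate of \<open>zero_order\<close>. The gain
  \<beta> is kept free below \<beta>0, since \<alpha> + \<beta> has to stay below 1 if \<alpha> < 1
  and to exceed 1 if \<alpha> = 1.\<close>

lemma g1_bounds:
  assumes \<beta>: "0 \<le> \<beta>" "\<beta> \<le> \<beta>0"
  shows "\<exists>A\<ge>0. forcing g1 (\<lambda>\<tau>. A * (1 + \<tau>) powr (- (\<alpha> + \<beta>)))"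
proof -
  obtain A where A: "A \<ge> 0" "forcing g (\<lambda>\<tau>. A * (1 + \<tau>) powr (- \<alpha>))"
    using g_bounds by blast
  obtain K where K: "K \<ge> 0" "\<And>t. t \<ge> 0 \<Longrightarrow> small (1 + t) (\<lambda>x. Cx (U t x)) K" using U_small by blast
  obtain C where C: "C \<ge> 0" "\<And>t. t \<ge> 1 \<Longrightarrow> \<exists>R. small t R (C * t powr (- \<beta>0)) \<and>
     (AE x in lborel. Cx (dev t x) = R x)" using zero_order by blast
  define k where "k = max K (cmod (Cx M) * gauss_const 0 \<mu>)"
  define D where "D = 2 * p * k powr (p - 1) * C"
  have D0: "D \<ge> 0" unfolding D_def using p2 C by simp
  define A' where "A' = 2 * A + D * 2 powr (\<beta>0 + \<alpha>)"
  have A'0: "A' \<ge> 0" unfolding A'_def using A(1) D0 by simp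
  have "(NN y. cmod (g1 \<tau> y)) \<le> ennreal (A' * (1 + \<tau>) powr (- (\<alpha> + \<beta>))) \<and>
     L2sq (g1 \<tau>) \<le> ennreal ((A' * (1 + \<tau>) powr (- (\<alpha> + \<beta>)) * \<tau> powr (- (1/4)))\<^sup>2)" if \<tau>: "\<tau> > 0" for \<tau>
  proof (cases "\<tau> \<ge> 1")
    case True
    have s1: "small \<tau> (\<lambda>x. Cx (U \<tau> x)) k"
      by (rule small_mono[OF small_time[OF K(2)]]) (use \<tau> in \<open>auto simp: k_def\<close>)
    have s2: "small \<tau> (\<lambda>x. Cx (M * heat_drift B b \<mu> \<tau> x)) k"
    proof -
      have "small \<tau> (\<lambda>x. Cx (M * heat_drift B b \<mu> \<tau> x)) (cmod (Cx M) * gauss_const 0 \<mu>)"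
        using small_cmult[OF small_heat_drift[OF \<tau>], of "Cx M"] by (simp only: of_real_mult)
      then show ?thesis by (rule small_mono) (simp add: k_def)
    qed
    have m: "(\<lambda>x. M * heat_drift B b \<mu> \<tau> x) \<in> borel_measurable borel" unfolding heat_drift_def by measurable
    obtain R where R: "small \<tau> R (C * \<tau> powr (- \<beta>0))" "AE x in lborel. Cx (u \<tau> x - M * heat_drift B b \<mu> \<tau> x) = R x"
      using C(2)[OF True] by blast
    have R': "AE x in lborel. Cx (U \<tau> x - M * heat_drift B b \<mu> \<tau> x) = R x"
      using R(2) U_AE[OF less_imp_le[OF \<tau>]] by eventually_elim simp
    have e: "Cx (nonlin p (U \<tau>) y) - Cx (nonlin p (\<lambda>x. M * heat_drift B b \<mu> \<tau> x) y) = g1 \<tau> y" for y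
      using True by (simp add: g1_def g_def g0_def h0_def)
    note bb = nonlin_small_diff[OF p2 \<tau> s1 s2 U_measurable m R(1) R', folded \<alpha>_def, unfolded e]
    show ?thesis
    proof (rule forcing_bound_mono[OF bb])
      have "2 * p * k powr (p - 1) * (C * \<tau> powr (- \<beta>0)) * \<tau> powr (- \<alpha>) = D * (\<tau> powr (- \<beta>0) * \<tau> powr (- \<alpha>))"
        by (simp only: D_def mult.assoc)
      also have "\<tau> powr (- \<beta>0) * \<tau> powr (- \<alpha>) = \<tau> powr (- (\<beta>0 + \<alpha>))" unfolding powr_add[symmetric] by simp
      also have "D * \<tau> powr (- (\<beta>0 + \<alpha>)) \<le> D * (2 powr (\<beta>0 + \<alpha>) * (1 + \<tau>) powr (- (\<alpha> + \<beta>)))"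
        using True \<alpha> \<beta> D0 by (intro mult_left_mono weight_compare) auto
      also have "\<dots> \<le> A' * (1 + \<tau>) powr (- (\<alpha> + \<beta>))" unfolding A'_def mult.assoc[symmetric] using A(1) by (intro mult_right_mono) auto
      finally show "2 * p * k powr (p - 1) * (C * \<tau> powr (- \<beta>0)) * \<tau> powr (- \<alpha>) \<le> A' * (1 + \<tau>) powr (- (\<alpha> + \<beta>))" .
    qed (use C(1) p2 in auto)
  next
    \<comment> \<open>Before time 1 the comparison forcing is switched off and there is nothing to
      gain; there (1 + \<tau>)^\<beta> \<le> 2 makes the stronger weight comparable to the original
      one, whence the summand 2 A in A'.\<close>
    case False
    then have e: "g1 \<tau> = g \<tau>" by (simp add: g1_def g0_def fun_eq_iff)
    show ?thesis unfolding e
    proof (rule forcing_bound_mono[OF forcingD(1)[OF A(2) \<tau>] forcingD(2)[OF A(2) \<tau>]])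
      have "(1 + \<tau>) powr \<beta> \<le> 2 powr 1" using False \<tau> \<beta> \<beta>0 by (intro powr_mono_both) auto
      then have "(1 + \<tau>) powr \<beta> * (1 + \<tau>) powr (- (\<alpha> + \<beta>)) \<le> 2 * (1 + \<tau>) powr (- (\<alpha> + \<beta>))" by (intro mult_right_mono) auto
      moreover have "(1 + \<tau>) powr \<beta> * (1 + \<tau>) powr (- (\<alpha> + \<beta>)) = (1 + \<tau>) powr (- \<alpha>)" unfolding powr_add[symmetric] by simp
      ultimately have "A * (1 + \<tau>) powr (- \<alpha>) \<le> A * (2 * (1 + \<tau>) powr (- (\<alpha> + \<beta>)))" using A(1) by (intro mult_left_mono) auto
      also have "\<dots> = 2 * A * (1 + \<tau>) powr (- (\<alpha> + \<beta>))" by simp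
      also have "\<dots> \<le> A' * (1 + \<tau>) powr (- (\<alpha> + \<beta>))" unfolding A'_def using D0 by (intro mult_right_mono) auto
      finally show "A * (1 + \<tau>) powr (- \<alpha>) \<le> A' * (1 + \<tau>) powr (- (\<alpha> + \<beta>))" .
    qed (use A(1) in auto)
  qed
  then show ?thesis unfolding forcing_def using A'0 by blast
qed

text \<open>Two replacements are made in the Duhamel term: D1 is the error from the forcing, D2 the
  error from the kernel acting on the explicit forcing, and D3 is explicit.\<close>

definition "D1 t x = (LBINT \<tau>:{0<..<t}. conv (K1 (t - \<tau>)) (g1 \<tau>) x)"
definition "D2 t x = (LBINT \<tau>:{0<..<t}. conv (KD (t - \<tau>)) (g0 \<tau>) x)"
definition "D3 t x = (LBINT \<tau>:{0<..<t}. conv (K0 (t - \<tau>)) (g0 \<tau>) x)"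
text \<open>The rate by which the errors beat t^(1/2 - \<alpha>). The entries are the gain available
  in the forcing, half the distance of \<alpha> to 1 (so that \<alpha> + \<gamma> < 1 for \<alpha> <
  1 and the linear error t^(-1/2) is covered), and the gain from the kernel difference. At \<alpha>
  = 1 it vanishes: there the gain over the main term is the logarithm alone.\<close>

definition "\<gamma> = min (min \<beta>0 ((1 - \<alpha>) / 2)) (1 / 16)"

lemma \<gamma>: "0 \<le> \<gamma>" "\<gamma> \<le> \<beta>0" "\<gamma> \<le> (1 - \<alpha>) / 2" "\<gamma> \<le> 1 / 16" "\<alpha> < 1 \<Longrightarrow> \<gamma> > 0"
  using \<beta>0 \<alpha>_le unfolding \<gamma>_def by (auto simp: min_def)

text \<open>If \<alpha> < 1, the weight \<alpha> + \<gamma> is still below 1 and the Beta integral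
  gives the rate. If \<alpha> = 1, the full gain \<beta>0 makes the forcing integrable in time, and
  the rate is t^(-1/2) with no logarithm.\<close>

lemma D1_small: "\<exists>C\<ge>0. \<forall>t\<ge>1. small t (D1 t) (C * t powr (1/2 - \<alpha> - \<gamma>)) \<and>
    (\<forall>x. set_integrable lborel {0<..<t} (\<lambda>\<tau>. conv (K1 (t - \<tau>)) (g1 \<tau>) x))"
proof -
  obtain A where A: "A \<ge> 0" "forcing g1 (\<lambda>\<tau>. A * (1 + \<tau>) powr (- (\<alpha> + \<gamma>)))"
    using g1_bounds[OF \<gamma>(1,2)] by blast
  have si: "set_integrable lborel {0<..<t} (\<lambda>\<tau>. conv (K1 (t - \<tau>)) (g1 \<tau>) x)" if "t \<ge> 1" for t x
  proof -
    have y: "(0::real) \<le> 1/2" "1/2 \<le> \<alpha> + \<gamma>" "(1/2::real) < 1" using \<alpha> \<gamma>(1) by auto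
    show ?thesis
      using duhamel_rate[OF K_measurable(1) g1_measurable_pair gauss_const_nonneg A(1) small_K(1) A(2) y] that by auto
  qed
  have "\<exists>C\<ge>0. \<forall>t\<ge>1. small t (D1 t) (C * t powr (1/2 - \<alpha> - \<gamma>))"
  proof (cases "\<alpha> < 1")
    case True
    have y: "0 \<le> \<alpha> + \<gamma>" "\<alpha> + \<gamma> \<le> \<alpha> + \<gamma>" "\<alpha> + \<gamma> < 1" using \<alpha> \<gamma>(1,3) True by auto
    obtain C where C: "C \<ge> 0" "\<And>t. t > 0 \<Longrightarrow> small t (D1 t) (C * t powr (1 - 1/2 - (\<alpha> + \<gamma>)))"
      using duhamel_rate[OF K_measurable(1) g1_measurable_pair gauss_const_nonneg A(1) small_K(1) A(2) y] unfolding D1_def[abs_def] by auto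
    have e: "1 - 1/2 - (\<alpha> + \<gamma>) = 1/2 - \<alpha> - \<gamma>" by simp
    show ?thesis using C unfolding e by (intro exI[of _ C]) auto
  next
    case False
    then have \<alpha>1: "\<alpha> = 1" using \<alpha>_le by simp
    then have \<gamma>0: "\<gamma> = 0" using \<gamma>(1,3) by simp
    obtain A where A: "A \<ge> 0" "forcing g1 (\<lambda>\<tau>. A * (1 + \<tau>) powr (- (\<alpha> + \<beta>0)))"
      using g1_bounds[of \<beta>0] \<beta>0 by auto
    have y: "1 < \<alpha> + \<beta>0" "(0::real) \<le> 1/2" "(1/2::real) < 3/4" using \<alpha>1 \<beta>0 by auto
    obtain C where C: "C \<ge> 0" "\<And>t. t \<ge> 1 \<Longrightarrow> small t (D1 t) (C * t powr (- (1/2)))"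
      using duhamel_rate_integrable[OF K_measurable(1) g1_measurable_pair gauss_const_nonneg A(1) small_K(1) A(2) y] unfolding D1_def[abs_def] by auto
    have e: "1/2 - \<alpha> - \<gamma> = - (1/2)" using \<alpha>1 \<gamma>0 by simp
    show ?thesis using C unfolding e by (intro exI[of _ C]) auto
  qed
  then show ?thesis using si by blast
qed

lemma D2_small: "\<exists>C\<ge>0. \<forall>t\<ge>1. small t (D2 t) (C * t powr (1/2 - \<alpha> - \<gamma>)) \<and>
    (\<forall>x. set_integrable lborel {0<..<t} (\<lambda>\<tau>. conv (KD (t - \<tau>)) (g0 \<tau>) x) \<and>
         set_integrable lborel {0<..<t} (\<lambda>\<tau>. conv (K0 (t - \<tau>)) (g0 \<tau>) x))"
proof -
  obtain A where A: "A \<ge> 0" "forcing g0 (\<lambda>\<tau>. A * (1 + \<tau>) powr (- \<alpha>))"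
    using g0_bounds by blast
  \<comment> \<open>The kernel difference gains 1/8, from s^(-1/2) to s^(-5/8). The cap 15/16 keeps
    the Beta integral finite at \<alpha> = 1 and gives back at most 1/16, so a gain of 1/16 always
    remains; this is the last entry of \<gamma>.\<close>
  define y where "y = min \<alpha> (15 / 16)"
  have y: "0 \<le> y" "y \<le> \<alpha>" "y < 1" using \<alpha> by (auto simp: y_def)
  have y2: "y \<ge> \<alpha> - 1/16" using \<alpha>_le by (auto simp: y_def)
  have CK: "0 \<le> 2 * gauss_const 1 \<mu> + W * gauss_const 4 \<mu>" using W0 gauss_const_nonneg by (simp add: add_nonneg_nonneg)
  have sK: "small s (KD s) ((2 * gauss_const 1 \<mu> + W * gauss_const 4 \<mu>) * s powr (- (5/8)))" if "0 < s" for s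
    using small_K_diff[OF that] by (simp only: KD_def[abs_def])
  obtain C where C: "C \<ge> 0" "\<And>t. t > 0 \<Longrightarrow> small t (D2 t) (C * t powr (1 - 5/8 - y))"
    "\<And>t x. t > 0 \<Longrightarrow> set_integrable lborel {0<..<t} (\<lambda>\<tau>. conv (KD (t - \<tau>)) (g0 \<tau>) x)"
    using duhamel_rate[OF KD_measurable g0_measurable_pair CK A(1) sK A(2) y] unfolding D2_def[abs_def] by auto
  have y': "(0::real) \<le> 1/2" "1/2 \<le> \<alpha>" "(1/2::real) < 1" using \<alpha> by auto
  have s3: "set_integrable lborel {0<..<t} (\<lambda>\<tau>. conv (K0 (t - \<tau>)) (g0 \<tau>) x)" if "t \<ge> 1" for t x
    using duhamel_rate[OF K_measurable(2) g0_measurable_pair gauss_const_nonneg A(1) small_K(2) A(2) y'] that by auto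
  have "small t (D2 t) (C * t powr (1/2 - \<alpha> - \<gamma>))" if t: "t \<ge> 1" for t
  proof (rule small_mono[OF C(2)])
    show "C * t powr (1 - 5/8 - y) \<le> C * t powr (1/2 - \<alpha> - \<gamma>)"
      using t y2 \<gamma>(4) by (intro mult_left_mono[OF _ C(1)] powr_mono) auto
  qed (use t in simp)
  then show ?thesis using C(1,3) s3 by (intro exI[of _ C]) auto
qed

lemma Dh_eq:
  assumes t: "t \<ge> 1" shows "Dh t x = D1 t x + D2 t x + D3 t x"
proof -
  obtain A where A: "forcing g (\<lambda>\<tau>. A * (1 + \<tau>) powr (- \<alpha>))"
    using g_bounds by blast
  obtain A0 where A0: "forcing g0 (\<lambda>\<tau>. A0 * (1 + \<tau>) powr (- \<alpha>))"
    using g0_bounds by blast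
  have s1: "set_integrable lborel {0<..<t} (\<lambda>\<tau>. conv (K1 (t - \<tau>)) (g1 \<tau>) x)" using D1_small t by blast
  have s2: "set_integrable lborel {0<..<t} (\<lambda>\<tau>. conv (KD (t - \<tau>)) (g0 \<tau>) x)" using D2_small t by blast
  have s3: "set_integrable lborel {0<..<t} (\<lambda>\<tau>. conv (K0 (t - \<tau>)) (g0 \<tau>) x)" using D2_small t by blast
  have "Dh t x = (LBINT \<tau>:{0<..<t}. conv (K1 (t - \<tau>)) (g1 \<tau>) x + conv (KD (t - \<tau>)) (g0 \<tau>) x + conv (K0 (t - \<tau>)) (g0 \<tau>) x)"
    unfolding Dh_def
  proof (rule set_lebesgue_integral_cong)
    show "\<forall>\<tau>. \<tau> \<in> {0<..<t} \<longrightarrow> conv (K1 (t - \<tau>)) (g \<tau>) x = conv (K1 (t - \<tau>)) (g1 \<tau>) x + conv (KD (t - \<tau>)) (g0 \<tau>) x + conv (K0 (t - \<tau>)) (g0 \<tau>) x"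
    proof (intro allI impI)
      fix \<tau> assume "\<tau> \<in> {0<..<t}"
      then have \<tau>: "\<tau> > 0" "t - \<tau> > 0" by auto
      have i1: "integrable lborel (\<lambda>y. K1 (t - \<tau>) (x - y) * g \<tau> y)" by (rule conv_integrable[OF small_K(1)[OF \<tau>(2)] g_measurable forcingD(1)[OF A \<tau>(1)]])
      have i2: "integrable lborel (\<lambda>y. K1 (t - \<tau>) (x - y) * g0 \<tau> y)" by (rule conv_integrable[OF small_K(1)[OF \<tau>(2)] g0_measurable forcingD(1)[OF A0 \<tau>(1)]])
      have i3: "integrable lborel (\<lambda>y. K0 (t - \<tau>) (x - y) * g0 \<tau> y)" by (rule conv_integrable[OF small_K(2)[OF \<tau>(2)] g0_measurable forcingD(1)[OF A0 \<tau>(1)]])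
      have "conv (K1 (t - \<tau>)) (g1 \<tau>) x = conv (K1 (t - \<tau>)) (g \<tau>) x - conv (K1 (t - \<tau>)) (g0 \<tau>) x"
        unfolding conv_def g1_def right_diff_distrib by (rule Bochner_Integration.integral_diff[OF i1 i2])
      moreover have "conv (KD (t - \<tau>)) (g0 \<tau>) x = conv (K1 (t - \<tau>)) (g0 \<tau>) x - conv (K0 (t - \<tau>)) (g0 \<tau>) x"
        unfolding conv_def KD_def left_diff_distrib by (rule Bochner_Integration.integral_diff[OF i2 i3])
      ultimately show "conv (K1 (t - \<tau>)) (g \<tau>) x = conv (K1 (t - \<tau>)) (g1 \<tau>) x + conv (KD (t - \<tau>)) (g0 \<tau>) x + conv (K0 (t - \<tau>)) (g0 \<tau>) x"
        by simp
    qed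
  qed simp
  also have "\<dots> = D1 t x + D2 t x + D3 t x"
    unfolding D1_def D2_def D3_def
    using set_integral_add(2)[OF set_integral_add(1)[OF s1 s2] s3] set_integral_add(2)[OF s1 s2] by (simp only:)
  finally show ?thesis .
qed

lemma remainder:
  "\<exists>C\<ge>0. \<forall>t\<ge>1. \<exists>R. small t R (C * t powr (1/2 - \<alpha> - \<gamma>)) \<and>
     (AE x in lborel. Cx (dev t x) = R x - D3 t x)"
proof -
  obtain C0 where C0: "C0 \<ge> 0" "\<And>t. t > 0 \<Longrightarrow> small t (\<lambda>x. ift (\<lambda>\<xi>. smb t \<xi> * uh \<xi>) x - Cx M * ift (smb0 t) x) (C0 * t powr (- (1/2)))"
    using linear_zero_order by blast
  obtain C1 where C1: "C1 \<ge> 0" "\<And>t. t \<ge> 1 \<Longrightarrow> small t (D1 t) (C1 * t powr (1/2 - \<alpha> - \<gamma>))" using D1_small by blast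
  obtain C2 where C2: "C2 \<ge> 0" "\<And>t. t \<ge> 1 \<Longrightarrow> small t (D2 t) (C2 * t powr (1/2 - \<alpha> - \<gamma>))" using D2_small by blast
  show ?thesis
  proof (intro exI[of _ "C0 + (C1 + C2)"] conjI allI impI)
    show "0 \<le> C0 + (C1 + C2)" using C0 C1 C2 by simp
    fix t :: real assume t1: "t \<ge> 1"
    then have t: "t > 0" by simp
    let ?L = "\<lambda>x. ift (\<lambda>\<xi>. smb t \<xi> * uh \<xi>) x - Cx M * ift (smb0 t) x"
    have "C0 * t powr (- (1/2)) \<le> C0 * t powr (1/2 - \<alpha> - \<gamma>)"
      using t1 \<gamma>(3) \<alpha>_le by (intro mult_left_mono[OF _ C0(1)] powr_mono) auto
    from small_diff[OF small_mono[OF C0(2)[OF t] this] small_add[OF C1(2)[OF t1] C2(2)[OF t1]]]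
    have "small t (\<lambda>x. ?L x - (D1 t x + D2 t x)) ((C0 + (C1 + C2)) * t powr (1/2 - \<alpha> - \<gamma>))" by (simp only: distrib_right)
    moreover have "AE x in lborel. Cx (dev t x) = (?L x - (D1 t x + D2 t x)) - D3 t x"
      using duhamel[OF t] by eventually_elim (simp add: heat_drift_eq[OF t, symmetric] Dh_eq[OF t1])
    ultimately show "\<exists>R. small t R ((C0 + (C1 + C2)) * t powr (1/2 - \<alpha> - \<gamma>)) \<and>
       (AE x in lborel. Cx (dev t x) = R x - D3 t x)" by blast
  qed
qed

text \<open>The heat times t - \<tau> and \<tau>/p add up, and so do the drifts V (t - \<tau>) and V
  \<tau>. Their sum V t does not depend on \<tau>, so the whole integral is centred at one moving
  point.\<close>

lemma conv_K0_h0: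
  assumes \<tau>: "0 < \<tau>" "\<tau> < t"
  shows "conv (K0 (t - \<tau>)) (h0 \<tau>) x = Cx (sM * cp * \<tau> powr (- \<alpha>)) * Pk (t - \<kappa> * \<tau>) (x - V * t)"
proof -
  have pos: "\<mu> * (\<tau> / p) > 0" "t - \<tau> > 0" using \<tau> \<mu>0 p2 by auto
  let ?c = "Cx (sM * cp * \<tau> powr (- \<alpha>))"
  let ?f = "\<lambda>y. Cx (heat \<mu> (\<tau> / p) (y - V * \<tau>))"
  have "conv (K0 (t - \<tau>)) (h0 \<tau>) x = (LBINT y. ?c * (K0 (t - \<tau>) (x - y) * ?f y))"
    unfolding conv_def h0_eq[OF \<tau>(1)] by (rule Bochner_Integration.integral_cong[OF refl]) (simp only: mult_ac)
  also have "\<dots> = ?c * conv (K0 (t - \<tau>)) ?f x" unfolding conv_def by (rule integral_mult_right_zero)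
  also have "conv (K0 (t - \<tau>)) ?f x = ift (\<lambda>\<xi>. \<i> * Cx \<xi> * smb0 (t - \<tau>) \<xi> *
      (iexp (- (\<xi> * (V * \<tau>))) * Cx (gauss (\<mu> * (\<tau> / p)) \<xi>))) x"
    unfolding K0_def conv_ift[OF smb_integrable(4)[OF pos(2)] heat_shift_integrable[OF pos(1)]] heat_fourier[OF pos(1)] ..
  also have "\<dots> = ift (\<lambda>\<xi>. \<i> * Cx \<xi> * Cx (gauss (\<mu> * (t - \<kappa> * \<tau>)) \<xi>) * iexp (- (V * t * \<xi>))) x"
  proof (rule arg_cong[where f = "\<lambda>k. ift k x"], rule ext)
    fix \<xi>
    have "- (\<mu> * (t - \<tau>) * \<xi>\<^sup>2) + - (\<mu> * (\<tau> / p) * \<xi>\<^sup>2) = - (\<mu> * (t - \<kappa> * \<tau>) * \<xi>\<^sup>2)" by (simp add: \<kappa>_def algebra_simps)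
    then have "gauss (\<mu> * (t - \<tau>)) \<xi> * gauss (\<mu> * (\<tau> / p)) \<xi> = gauss (\<mu> * (t - \<kappa> * \<tau>)) \<xi>" by (simp only: exp_add[symmetric])
    then have e1: "Cx (gauss (\<mu> * (t - \<kappa> * \<tau>)) \<xi>) = Cx (gauss (\<mu> * (t - \<tau>)) \<xi>) * Cx (gauss (\<mu> * (\<tau> / p)) \<xi>)"
      by (simp only: of_real_mult[symmetric])
    have e2: "iexp (- (V * t * \<xi>)) = iexp (- (V * (t - \<tau>) * \<xi>)) * iexp (- (\<xi> * (V * \<tau>)))"
      by (simp add: exp_add[symmetric] algebra_simps)
    show "\<i> * Cx \<xi> * smb0 (t - \<tau>) \<xi> * (iexp (- (\<xi> * (V * \<tau>))) * Cx (gauss (\<mu> * (\<tau> / p)) \<xi>))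
      = \<i> * Cx \<xi> * Cx (gauss (\<mu> * (t - \<kappa> * \<tau>)) \<xi>) * iexp (- (V * t * \<xi>))"
      unfolding e1 e2 smb0_def by (simp only: mult_ac)
  qed
  also have "\<dots> = Pk (t - \<kappa> * \<tau>) (x - V * t)" unfolding Pk_def by (rule ift_shift)
  finally show ?thesis .
qed

lemma D3_eq:
  "D3 t x = Cx (sM * cp) * J {1..<t} t (x - V * t)"
proof -
  have "D3 t x = (LBINT \<tau>. Cx (sM * cp) * (Pk (t - \<kappa> * \<tau>) (x - V * t) * Cx (indicator {1..<t} \<tau> * \<tau> powr (- \<alpha>))))"
    unfolding D3_def set_lebesgue_integral_def
  proof (rule Bochner_Integration.integral_cong[OF refl])
    fix \<tau>
    show "indicator {0<..<t} \<tau> *\<^sub>R conv (K0 (t - \<tau>)) (g0 \<tau>) x = Cx (sM * cp) * (Pk (t - \<kappa> * \<tau>) (x - V * t) * Cx (indicator {1..<t} \<tau> * \<tau> powr (- \<alpha>)))"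
    proof (cases "\<tau> \<in> {1..<t}")
      case True
      then have "g0 \<tau> = h0 \<tau>" by (simp add: g0_def fun_eq_iff)
      moreover have "conv (K0 (t - \<tau>)) (h0 \<tau>) x = Cx (sM * cp * \<tau> powr (- \<alpha>)) * Pk (t - \<kappa> * \<tau>) (x - V * t)"
        using True by (intro conv_K0_h0) auto
      ultimately show ?thesis using True by (simp add: mult_ac)
    next
      case False
      then have "indicator {0<..<t} \<tau> *\<^sub>R conv (K0 (t - \<tau>)) (g0 \<tau>) x = 0"
        by (cases "\<tau> < 1") (auto simp: g0_def conv_def indicator_def)
      then show ?thesis using False by simp
    qed
  qed
  then show ?thesis unfolding J_def integral_mult_right_zero .
qed

text \<open>The explicit term over (0, t) is exactly self-similar with profile
  \<open>w_profile\<close>, so it provides the leading order; the errors are \<gamma> powers smaller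
  or come from the cutoff at time 1.\<close>

lemma subcritical:
  assumes q: "q \<ge> 2" and p3: "p < 3"
  shows "leading_order (\<lambda>t. Lq_norm q (\<lambda>x. dev t x))
    (ereal (\<bar>M\<bar> powr p) * Lq_norm q (w_profile p \<mu>))
    (\<lambda>t. t powr (- (1 / 2 * (1 - real_of_ereal (1 / q)))) * t powr (1/2 - \<alpha>))"
proof -
  have \<alpha>1: "\<alpha> < 1" using p3 by (simp add: \<alpha>_def)
  obtain C where C: "C \<ge> 0" "\<And>t. t \<ge> 1 \<Longrightarrow> \<exists>R. small t R (C * t powr (1/2 - \<alpha> - \<gamma>)) \<and>
     (AE x in lborel. Cx (dev t x) = R x - D3 t x)" using remainder by blast
  obtain C' where C': "C' \<ge> 0" "\<And>t. t > 0 \<Longrightarrow> (NN \<tau>. indicator {0<..<t} \<tau> * \<tau> powr (- \<alpha>)) \<le> ennreal (C' * t powr (1 - \<alpha>))"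
    using weight_bound[OF \<alpha>1] by blast
  have w01: "(NN \<tau>. indicator {0<..<1} \<tau> * \<tau> powr (- \<alpha>)) \<le> ennreal C'" using C'(2)[of 1] by simp
  have J01: "small t (J {0<..<1} t) (GP * t powr (- (1/2)) * C')" if "t \<ge> 1" for t
    by (rule J_small(1)[OF _ _ _ w01 C'(1)]) (use that in auto)
  define c where "c = Cx (sM * cp)"
  define A where "A = cmod (Cx cp) * (GP * 1 powr (- (1/2)) * C')"
  have ws: "small 1 (\<lambda>x. Cx (w_profile p \<mu> x)) A"
    unfolding w_profile_eq[OF \<alpha>1] A_def by (rule small_cmult[OF J01]) simp
  have wm: "w_profile p \<mu> \<in> borel_measurable borel"
  proof -
    have "(\<lambda>x. Re (Cx (w_profile p \<mu> x))) \<in> borel_measurable borel" using small_measurable[OF ws] by measurable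
    then show ?thesis by simp
  qed
  define \<Phi> where "\<Phi> x = - sM * w_profile p \<mu> x" for x
  have \<Phi>m: "\<Phi> \<in> borel_measurable borel" unfolding \<Phi>_def[abs_def] using wm by measurable
  have \<Phi>s: "small 1 (\<lambda>x. Cx (\<Phi> x)) (cmod (Cx (- sM)) * A)"
    using small_cmult[OF ws, of "Cx (- sM)"] by (simp only: \<Phi>_def of_real_mult)
  define \<rho> where "\<rho> t = C * t powr (1/2 - \<alpha> - \<gamma>) + cmod c * (GP * t powr (- (1/2)) * C')" for t
  have "leading_order (\<lambda>t. Lq_norm q (\<lambda>x. dev t x)) (Lq_norm q \<Phi>)
    (\<lambda>t. t powr (- (1 / 2 * (1 - real_of_ereal (1 / q)))) * t powr (1/2 - \<alpha>))"
  proof (rule leading_order_main[where V = V and \<rho> = \<rho>, OF q \<Phi>m \<Phi>s])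
    show "\<forall>\<^sub>F t in at_top. (\<lambda>x. dev t x) \<in> borel_measurable borel \<and> 0 < t powr (1/2 - \<alpha>) \<and>
       (\<exists>R. small t R (\<rho> t) \<and> (AE x in lborel. Cx (dev t x) =
          Cx (t powr (1/2 - \<alpha>) * t powr (- (1/2)) * \<Phi> ((x - V * t) / sqrt t)) + R x))"
      using eventually_ge_at_top[of 1]
    proof eventually_elim
      case (elim t)
      then have t: "t > 0" by simp
      have [measurable]: "u t \<in> borel_measurable borel" using t by (intro u_measurable) simp
      have [measurable]: "heat_drift B b \<mu> t \<in> borel_measurable borel" unfolding heat_drift_def[abs_def] by measurable
      obtain R where R: "small t R (C * t powr (1/2 - \<alpha> - \<gamma>))"
        "AE x in lborel. Cx (dev t x) = R x - D3 t x" using C(2)[OF elim] by blast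
      let ?R = "\<lambda>x. R x + c * J {0<..<1} t (x - V * t)"
      \<comment> \<open>For \<alpha> < 1 the weight \<tau>^(-\<alpha>) is integrable at 0, so the
        cutoff can be undone: the missing piece over (0, 1) is O(t^(-1/2)), which is o(t^(1/2 -
        \<alpha>)).\<close>
      have split: "J {1..<t} t z = J {0<..<t} t z - J {0<..<1} t z" for z
      proof -
        have R': "0 \<le> C' * t powr (1 - \<alpha>)" using C'(1) by simp
        have i1: "integrable lborel (\<lambda>\<tau>. Pk (t - \<kappa> * \<tau>) z * Cx (indicator {0<..<t} \<tau> * \<tau> powr (- \<alpha>)))"
          by (rule J_small(2)[OF t _ _ C'(2)[OF t] R']) auto
        have i2: "integrable lborel (\<lambda>\<tau>. Pk (t - \<kappa> * \<tau>) z * Cx (indicator {0<..<1} \<tau> * \<tau> powr (- \<alpha>)))"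
          by (rule J_small(2)[OF t _ _ w01 C'(1)]) (use elim in auto)
        have "J {0<..<t} t z - J {0<..<1} t z = (LBINT \<tau>. Pk (t - \<kappa> * \<tau>) z * Cx (indicator {0<..<t} \<tau> * \<tau> powr (- \<alpha>)) - Pk (t - \<kappa> * \<tau>) z * Cx (indicator {0<..<1} \<tau> * \<tau> powr (- \<alpha>)))"
          unfolding J_def by (rule Bochner_Integration.integral_diff[OF i1 i2, symmetric])
        also have "\<dots> = J {1..<t} t z" unfolding J_def
          by (rule Bochner_Integration.integral_cong[OF refl]) (use elim in \<open>auto simp: indicator_def\<close>)
        finally show ?thesis by simp
      qed
      have "small t ?R (\<rho> t)" unfolding \<rho>_def
        by (rule small_add[OF R(1) small_cmult[OF small_translate[OF J01[OF elim]]]])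
      moreover have "AE x in lborel. Cx (dev t x) =
          Cx (t powr (1/2 - \<alpha>) * t powr (- (1/2)) * \<Phi> ((x - V * t) / sqrt t)) + ?R x"
        using R(2)
      proof eventually_elim
        case (elim x)
        define z where "z = (x - V * t) / sqrt t"
        have pw: "t powr (1/2 - \<alpha>) * t powr (- (1/2)) = t powr (- \<alpha>)" unfolding powr_add[symmetric] by simp
        have "D3 t x = c * (Cx (t powr (- \<alpha>)) * J {0<..<1} 1 z) - c * J {0<..<1} t (x - V * t)"
          unfolding D3_eq split J_scale[OF t] c_def z_def by (rule right_diff_distrib)
        also have "c * (Cx (t powr (- \<alpha>)) * J {0<..<1} 1 z) = Cx sM * Cx (t powr (- \<alpha>)) * (Cx cp * J {0<..<1} 1 z)"
          by (simp only: c_def of_real_mult mult_ac)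
        also have "\<dots> = - Cx (t powr (1/2 - \<alpha>) * t powr (- (1/2)) * \<Phi> z)"
          unfolding w_profile_eq[OF \<alpha>1, symmetric] pw \<Phi>_def by simp
        finally show ?case using elim unfolding z_def by simp
      qed
      ultimately show ?case using t by auto
    qed
    have l1: "((\<lambda>t. t powr (- \<gamma>)) \<longlongrightarrow> 0) at_top" by (rule tendsto_neg_powr[OF _ filterlim_ident]) (use \<gamma>(5)[OF \<alpha>1] in simp)
    have l2: "((\<lambda>t. t powr (- (1 - \<alpha>))) \<longlongrightarrow> 0) at_top" by (rule tendsto_neg_powr[OF _ filterlim_ident]) (use \<alpha>1 in simp)
    have "((\<lambda>t. C * t powr (- \<gamma>) + cmod c * (GP * t powr (- (1 - \<alpha>)) * C')) \<longlongrightarrow> C * 0 + cmod c * (GP * 0 * C')) at_top"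
      by (intro tendsto_intros l1 l2)
    then have l: "((\<lambda>t. C * t powr (- \<gamma>) + cmod c * (GP * t powr (- (1 - \<alpha>)) * C')) \<longlongrightarrow> 0) at_top" by simp
    show "((\<lambda>t. \<rho> t / t powr (1/2 - \<alpha>)) \<longlongrightarrow> 0) at_top"
    proof (rule Lim_transform_eventually[OF l])
      show "\<forall>\<^sub>F t in at_top. C * t powr (- \<gamma>) + cmod c * (GP * t powr (- (1 - \<alpha>)) * C') = \<rho> t / t powr (1/2 - \<alpha>)"
        using eventually_gt_at_top[of 0]
      proof eventually_elim
        case (elim t)
        have a: "t powr (- \<gamma>) = t powr (1/2 - \<alpha> - \<gamma>) / t powr (1/2 - \<alpha>)" by (subst powr_diff[symmetric]) simp
        have b: "t powr (- (1 - \<alpha>)) = t powr (- (1/2)) / t powr (1/2 - \<alpha>)" by (subst powr_diff[symmetric]) simp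
        show ?case unfolding \<rho>_def a b add_divide_distrib by (simp only: times_divide_eq_right times_divide_eq_left)
      qed
    qed
  qed
  moreover have "Lq_norm q \<Phi> = ereal (\<bar>M\<bar> powr p) * Lq_norm q (w_profile p \<mu>)"
    unfolding \<Phi>_def[abs_def] Lq_norm_cmult[OF q wm ws] by (simp add: abs_sM)
  ultimately show ?thesis by (simp only:)
qed

lemma critical_error:
  assumes \<alpha>1: "\<alpha> = 1" and t1: "t \<ge> 1"
  shows "small t (\<lambda>z. J {1..<t} t z - Cx (ln t) * Pk t z) (\<mu> * gauss_const 3 (\<mu> / p) * t powr (- (1/2)))"
proof -
  have t: "t > 0" using t1 by simp
  define Q where "Q = gauss_const 3 (\<mu> / p)"
  have Q0: "Q \<ge> 0" unfolding Q_def by (rule gauss_const_nonneg)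
  define f where "f \<tau> x = indicator {1..<t} \<tau> *\<^sub>R (Pk (t - \<kappa> * \<tau>) x - Pk t x)" for \<tau> x
  define \<rho> where "\<rho> \<tau> = indicator {1..<t} \<tau> * (\<mu> * \<tau> * Q * t powr (- (3/2)))" for \<tau> :: real
  define w where "w \<tau> = Cx (indicator {1..<t} \<tau> * \<tau> powr (- 1))" for \<tau>
  have sm: "small t (f \<tau>) (\<rho> \<tau>)" for \<tau>
  proof (cases "\<tau> \<in> {1..<t}")
    case True
    then have \<tau>: "0 \<le> \<tau>" "\<tau> \<le> t" by auto
    have s: "t - \<kappa> * \<tau> > 0"
    proof -
      have "t / p > 0" using t p2 by simp
      then show ?thesis using \<kappa>_time[OF \<tau>] by linarith
    qed
    have "small t (ift (\<lambda>\<xi>. \<i> * Cx \<xi> * Cx (gauss (\<mu> * (t - \<kappa> * \<tau>)) \<xi>) - \<i> * Cx \<xi> * Cx (gauss (\<mu> * t) \<xi>)))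
       (\<mu> * \<tau> * gauss_const 3 (\<mu> / p) * t powr (0 - real 3 / 2))"
    proof (rule small_ift_rate_gen[THEN conjunct2, OF _ t])
      fix \<xi>
      define a where "a = \<mu> * (t - \<kappa> * \<tau>) * \<xi>\<^sup>2"
      define d where "d = \<mu> * t * \<xi>\<^sup>2"
      have ab: "0 \<le> a" "a \<le> d" unfolding a_def d_def using s \<mu>0 \<tau> \<kappa> by (auto intro!: mult_right_mono mult_left_mono)
      have "d - a = \<mu> * \<tau> * \<xi>\<^sup>2 * \<kappa>" by (simp add: a_def d_def algebra_simps)
      also have "\<dots> \<le> \<mu> * \<tau> * \<xi>\<^sup>2 * 1" using \<mu>0 \<tau> \<kappa> by (intro mult_left_mono) auto
      finally have da: "d - a \<le> \<mu> * \<tau> * \<xi>\<^sup>2" by simp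
      have "\<mu> / p * t * \<xi>\<^sup>2 \<le> a" unfolding a_def
        using mult_left_mono[OF \<kappa>_time[OF \<tau>], of \<mu>] \<mu>0 by (intro mult_right_mono) auto
      then have ea: "exp (- a) \<le> gauss (\<mu> / p * t) \<xi>" by simp
      have "\<bar>exp (- a) - exp (- d)\<bar> \<le> exp (- a) * (d - a)" by (rule exp_diff_le[OF ab])
      also have "\<dots> \<le> gauss (\<mu> / p * t) \<xi> * (\<mu> * \<tau> * \<xi>\<^sup>2)" using ea da ab by (intro mult_mono) auto
      finally have le: "\<bar>exp (- a) - exp (- d)\<bar> \<le> gauss (\<mu> / p * t) \<xi> * (\<mu> * \<tau> * \<xi>\<^sup>2)" .
      have "cmod (\<i> * Cx \<xi> * Cx (exp (- a)) - \<i> * Cx \<xi> * Cx (exp (- d))) = \<bar>\<xi>\<bar> * \<bar>exp (- a) - exp (- d)\<bar>"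
        unfolding right_diff_distrib[symmetric] of_real_diff[symmetric] norm_mult norm_of_real by simp
      also have "\<dots> \<le> \<bar>\<xi>\<bar> * (gauss (\<mu> / p * t) \<xi> * (\<mu> * \<tau> * \<xi>\<^sup>2))" by (rule mult_left_mono[OF le]) simp
      also have "\<dots> = \<mu> * \<tau> * (\<bar>\<xi>\<bar> * \<xi>\<^sup>2) * gauss (\<mu> / p * t) \<xi>" by (simp only: mult_ac)
      also have "\<bar>\<xi>\<bar> * \<xi>\<^sup>2 = \<bar>\<xi>\<bar> ^ 3" by (simp add: power3_eq_cube power2_eq_square)
      finally show "cmod (\<i> * Cx \<xi> * Cx (gauss (\<mu> * (t - \<kappa> * \<tau>)) \<xi>) - \<i> * Cx \<xi> * Cx (gauss (\<mu> * t) \<xi>))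
        \<le> \<mu> * \<tau> * t powr 0 * \<bar>\<xi>\<bar> ^ 3 * gauss (\<mu> / p * t) \<xi>"
        using t unfolding a_def d_def by simp
    qed (use \<mu>0 p2 \<tau> in auto)
    moreover have "f \<tau> = ift (\<lambda>\<xi>. \<i> * Cx \<xi> * Cx (gauss (\<mu> * (t - \<kappa> * \<tau>)) \<xi>) - \<i> * Cx \<xi> * Cx (gauss (\<mu> * t) \<xi>))"
      using True unfolding f_def fun_eq_iff ift_diff[OF Pk_symbol_integrable[OF s] Pk_symbol_integrable[OF t]] Pk_def by simp
    ultimately show ?thesis using True by (simp add: \<rho>_def Q_def)
  next
    case False
    then have "f \<tau> = (\<lambda>x. 0)" "\<rho> \<tau> = 0" by (auto simp: f_def \<rho>_def fun_eq_iff)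
    then show ?thesis by (simp add: small_zero)
  qed
  have fm: "(\<lambda>(\<tau>, x). f \<tau> x) \<in> borel_measurable (lborel \<Otimes>\<^sub>M borel)"
  proof -
    have [measurable]: "Pk t \<in> borel_measurable borel" unfolding Pk_def by (rule ift_measurable) measurable
    have "(\<lambda>(\<tau>, x). f \<tau> x) \<in> borel_measurable (borel \<Otimes>\<^sub>M borel)"
      using Pk_measurable_time unfolding f_def split_beta' by measurable
    then show ?thesis by (simp cong: measurable_cong_sets add: sets_pair_measure_cong[of lborel borel borel borel])
  qed
  have fm1: "(\<lambda>\<tau>. f \<tau> z) \<in> borel_measurable lborel" for z unfolding f_def by measurable
  have wm: "w \<in> borel_measurable lborel" unfolding w_def[abs_def] by measurable
  have \<rho>m: "\<rho> \<in> borel_measurable lborel" unfolding \<rho>_def[abs_def] by measurable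
  have k0: "0 \<le> \<mu> * Q * t powr (- (3/2))" using \<mu>0 Q0 by simp
  have "(NN \<tau>. \<rho> \<tau> * cmod (w \<tau>)) \<le> (\<integral>\<^sup>+ \<tau>. ennreal (\<mu> * Q * t powr (- (3/2))) * indicator {1..<t} \<tau> \<partial>lborel)"
  proof (intro nn_integral_mono)
    fix \<tau>
    show "ennreal (\<rho> \<tau> * cmod (w \<tau>)) \<le> ennreal (\<mu> * Q * t powr (- (3/2))) * indicator {1..<t} \<tau>"
    proof (cases "\<tau> \<in> {1..<t}")
      case True
      then have "cmod (w \<tau>) = 1 / \<tau>" unfolding w_def norm_of_real by (simp add: powr_minus_divide)
      moreover have "\<rho> \<tau> = \<mu> * Q * t powr (- (3/2)) * \<tau>" using True by (simp add: \<rho>_def)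
      ultimately have "\<rho> \<tau> * cmod (w \<tau>) = \<mu> * Q * t powr (- (3/2))" using True by simp
      then show ?thesis using True by simp
    qed (simp add: \<rho>_def)
  qed
  \<comment> \<open>After the cancellation the integrand is constant on [1, t), an interval of
    length t - 1.\<close>
  also have "\<dots> = ennreal (\<mu> * Q * t powr (- (3/2))) * ennreal (t - 1)" using t1 by (simp add: nn_integral_cmult_indicator)
  also have "\<dots> \<le> ennreal (\<mu> * Q * t powr (- (3/2))) * ennreal t" by (intro mult_left_mono ennreal_leI) auto
  also have "\<dots> = ennreal (\<mu> * Q * t powr (- (3/2)) * t)" using k0 t by (simp only: ennreal_mult less_imp_le)
  also have "\<mu> * Q * t powr (- (3/2)) * t = \<mu> * Q * t powr (- (1/2))"
  proof -
    have "t powr (- (3/2)) * t = t powr (- (3/2)) * t powr 1" using t by simp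
    also have "\<dots> = t powr (- (1/2))" unfolding powr_add[symmetric] by simp
    finally show ?thesis by (simp only: mult.assoc)
  qed
  finally have RR: "(NN \<tau>. \<rho> \<tau> * cmod (w \<tau>)) \<le> ennreal (\<mu> * Q * t powr (- (1/2)))" .
  have sE: "small t (\<lambda>x. \<integral>\<tau>. f \<tau> x * w \<tau> \<partial>lborel) (\<mu> * Q * t powr (- (1/2)))"
    by (rule small_integral[OF sigma_finite_lborel fm wm \<rho>m sm RR]) (use \<mu>0 Q0 in simp)
  have wi: "integrable lborel w" unfolding w_def[abs_def] by (rule integrable_of_real[OF integral_inverse_indicator(1)[OF t1]])
  have wI: "(LBINT \<tau>. w \<tau>) = Cx (ln t)"
    unfolding w_def integral_complex_of_real integral_inverse_indicator(2)[OF t1] ..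
  have "(\<integral>\<tau>. f \<tau> z * w \<tau> \<partial>lborel) = J {1..<t} t z - Cx (ln t) * Pk t z" for z
  proof -
    have fi: "integrable lborel (\<lambda>\<tau>. f \<tau> z * w \<tau>)" by (rule integrable_small[OF fm1 wm \<rho>m sm RR])
    have "J {1..<t} t z = (LBINT \<tau>. f \<tau> z * w \<tau> + Pk t z * w \<tau>)" unfolding J_def \<alpha>1
      by (rule Bochner_Integration.integral_cong[OF refl]) (simp add: f_def w_def indicator_def algebra_simps)
    also have "\<dots> = (LBINT \<tau>. f \<tau> z * w \<tau>) + Pk t z * (LBINT \<tau>. w \<tau>)"
      unfolding Bochner_Integration.integral_add[OF fi integrable_mult_right[OF wi]] integral_mult_right_zero ..
    finally show ?thesis unfolding wI by (simp add: mult.commute)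
  qed
  with sE show ?thesis unfolding Q_def by (simp only:)
qed

lemma critical:
  assumes q: "q \<ge> 2" and p3: "p = 3"
  shows "leading_order (\<lambda>t. Lq_norm q (\<lambda>x. dev t x))
    (ereal (\<bar>M\<bar> ^ 3 / (4 * sqrt 3 * pi * \<mu>)) * Lq_norm q (deriv (heat \<mu> 1)))
    (\<lambda>t. t powr (- (1 / 2 * (1 - real_of_ereal (1 / q)))) * (t powr (- (1/2)) * ln t))"
proof -
  have "\<alpha> = (p - 1) / 2" by (rule \<alpha>_def)
  also have "\<dots> = 1" using p3 by simp
  finally have \<alpha>1: "\<alpha> = 1" .
  have \<gamma>0: "\<gamma> = 0" using \<gamma>(1,3) \<alpha>1 by simp
  have ex: "1/2 - \<alpha> - \<gamma> = - (1/2)" using \<alpha>1 \<gamma>0 by simp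
  obtain C where C: "C \<ge> 0" "\<And>t. t \<ge> 1 \<Longrightarrow> \<exists>R. small t R (C * t powr (- (1/2))) \<and>
     (AE x in lborel. Cx (dev t x) = R x - D3 t x)" using remainder unfolding ex by blast
  define c where "c = Cx (sM * cp)"
  define Q where "Q = \<mu> * gauss_const 3 (\<mu> / p)"
  have hs: "small 1 (\<lambda>x. Cx (deriv (heat \<mu> 1) x)) (gauss_const 1 \<mu>)"
    using small_gk[of 1] heat_deriv[of 1] by simp
  have hm: "deriv (heat \<mu> 1) \<in> borel_measurable borel"
  proof -
    have "(\<lambda>x. Re (Cx (deriv (heat \<mu> 1) x))) \<in> borel_measurable borel" using small_measurable[OF hs] by measurable
    then show ?thesis by simp
  qed
  define \<Phi> where "\<Phi> x = - (sM * cp) * deriv (heat \<mu> 1) x" for x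
  have \<Phi>m: "\<Phi> \<in> borel_measurable borel" unfolding \<Phi>_def[abs_def] using hm by measurable
  have \<Phi>s: "small 1 (\<lambda>x. Cx (\<Phi> x)) (cmod (Cx (- (sM * cp))) * gauss_const 1 \<mu>)"
    using small_cmult[OF hs, of "Cx (- (sM * cp))"] by (simp only: \<Phi>_def of_real_mult)
  define \<rho> where "\<rho> t = C * t powr (- (1/2)) + cmod c * (Q * t powr (- (1/2)))" for t
  have "leading_order (\<lambda>t. Lq_norm q (\<lambda>x. dev t x)) (Lq_norm q \<Phi>)
    (\<lambda>t. t powr (- (1 / 2 * (1 - real_of_ereal (1 / q)))) * (t powr (- (1/2)) * ln t))"
  proof (rule leading_order_main[where V = V and \<rho> = \<rho>, OF q \<Phi>m \<Phi>s])
    show "\<forall>\<^sub>F t in at_top. (\<lambda>x. dev t x) \<in> borel_measurable borel \<and> 0 < t powr (- (1/2)) * ln t \<and>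
       (\<exists>R. small t R (\<rho> t) \<and> (AE x in lborel. Cx (dev t x) =
          Cx (t powr (- (1/2)) * ln t * t powr (- (1/2)) * \<Phi> ((x - V * t) / sqrt t)) + R x))"
      using eventually_gt_at_top[of 1]
    proof eventually_elim
      case (elim t)
      then have t: "t > 0" and t1: "t \<ge> 1" by auto
      have [measurable]: "u t \<in> borel_measurable borel" using t by (intro u_measurable) simp
      have [measurable]: "heat_drift B b \<mu> t \<in> borel_measurable borel" unfolding heat_drift_def[abs_def] by measurable
      obtain R where R: "small t R (C * t powr (- (1/2)))"
        "AE x in lborel. Cx (dev t x) = R x - D3 t x" using C(2)[OF t1] by blast
      let ?E = "\<lambda>z. J {1..<t} t z - Cx (ln t) * Pk t z"
      let ?R = "\<lambda>x. R x - c * ?E (x - V * t)"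
      have "small t ?R (\<rho> t)" unfolding \<rho>_def Q_def
        by (rule small_diff[OF R(1) small_cmult[OF small_translate[OF critical_error[OF \<alpha>1 t1]]]])
      moreover have "AE x in lborel. Cx (dev t x) =
          Cx (t powr (- (1/2)) * ln t * t powr (- (1/2)) * \<Phi> ((x - V * t) / sqrt t)) + ?R x"
        using R(2)
      proof eventually_elim
        case (elim x)
        define z where "z = x - V * t"
        have "c * (Cx (ln t) * Pk t z) = - Cx (t powr (- (1/2)) * ln t * t powr (- (1/2)) * \<Phi> (z / sqrt t))"
          unfolding Pk_heat[OF t] c_def \<Phi>_def of_real_mult[symmetric] of_real_minus[symmetric]
          by (rule arg_cong[where f = Cx]) (simp only: mult_minus_left mult_minus_right minus_minus mult_ac)
        moreover have "D3 t x = c * ?E z + c * (Cx (ln t) * Pk t z)"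
          unfolding D3_eq c_def z_def by (simp add: algebra_simps)
        ultimately show ?case using elim unfolding z_def by simp
      qed
      ultimately show ?case using elim by auto
    qed
    have "((\<lambda>t. (C + cmod c * Q) / ln t) \<longlongrightarrow> 0) at_top"
      by (rule real_tendsto_divide_at_top[OF tendsto_const ln_at_top])
    then show "((\<lambda>t. \<rho> t / (t powr (- (1/2)) * ln t)) \<longlongrightarrow> 0) at_top"
    proof (rule Lim_transform_eventually)
      show "\<forall>\<^sub>F t in at_top. (C + cmod c * Q) / ln t = \<rho> t / (t powr (- (1/2)) * ln t)"
        using eventually_gt_at_top[of 1]
      proof eventually_elim
        case (elim t)
        have n: "t powr (- (1/2)) \<noteq> 0" using elim by simp
        have "\<rho> t = t powr (- (1/2)) * (C + cmod c * Q)" by (simp add: \<rho>_def algebra_simps)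
        then show ?case by (simp only: mult_divide_mult_cancel_left[OF n])
      qed
    qed
  qed
  moreover have "Lq_norm q \<Phi> = ereal (\<bar>M\<bar> ^ 3 / (4 * sqrt 3 * pi * \<mu>)) * Lq_norm q (deriv (heat \<mu> 1))"
  proof -
    \<comment> \<open>The constant of the third power of the heat kernel: at p = 3 the general
      factor (4 pi \<mu>)^(-(p-1)/2) p^(-1/2) becomes 1/(4 sqrt 3 pi \<mu>).\<close>
    have "cp = (4 * pi * \<mu>) powr (- 1) * p powr (- (1/2))" unfolding cp_def \<alpha>1 ..
    also have "p powr (- (1/2)) = 1 / sqrt 3" using p3 by (simp add: powr_minus_divide powr_half_sqrt)
    also have "(4 * pi * \<mu>) powr (- 1) = 1 / (4 * pi * \<mu>)" using \<mu>0 by (simp add: powr_minus_divide)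
    finally have cp: "cp = 1 / (4 * sqrt 3 * pi * \<mu>)" by simp
    have "\<bar>- (sM * cp)\<bar> = \<bar>M\<bar> powr p * cp" using \<mu>0 by (simp add: abs_mult abs_sM cp)
    also have "\<bar>M\<bar> powr p = \<bar>M\<bar> ^ 3" unfolding p3 by (cases "M = 0") (auto simp: powr_numeral)
    finally have "\<bar>- (sM * cp)\<bar> = \<bar>M\<bar> ^ 3 / (4 * sqrt 3 * pi * \<mu>)" unfolding cp by simp
    then show ?thesis unfolding \<Phi>_def[abs_def] Lq_norm_cmult[OF q hm hs] by (simp only:)
  qed
  ultimately show ?thesis by (simp only:)
qed

end

section \<open>Assembly of the three regimes\<close>

theorem corollary1p6:
  fixes p B b \<mu> :: real
  assumes "p > 2" and "B > 0" and "b > 0" and "\<mu> > 0"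
  shows "\<exists>\<delta>>0. \<forall>(u\<^sub>0 :: real \<Rightarrow> real) (u :: real \<Rightarrow> real \<Rightarrow> real).
    u\<^sub>0 \<in> Hs_space 1 \<longrightarrow>
    integrable lborel u\<^sub>0 \<longrightarrow>
    integrable lborel (\<lambda>x. x * u\<^sub>0 x) \<longrightarrow>
    initial_size u\<^sub>0 \<le> ereal \<delta> \<longrightarrow>
    global_mild_solution p B b \<mu> u\<^sub>0 u \<longrightarrow>
    decay_estimates u\<^sub>0 u \<longrightarrow>
    (\<forall>q :: ereal. q \<ge> 2 \<longrightarrow>
      (let M = mass u\<^sub>0;
           m = moment u\<^sub>0;
           N = nonlinear_mass p u;
           a = 1 / 2 * (1 - real_of_ereal (1 / q));
           F = (\<lambda>t. Lq_norm q (\<lambda>x. u t x - M * heat_drift B b \<mu> t x))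
       in
        (p < 3 \<longrightarrow> leading_order F
           (ereal (\<bar>M\<bar> powr p) * Lq_norm q (w_profile p \<mu>))
           (\<lambda>t. t powr (- a - (p - 2) / 2))) \<and>
        (p = 3 \<longrightarrow> leading_order F
           (ereal (\<bar>M\<bar> ^ 3 / (4 * sqrt 3 * pi * \<mu>)) * Lq_norm q (deriv (heat \<mu> 1)))
           (\<lambda>t. t powr (- a - 1 / 2) * ln t)) \<and>
        (p > 3 \<longrightarrow> leading_order F
           (Lq_norm q (\<lambda>x. (m + N) * deriv (heat \<mu> 1) x
              + 2 * B * M / b ^ 3 * (deriv ^^ 3) (heat \<mu> 1) x))
           (\<lambda>t. t powr (- a - 1 / 2)))))"
proof (intro exI[of _ 1] conjI allI impI)
  \<comment> \<open>The threshold 1 turns the factor \<open>initial_size u\<^sub>0\<close> in the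
    decay estimates into an absolute bound.\<close>
  show "0 < (1 :: real)" by simp
  fix u\<^sub>0 :: "real \<Rightarrow> real" and u :: "real \<Rightarrow> real \<Rightarrow> real" and q :: ereal
  assume h: "u\<^sub>0 \<in> Hs_space 1" "integrable lborel u\<^sub>0" "integrable lborel (\<lambda>x. x * u\<^sub>0 x)"
    "initial_size u\<^sub>0 \<le> ereal 1" "global_mild_solution p B b \<mu> u\<^sub>0 u" "decay_estimates u\<^sub>0 u"
  assume q: "q \<ge> 2"
  interpret solution B b \<mu> u\<^sub>0 p u
    by unfold_locales (use assms h in \<open>auto simp: one_ereal_def\<close>)
  define a where "a = 1 / 2 * (1 - real_of_ereal (1 / q))"
  show "let M = mass u\<^sub>0;
           m = moment u\<^sub>0;
           N = nonlinear_mass p u;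
           a = 1 / 2 * (1 - real_of_ereal (1 / q));
           F = (\<lambda>t. Lq_norm q (\<lambda>x. u t x - M * heat_drift B b \<mu> t x))
       in
        (p < 3 \<longrightarrow> leading_order F
           (ereal (\<bar>M\<bar> powr p) * Lq_norm q (w_profile p \<mu>))
           (\<lambda>t. t powr (- a - (p - 2) / 2))) \<and>
        (p = 3 \<longrightarrow> leading_order F
           (ereal (\<bar>M\<bar> ^ 3 / (4 * sqrt 3 * pi * \<mu>)) * Lq_norm q (deriv (heat \<mu> 1)))
           (\<lambda>t. t powr (- a - 1 / 2) * ln t)) \<and>
        (p > 3 \<longrightarrow> leading_order F
           (Lq_norm q (\<lambda>x. (m + N) * deriv (heat \<mu> 1) x
              + 2 * B * M / b ^ 3 * (deriv ^^ 3) (heat \<mu> 1) x))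
           (\<lambda>t. t powr (- a - 1 / 2)))"
    unfolding Let_def a_def[symmetric]
  proof (intro conjI impI)
    assume lt: "p < 3"
    interpret solution_subcritical B b \<mu> u\<^sub>0 p u by unfold_locales (use lt in simp)
    have "- a + (1/2 - \<alpha>) = - a - (p - 2) / 2" unfolding \<alpha>_def by (simp add: field_simps)
    then have "t powr (- a) * t powr (1/2 - \<alpha>) = t powr (- a - (p - 2) / 2)" for t
      by (simp only: powr_add[symmetric])
    with subcritical[OF q lt, folded a_def]
    show "leading_order (\<lambda>t. Lq_norm q (\<lambda>x. u t x - mass u\<^sub>0 * heat_drift B b \<mu> t x))
       (ereal (\<bar>mass u\<^sub>0\<bar> powr p) * Lq_norm q (w_profile p \<mu>)) (\<lambda>t. t powr (- a - (p - 2) / 2))"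
      by (simp only:)
  next
    assume lt: "p = 3"
    interpret solution_subcritical B b \<mu> u\<^sub>0 p u by unfold_locales (use lt in simp)
    have "t powr (- a) * (t powr (- (1/2)) * ln t) = t powr (- a - 1 / 2) * ln t" for t
      unfolding mult.assoc[symmetric] powr_add[symmetric] by simp
    with critical[OF q lt, folded a_def]
    show "leading_order (\<lambda>t. Lq_norm q (\<lambda>x. u t x - mass u\<^sub>0 * heat_drift B b \<mu> t x))
       (ereal (\<bar>mass u\<^sub>0\<bar> ^ 3 / (4 * sqrt 3 * pi * \<mu>)) * Lq_norm q (deriv (heat \<mu> 1))) (\<lambda>t. t powr (- a - 1 / 2) * ln t)"
      by (simp only:)
  next
    assume lt: "p > 3"
    interpret solution_supercritical B b \<mu> u\<^sub>0 p u by unfold_locales (rule lt)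
    have "t powr (- a) * t powr (- (1/2)) = t powr (- a - 1 / 2)" for t
      unfolding powr_add[symmetric] by simp
    with supercritical[OF q, folded a_def]
    show "leading_order (\<lambda>t. Lq_norm q (\<lambda>x. u t x - mass u\<^sub>0 * heat_drift B b \<mu> t x))
       (Lq_norm q (\<lambda>x. (moment u\<^sub>0 + nonlinear_mass p u) * deriv (heat \<mu> 1) x
          + 2 * B * mass u\<^sub>0 / b ^ 3 * (deriv ^^ 3) (heat \<mu> 1) x)) (\<lambda>t. t powr (- a - 1 / 2))"
      by (simp only:)
  qed
qed

end
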